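(* Let $p\ge5$ and let $\chi:\mathcal{O}_D^\times\to\mathbb{F}^\times$ be a smooth character. Then there does not exist any smooth $\mathbb{F}$-representation $\pi$ of $D^\times$ with a central character such that there is an isomorphism of graded $\mathrm{gr}(\Lambda)$-modules with compatible $H$-action $$\mathrm{gr}_{\mathfrak{m}_D}(\pi^\vee)\cong\big(\chi^\vee\otimes\mathbb{F}[y]/(y^{p+3})\big)\oplus\big((\chi^\sigma)^\vee\otimes\mathbb{F}[z]/(z^{p+3})\big).$$
   Context: $\mathbb{F}$ finite field of characteristic $p$ with a fixed embedding $\mathbb{F}_{q}\hookrightarrow\mathbb{F}$, $q=p^2$. $D$ non-split quaternion algebra over $\mathbb{Q}_p$, $\mathcal{O}_D$ its maximal order, $\varpi_D$ a uniformizer with $\varpi_D^2=p$ and $\varpi_D^{-1}a\varpi_D=\sigma(a)$ for $a\in\mathbb{Q}_{p^2}$; $U_D^n=1+\varpi_D^n\mathcal{O}_D$; $Z_D^1=U_D^1\cap Z(D^\times)$ (acting trivially on any smooth $\mathbb{F}$-representation with central character); $H\subset\mathcal{O}_D^\times$ is the Teichmüller image of $\mathbb{F}_q^\times$. $\alpha(x)=\overline{x}^{p-1}$; $\chi^\sigma(x)=\chi(\varpi_D^{-1}x\varpi_D)$, $\chi^\vee=\chi^{-1}$. $\Lambda=\mathbb{F}[[U_D^1/Z_D^1]]$ with maximal ideal $\mathfrak{m}_D$, $\mathrm{gr}(\Lambda)=\bigoplus\mathfrak{m}_D^n/\mathfrak{m}_D^{n+1}$; $y,z$ are the images of $Y=\sum_{\lambda\in\mathbb{F}_q^\times}\lambda^{-1}(1+\varpi_D[\lambda])$,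 $Z=\sum_{\lambda\in\mathbb{F}_q^\times}\lambda^{-p}(1+\varpi_D[\lambda])$. $\mathrm{gr}(\Lambda)$ is the enveloping algebra of $\mathbb{F}y\oplus\mathbb{F}z\oplus\mathbb{F}h$ with $[y,z]=h$ central; $H$ acts by $gy=\alpha(g)y$, $gz=\alpha^{-1}(g)z$, $gh=h$. $\mathbb{F}[y]/(y^{p+3})$ denotes $\mathrm{gr}(\Lambda)/(z,y^{p+3})$ (similarly for $z$), $\chi^\vee\otimes(-)$ twists the $H$-action. *)

theory Defs
  imports Complex_Main "HOL-Computational_Algebra.Primes" "HOL-Algebra.QuotRing"
    "HOL-Algebra.Ideal_Product" "HOL-Algebra.Module" "HOL-Algebra.Generated_Groups"
begin

text \<open>Ground objects (the field of p-adic numbers, the quaternion algebra, finite fields,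
  representation spaces) are types of the appropriate class; rings constructed from them are
  HOL-Algebra records.\<close>

text \<open>The inverse limit of the rings of integers modulo \<open>p ^ n\<close>, each residue class being
  represented by its least non-negative member.\<close>

definition padic_int :: "nat \<Rightarrow> (nat \<Rightarrow> int) ring" where
  "padic_int p =
    \<lparr>carrier = {x. \<forall>n. 0 \<le> x n \<and> x n < int p ^ n \<and> x (Suc n) mod int p ^ n = x n},
     mult = (\<lambda>x y n. (x n * y n) mod int p ^ n),
     one = (\<lambda>n. 1 mod int p ^ n),
     zero = (\<lambda>n. 0),
     add = (\<lambda>x y n. (x n + y n) mod int p ^ n)\<rparr>"

definition univ_ring :: "'a::ring_1 ring" where
  "univ_ring = \<lparr>carrier = UNIV, mult = (*), one = 1, zero = 0, add = (+)\<rparr>"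

definition ring_hom_on :: "'a::ring_1 set \<Rightarrow> ('a \<Rightarrow> 'b::ring_1) \<Rightarrow> bool" where
  "ring_hom_on A f \<longleftrightarrow> f 1 = 1 \<and>
     (\<forall>x\<in>A. \<forall>y\<in>A. f (x + y) = f x + f y \<and> f (x * y) = f x * f y)"

text \<open>The field \<open>'k\<close> is the fraction field of the p-adic integers, embedded by \<open>e\<close>
  (it suffices to invert \<open>p\<close>).\<close>

definition is_Qp :: "nat \<Rightarrow> ((nat \<Rightarrow> int) \<Rightarrow> 'k::field) \<Rightarrow> bool" where
  "is_Qp p e \<longleftrightarrow>
     e \<in> ring_hom (padic_int p) univ_ring \<and> inj_on e (carrier (padic_int p)) \<and>
     (\<forall>a. \<exists>n. a * of_nat p ^ n \<in> e ` carrier (padic_int p))"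

definition centre :: "'d::division_ring set" where
  "centre = {z. \<forall>x. z * x = x * z}"

text \<open>\<open>Zp\<close> is a subring of the field \<open>'k\<close>, and \<open>emb\<close> makes \<open>'d\<close> a \<open>'k\<close>-algebra. An order is
  a subring which is a finitely generated \<open>Zp\<close>-module spanning \<open>'d\<close> over \<open>'k\<close>.\<close>

definition is_order :: "'k::field set \<Rightarrow> ('k \<Rightarrow> 'd::division_ring) \<Rightarrow> 'd set \<Rightarrow> bool" where
  "is_order Zp emb R \<longleftrightarrow>
     1 \<in> R \<and> (\<forall>x\<in>R. \<forall>y\<in>R. x - y \<in> R \<and> x * y \<in> R) \<and>
     (\<exists>S. finite S \<and> R = {\<Sum>s\<in>S. emb (c s) * s |c. c ` S \<subseteq> Zp}) \<and>
     Modules.module.span (\<lambda>a x. emb a * x) R = UNIV"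

definition is_maximal_order :: "'k::field set \<Rightarrow> ('k \<Rightarrow> 'd::division_ring) \<Rightarrow> 'd set \<Rightarrow> bool" where
  "is_maximal_order Zp emb R \<longleftrightarrow>
     is_order Zp emb R \<and> (\<forall>R'. is_order Zp emb R' \<longrightarrow> R \<subseteq> R' \<longrightarrow> R' = R)"

definition units_of_order :: "'d::division_ring set \<Rightarrow> 'd set" where
  "units_of_order OD = {x \<in> OD. x \<noteq> 0 \<and> inverse x \<in> OD}"

text \<open>Here \<open>'k\<close> is the field of p-adic numbers, \<open>'d\<close> the quaternion algebra (a central division
  algebra of dimension 4), \<open>w\<close> the uniformizer, \<open>'q\<close> the field with \<open>p\<^sup>2\<close> elements, \<open>res\<close> the
  reduction map identifying the residue field of \<open>OD\<close> with \<open>'q\<close>, and \<open>j\<close> the fixed embedding of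
  \<open>'q\<close> in the coefficient field \<open>'f\<close>. The subfield \<open>L\<close> is the unramified quadratic extension of
  the p-adic numbers: the extension of degree 2 generated by the roots of unity of order
  \<open>p\<^sup>2 - 1\<close>; \<open>\<sigma>\<close> is its non-trivial automorphism.\<close>

locale quaternion_setup =
  fixes p :: nat
    and e :: "(nat \<Rightarrow> int) \<Rightarrow> 'k::field"
    and emb :: "'k \<Rightarrow> 'd::division_ring"
    and L :: "'d set"
    and \<sigma> :: "'d \<Rightarrow> 'd"
    and OD :: "'d set"
    and w :: 'd
    and res :: "'d \<Rightarrow> 'q::{field,finite}"
    and j :: "'q \<Rightarrow> 'f::{field,finite}"
  assumes p_prime: "prime p"
    and Qp: "is_Qp p e"
    and emb_hom: "ring_hom_on UNIV emb"
    and emb_centre: "range emb = centre"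
    and dim_D: "vector_space.dim (\<lambda>a x. emb a * x) (UNIV :: 'd set) = 4"
    and L_subfield: "range emb \<subseteq> L"
      "\<And>x y. x \<in> L \<Longrightarrow> y \<in> L \<Longrightarrow> x + y \<in> L \<and> x * y \<in> L \<and> x * y = y * x"
      "\<And>x. x \<in> L \<Longrightarrow> inverse x \<in> L"
    and dim_L: "vector_space.dim (\<lambda>a x. emb a * x) L = 2"
    and L_root_of_unity:
      "\<exists>\<zeta>\<in>L. \<zeta> ^ (p\<^sup>2 - 1) = 1 \<and> (\<forall>k. 0 < k \<and> k < p\<^sup>2 - 1 \<longrightarrow> \<zeta> ^ k \<noteq> 1)"
    and sigma_aut: "\<sigma> ` L = L" "ring_hom_on L \<sigma>" "\<And>a. \<sigma> (emb a) = emb a"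
      "\<exists>a\<in>L. \<sigma> a \<noteq> a"
    and max_order: "is_maximal_order (e ` carrier (padic_int p)) emb OD"
    and w_uniformizer: "w \<in> OD" "OD - units_of_order OD = {w * x |x. x \<in> OD}"
    and w_square: "w\<^sup>2 = of_nat p"
    and w_conj: "\<And>a. a \<in> L \<Longrightarrow> inverse w * a * w = \<sigma> a"
    and card_q: "card (UNIV :: 'q set) = p\<^sup>2"
    and res_hom: "ring_hom_on OD res"
    and res_surj: "res ` OD = UNIV"
    and res_kernel: "{x \<in> OD. res x = 0} = {w * x |x. x \<in> OD}"
    and char_f: "CHAR('f) = p"
    and j_hom: "ring_hom_on UNIV j"

definition teich :: "nat \<Rightarrow> 'd::division_ring set \<Rightarrow> 'd set \<Rightarrow> ('d \<Rightarrow> 'q::{field,finite}) \<Rightarrow> 'q \<Rightarrow> 'd"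
  where "teich p L OD res a = (THE t. t \<in> L \<inter> OD \<and> t ^ (p\<^sup>2) = t \<and> res t = a)"

definition teich_group :: "nat \<Rightarrow> 'd::division_ring set \<Rightarrow> 'd set \<Rightarrow> ('d \<Rightarrow> 'q::{field,finite}) \<Rightarrow> 'd set"
  where "teich_group p L OD res = teich p L OD res ` (UNIV - {0})"

text \<open>The sets \<open>{x + w ^ n * y |y. y \<in> OD}\<close> form a neighbourhood basis of \<open>x\<close>.\<close>

definition D_open :: "'d::division_ring set \<Rightarrow> 'd \<Rightarrow> 'd set \<Rightarrow> bool" where
  "D_open OD w S \<longleftrightarrow> (\<forall>x\<in>S. \<exists>n. \<forall>y\<in>OD. x + w ^ n * y \<in> S)"

definition U1 :: "'d::division_ring set \<Rightarrow> 'd \<Rightarrow> 'd monoid" where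
  "U1 OD w = \<lparr>carrier = {1 + w * x |x. x \<in> OD}, mult = (*), one = 1\<rparr>"

definition Z1 :: "'d::division_ring set \<Rightarrow> 'd \<Rightarrow> 'd set" where
  "Z1 OD w = carrier (U1 OD w) \<inter> (centre - {0})"

text \<open>The open normal subgroups of the quotient \<open>U1 / Z1\<close> are written as the open normal subgroups
  \<open>N\<close> of \<open>U1\<close> containing \<open>Z1\<close>, the corresponding finite quotient being \<open>U1 / N\<close>.\<close>

definition open_normal :: "'d::division_ring set \<Rightarrow> 'd \<Rightarrow> 'd set set" where
  "open_normal OD w = {N. N \<lhd> U1 OD w \<and> Z1 OD w \<subseteq> N \<and> D_open OD w N}"

text \<open>An element of the inverse limit of the group algebras of the \<open>U1 / N\<close> is a function
  assigning to \<open>N\<close> and to a coset \<open>c\<close> of \<open>N\<close> the coefficient of \<open>c\<close> in the \<open>N\<close>-component.\<close>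

type_synonym ('d, 'f) iw = "'d set \<Rightarrow> 'd set \<Rightarrow> 'f"

definition iwasawa :: "'d::division_ring set \<Rightarrow> 'd \<Rightarrow> ('d, 'f::field) iw ring" where
  "iwasawa OD w =
    \<lparr>carrier = {a.
       (\<forall>N c. \<not> (N \<in> open_normal OD w \<and> c \<in> rcosets\<^bsub>U1 OD w\<^esub> N) \<longrightarrow> a N c = 0) \<and>
       (\<forall>N\<in>open_normal OD w. \<forall>M\<in>open_normal OD w. N \<subseteq> M \<longrightarrow>
          (\<forall>c\<in>rcosets\<^bsub>U1 OD w\<^esub> M. a M c = (\<Sum>c'\<in>{c' \<in> rcosets\<^bsub>U1 OD w\<^esub> N. c' \<subseteq> c}. a N c')))},
     mult = (\<lambda>a b N c. \<Sum>(r, s)\<in>{(r, s). r \<in> rcosets\<^bsub>U1 OD w\<^esub> N \<and> s \<in> rcosets\<^bsub>U1 OD w\<^esub> N \<and>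
       r <#>\<^bsub>U1 OD w\<^esub> s = c}. a N r * b N s),
     one = (\<lambda>N c. if N \<in> open_normal OD w \<and> c = N then 1 else 0),
     zero = (\<lambda>N c. 0),
     add = (\<lambda>a b N c. a N c + b N c)\<rparr>"

definition group_elt :: "'d::division_ring set \<Rightarrow> 'd \<Rightarrow> 'd \<Rightarrow> ('d, 'f::field) iw" where
  "group_elt OD w g =
     (\<lambda>N c. if N \<in> open_normal OD w \<and> c \<in> rcosets\<^bsub>U1 OD w\<^esub> N \<and> g \<in> c then 1 else 0)"

definition max_ideal :: "'d::division_ring set \<Rightarrow> 'd \<Rightarrow> ('d, 'f::field) iw set" where
  "max_ideal OD w = (THE I. maximalideal I (iwasawa OD w))"

text \<open>The element \<open>Y\<close> is obtained for \<open>k = 1\<close> and \<open>Z\<close> for \<open>k = p\<close>.\<close>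

definition elt_YZ :: "nat \<Rightarrow> 'd::division_ring set \<Rightarrow> 'd set \<Rightarrow> 'd \<Rightarrow> ('d \<Rightarrow> 'q::{field,finite}) \<Rightarrow>
    ('q \<Rightarrow> 'f::field) \<Rightarrow> nat \<Rightarrow> ('d, 'f) iw" where
  "elt_YZ p L OD w res j k =
     (\<lambda>N c. \<Sum>l\<in>UNIV - {0}. inverse (j l ^ k) * group_elt OD w (1 + w * teich p L OD res l) N c)"

text \<open>The automorphism of the Iwasawa algebra induced by \<open>x \<mapsto> g x g\<^sup>-\<^sup>1\<close>.\<close>

definition iw_conj :: "'d::division_ring \<Rightarrow> ('d, 'f) iw \<Rightarrow> ('d, 'f) iw" where
  "iw_conj g a =
     (\<lambda>N c. a ((\<lambda>x. inverse g * x * g) ` N) ((\<lambda>x. inverse g * x * g) ` c))"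

primrec ideal_pow :: "('a, 'r) ring_scheme \<Rightarrow> 'a set \<Rightarrow> nat \<Rightarrow> 'a set" where
  "ideal_pow R I 0 = carrier R"
| "ideal_pow R I (Suc n) = I \<cdot>\<^bsub>R\<^esub> ideal_pow R I n"

text \<open>An element of the direct sum of the \<open>F n / F (Suc n)\<close> is a finitely supported family of
  cosets; the zero of the \<open>n\<close>-th summand is \<open>F (Suc n)\<close>.\<close>

definition gr_carrier :: "('a, 'r) ring_scheme \<Rightarrow> (nat \<Rightarrow> 'a set) \<Rightarrow> (nat \<Rightarrow> 'a set) set" where
  "gr_carrier A F = {x. (\<forall>n. \<exists>a\<in>F n. x n = F (Suc n) +>\<^bsub>A\<^esub> a) \<and> finite {n. x n \<noteq> F (Suc n)}}"

definition rep :: "'a set \<Rightarrow> 'a" where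
  "rep c = (SOME a. a \<in> c)"

definition gr_ring :: "('a, 'r) ring_scheme \<Rightarrow> 'a set \<Rightarrow> (nat \<Rightarrow> 'a set) ring" where
  "gr_ring R I =
    \<lparr>carrier = gr_carrier R (ideal_pow R I),
     mult = (\<lambda>x y n. ideal_pow R I (Suc n) +>\<^bsub>R\<^esub>
       (\<Oplus>\<^bsub>R\<^esub>i\<in>{..n}. rep (x i) \<otimes>\<^bsub>R\<^esub> rep (y (n - i)))),
     one = (\<lambda>n. ideal_pow R I (Suc n) +>\<^bsub>R\<^esub> (if n = 0 then \<one>\<^bsub>R\<^esub> else \<zero>\<^bsub>R\<^esub>)),
     zero = (\<lambda>n. ideal_pow R I (Suc n)),
     add = (\<lambda>x y n. x n <+>\<^bsub>R\<^esub> y n)\<rparr>"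

text \<open>The homogeneous element of degree \<open>n\<close> given by the class of \<open>a \<in> ideal_pow R I n\<close>.\<close>

definition gr_class :: "('a, 'r) ring_scheme \<Rightarrow> 'a set \<Rightarrow> nat \<Rightarrow> 'a \<Rightarrow> (nat \<Rightarrow> 'a set)" where
  "gr_class R I n a = (\<lambda>k. ideal_pow R I (Suc k) +>\<^bsub>R\<^esub> (if k = n then a else \<zero>\<^bsub>R\<^esub>))"

definition gr_piece :: "('a, 'r) ring_scheme \<Rightarrow> (nat \<Rightarrow> 'a set) \<Rightarrow> nat \<Rightarrow> (nat \<Rightarrow> 'a set) set" where
  "gr_piece A F n = {x \<in> gr_carrier A F. \<forall>k. k \<noteq> n \<longrightarrow> x k = F (Suc k)}"

text \<open>Left modules over a not necessarily commutative ring, with a grading and with operators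
  from \<open>'g\<close>. The record extends HOL-Algebra's module record, whose inherited fields \<open>mult\<close> and
  \<open>one\<close> are irrelevant.\<close>

record ('g, 'a, 'b) graded_module = "('a, 'b) module" +
  piece :: "nat \<Rightarrow> 'b set"
  act :: "'g \<Rightarrow> 'b \<Rightarrow> 'b"

definition ideal_times_module ::
    "('a, 'r) ring_scheme \<Rightarrow> 'a set \<Rightarrow> ('a, 'm, 's) module_scheme \<Rightarrow> nat \<Rightarrow> 'm set" where
  "ideal_times_module R I M n =
     generate (add_monoid M) {a \<odot>\<^bsub>M\<^esub> x |a x. a \<in> ideal_pow R I n \<and> x \<in> carrier M}"

text \<open>The graded module of the \<open>I\<close>-adic filtration on \<open>M\<close>; the operator \<open>T g\<close> on \<open>M\<close> is
  assumed to preserve the filtration and acts on cosets by taking images.\<close>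

definition gr_module :: "('a, 'r) ring_scheme \<Rightarrow> 'a set \<Rightarrow> ('a, 'm, 's) module_scheme \<Rightarrow>
    ('g \<Rightarrow> 'm \<Rightarrow> 'm) \<Rightarrow> ('g, nat \<Rightarrow> 'a set, nat \<Rightarrow> 'm set) graded_module" where
  "gr_module R I M T =
    \<lparr>carrier = gr_carrier M (ideal_times_module R I M),
     mult = undefined,
     one = undefined,
     zero = (\<lambda>n. ideal_times_module R I M (Suc n)),
     add = (\<lambda>x y n. x n <+>\<^bsub>M\<^esub> y n),
     smult = (\<lambda>a x n. ideal_times_module R I M (Suc n) +>\<^bsub>M\<^esub>
       (\<Oplus>\<^bsub>M\<^esub>i\<in>{..n}. rep (a i) \<odot>\<^bsub>M\<^esub> rep (x (n - i)))),
     piece = gr_piece M (ideal_times_module R I M),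
     act = (\<lambda>g x n. T g ` x n)\<rparr>"

text \<open>The quotient of \<open>R\<close> by a two-sided ideal \<open>J\<close> as a left \<open>R\<close>-module, with the grading and the
  operators induced from a grading \<open>P\<close> of \<open>R\<close> and operators \<open>T\<close> on \<open>R\<close> preserving \<open>J\<close>.\<close>

definition quot_module :: "('a, 'r) ring_scheme \<Rightarrow> 'a set \<Rightarrow> (nat \<Rightarrow> 'a set) \<Rightarrow> ('g \<Rightarrow> 'a \<Rightarrow> 'a) \<Rightarrow>
    ('g, 'a, 'a set) graded_module" where
  "quot_module R J P T =
    \<lparr>carrier = carrier (R Quot J),
     mult = mult (R Quot J),
     one = one (R Quot J),
     zero = zero (R Quot J),
     add = add (R Quot J),
     smult = (\<lambda>a c. (J +>\<^bsub>R\<^esub> a) \<otimes>\<^bsub>R Quot J\<^esub> c),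
     piece = (\<lambda>n. {J +>\<^bsub>R\<^esub> x |x. x \<in> P n}),
     act = (\<lambda>g c. T g ` c)\<rparr>"

definition direct_sum :: "('g, 'a, 'b) graded_module \<Rightarrow> ('g, 'a, 'c) graded_module \<Rightarrow>
    ('g, 'a, 'b \<times> 'c) graded_module" where
  "direct_sum M N =
    \<lparr>carrier = carrier M \<times> carrier N,
     mult = undefined,
     one = undefined,
     zero = (\<zero>\<^bsub>M\<^esub>, \<zero>\<^bsub>N\<^esub>),
     add = (\<lambda>(x, y) (x', y'). (x \<oplus>\<^bsub>M\<^esub> x', y \<oplus>\<^bsub>N\<^esub> y')),
     smult = (\<lambda>a (x, y). (a \<odot>\<^bsub>M\<^esub> x, a \<odot>\<^bsub>N\<^esub> y)),
     piece = (\<lambda>n. piece M n \<times> piece N n),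
     act = (\<lambda>g (x, y). (act M g x, act N g y))\<rparr>"

definition graded_isomorphic :: "('a, 'r) ring_scheme \<Rightarrow> 'g set \<Rightarrow> ('g, 'a, 'b) graded_module \<Rightarrow>
    ('g, 'a, 'c) graded_module \<Rightarrow> bool" where
  "graded_isomorphic R H M N \<longleftrightarrow>
     (\<exists>\<phi>. bij_betw \<phi> (carrier M) (carrier N) \<and>
        (\<forall>x\<in>carrier M. \<forall>y\<in>carrier M. \<phi> (x \<oplus>\<^bsub>M\<^esub> y) = \<phi> x \<oplus>\<^bsub>N\<^esub> \<phi> y) \<and>
        (\<forall>a\<in>carrier R. \<forall>x\<in>carrier M. \<phi> (a \<odot>\<^bsub>M\<^esub> x) = a \<odot>\<^bsub>N\<^esub> \<phi> x) \<and>
        (\<forall>n. \<phi> ` piece M n = piece N n) \<and>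
        (\<forall>g\<in>H. \<forall>x\<in>carrier M. \<phi> (act M g x) = act N g (\<phi> x)))"

definition gr_iwasawa :: "'d::division_ring set \<Rightarrow> 'd \<Rightarrow> (nat \<Rightarrow> ('d, 'f::field) iw set) ring" where
  "gr_iwasawa OD w = gr_ring (iwasawa OD w) (max_ideal OD w)"

definition gr_y :: "nat \<Rightarrow> 'd::division_ring set \<Rightarrow> 'd set \<Rightarrow> 'd \<Rightarrow> ('d \<Rightarrow> 'q::{field,finite}) \<Rightarrow>
    ('q \<Rightarrow> 'f::field) \<Rightarrow> nat \<Rightarrow> ('d, 'f) iw set" where
  "gr_y p L OD w res j = gr_class (iwasawa OD w) (max_ideal OD w) 1 (elt_YZ p L OD w res j 1)"

definition gr_z :: "nat \<Rightarrow> 'd::division_ring set \<Rightarrow> 'd set \<Rightarrow> 'd \<Rightarrow> ('d \<Rightarrow> 'q::{field,finite}) \<Rightarrow>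
    ('q \<Rightarrow> 'f::field) \<Rightarrow> nat \<Rightarrow> ('d, 'f) iw set" where
  "gr_z p L OD w res j = gr_class (iwasawa OD w) (max_ideal OD w) 1 (elt_YZ p L OD w res j p)"

text \<open>The quotient of the graded Iwasawa algebra by the two-sided ideal generated by \<open>b\<close> and
  \<open>a ^ m\<close>, with the action of \<open>g\<close> induced by conjugation; for \<open>a = y\<close>, \<open>b = z\<close> this is the
  module denoted \<open>F[y] / (y ^ m)\<close>. On the generators, conjugation is multiplication of \<open>y\<close> by
  \<open>\<alpha>(g)\<close> and of \<open>z\<close> by its inverse.\<close>

definition truncated :: "'d::division_ring set \<Rightarrow> 'd \<Rightarrow> (nat \<Rightarrow> ('d, 'f::field) iw set) \<Rightarrow>
    (nat \<Rightarrow> ('d, 'f) iw set) \<Rightarrow> nat \<Rightarrow>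
    ('d, nat \<Rightarrow> ('d, 'f) iw set, (nat \<Rightarrow> ('d, 'f) iw set) set) graded_module" where
  "truncated OD w a b m =
     quot_module (gr_iwasawa OD w)
       (Idl\<^bsub>gr_iwasawa OD w\<^esub> {b, a [^]\<^bsub>gr_iwasawa OD w\<^esub> m})
       (gr_piece (iwasawa OD w) (ideal_pow (iwasawa OD w) (max_ideal OD w)))
       (\<lambda>g x n. iw_conj g ` x n)"

text \<open>Scalars of the coefficient field act through the degree 0 part of the graded algebra.\<close>

definition gr_const :: "'d::division_ring set \<Rightarrow> 'd \<Rightarrow> 'f::field \<Rightarrow> nat \<Rightarrow> ('d, 'f) iw set" where
  "gr_const OD w a = gr_class (iwasawa OD w) (max_ideal OD w) 0
     (\<lambda>N c. a * \<one>\<^bsub>iwasawa OD w\<^esub> N c)"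

definition twist :: "'d::division_ring set \<Rightarrow> 'd \<Rightarrow> ('d \<Rightarrow> 'f::field) \<Rightarrow>
    ('d, nat \<Rightarrow> ('d, 'f) iw set, 'b) graded_module \<Rightarrow>
    ('d, nat \<Rightarrow> ('d, 'f) iw set, 'b) graded_module" where
  "twist OD w \<psi> M = M\<lparr>act := (\<lambda>g x. gr_const OD w (\<psi> g) \<odot>\<^bsub>M\<^esub> act M g x)\<rparr>"

definition smooth_character :: "'d::division_ring set \<Rightarrow> 'd \<Rightarrow> ('d \<Rightarrow> 'f::field) \<Rightarrow> bool" where
  "smooth_character OD w \<chi> \<longleftrightarrow>
     (\<forall>x\<in>units_of_order OD. \<chi> x \<noteq> 0 \<and> (\<forall>y\<in>units_of_order OD. \<chi> (x * y) = \<chi> x * \<chi> y)) \<and>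
     D_open OD w {x \<in> units_of_order OD. \<chi> x = 1}"

definition dual_char :: "('d \<Rightarrow> 'f::field) \<Rightarrow> 'd \<Rightarrow> 'f" where
  "dual_char \<chi> = (\<lambda>x. inverse (\<chi> x))"

definition sigma_char :: "'d::division_ring \<Rightarrow> ('d \<Rightarrow> 'f::field) \<Rightarrow> 'd \<Rightarrow> 'f" where
  "sigma_char w \<chi> = (\<lambda>x. \<chi> (inverse w * x * w))"

definition smooth_representation :: "'d::division_ring set \<Rightarrow> 'd \<Rightarrow>
    ('f::field \<Rightarrow> 'v::ab_group_add \<Rightarrow> 'v) \<Rightarrow> ('d \<Rightarrow> 'v \<Rightarrow> 'v) \<Rightarrow> bool" where
  "smooth_representation OD w scl \<rho> \<longleftrightarrow>
     vector_space scl \<and>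
     (\<forall>g. g \<noteq> 0 \<longrightarrow> Vector_Spaces.linear scl scl (\<rho> g)) \<and>
     (\<forall>v. \<rho> 1 v = v) \<and>
     (\<forall>g h v. g \<noteq> 0 \<longrightarrow> h \<noteq> 0 \<longrightarrow> \<rho> (g * h) v = \<rho> g (\<rho> h v)) \<and>
     (\<forall>v. D_open OD w {g. g \<noteq> 0 \<and> \<rho> g v = v})"

definition has_central_character ::
    "('f::field \<Rightarrow> 'v::ab_group_add \<Rightarrow> 'v) \<Rightarrow> ('d::division_ring \<Rightarrow> 'v \<Rightarrow> 'v) \<Rightarrow> bool" where
  "has_central_character scl \<rho> \<longleftrightarrow>
     (\<exists>\<psi>. (\<forall>z\<in>centre - {0}. \<psi> z \<noteq> 0 \<and> (\<forall>y\<in>centre - {0}. \<psi> (z * y) = \<psi> z * \<psi> y)) \<and>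
        (\<forall>z\<in>centre - {0}. \<forall>v. \<rho> z v = scl (\<psi> z) v))"

text \<open>The dual of a representation, on which the group acts by \<open>(g f)(v) = f (g\<^sup>-\<^sup>1 v)\<close>. An
  element \<open>a\<close> of the Iwasawa algebra acts on \<open>f\<close> at \<open>v\<close> through its \<open>N\<close>-component, for any open
  normal subgroup \<open>N\<close> fixing \<open>v\<close>; the result does not depend on \<open>N\<close>.\<close>

definition dual_act :: "('d::division_ring \<Rightarrow> 'v \<Rightarrow> 'v) \<Rightarrow> 'd \<Rightarrow> ('v \<Rightarrow> 'f) \<Rightarrow> 'v \<Rightarrow> 'f" where
  "dual_act \<rho> g f = (\<lambda>v. f (\<rho> (inverse g) v))"

definition dual_module :: "'d::division_ring set \<Rightarrow> 'd \<Rightarrow> ('f::field \<Rightarrow> 'v::ab_group_add \<Rightarrow> 'v) \<Rightarrow>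
    ('d \<Rightarrow> 'v \<Rightarrow> 'v) \<Rightarrow> (('d, 'f) iw, 'v \<Rightarrow> 'f) module" where
  "dual_module OD w scl \<rho> =
    \<lparr>carrier = {f. Vector_Spaces.linear scl (*) f},
     mult = undefined,
     one = undefined,
     zero = (\<lambda>v. 0),
     add = (\<lambda>f g v. f v + g v),
     smult = (\<lambda>a f v. let N = (SOME N. N \<in> open_normal OD w \<and> (\<forall>g\<in>N. \<rho> g v = v))
       in \<Sum>c\<in>rcosets\<^bsub>U1 OD w\<^esub> N. a N c * dual_act \<rho> (rep c) f v)\<rparr>"

definition gr_dual :: "'d::division_ring set \<Rightarrow> 'd \<Rightarrow> ('f::field \<Rightarrow> 'v::ab_group_add \<Rightarrow> 'v) \<Rightarrow>
    ('d \<Rightarrow> 'v \<Rightarrow> 'v) \<Rightarrow> ('d, nat \<Rightarrow> ('d, 'f) iw set, nat \<Rightarrow> ('v \<Rightarrow> 'f) set) graded_module" where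
  "gr_dual OD w scl \<rho> =
     gr_module (iwasawa OD w) (max_ideal OD w) (dual_module OD w scl \<rho>) (dual_act \<rho>)"

end

theory Submission
  imports Defs "HOL-Library.Function_Algebras" "HOL-Computational_Algebra.Polynomial" "HOL-Algebra.UnivPoly" "HOL-Algebra.Subrings"
begin

text \<open>Let \<open>F n\<close> be the \<open>n\<close>-th step of the filtration of the dual of \<open>\<pi>\<close> and let \<open>Y\<close>, \<open>Z\<close> also denote the
  operators on the dual given by these elements of the Iwasawa algebra. An isomorphism yields
  \<open>v0\<close>, \<open>v1\<close> which span the dual modulo \<open>F 1\<close>, such that \<open>Z Y\<^sup>i v0\<close> and \<open>Y Z\<^sup>i v1\<close> lie in \<open>F (i + 2)\<close>
  while \<open>Y\<^sup>n v0\<close> and \<open>Z\<^sup>n v1\<close> are linearly independent modulo \<open>F (n + 1)\<close> for \<open>n \<le> p\<close>. The last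
  property holds because \<open>y\<^sup>n\<close> does not vanish in the graded algebra modulo \<open>z\<close> and \<open>y\<^sup>p\<^sup>+\<^sup>3\<close>, as
  is seen by pairing with explicit functions on the group.

  Put \<open>T = u - 1\<close>, where \<open>u\<close> is the commutator of \<open>1 + w\<close> and \<open>1 + w [\<mu>]\<close> for a generator \<open>\<mu>\<close> of the
  residue field. Then \<open>T\<close> is congruent to a multiple of \<open>Y Z - Z Y\<close>, so it maps \<open>v0\<close> and \<open>v1\<close> to \<open>F 3\<close>. The
  commutator of \<open>u\<close> with \<open>1 + w [\<lambda>]\<close> is congruent modulo \<open>w\<^sup>4\<close> to the \<open>p\<close>-th power of \<open>1 + w [\<beta> \<lambda>]\<close>
  with a fixed \<open>\<beta> \<noteq> 0\<close>. Hence \<open>T Z - Z T\<close> raises degrees by \<open>p\<close> and maps \<open>v0\<close> to \<open>\<beta>\<^sup>p Y\<^sup>p v0\<close> modulo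
  \<open>F (p + 1)\<close>. A comparison of eigenvalues for the Teichmueller lifts shows that \<open>Y\<^sup>p v0\<close> would
  then lie in the span of the \<open>Z\<^sup>i v1\<close> modulo \<open>F (p + 1)\<close>.\<close>

section \<open>Arithmetic of the maximal order\<close>

text \<open>Both summands are modules over the graded algebra, so its relations alone give no
  contradiction. The proof uses a relation of the Iwasawa algebra which they hide: \<open>h\<close>
  is central in the graded algebra, but \<open>T Z - Z T\<close>, invisible in degree 3, has terms
  in degree \<open>p\<close>. The reason is that elements of the third congruence subgroup are
  limits of products of \<open>p\<close>-th powers, and
  \<open>g\<^sup>p - 1 = (g - 1)\<^sup>p\<close> in characteristic \<open>p\<close>.

  The obstacle is that an isomorphism controls leading terms only: \<open>Z Y\<^sup>i v0\<close>
  lies in \<open>F (i + 2)\<close> but need not vanish, and its part of higher degree could contain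
  \<open>Y\<^sup>p v0\<close>. Eigenvalues under the Teichmueller group exclude this, since
  \<open>\<alpha>\<close> has order \<open>p + 1\<close> and so separates the
  \<open>Y\<^sup>i v0\<close> with \<open>0 \<le> i \<le> p\<close>.

  Degrees are measured on the representation itself: powers of the maximal ideal correspond to a
  socle filtration, on which commutators and \<open>p\<close>-th powers of group elements are easy
  to follow. The Iwasawa algebra is treated as the dual of the locally constant functions, which
  avoids computing in inverse limits.\<close>

context quaternion_setup
begin

lemma OD_one [simp]: "1 \<in> OD"
  and OD_diff [intro]: "x \<in> OD \<Longrightarrow> y \<in> OD \<Longrightarrow> x - y \<in> OD"
  and OD_mult [intro]: "x \<in> OD \<Longrightarrow> y \<in> OD \<Longrightarrow> x * y \<in> OD"
proof -
  have "1 \<in> OD \<and> (\<forall>x\<in>OD. \<forall>y\<in>OD. x - y \<in> OD \<and> x * y \<in> OD)"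
    using max_order unfolding is_maximal_order_def is_order_def by (elim conjE) (intro conjI)
  then show "1 \<in> OD" "x \<in> OD \<Longrightarrow> y \<in> OD \<Longrightarrow> x - y \<in> OD" "x \<in> OD \<Longrightarrow> y \<in> OD \<Longrightarrow> x * y \<in> OD"
    by simp_all
qed

lemma OD_zero [simp]: "0 \<in> OD"
  using OD_diff[of 1 1] by simp

lemma OD_uminus [intro]: "x \<in> OD \<Longrightarrow> - x \<in> OD"
  using OD_diff[of 0 x] by simp

lemma OD_add [intro]: "x \<in> OD \<Longrightarrow> y \<in> OD \<Longrightarrow> x + y \<in> OD"
  using OD_diff[of x "- y"] OD_uminus[of y] by simp

lemma OD_power [intro]: "x \<in> OD \<Longrightarrow> x ^ n \<in> OD"
  by (induction n) auto

lemma OD_of_nat [simp]: "of_nat n \<in> OD"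
  by (induction n) auto

lemma OD_sum [intro]: "(\<And>i. i \<in> A \<Longrightarrow> f i \<in> OD) \<Longrightarrow> sum f A \<in> OD"
  by (induction A rule: infinite_finite_induct) auto

lemma p_gt_1: "p > 1"
  using p_prime prime_gt_1_nat by blast

lemma emb_add: "emb (x + y) = emb x + emb y"
  and emb_mult: "emb (x * y) = emb x * emb y"
  and emb_one [simp]: "emb 1 = 1"
  using emb_hom unfolding ring_hom_on_def by auto

lemma emb_zero [simp]: "emb 0 = 0"
  using emb_add[of 0 0] by simp

lemma emb_of_nat [simp]: "emb (of_nat n) = of_nat n"
  by (induction n) (simp_all add: emb_add)

lemma emb_power: "emb (x ^ n) = emb x ^ n"
  by (induction n) (simp_all add: emb_mult)

lemma emb_eq_0_iff [simp]: "emb x = 0 \<longleftrightarrow> x = 0"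
proof
  assume "emb x = 0"
  show "x = 0"
  proof (rule ccontr)
    assume "x \<noteq> 0"
    then have "emb x * emb (inverse x) = 1"
      by (simp flip: emb_mult)
    with \<open>emb x = 0\<close> show False by simp
  qed
qed simp

lemma emb_commute: "emb a * x = x * emb a"
  using emb_centre unfolding centre_def by (metis (mono_tags, lifting) mem_Collect_eq rangeI)

lemma e_add: "x \<in> carrier (padic_int p) \<Longrightarrow> y \<in> carrier (padic_int p) \<Longrightarrow>
    e (\<lambda>n. (x n + y n) mod int p ^ n) = e x + e y"
  and e_mult: "x \<in> carrier (padic_int p) \<Longrightarrow> y \<in> carrier (padic_int p) \<Longrightarrow>
    e (\<lambda>n. (x n * y n) mod int p ^ n) = e x * e y"
  and e_one: "e (\<lambda>n. 1 mod int p ^ n) = 1"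
  and e_inj: "inj_on e (carrier (padic_int p))"
  and e_fraction: "\<exists>n. a * of_nat p ^ n \<in> e ` carrier (padic_int p)"
  using Qp unfolding is_Qp_def ring_hom_def by (auto simp: univ_ring_def padic_int_def)

lemma padic_of_nat_closed: "(\<lambda>k. int n mod int p ^ k) \<in> carrier (padic_int p)"
  using p_gt_1 by (auto simp: padic_int_def mod_mod_cancel)

lemma padic_mult_closed:
  "x \<in> carrier (padic_int p) \<Longrightarrow> y \<in> carrier (padic_int p) \<Longrightarrow>
    (\<lambda>n. (x n * y n) mod int p ^ n) \<in> carrier (padic_int p)"
  using p_gt_1 apply (auto simp: padic_int_def mod_mod_cancel)
  by (metis mod_mult_eq)

lemma padic_add_closed:
  assumes "x \<in> carrier (padic_int p)" "y \<in> carrier (padic_int p)"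
  shows "(\<lambda>n. (x n + y n) mod int p ^ n) \<in> carrier (padic_int p)"
proof -
  have "(x (Suc n) + y (Suc n)) mod int p ^ n = (x n + y n) mod int p ^ n" for n
  proof -
    have "x (Suc n) mod int p ^ n = x n" "y (Suc n) mod int p ^ n = y n"
      using assms by (auto simp: padic_int_def)
    then show ?thesis by (metis mod_add_eq mod_mod_trivial)
  qed
  then show ?thesis using p_gt_1 by (auto simp: padic_int_def mod_mod_cancel)
qed

lemma e_of_nat: "e (\<lambda>k. int n mod int p ^ k) = of_nat n"
proof (induction n)
  case 0
  have "e (\<lambda>k. 0) + e (\<lambda>k. 0) = e (\<lambda>k. 0)"
    using e_add[OF padic_of_nat_closed[of 0] padic_of_nat_closed[of 0]] by simp
  then have "e (\<lambda>k. 0) = 0" by (metis add_cancel_right_right)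
  then show ?case by simp
next
  case (Suc n)
  have "e (\<lambda>k. int (Suc n) mod int p ^ k) = e (\<lambda>k. (int n mod int p ^ k + int 1 mod int p ^ k) mod int p ^ k)"
    by (intro arg_cong[of _ _ e] ext) (simp add: mod_simps add.commute)
  also have "\<dots> = of_nat n + 1"
    using e_add[OF padic_of_nat_closed[of n] padic_of_nat_closed[of 1]] Suc e_one by simp
  finally show ?case by simp
qed

lemma of_nat_p_nonzero_k: "(of_nat p :: 'k) \<noteq> 0"
proof
  assume "(of_nat p :: 'k) = 0"
  then have "e (\<lambda>k. int p mod int p ^ k) = e (\<lambda>k. int 0 mod int p ^ k)"
    using e_of_nat[of p] e_of_nat[of 0] by simp
  then have "(\<lambda>k. int p mod int p ^ k) = (\<lambda>k. int 0 mod int p ^ k)"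
    using e_inj padic_of_nat_closed[of p] padic_of_nat_closed[of 0] by (meson inj_onD)
  then have "int p mod int p ^ 2 = 0"
    by (metis mod_0 of_nat_0)
  moreover have "int p < int p ^ 2"
    using p_gt_1 by (simp add: power2_eq_square)
  ultimately show False using p_gt_1 by simp
qed

lemma of_nat_p_nonzero: "(of_nat p :: 'd) \<noteq> 0"
  using of_nat_p_nonzero_k by (metis emb_of_nat emb_eq_0_iff)

lemma w_nonzero [simp]: "w \<noteq> 0"
  using w_square of_nat_p_nonzero by auto

lemma w_OD [simp]: "w \<in> OD" by (fact w_uniformizer(1))

lemma ww: "w * w = of_nat p"
  using w_square by (simp add: power2_eq_square)

lemma res_one [simp]: "res 1 = 1"
  and res_add: "x \<in> OD \<Longrightarrow> y \<in> OD \<Longrightarrow> res (x + y) = res x + res y"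
  and res_mult: "x \<in> OD \<Longrightarrow> y \<in> OD \<Longrightarrow> res (x * y) = res x * res y"
  using res_hom unfolding ring_hom_on_def by auto

lemma res_zero [simp]: "res 0 = 0"
  using res_add[of 0 0] by (metis OD_zero add_cancel_right_right)

lemma res_uminus: "x \<in> OD \<Longrightarrow> res (- x) = - res x"
  using res_add[of x "- x"] OD_uminus by (simp add: eq_neg_iff_add_eq_0 add.commute)

lemma res_diff: "x \<in> OD \<Longrightarrow> y \<in> OD \<Longrightarrow> res (x - y) = res x - res y"
  using res_add[of x "- y"] res_uminus[of y] OD_uminus by simp

lemma res_power: "x \<in> OD \<Longrightarrow> res (x ^ n) = res x ^ n"
  by (induction n) (simp_all add: res_mult OD_power)

lemma res_of_nat [simp]: "res (of_nat n) = of_nat n"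
  by (induction n) (auto simp: res_add)

lemma res_sum: "(\<And>i. i \<in> A \<Longrightarrow> f i \<in> OD) \<Longrightarrow> res (sum f A) = (\<Sum>i\<in>A. res (f i))"
  by (induction A rule: infinite_finite_induct) (auto simp: res_add OD_sum)

lemma res_eq_0_iff: "x \<in> OD \<Longrightarrow> res x = 0 \<longleftrightarrow> (\<exists>y\<in>OD. x = w * y)"
  using res_kernel by blast

lemma res_w_mult [simp]: "x \<in> OD \<Longrightarrow> res (w * x) = 0"
  using res_eq_0_iff[of "w * x"] OD_mult[OF w_OD] by blast

lemma res_w [simp]: "res w = 0"
  using res_w_mult[of 1] by simp

lemma res_eq_iff: "x \<in> OD \<Longrightarrow> y \<in> OD \<Longrightarrow> res x = res y \<longleftrightarrow> (\<exists>z\<in>OD. x = y + w * z)"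
  using res_eq_0_iff[of "x - y"] by (auto simp: res_diff algebra_simps)

lemma OD_w_swap:
  assumes "x \<in> OD" obtains y where "y \<in> OD" "x * w = w * y"
proof -
  have "res (x * w) = 0" using assms by (simp add: res_mult)
  then show ?thesis using res_eq_0_iff[OF OD_mult[OF assms w_OD]] that by blast
qed

lemma OD_w_conj: "x \<in> OD \<Longrightarrow> inverse w * x * w \<in> OD"
  using OD_w_swap[of x] by (metis left_inverse mult.assoc mult_1_left w_nonzero)

lemma OD_w_power_swap:
  assumes "x \<in> OD" obtains y where "y \<in> OD" "x * w ^ n = w ^ n * y"
proof -
  have "\<exists>y\<in>OD. x * w ^ n = w ^ n * y" using assms
  proof (induction n arbitrary: x)
    case (Suc n)
    obtain y where y: "y \<in> OD" "x * w = w * y" using OD_w_swap Suc.prems by blast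
    obtain z where "z \<in> OD" "y * w ^ n = w ^ n * z" using Suc.IH y by blast
    then show ?case using y by (metis mult.assoc power_Suc)
  qed auto
  then show ?thesis using that by blast
qed

lemma OD_unit:
  assumes "x \<in> OD" "res x \<noteq> 0" shows "inverse x \<in> OD" "x \<noteq> 0"
proof -
  have "x \<notin> {w * x |x. x \<in> OD}" using assms by auto
  then have "x \<in> units_of_order OD" using w_uniformizer(2) assms by blast
  then show "inverse x \<in> OD" "x \<noteq> 0" by (auto simp: units_of_order_def)
qed

section \<open>The residue field and its prime field\<close>

lemma CHAR_q: "CHAR('q) = p"
proof -
  have "of_nat p = (0 :: 'q)"
    using res_of_nat[of p] res_w_mult[of w] by (simp add: ww)
  then have "CHAR('q) dvd p" by (simp add: of_nat_eq_0_iff_char_dvd)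
  moreover have "CHAR('q) \<noteq> 1" using CHAR_not_1' by simp
  ultimately show ?thesis using p_prime by (auto simp: prime_nat_iff)
qed

lemma q_frob_add: "(x + y :: 'q) ^ p = x ^ p + y ^ p"
  using freshmans_dream[where ?'a = 'q] CHAR_q p_prime by auto

lemma q_power_card_pred:
  assumes "(x :: 'q) \<noteq> 0" shows "x ^ (p\<^sup>2 - 1) = 1"
proof -
  have "(\<Prod>y\<in>UNIV - {0}. y) = (\<Prod>y\<in>UNIV - {0}. x * y)"
    by (rule prod.reindex_bij_witness[of _ "\<lambda>y. x * y" "\<lambda>y. y / x"]) (use assms in auto)
  also have "\<dots> = x ^ card (UNIV - {0 :: 'q}) * (\<Prod>y\<in>UNIV - {0}. y)"
    by (simp add: prod.distrib)
  finally have "x ^ card (UNIV - {0 :: 'q}) = 1" by simp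
  then show ?thesis by (simp add: card_Diff_singleton card_q)
qed

lemma p_sq_gt_1: "p\<^sup>2 > 1"
  using p_gt_1 one_less_power[of p 2] by simp

lemma q_power_card: "(x :: 'q) ^ (p\<^sup>2) = x"
proof (cases "x = 0")
  case False
  have "x ^ (p\<^sup>2) = x ^ Suc (p\<^sup>2 - 1)" using p_sq_gt_1 by (metis Suc_diff_1 order_less_trans zero_less_one)
  then show ?thesis using q_power_card_pred[OF False] by (simp only: power_Suc mult_1_right)
qed (use p_gt_1 in simp)

lemma q_frob_frob: "((x :: 'q) ^ p) ^ p = x"
  using q_power_card[of x] by (simp add: power2_eq_square power_mult)

lemma q_of_nat_frob: "(of_nat n :: 'q) ^ p = of_nat n"
  using p_gt_1 by (induction n) (auto simp: q_frob_add)

lemma q_of_nat_eq_0_iff: "(of_nat n :: 'q) = 0 \<longleftrightarrow> p dvd n"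
  by (simp add: of_nat_eq_0_iff_char_dvd CHAR_q)

text \<open>The polynomial \<open>X\<^sup>p - X\<close> has at most \<open>p\<close> roots, and the
  images of \<open>0, ..., p - 1\<close> are \<open>p\<close> distinct ones. Traces and norms from
  the residue field can thereby be treated as integers.\<close>

lemma q_frob_fixed:
  assumes "(x :: 'q) ^ p = x" obtains n where "x = of_nat n"
proof -
  define f :: "'q poly" where "f = [:0, 1:] ^ p - [:0, 1:]"
  have pf: "poly f y = y ^ p - y" for y by (simp add: f_def)
  have degX: "degree ([:0, 1:] ^ p :: 'q poly) = p"
    by (simp add: degree_power_eq)
  have deg: "degree f = p"
    unfolding f_def diff_conv_add_uminus using degX p_gt_1 by (subst degree_add_eq_left) simp_all
  have f0: "f \<noteq> 0" using deg p_gt_1 by auto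
  have inj: "inj_on (of_nat :: nat \<Rightarrow> 'q) {..<p}"
  proof (rule inj_onI)
    fix a b assume ab: "a \<in> {..<p}" "b \<in> {..<p}" "(of_nat a :: 'q) = of_nat b"
    have *: "a = b" if "a \<le> b" "(of_nat a :: 'q) = of_nat b" "b < p" for a b
    proof -
      have "(of_nat (b - a) :: 'q) = 0" using that by (simp add: of_nat_diff)
      then have "p dvd b - a" using q_of_nat_eq_0_iff by blast
      then show "a = b" using that by (metis diff_is_0_eq' dvd_imp_le less_imp_diff_less not_le order.antisym zero_less_diff)
    qed
    show "a = b" using *[of a b] *[of b a] ab by (metis lessThan_iff nle_le)
  qed
  have "of_nat ` {..<p} \<subseteq> {y. poly f y = 0}"
    by (auto simp: pf q_of_nat_frob)
  moreover have "card {y. poly f y = 0} \<le> p"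
    using card_poly_roots_bound[OF f0] deg by simp
  moreover have "card ((of_nat :: nat \<Rightarrow> 'q) ` {..<p}) = p"
    using card_image[OF inj] by simp
  ultimately have "of_nat ` {..<p} = {y. poly f y = 0}"
    by (intro card_seteq) auto
  then show ?thesis using assms that pf by (metis (mono_tags, lifting) diff_self imageE mem_Collect_eq)
qed

section \<open>The maximal order as a valuation ring\<close>

lemma vector_space_D: "vector_space (\<lambda>a x. emb a * x)"
  by unfold_locales (simp_all add: emb_add emb_mult algebra_simps)

text \<open>\<open>is_order\<close> does not state closure under scalars directly. Expanding
  \<open>1\<close> in the generators and scaling the coefficients exhibits \<open>emb (e z)\<close>
  itself as an element of the generated module.\<close>

lemma padic_in_OD:
  assumes "z \<in> carrier (padic_int p)" shows "emb (e z) \<in> OD"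
proof -
  have "\<exists>S. finite S \<and> OD = {\<Sum>s\<in>S. emb (c s) * s |c. c ` S \<subseteq> e ` carrier (padic_int p)}"
    using max_order unfolding is_maximal_order_def is_order_def by (elim conjE)
  then obtain S where S: "finite S" "OD = {\<Sum>s\<in>S. emb (c s) * s |c. c ` S \<subseteq> e ` carrier (padic_int p)}"
    by (elim exE conjE)
  have "1 \<in> {\<Sum>s\<in>S. emb (c s) * s |c. c ` S \<subseteq> e ` carrier (padic_int p)}"
    using OD_one unfolding S(2) .
  then obtain c where c: "c ` S \<subseteq> e ` carrier (padic_int p)" "1 = (\<Sum>s\<in>S. emb (c s) * s)"
    unfolding mem_Collect_eq by (elim exE conjE)
  have "emb (e z) = (\<Sum>s\<in>S. emb (e z * c s) * s)"
    using arg_cong[OF c(2), of "\<lambda>x. emb (e z) * x"]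
    by (simp add: sum_distrib_left emb_mult mult.assoc)
  moreover have "(\<lambda>s. e z * c s) ` S \<subseteq> e ` carrier (padic_int p)"
  proof -
    have "e z * c s \<in> e ` carrier (padic_int p)" if s: "s \<in> S" for s
    proof -
      obtain y where y: "y \<in> carrier (padic_int p)" "c s = e y" using c(1) s by blast
      show ?thesis using e_mult[OF assms y(1)] imageI[OF padic_mult_closed[OF assms y(1)], of e] y(2)
        by simp
    qed
    then show ?thesis by blast
  qed
  ultimately have "emb (e z) \<in> {\<Sum>s\<in>S. emb (c s) * s |c. c ` S \<subseteq> e ` carrier (padic_int p)}"
    by (intro CollectI exI[of _ "\<lambda>s. e z * c s"] conjI)
  then show ?thesis unfolding S(2) .
qed

lemma w_power_even: "w ^ (2 * n) = of_nat p ^ n"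
  by (simp add: power_mult w_square)

text \<open>\<open>OD\<close> spans the algebra, each coefficient has a denominator
  \<open>p ^ m\<close>, and \<open>p ^ m = w ^ (2 * m)\<close> is central. So powers of
  \<open>w\<close> clear the denominators one summand at a time.\<close>

lemma scaled_into_OD: "\<exists>n. w ^ n * x \<in> OD"
proof -
  interpret VS: vector_space "\<lambda>a x. emb a * x" by (fact vector_space_D)
  have "x \<in> VS.span OD"
    using max_order unfolding is_maximal_order_def is_order_def by (elim conjE) simp
  then show ?thesis
  proof (induction rule: VS.span_induct_alt)
    case base
    show ?case by simp
  next
    case (step c x y)
    obtain n where n: "w ^ n * y \<in> OD" using step by blast
    obtain m where m: "c * of_nat p ^ m \<in> e ` carrier (padic_int p)" using e_fraction by blast
    have "emb (c * of_nat p ^ m) \<in> OD" using m padic_in_OD by auto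
    then have "emb (c * of_nat p ^ m) * x \<in> OD" using step by auto
    moreover have "emb (c * of_nat p ^ m) * x = w ^ (2 * m) * (emb c * x)"
      using emb_commute[of c "of_nat p ^ m"] by (simp add: w_power_even emb_mult emb_power mult.assoc[symmetric])
    ultimately have A: "w ^ (2 * m) * (emb c * x) \<in> OD" by simp
    have "w ^ n * (w ^ (2 * m) * (emb c * x)) + w ^ (2 * m) * (w ^ n * y) \<in> OD"
      using OD_add[OF OD_mult[OF OD_power[OF w_OD] A] OD_mult[OF OD_power[OF w_OD] n]] .
    moreover have "w ^ (2 * m) * (w ^ n * y) = w ^ (n + 2 * m) * y"
      by (metis add.commute mult.assoc power_add)
    ultimately have "w ^ (n + 2 * m) * (emb c * x + y) \<in> OD"
      by (simp add: distrib_left power_add mult.assoc)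
    then show ?case by blast
  qed
qed

text \<open>For the least \<open>n\<close> with \<open>w ^ n * x\<close> integral, either
  \<open>n = 0\<close> or \<open>w ^ n * x\<close> is a unit, as otherwise a factor \<open>w\<close>
  could be removed. The inverse of this unit times \<open>w ^ n\<close> is
  \<open>inverse x\<close>.\<close>

lemma OD_or_inverse:
  assumes "x \<noteq> 0" shows "x \<in> OD \<or> inverse x \<in> OD"
proof -
  define n where "n = (LEAST n. w ^ n * x \<in> OD)"
  have n: "w ^ n * x \<in> OD" unfolding n_def using scaled_into_OD by (rule LeastI_ex)
  show ?thesis
  proof (cases n)
    case (Suc m)
    have "w ^ m * x \<notin> OD"
      using not_less_Least[of m "\<lambda>n. w ^ n * x \<in> OD"] Suc n_def by auto
    then have "res (w ^ n * x) \<noteq> 0"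
      using n Suc by (auto simp: res_eq_0_iff mult.assoc)
    then have "inverse (w ^ n * x) \<in> OD" using OD_unit n by blast
    then have "inverse (w ^ n * x) * w ^ n \<in> OD" by (intro OD_mult OD_power w_OD)
    moreover have "inverse (w ^ n * x) * w ^ n = inverse x"
      by (simp add: nonzero_inverse_mult_distrib assms mult.assoc)
    ultimately show ?thesis by simp
  qed (use n in simp)
qed

lemma padic_decompose:
  assumes "z \<in> carrier (padic_int p)"
  obtains m z' where "z' \<in> carrier (padic_int p)" "e z = of_nat m + of_nat p * e z'"
proof -
  \<comment> \<open>The lowest digit \<open>z 1\<close> is split off and the others are shifted.
    Division by \<open>p\<close> lowers the modulus from \<open>p ^ (k + 1)\<close> to
    \<open>p ^ k\<close>, hence the index \<open>Suc k\<close>.\<close>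
  define z' where "z' = (\<lambda>k. z (Suc k) div int p)"
  have z: "0 \<le> z n" "z n < int p ^ n" "z (Suc n) mod int p ^ n = z n" for n
    using assms by (auto simp: padic_int_def)
  have p0: "int p > 0" using p_gt_1 by simp
  have z1: "z (Suc n) mod int p = z 1" for n
  proof (induction n)
    case 0
    show ?case using z(1,2)[of 1] by simp
  next
    case (Suc n)
    have "z (Suc (Suc n)) mod int p = z (Suc (Suc n)) mod int p ^ Suc n mod int p"
      by (simp add: mod_mod_cancel)
    then show ?case using Suc z(3)[of "Suc n"] by simp
  qed
  have c: "z' \<in> carrier (padic_int p)"
  proof -
    have "z' n < int p ^ n" for n
    proof -
      have "int p * z' n \<le> z (Suc n)" unfolding z'_def using p0 z(1)[of "Suc n"]
        by (metis div_mult_self1_is_m mult.commute mult_div_mod_eq pos_mod_sign le_add_same_cancel1)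
      also have "\<dots> < int p * int p ^ n" using z(2)[of "Suc n"] by simp
      finally show ?thesis using p0 by simp
    qed
    moreover have "z' (Suc n) mod int p ^ n = z' n" for n
    proof -
      have "z (Suc (Suc n)) mod (int p * int p ^ n) = int p * (z (Suc (Suc n)) div int p mod int p ^ n) + z (Suc (Suc n)) mod int p"
        by (rule zmod_zmult2_eq) simp
      then have "z (Suc n) = int p * (z' (Suc n) mod int p ^ n) + z 1"
        using z(3)[of "Suc n"] z1[of "Suc n"] by (simp add: z'_def)
      moreover have "z (Suc n) = int p * z' n + z 1"
        using z1[of n] unfolding z'_def by (metis mult_div_mod_eq)
      ultimately show ?thesis using p0 by simp
    qed
    ultimately show ?thesis using z(1) p0 by (auto simp: padic_int_def z'_def pos_imp_zdiv_nonneg_iff)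
  qed
  have *: "z n = (int (nat (z 1)) mod int p ^ n + (int p mod int p ^ n * z' n) mod int p ^ n) mod int p ^ n" for n
  proof -
    have "z n = (z 1 + int p * z' n) mod int p ^ n"
      using z(3)[of n] z1[of n] unfolding z'_def by (metis add.commute mult_div_mod_eq)
    then show ?thesis using z(1)[of 1] by (simp add: mod_simps)
  qed
  have "z = (\<lambda>n. (int (nat (z 1)) mod int p ^ n + (int p mod int p ^ n * z' n) mod int p ^ n) mod int p ^ n)"
    by (rule ext) (rule *)
  then have "e z = e (\<lambda>n. int (nat (z 1)) mod int p ^ n) + e (\<lambda>n. (int p mod int p ^ n * z' n) mod int p ^ n)"
    using e_add[OF padic_of_nat_closed[of "nat (z 1)"] padic_mult_closed[OF padic_of_nat_closed[of p] c]]
    by metis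
  also have "\<dots> = of_nat (nat (z 1)) + of_nat p * e z'"
    unfolding e_mult[OF padic_of_nat_closed[of p] c] by (simp only: e_of_nat)
  finally have "e z = of_nat (nat (z 1)) + of_nat p * e z'" .
  then show ?thesis using that c by blast
qed

text \<open>A denominator \<open>p ^ n\<close> with \<open>n > 0\<close> would force the numerator
  to have nilpotent residue, hence to be divisible by \<open>p\<close>, against minimality. So the
  root of unity is a p-adic integer and its residue lies in the prime field. This is what separates
  \<open>zeta\<close> from the centre.\<close>

lemma emb_root_of_unity_residue:
  assumes "x ^ (p\<^sup>2 - 1) = 1" shows "emb x \<in> OD" "res (emb x) ^ p = res (emb x)"
proof -
  let ?P = "\<lambda>n. x * of_nat p ^ n \<in> e ` carrier (padic_int p)"
  define n where "n = (LEAST n. ?P n)"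
  have n: "?P n" unfolding n_def using e_fraction by (rule LeastI_ex)
  then obtain z where z: "z \<in> carrier (padic_int p)" "x * of_nat p ^ n = e z" by auto
  obtain m z' where m: "z' \<in> carrier (padic_int p)" "e z = of_nat m + of_nat p * e z'"
    using padic_decompose z by blast
  have r: "res (emb (e z)) = of_nat m"
    using padic_in_OD[OF m(1)] unfolding m(2)
    by (simp add: emb_add emb_mult res_add OD_mult res_mult flip: ww)
  have "n = 0"
  proof (cases n)
    case (Suc k)
    have "(x * of_nat p ^ n) ^ (p\<^sup>2 - 1) = of_nat p ^ (n * (p\<^sup>2 - 1))"
      using assms by (simp add: power_mult_distrib power_mult)
    then have "res (emb (e z) ^ (p\<^sup>2 - 1)) = res (of_nat (p ^ (n * (p\<^sup>2 - 1))))"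
      unfolding z(2) by (metis emb_of_nat emb_power of_nat_power)
    moreover have "n * (p\<^sup>2 - 1) > 0" using Suc p_gt_1
      by (metis nat_0_less_mult_iff one_less_power pos2 zero_less_Suc zero_less_diff)
    moreover have "(of_nat p :: 'q) = 0" using CHAR_q by (metis of_nat_CHAR)
    ultimately have "(of_nat m :: 'q) ^ (p\<^sup>2 - 1) = 0"
    proof -
      have "(of_nat (p ^ (n * (p\<^sup>2 - 1))) :: 'q) = of_nat p ^ (n * (p\<^sup>2 - 1))" by simp
      also have "\<dots> = 0" using \<open>n * (p\<^sup>2 - 1) > 0\<close> \<open>(of_nat p :: 'q) = 0\<close> by simp
      finally show ?thesis
        using \<open>res (emb (e z) ^ (p\<^sup>2 - 1)) = _\<close> padic_in_OD[OF z(1)] r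
        by (simp only: res_power res_of_nat)
    qed
    then have "(of_nat m :: 'q) = 0" by (metis power_eq_0_iff)
    then obtain l where l: "m = p * l" using q_of_nat_eq_0_iff by (metis dvd_def)
    have "x * of_nat p ^ k = of_nat l + e z'"
    proof -
      have "of_nat p * (x * of_nat p ^ k) = of_nat p * (of_nat l + e z')"
        using z(2) m(2) unfolding l Suc by (simp add: algebra_simps)
      then show ?thesis using of_nat_p_nonzero_k by simp
    qed
    moreover have "of_nat l + e z' \<in> e ` carrier (padic_int p)"
    proof -
      have c: "(\<lambda>k. (int l mod int p ^ k + z' k) mod int p ^ k) \<in> carrier (padic_int p)"
        by (rule padic_add_closed[OF padic_of_nat_closed m(1)])
      show ?thesis using e_add[OF padic_of_nat_closed[of l] m(1)] imageI[OF c, of e] by (simp add: e_of_nat)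
    qed
    ultimately have "?P k" by simp
    then have "n \<le> k" unfolding n_def by (rule Least_le)
    then show ?thesis using Suc by simp
  qed simp
  then have "emb x = emb (e z)" using z(2) by simp
  then show "emb x \<in> OD" "res (emb x) ^ p = res (emb x)"
    using padic_in_OD[OF z(1)] r q_of_nat_frob by simp_all
qed

end

section \<open>Teichmueller representatives\<close>

lemma commuting_power_mult:
  fixes x y :: "'a::monoid_mult"
  assumes "x * y = y * x" shows "(x * y) ^ n = x ^ n * y ^ n"
proof (induction n)
  case (Suc n)
  have "x ^ n * y = y * x ^ n"
    using assms power_commuting_commutes by metis
  have "(x * y) ^ Suc n = x * y * (x ^ n * y ^ n)" using Suc by simp
  also have "\<dots> = x * (y * x ^ n) * y ^ n" by (simp only: mult.assoc)
  also have "\<dots> = x * (x ^ n * y) * y ^ n" by (simp only: \<open>x ^ n * y = y * x ^ n\<close>)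
  also have "\<dots> = x ^ Suc n * y ^ Suc n" by (simp only: power_Suc mult.assoc)
  finally show ?case .
qed simp

lemma geometric_sum_ring:
  fixes x :: "'a::ring_1"
  shows "(x - 1) * (\<Sum>i<n. x ^ i) = x ^ n - 1"
  by (induction n) (simp_all add: algebra_simps)

context quaternion_setup
begin

abbreviation tau :: "'q \<Rightarrow> 'd" where
  "tau \<equiv> teich p L OD res"

lemma emb_in_L: "emb a \<in> L"
  using L_subfield(1) by (simp add: subset_iff)

lemma L_one: "1 \<in> L"
  using emb_in_L[of 1] by simp

lemma L_zero: "0 \<in> L"
  using emb_in_L[of 0] by simp

lemma L_add: "x \<in> L \<Longrightarrow> y \<in> L \<Longrightarrow> x + y \<in> L"
  and L_mult: "x \<in> L \<Longrightarrow> y \<in> L \<Longrightarrow> x * y \<in> L"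
  and L_commute: "x \<in> L \<Longrightarrow> y \<in> L \<Longrightarrow> x * y = y * x"
  using L_subfield(2) by simp_all

lemma L_power: "x \<in> L \<Longrightarrow> x ^ n \<in> L"
  by (induction n) (simp_all add: L_one L_mult)

lemma q_of_nat_order: "(of_nat (p\<^sup>2 - 1) :: 'q) = - 1"
proof -
  have "(of_nat (p\<^sup>2) :: 'q) = 0" unfolding q_of_nat_eq_0_iff by simp
  then show ?thesis using p_sq_gt_1 by (simp add: of_nat_diff)
qed

lemma power_p_sq: "(x :: 'a::monoid_mult) ^ (p\<^sup>2) = x * x ^ (p\<^sup>2 - 1)"
  using p_sq_gt_1 by (metis Suc_diff_1 order_less_trans power_Suc zero_less_one)

text \<open>Reduction is injective on these roots of unity: the geometric sum has residue
  \<open>p\<^sup>2 - 1 = - 1\<close>, so it is nonzero and can be cancelled in the division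
  ring.\<close>

lemma root_of_unity_res_one:
  assumes "x \<in> OD" "x ^ (p\<^sup>2 - 1) = 1" "res x = 1" shows "x = 1"
proof -
  define S where "S = (\<Sum>i<p\<^sup>2 - 1. x ^ i)"
  have "res S = - 1"
    unfolding S_def using assms by (simp add: res_sum OD_power res_power q_of_nat_order[simplified])
  then have "S \<noteq> 0" by auto
  moreover have "(x - 1) * S = 0"
    unfolding S_def geometric_sum_ring using assms by simp
  ultimately show ?thesis by simp
qed

definition zeta :: 'd where
  "zeta = (SOME \<zeta>. \<zeta> \<in> L \<and> \<zeta> ^ (p\<^sup>2 - 1) = 1 \<and> (\<forall>k. 0 < k \<and> k < p\<^sup>2 - 1 \<longrightarrow> \<zeta> ^ k \<noteq> 1))"

lemma zeta_L: "zeta \<in> L"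
  and zeta_order: "zeta ^ (p\<^sup>2 - 1) = 1"
  and zeta_primitive: "0 < k \<Longrightarrow> k < p\<^sup>2 - 1 \<Longrightarrow> zeta ^ k \<noteq> 1"
proof -
  have "\<exists>\<zeta>. \<zeta> \<in> L \<and> \<zeta> ^ (p\<^sup>2 - 1) = 1 \<and> (\<forall>k. 0 < k \<and> k < p\<^sup>2 - 1 \<longrightarrow> \<zeta> ^ k \<noteq> 1)"
    using L_root_of_unity by (simp add: Bex_def)
  from someI_ex[OF this, folded zeta_def]
  show "zeta \<in> L" "zeta ^ (p\<^sup>2 - 1) = 1" "0 < k \<Longrightarrow> k < p\<^sup>2 - 1 \<Longrightarrow> zeta ^ k \<noteq> 1"
    by auto
qed

lemma p_sq_pred_gt: "p\<^sup>2 - 1 > p - 1" "p\<^sup>2 - 1 > 0"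
proof -
  have "p\<^sup>2 > p * 1" unfolding power2_eq_square using p_gt_1 by (intro mult_strict_left_mono) auto
  then show "p\<^sup>2 - 1 > p - 1" "p\<^sup>2 - 1 > 0" using p_gt_1 by simp_all
qed

lemma zeta_nonzero: "zeta \<noteq> 0"
  using zeta_order p_sq_pred_gt(2) by (metis power_0_left not_less0 zero_neq_one)

text \<open>If only \<open>inverse zeta\<close> were integral, then \<open>zeta\<close>, being a
  power of its inverse, would be integral too.\<close>

lemma zeta_OD: "zeta \<in> OD"
proof (rule ccontr)
  assume "zeta \<notin> OD"
  then have inv: "inverse zeta \<in> OD" using OD_or_inverse zeta_nonzero by blast
  have "inverse zeta * inverse zeta ^ (p\<^sup>2 - 2) = inverse zeta ^ (p\<^sup>2 - 1)"
    using p_sq_pred_gt by (metis Suc_diff_Suc Suc_1 diff_Suc_1 less_diff_conv one_add_one plus_1_eq_Suc power_Suc zero_less_diff add.commute add_0)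
  also have "\<dots> = 1" using zeta_order by (simp add: power_inverse)
  finally have "inverse zeta ^ (p\<^sup>2 - 2) = zeta"
    using zeta_nonzero by (metis inverse_inverse_eq inverse_unique)
  then show False using OD_power[OF inv, of "p\<^sup>2 - 2"] \<open>zeta \<notin> OD\<close> by simp
qed

lemma zeta_power_res: "res zeta ^ k = 1 \<Longrightarrow> zeta ^ k = 1"
  using root_of_unity_res_one[of "zeta ^ k"] zeta_OD zeta_order
  by (metis OD_power mult.commute power_mult power_one res_power)

lemma res_zeta_nonzero: "res zeta \<noteq> 0"
  using zeta_order p_sq_pred_gt(2) zeta_OD
  by (metis power_0_left res_one res_power less_irrefl zero_neq_one)

text \<open>The powers of \<open>zeta\<close> below its order keep distinct residues by
  \<open>root_of_unity_res_one\<close>, and there are as many of them as nonzero residues.\<close>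

lemma res_zeta_generates:
  assumes "a \<noteq> 0" obtains k where "a = res zeta ^ k"
proof -
  have *: "i = k" if "i \<le> k" "k < p\<^sup>2 - 1" "res zeta ^ i = res zeta ^ k" for i k
  proof (rule ccontr)
    assume "i \<noteq> k"
    have "res zeta ^ k = res zeta ^ i * res zeta ^ (k - i)"
      using that by (metis le_add_diff_inverse power_add)
    then have "res zeta ^ (k - i) = 1" using that res_zeta_nonzero by simp
    then have "zeta ^ (k - i) = 1" by (rule zeta_power_res)
    then show False using zeta_primitive[of "k - i"] that \<open>i \<noteq> k\<close> by simp
  qed
  have "inj_on (\<lambda>k. res zeta ^ k) {..<p\<^sup>2 - 1}"
    using * by (intro inj_onI) (metis lessThan_iff nle_le)
  then have "card ((\<lambda>k. res zeta ^ k) ` {..<p\<^sup>2 - 1}) = p\<^sup>2 - 1"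
    by (simp add: card_image)
  then have "(\<lambda>k. res zeta ^ k) ` {..<p\<^sup>2 - 1} = UNIV - {0}"
    using res_zeta_nonzero by (intro card_seteq) (auto simp: card_Diff_singleton card_q)
  then have "a \<in> (\<lambda>k. res zeta ^ k) ` {..<p\<^sup>2 - 1}" using assms by simp
  then show ?thesis using that by (elim imageE)
qed

lemma res_zeta_frob: "res zeta ^ p \<noteq> res zeta"
proof
  assume "res zeta ^ p = res zeta"
  then have "res zeta * res zeta ^ (p - 1) = res zeta * 1"
    using p_gt_1 by (simp flip: power_Suc)
  then have "res zeta ^ (p - 1) = 1" using res_zeta_nonzero by simp
  then have "zeta ^ (p - 1) = 1" by (rule zeta_power_res)
  then show False using zeta_primitive[of "p - 1"] p_sq_pred_gt p_gt_1 by simp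
qed

lemma teich_fixed_zero:
  assumes "t \<in> OD" "t ^ (p\<^sup>2) = t" "t \<noteq> 0" shows "res t \<noteq> 0" "t ^ (p\<^sup>2 - 1) = 1"
proof -
  have "t * t ^ (p\<^sup>2 - 1) = t * 1"
    using assms(2) power_p_sq[of t] by (metis mult_1_right)
  then show *: "t ^ (p\<^sup>2 - 1) = 1" using assms(3) by (simp only: mult_cancel_left simp_thms)
  have "res t ^ (p\<^sup>2 - 1) = 1" using * assms by (metis res_one res_power)
  then show "res t \<noteq> 0" using p_sq_pred_gt(2) by (metis power_0_left less_irrefl zero_neq_one)
qed

text \<open>Both lifts lie in the commutative field \<open>L\<close>, so their quotient is a root of
  unity, and its residue is \<open>1\<close>. Together with existence this justifies the definite
  description in \<open>teich\<close>.\<close>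

lemma teich_unique_aux:
  assumes "t \<in> L" "t \<in> OD" "t ^ (p\<^sup>2) = t" "s \<in> L" "s \<in> OD" "s ^ (p\<^sup>2) = s" "res t = res s"
  shows "t = s"
proof (cases "s = 0")
  case True
  then show ?thesis using teich_fixed_zero(1)[of t] assms by fastforce
next
  case False
  have rs: "res s \<noteq> 0" using teich_fixed_zero(1)[of s] assms False by blast
  then have t0: "t \<noteq> 0" using assms by fastforce
  have inv: "inverse s \<in> OD" using OD_unit(1)[OF _ rs] assms by blast
  have com: "t * inverse s = inverse s * t" using L_commute assms(1) L_subfield(3)[OF assms(4)] by blast
  have "(t * inverse s) ^ (p\<^sup>2 - 1) = 1"
    using commuting_power_mult[OF com] teich_fixed_zero(2)[OF assms(2,3) t0]
      teich_fixed_zero(2)[OF assms(5,6) False] by (simp add: power_inverse)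
  moreover have "res (t * inverse s) = 1"
  proof -
    have "res (s * inverse s) = 1" using False by simp
    then show ?thesis using assms inv by (simp add: res_mult)
  qed
  ultimately have "t * inverse s = 1" using root_of_unity_res_one[of "t * inverse s"] assms inv by blast
  then show ?thesis by (metis False right_inverse mult_right_cancel nonzero_imp_inverse_nonzero)
qed

lemma teich_exists: "\<exists>t. t \<in> L \<inter> OD \<and> t ^ (p\<^sup>2) = t \<and> res t = a"
proof (cases "a = 0")
  case True
  then show ?thesis using L_zero p_gt_1 by (intro exI[of _ 0]) simp
next
  case False
  then obtain k where k: "a = res zeta ^ k" using res_zeta_generates by blast
  have "zeta ^ (p\<^sup>2) = zeta"
    using zeta_order power_p_sq[of zeta] by (metis mult_1_right)
  then have "(zeta ^ k) ^ (p\<^sup>2) = zeta ^ k" by (metis mult.commute power_mult)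
  then show ?thesis
    using zeta_L zeta_OD by (intro exI[of _ "zeta ^ k"]) (simp add: L_power OD_power res_power k)
qed

lemma teich_ex1: "\<exists>!t. t \<in> L \<inter> OD \<and> t ^ (p\<^sup>2) = t \<and> res t = a"
  using teich_exists[of a] teich_unique_aux by (auto intro!: ex_ex1I)

lemma tau_L: "tau a \<in> L"
  and tau_OD [simp]: "tau a \<in> OD"
  and tau_power_card: "tau a ^ (p\<^sup>2) = tau a"
  and res_tau [simp]: "res (tau a) = a"
  using theI'[OF teich_ex1[of a]] unfolding teich_def by simp_all

lemma tau_unique:
  "t \<in> L \<Longrightarrow> t \<in> OD \<Longrightarrow> t ^ (p\<^sup>2) = t \<Longrightarrow> res t = a \<Longrightarrow> tau a = t"
  by (rule teich_unique_aux) (simp_all add: tau_L tau_power_card)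

lemma tau_commute: "tau a * tau b = tau b * tau a"
  using L_commute tau_L by simp

lemma tau_mult: "tau (a * b) = tau a * tau b"
  by (rule tau_unique)
    (simp_all add: L_mult tau_L OD_mult res_mult commuting_power_mult[OF tau_commute] tau_power_card)

lemma tau_zero [simp]: "tau 0 = 0"
  using p_gt_1 by (intro tau_unique) (simp_all add: L_zero)

lemma tau_one [simp]: "tau 1 = 1"
  by (intro tau_unique) (simp_all add: L_one)

lemma tau_power: "tau (a ^ n) = tau a ^ n"
  by (induction n) (simp_all add: tau_mult)

lemma tau_res_zeta: "tau (res zeta) = zeta"
proof (rule tau_unique)
  show "zeta ^ (p\<^sup>2) = zeta" using zeta_order power_p_sq[of zeta] by (metis mult_1_right)
qed (simp_all add: zeta_L zeta_OD)

section \<open>Conjugation by the uniformizer induces the Frobenius\<close>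

lemma w_conj_add: "inverse w * (x + y) * w = inverse w * x * w + inverse w * y * w"
  by (simp add: algebra_simps)

lemma w_conj_mult: "inverse w * (x * y) * w = (inverse w * x * w) * (inverse w * y * w)"
  by (simp add: mult.assoc) (simp flip: mult.assoc)

lemma w_conj_power: "inverse w * x ^ n * w = (inverse w * x * w) ^ n"
proof (induction n)
  case (Suc n)
  then show ?case using w_conj_mult[of x "x ^ n"] by simp
qed simp

lemma w_conj_res:
  assumes "x \<in> OD" "y \<in> OD" "res x = res y"
  shows "res (inverse w * x * w) = res (inverse w * y * w)"
proof -
  obtain z where z: "z \<in> OD" "x = y + w * z" using assms res_eq_iff by blast
  have "inverse w * (w * z) * w = z * w" by (simp flip: mult.assoc)
  then have "inverse w * x * w = inverse w * y * w + z * w"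
    unfolding z(2) w_conj_add by simp
  then show ?thesis using z(1) assms OD_w_conj by (simp add: res_add OD_mult res_mult)
qed

text \<open>The automorphism of the residue field induced by conjugation with \<open>w\<close>. It
  does not depend on the lift by \<open>w_conj_res\<close>, and \<open>theta_frob\<close> identifies
  it.\<close>

definition theta :: "'q \<Rightarrow> 'q" where
  "theta a = res (inverse w * tau a * w)"

lemma theta_res: "x \<in> OD \<Longrightarrow> res (inverse w * x * w) = theta (res x)"
  unfolding theta_def by (rule w_conj_res) simp_all

lemma theta_add: "theta (a + b) = theta a + theta b"
proof -
  have "theta (a + b) = res (inverse w * (tau a + tau b) * w)"
    by (subst theta_res) (simp_all add: OD_add res_add)
  then show ?thesis unfolding w_conj_add by (simp add: res_add OD_w_conj theta_def)
qed

lemma theta_mult: "theta (a * b) = theta a * theta b"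
  unfolding theta_def tau_mult w_conj_mult by (simp add: res_mult OD_w_conj)

lemma theta_power: "theta (a ^ n) = theta a ^ n"
  unfolding theta_def tau_power w_conj_power by (simp add: res_power OD_w_conj)

lemma theta_of_nat: "theta (of_nat n) = of_nat n"
proof -
  have "inverse w * of_nat n * w = of_nat n"
    by (simp add: mult.assoc) (simp add: mult_of_nat_commute[of n w] flip: mult.assoc)
  then show ?thesis using theta_res[of "of_nat n"] by simp
qed

lemma tau_w_conj: "inverse w * tau a * w = tau (theta a)"
proof (rule sym, rule tau_unique)
  show "inverse w * tau a * w \<in> L"
    using w_conj[OF tau_L] sigma_aut(1) tau_L by (metis imageI)
  show "(inverse w * tau a * w) ^ p\<^sup>2 = inverse w * tau a * w"
    by (simp add: tau_power_card flip: w_conj_power)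
qed (simp_all add: OD_w_conj theta_def)

lemma zeta_not_central: "zeta \<noteq> emb x"
proof
  assume z: "zeta = emb x"
  have "emb (x ^ (p\<^sup>2 - 1) - 1) + emb 1 = emb (x ^ (p\<^sup>2 - 1))"
    by (simp flip: emb_add del: emb_one)
  then have "emb (x ^ (p\<^sup>2 - 1) - 1) = 0"
    using zeta_order by (simp add: z emb_power)
  then have "x ^ (p\<^sup>2 - 1) = 1" unfolding emb_eq_0_iff by simp
  then show False using emb_root_of_unity_residue(2)[of x] res_zeta_frob unfolding z by simp
qed

text \<open>\<open>1\<close> and \<open>zeta\<close> are independent because \<open>zeta\<close> is
  not central; a third independent element would exceed the dimension 2 of \<open>L\<close>.\<close>

lemma L_span: 
  assumes "x \<in> L" shows "x \<in> module.span (\<lambda>a x. emb a * x) {1, zeta}"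
proof -
  interpret VS: vector_space "\<lambda>a x. emb a * x" by (fact vector_space_D)
  obtain B where B: "B \<subseteq> L" "VS.independent B" "L \<subseteq> VS.span B" "card B = VS.dim L"
    by (rule VS.basis_exists[of L])
  have cB: "card B = 2" using B dim_L by simp
  then have fB: "finite B" using card_ge_0_finite[of B] by simp
  have "zeta \<notin> VS.span {1}"
  proof
    assume "zeta \<in> VS.span {1}"
    then obtain k where "zeta = emb k * 1" unfolding VS.span_singleton by (rule rangeE)
    then show False using zeta_not_central[of k] by (simp only: mult_1_right)
  qed
  moreover have z1: "zeta \<noteq> 1" using zeta_not_central[of 1] by simp
  ultimately have ind: "VS.independent {zeta, 1}"
    by (simp add: VS.independent_insert)
  have "x \<in> VS.span {zeta, 1}"
  proof (rule ccontr)
    assume x: "x \<notin> VS.span {zeta, 1}"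
    then have x': "x \<notin> {zeta, 1}" using VS.span_base[of x] by (rule contrapos_nn)
    have "VS.independent {x, zeta, 1}" using ind x x' by (simp add: VS.independent_insert)
    moreover have "{x, zeta, 1} \<subseteq> VS.span B" using B(3) zeta_L L_one assms by (simp add: subset_iff)
    ultimately have "card {x, zeta, 1} \<le> 2" using VS.independent_span_bound[OF fB] cB by metis
    then show False using x' z1 by simp
  qed
  then show ?thesis by (simp only: insert_commute)
qed

text \<open>By uniqueness of Teichmueller lifts, \<open>\<sigma>\<close> would fix
  \<open>zeta\<close>, hence the whole span of \<open>1\<close> and \<open>zeta\<close>, which is
  \<open>L\<close>; but \<open>\<sigma>\<close> is nontrivial.\<close>

lemma theta_zeta: "theta (res zeta) \<noteq> res zeta"
proof
  assume "theta (res zeta) = res zeta"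
  then have s: "\<sigma> zeta = zeta"
    using tau_w_conj[of "res zeta"] w_conj[OF zeta_L] tau_res_zeta by simp
  interpret VS: vector_space "\<lambda>a x. emb a * x" by (fact vector_space_D)
  have hom: "\<sigma> 1 = 1" "\<And>x y. x \<in> L \<Longrightarrow> y \<in> L \<Longrightarrow> \<sigma> (x + y) = \<sigma> x + \<sigma> y"
    "\<And>x y. x \<in> L \<Longrightarrow> y \<in> L \<Longrightarrow> \<sigma> (x * y) = \<sigma> x * \<sigma> y"
    using sigma_aut(2) unfolding ring_hom_on_def by simp_all
  have "x \<in> L \<and> \<sigma> x = x" if "x \<in> VS.span {1, zeta}" for x
    using that
  proof (induction rule: VS.span_induct_alt)
    case base
    then show ?case using sigma_aut(3)[of 0] L_zero by simp
  next
    case (step c x y)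
    have x: "x \<in> L" "\<sigma> x = x" using step(1) s hom(1) zeta_L L_one by auto
    have "emb c * x \<in> L" "\<sigma> (emb c * x) = emb c * x"
      using x hom(3)[OF emb_in_L x(1)] sigma_aut(3) L_mult emb_in_L by simp_all
    then show ?case using step hom(2) L_add by simp
  qed
  then have "\<sigma> a = a" if "a \<in> L" for a using L_span that by simp
  then show False using sigma_aut(4) by simp
qed

text \<open>For the residue \<open>g\<close>, both \<open>g + g\<^sup>p\<close> and
  \<open>g * g\<^sup>p\<close> lie in the prime field, so \<open>theta\<close> fixes them. Hence
  \<open>theta g\<close> is a root of the quadratic polynomial with roots \<open>g\<close> and
  \<open>g\<^sup>p\<close>, and \<open>theta_zeta\<close> excludes \<open>g\<close>.\<close>

lemma theta_zeta_frob: "theta (res zeta) = res zeta ^ p"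
proof -
  define g where "g = res zeta"
  have fixd: "theta a = a" if "a ^ p = a" for a
    using that q_frob_fixed theta_of_nat by metis
  have "(g + g ^ p) ^ p = g + g ^ p" by (simp add: q_frob_add q_frob_frob add.commute)
  then have s: "theta (g + g ^ p) = g + g ^ p" by (rule fixd)
  have "(g * g ^ p) ^ p = g * g ^ p" unfolding power_mult_distrib q_frob_frob by (simp add: mult.commute)
  then have n: "theta (g * g ^ p) = g * g ^ p" by (rule fixd)
  have "theta g ^ p = g + g ^ p - theta g" using s by (simp add: theta_add theta_power algebra_simps)
  then have "theta g * (g + g ^ p - theta g) = g * g ^ p" using n by (simp add: theta_mult theta_power)
  then have "(theta g - g) * (theta g - g ^ p) = 0" by (simp add: algebra_simps)
  then show ?thesis using theta_zeta unfolding g_def by simp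
qed

lemma theta_frob: "theta a = a ^ p"
proof (cases "a = 0")
  case True
  then show ?thesis using theta_of_nat[of 0] p_gt_1 by simp
next
  case False
  then obtain k where "a = res zeta ^ k" using res_zeta_generates by blast
  then show ?thesis by (simp add: theta_power theta_zeta_frob mult.commute flip: power_mult)
qed

lemma tau_w: "tau a * w = w * tau (a ^ p)"
  using tau_w_conj[of a] unfolding theta_frob by (metis mult.assoc mult_1_left right_inverse w_nonzero)

lemma commute_zeta_residue:
  assumes "x \<in> OD" "w * x * zeta = zeta * (w * x)"
  shows "res x = 0"
proof -
  have "w * (x * zeta) = w * (tau (res zeta ^ p) * x)"
    using assms(2) tau_w[of "res zeta"] by (simp add: tau_res_zeta flip: mult.assoc)
  then have "x * zeta = tau (res zeta ^ p) * x" by simp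
  then have "res (x * zeta) = res (tau (res zeta ^ p) * x)" by simp
  then have "(res zeta - res zeta ^ p) * res x = 0"
    using assms zeta_OD by (simp add: res_mult algebra_simps)
  then show ?thesis using res_zeta_frob by simp
qed

lemma ww_commute: "x * (w * w) = w * w * x"
  unfolding ww by (rule mult_of_nat_commute[symmetric])

text \<open>Elements commuting with \<open>zeta\<close> have even valuation, since moving
  \<open>zeta\<close> past a single factor \<open>w\<close> applies the Frobenius to its residue. So
  a congruence modulo \<open>w\<close> between such elements already holds modulo
  \<open>w\<^sup>2\<close>, as is used for sums of Teichmueller lifts.\<close>

lemma commute_zeta_div_p:
  assumes "d \<in> OD" "res d = 0" "d * zeta = zeta * d"
  obtains y where "y \<in> OD" "d = w * w * y" "y * zeta = zeta * y"
proof -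
  obtain x where x: "x \<in> OD" "d = w * x" using assms res_eq_0_iff by blast
  have "res x = 0" using commute_zeta_residue[of x] x assms by simp
  then obtain y where y: "y \<in> OD" "x = w * y" using x res_eq_0_iff by blast
  have "w * w * (y * zeta) = w * w * (zeta * y)"
  proof -
    have "w * w * (y * zeta) = d * zeta" unfolding x(2) y(2) by (simp only: mult.assoc)
    also have "\<dots> = zeta * d" by (fact assms(3))
    also have "\<dots> = zeta * (w * w) * y" unfolding x(2) y(2) by (simp only: mult.assoc)
    also have "\<dots> = w * w * (zeta * y)" unfolding ww_commute by (simp only: mult.assoc)
    finally show ?thesis .
  qed
  then have "y * zeta = zeta * y" by (simp add: mult.assoc)
  then show ?thesis using that y x by (simp add: mult.assoc)
qed

lemma tau_commute_zeta: "tau a * zeta = zeta * tau a"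
  using L_commute tau_L zeta_L by simp

lemma tau_add_cong:
  obtains y where "y \<in> OD" "tau a + tau b = tau (a + b) + w * w * y"
proof -
  have "(tau a + tau b - tau (a + b)) * zeta = zeta * (tau a + tau b - tau (a + b))"
    by (simp add: algebra_simps tau_commute_zeta)
  then obtain y where "y \<in> OD" "tau a + tau b - tau (a + b) = w * w * y"
    by (rule commute_zeta_div_p[rotated 2]) (simp_all add: OD_add OD_diff res_add res_diff)
  then show ?thesis using that by (simp add: algebra_simps)
qed

end

section \<open>The filtration of the unit group\<close>

text \<open>Natural multiples in a bare additive group: the binomial expansion of an additive
  operator is needed alike for vectors, for functions and for elements of the division ring.\<close>

definition nscale :: "nat \<Rightarrow> 'a::comm_monoid_add \<Rightarrow> 'a" where
  "nscale n v = (\<Sum>i<n. v)"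

lemma nscale_0 [simp]: "nscale 0 v = 0"
  and nscale_Suc [simp]: "nscale (Suc n) v = nscale n v + v"
  by (simp_all add: nscale_def)

lemma nscale_zero [simp]: "nscale n 0 = 0"
  by (simp add: nscale_def)

lemma nscale_add: "nscale (m + n) v = nscale m v + nscale n v"
  by (induction n) (simp_all add: algebra_simps)

lemma nscale_mult: "nscale (m * n) v = nscale m (nscale n v)"
  by (induction m) (simp_all add: nscale_add algebra_simps)

lemma nscale_ring: "nscale n v = of_nat n * (v :: 'a::ring_1)"
  by (simp add: nscale_def)

lemma funpow_binomial:
  fixes f :: "'a::ab_group_add \<Rightarrow> 'a"
  assumes add: "\<And>x y. f (x + y) = f x + f y"
  shows "((\<lambda>x. x + f x) ^^ n) x = (\<Sum>k\<le>n. nscale (n choose k) ((f ^^ k) x))"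
proof (induction n)
  case (Suc n)
  have f0: "f 0 = 0" using add[of 0 0] by simp
  have fs: "f (sum g A) = (\<Sum>i\<in>A. f (g i))" for g and A :: "nat set"
    by (induction A rule: infinite_finite_induct) (simp_all add: f0 add)
  have fn: "f (nscale m v) = nscale m (f v)" for m v
    by (induction m) (simp_all add: f0 add)
  let ?t = "\<lambda>k. (f ^^ k) x"
  have A: "(\<Sum>k\<le>n. nscale (n choose k) (?t k)) = x + (\<Sum>k\<le>n. nscale (n choose Suc k) (?t (Suc k)))"
  proof -
    have "(\<Sum>k\<le>n. nscale (n choose k) (?t k)) = (\<Sum>k\<le>Suc n. nscale (n choose k) (?t k))"
      by (simp add: binomial_eq_0)
    also have "\<dots> = x + (\<Sum>k\<le>n. nscale (n choose Suc k) (?t (Suc k)))"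
      by (subst sum.atMost_Suc_shift) simp
    finally show ?thesis .
  qed
  have "((\<lambda>x. x + f x) ^^ Suc n) x =
      (\<Sum>k\<le>n. nscale (n choose k) (?t k)) + (\<Sum>k\<le>n. nscale (n choose k) (?t (Suc k)))"
    by (simp add: Suc fs fn)
  also have "\<dots> = x + (\<Sum>k\<le>n. nscale (Suc n choose Suc k) (?t (Suc k)))"
    unfolding A by (simp add: nscale_add sum.distrib add_ac)
  also have "\<dots> = (\<Sum>k\<le>Suc n. nscale (Suc n choose k) (?t k))"
    by (subst sum.atMost_Suc_shift) (simp del: binomial_Suc_Suc)
  finally show ?case .
qed simp

text \<open>The operator identity \<open>(1 + f)\<^sup>p = 1 + f\<^sup>p\<close>: the inner binomial
  coefficients are multiples of \<open>p\<close>, which kills the image of \<open>f\<close>. With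
  \<open>f = g - 1\<close> it converts \<open>p\<close>-th powers in the group into
  \<open>p\<close>-th powers of operators.\<close>

lemma funpow_prime_binomial:
  fixes f :: "'a::ab_group_add \<Rightarrow> 'a"
  assumes add: "\<And>x y. f (x + y) = f x + f y" and p: "prime p"
    and kill: "\<And>x. nscale p (f x) = 0"
  shows "((\<lambda>x. x + f x) ^^ p) x = x + (f ^^ p) x"
proof -
  have p1: "p > 1" using p prime_gt_1_nat by blast
  have z: "nscale (p choose k) ((f ^^ k) x) = 0" if k: "k \<in> {1..<p}" for k
  proof -
    have "p dvd p choose k" using k p by (intro dvd_choose_prime) auto
    then obtain m where "p choose k = m * p" by (metis dvd_def mult.commute)
    moreover obtain l where "k = Suc l" using k by (cases k) simp_all
    ultimately show ?thesis using kill by (simp add: nscale_mult)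
  qed
  have "{..p} = insert 0 (insert p {1..<p})" using p1 by auto
  then have "(\<Sum>k\<le>p. nscale (p choose k) ((f ^^ k) x)) = x + ((f ^^ p) x + (\<Sum>k\<in>{1..<p}. nscale (p choose k) ((f ^^ k) x)))"
    using p1 by simp
  also have "\<dots> = x + (f ^^ p) x" using z by simp
  finally show ?thesis unfolding funpow_binomial[OF add] .
qed

text \<open>Left multiplication by \<open>y\<close> is an additive operator, so
  \<open>funpow_binomial\<close> applies to it, started at \<open>1\<close>, although the ring is
  not commutative.\<close>

lemma one_plus_power:
  fixes y :: "'a::ring_1"
  shows "(1 + y) ^ n = (\<Sum>k\<le>n. of_nat (n choose k) * y ^ k)"
proof -
  have "((\<lambda>x. x + y * x) ^^ n) 1 = (1 + y) ^ n" for n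
    by (induction n) (simp_all add: algebra_simps)
  moreover have "((\<lambda>x. y * x) ^^ k) 1 = y ^ k" for k
    by (induction k) simp_all
  ultimately show ?thesis
    using funpow_binomial[of "\<lambda>x. y * x" n 1] by (simp add: distrib_left nscale_ring)
qed

locale quaternion_setup_ge5 = quaternion_setup p e emb L \<sigma> OD w res j
  for p :: nat
    and e :: "(nat \<Rightarrow> int) \<Rightarrow> 'k::field"
    and emb :: "'k \<Rightarrow> 'd::division_ring"
    and L :: "'d set"
    and \<sigma> :: "'d \<Rightarrow> 'd"
    and OD :: "'d set"
    and w :: 'd
    and res :: "'d \<Rightarrow> 'q::{field,finite}"
    and j :: "'q \<Rightarrow> 'f::{field,finite}" +
  assumes p_ge_5: "p \<ge> 5"

context quaternion_setup
begin

text \<open>Congruence modulo \<open>w ^ n * OD\<close>. Factors \<open>w\<close> can be moved to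
  the left past integral elements (\<open>OD_w_swap\<close>), so this is a two-sided ideal and the
  relation respects products from both sides.\<close>

definition cg :: "nat \<Rightarrow> 'd \<Rightarrow> 'd \<Rightarrow> bool" where
  "cg n x y \<longleftrightarrow> (\<exists>z\<in>OD. x = y + w ^ n * z)"

lemma cgI: "z \<in> OD \<Longrightarrow> x = y + w ^ n * z \<Longrightarrow> cg n x y"
  unfolding cg_def by (rule bexI)

lemma cgE:
  assumes "cg n x y" obtains z where "z \<in> OD" "x = y + w ^ n * z"
  using assms unfolding cg_def by (elim bexE)

lemma cg_refl [simp]: "cg n x x"
  by (rule cgI[of 0]) simp_all

lemma cg_sym: "cg n x y \<Longrightarrow> cg n y x"
proof (elim cgE)
  fix z assume "z \<in> OD" "x = y + w ^ n * z"
  then show "cg n y x" by (intro cgI[of "- z"]) (simp_all add: OD_uminus)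
qed

lemma cg_trans [trans]: "cg n x y \<Longrightarrow> cg n y z \<Longrightarrow> cg n x z"
proof (elim cgE)
  fix a b assume "a \<in> OD" "x = y + w ^ n * a" "b \<in> OD" "y = z + w ^ n * b"
  then show "cg n x z" by (intro cgI[of "b + a"]) (simp_all add: OD_add algebra_simps)
qed

lemma cg_add: "cg n x y \<Longrightarrow> cg n x' y' \<Longrightarrow> cg n (x + x') (y + y')"
proof (elim cgE)
  fix a b assume "a \<in> OD" "x = y + w ^ n * a" "b \<in> OD" "x' = y' + w ^ n * b"
  then show "cg n (x + x') (y + y')" by (intro cgI[of "a + b"]) (simp_all add: OD_add algebra_simps)
qed

lemma cg_uminus: "cg n x y \<Longrightarrow> cg n (- x) (- y)"
proof (elim cgE)
  fix z assume "z \<in> OD" "x = y + w ^ n * z"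
  then show "cg n (- x) (- y)" by (intro cgI[of "- z"]) (simp_all add: OD_uminus)
qed

lemma cg_diff: "cg n x y \<Longrightarrow> cg n x' y' \<Longrightarrow> cg n (x - x') (y - y')"
  using cg_add[of n x y "- x'" "- y'"] cg_uminus[of n x' y'] by simp

lemma cg_OD: "cg n x y \<Longrightarrow> y \<in> OD \<Longrightarrow> x \<in> OD"
  by (elim cgE) (simp add: OD_add OD_mult OD_power)

lemma cg_mult_right: "cg n x y \<Longrightarrow> c \<in> OD \<Longrightarrow> cg n (x * c) (y * c)"
proof (elim cgE)
  fix a assume "a \<in> OD" "x = y + w ^ n * a" "c \<in> OD"
  then show ?thesis by (intro cgI[of "a * c"]) (simp_all add: OD_mult algebra_simps)
qed

lemma cg_mult_left: "cg n x y \<Longrightarrow> c \<in> OD \<Longrightarrow> cg n (c * x) (c * y)"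
proof (elim cgE)
  fix a assume a: "a \<in> OD" "x = y + w ^ n * a" and c: "c \<in> OD"
  obtain c' where c': "c' \<in> OD" "c * w ^ n = w ^ n * c'" using OD_w_power_swap[OF c] .
  have "c * x = c * y + w ^ n * (c' * a)"
    unfolding a(2) distrib_left by (simp only: mult.assoc[symmetric] c')
  then show ?thesis using a c' by (intro cgI[of "c' * a"]) (simp_all add: OD_mult)
qed

lemma cg_mult: "cg n x y \<Longrightarrow> cg n x' y' \<Longrightarrow> y \<in> OD \<Longrightarrow> y' \<in> OD \<Longrightarrow> cg n (x * x') (y * y')"
  using cg_mult_right[of n x y x'] cg_mult_left[of n x' y' y] cg_OD cg_trans by blast

lemma cg_mono: "cg n x y \<Longrightarrow> m \<le> n \<Longrightarrow> cg m x y"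
proof (elim cgE)
  fix a assume a: "a \<in> OD" "x = y + w ^ n * a" and "m \<le> n"
  have "w ^ n = w ^ m * w ^ (n - m)" using \<open>m \<le> n\<close> by (simp flip: power_add)
  then show ?thesis using a by (intro cgI[of "w ^ (n - m) * a"]) (simp_all add: OD_mult OD_power mult.assoc)
qed

lemma cg_w_mult: "cg n x y \<Longrightarrow> cg (m + n) (w ^ m * x) (w ^ m * y)"
proof (elim cgE)
  fix a assume a: "a \<in> OD" "x = y + w ^ n * a"
  then show ?thesis by (intro cgI[of a]) (simp_all add: algebra_simps power_add)
qed

lemma cg_w_power: "m \<le> n \<Longrightarrow> x \<in> OD \<Longrightarrow> cg m (w ^ n * x) 0"
  by (rule cg_mono[of n]) (auto intro: cgI[of x])

lemma cg_1_iff: "x \<in> OD \<Longrightarrow> y \<in> OD \<Longrightarrow> cg 1 x y \<longleftrightarrow> res x = res y"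
  by (simp add: cg_def res_eq_iff)

lemmas cg_Suc_0_iff = cg_1_iff[simplified]

lemma cg_tau_res: "x \<in> OD \<Longrightarrow> cg 1 x (tau (res x))"
  by (simp add: cg_1_iff cg_Suc_0_iff)

lemma cg_tau_add: "cg 2 (tau a + tau b) (tau (a + b))"
  by (rule tau_add_cong[of a b]) (auto simp: power2_eq_square intro!: cgI)

lemma tau_w_power: "tau a * w ^ n = w ^ n * tau (if even n then a else a ^ p)"
proof (induction n)
  case (Suc n)
  have "tau a * w ^ Suc n = tau a * w ^ n * w" by (simp only: power_Suc2 mult.assoc)
  also have "\<dots> = w ^ n * (tau (if even n then a else a ^ p) * w)" unfolding Suc by (simp only: mult.assoc)
  also have "\<dots> = w ^ n * (w * tau ((if even n then a else a ^ p) ^ p))" by (simp only: tau_w)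
  also have "\<dots> = w ^ Suc n * tau (if even (Suc n) then a else a ^ p)"
    by (simp add: q_frob_frob power_commutes mult.assoc[symmetric])
  finally show ?case .
qed simp

section \<open>Congruence subgroups: digits, commutators and \<open>p\<close>-th powers\<close>

definition UU :: "nat \<Rightarrow> 'd set" where
  "UU n = {g. cg n g 1}"

lemma UU_iff: "g \<in> UU n \<longleftrightarrow> cg n g 1" by (simp add: UU_def)

lemma UU_OD: "g \<in> UU n \<Longrightarrow> g \<in> OD"
  using cg_OD UU_iff OD_one by blast

lemma UU_mono: "m \<le> n \<Longrightarrow> UU n \<subseteq> UU m"
  using cg_mono UU_iff by blast

lemma UU_one [simp]: "1 \<in> UU n" by (simp add: UU_def)

lemma UU_res: "n \<ge> 1 \<Longrightarrow> g \<in> UU n \<Longrightarrow> res g = 1"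
  using cg_mono[of n g 1 1] cg_1_iff[of g 1] UU_OD UU_iff by simp

lemma UU_unit: "n \<ge> 1 \<Longrightarrow> g \<in> UU n \<Longrightarrow> inverse g \<in> OD" "n \<ge> 1 \<Longrightarrow> g \<in> UU n \<Longrightarrow> g \<noteq> 0"
  using OD_unit[OF UU_OD] UU_res by fastforce+

lemma UU_mult: "g \<in> UU n \<Longrightarrow> h \<in> UU n \<Longrightarrow> g * h \<in> UU n"
  using cg_mult[of n g 1 h 1] by (simp add: UU_iff)

lemma cg_right_quotient:
  assumes "cg n g h" "inverse h \<in> OD" "h \<noteq> 0" shows "g * inverse h \<in> UU n"
  using cg_mult_right[OF assms(1,2)] assms(3) by (simp add: UU_iff)

lemma cg_left_quotient:
  assumes "cg n g h" "inverse h \<in> OD" "h \<noteq> 0" shows "inverse h * g \<in> UU n"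
  using cg_mult_left[OF assms(1,2)] assms(3) by (simp add: UU_iff)

lemma UU_inverse: "n \<ge> 1 \<Longrightarrow> g \<in> UU n \<Longrightarrow> inverse g \<in> UU n"
  using cg_right_quotient[of n 1 g] UU_unit[of n g] cg_sym[of n g 1] by (simp add: UU_iff)

lemma UU_power: "g \<in> UU n \<Longrightarrow> g ^ k \<in> UU n"
  by (induction k) (simp_all add: UU_mult)

lemma UU_conj:
  assumes "g \<in> UU n" "h \<in> OD" "inverse h \<in> OD" "h \<noteq> 0" shows "h * g * inverse h \<in> UU n"
  using cg_mult_right[OF cg_mult_left[OF assms(1)[unfolded UU_iff] assms(2)] assms(3)] assms(4)
  by (simp add: UU_iff)

lemma UU_digit:
  assumes "g \<in> UU n" obtains c where "cg (n + 1) g (1 + w ^ n * tau c)"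
proof -
  obtain x where x: "x \<in> OD" "g = 1 + w ^ n * x" using assms UU_iff cgE by blast
  have "cg (n + 1) (1 + w ^ n * x) (1 + w ^ n * tau (res x))"
    using x by (intro cg_add cg_w_mult cg_tau_res) simp_all
  then show ?thesis using that x by simp
qed

lemma UU_intro: "x \<in> OD \<Longrightarrow> 1 + w ^ n * x \<in> UU n"
  unfolding UU_iff by (rule cgI) simp_all

definition teich_elt :: "'q \<Rightarrow> 'd" where
  "teich_elt c = 1 + w * tau c"

lemma teich_elt_UU: "teich_elt c \<in> UU 1"
  using UU_intro[of "tau c" 1] by (simp add: teich_elt_def)

text \<open>The product differs from \<open>1 + w * (tau a + tau b)\<close> by a multiple of
  \<open>w\<^sup>2\<close>, and \<open>tau\<close> is additive modulo \<open>w\<close>. So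
  \<open>teich_elt\<close> is a homomorphism from the additive group of the residue field to
  \<open>UU 1\<close> modulo \<open>UU 2\<close>.\<close>

lemma teich_elt_add: "inverse (teich_elt (a + b)) * (teich_elt a * teich_elt b) \<in> UU 2"
proof (rule cg_left_quotient)
  have "cg (1 + 1) (w ^ 1 * (tau a + tau b)) (w ^ 1 * tau (a + b))"
    by (intro cg_w_mult) (simp add: cg_1_iff cg_Suc_0_iff OD_add res_add)
  then have A: "cg 2 (1 + w * (tau a + tau b)) (1 + w * tau (a + b))"
    by (intro cg_add) (simp_all add: numeral_2_eq_2)
  have "w * tau a * (w * tau b) = w ^ 2 * (tau (a ^ p) * tau b)"
  proof -
    have "w * tau a * (w * tau b) = w * (tau a * w) * tau b" by (simp only: mult.assoc)
    then show ?thesis by (simp only: tau_w power2_eq_square mult.assoc)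
  qed
  then have B: "cg 2 (w * tau a * (w * tau b)) 0" by (simp add: cg_w_power OD_mult)
  have "teich_elt a * teich_elt b = 1 + w * (tau a + tau b) + w * tau a * (w * tau b)"
    by (simp add: teich_elt_def algebra_simps)
  then show "cg 2 (teich_elt a * teich_elt b) (teich_elt (a + b))"
    using cg_add[OF A B] by (simp add: teich_elt_def)
qed (use UU_unit[OF order_refl teich_elt_UU] in simp_all)

text \<open>Passing \<open>w\<close> turns \<open>zeta\<close> into \<open>zeta\<^sup>p\<close>; one
  factor \<open>zeta\<close> is returned to the right, which leaves the exponent
  \<open>p - 1\<close>. This is the source of the character \<open>\<alpha>\<close>.\<close>

lemma zeta_conj_teich_elt:
  "zeta * teich_elt c = teich_elt (res zeta ^ (p - 1) * c) * zeta"
proof -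
  have r: "res zeta ^ (p - 1) * c * res zeta = res zeta ^ p * c"
    using p_gt_1 power_Suc[of "res zeta" "p - 1"] by simp
  have "zeta * w = w * tau (res zeta ^ p)" using tau_w[of "res zeta"] by (simp only: tau_res_zeta)
  then have "zeta * (w * tau c) = w * tau (res zeta ^ p * c)"
    by (simp only: tau_mult mult.assoc[symmetric])
  moreover have "w * tau (res zeta ^ (p - 1) * c) * zeta = w * tau (res zeta ^ p * c)"
    using tau_mult[of "res zeta ^ (p - 1) * c" "res zeta"] unfolding r tau_res_zeta
    by (simp only: mult.assoc)
  ultimately show ?thesis by (simp add: teich_elt_def distrib_left distrib_right)
qed

definition commutator :: "'d \<Rightarrow> 'd \<Rightarrow> 'd" where
  "commutator g h = g * h * inverse (h * g)"

text \<open>Dividing \<open>g * h = h * g + w ^ n * x\<close> by \<open>h * g\<close>, which is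
  \<open>1\<close> modulo \<open>w\<close>, leaves the leading digit of the difference
  unchanged.\<close>

lemma commutator_cong:
  assumes "g \<in> UU 1" "h \<in> UU 1" "g * h = h * g + w ^ n * x" "x \<in> OD"
  shows "cg (n + 1) (commutator g h) (1 + w ^ n * x)"
proof -
  have hg: "h * g \<in> UU 1" using assms UU_mult by blast
  have i: "inverse (h * g) \<in> UU 1" using UU_inverse[OF _ hg] by simp
  have "commutator g h = 1 + w ^ n * (x * inverse (h * g))"
    unfolding commutator_def assms(3) distrib_right right_inverse[OF UU_unit(2)[OF order_refl hg]]
    by (simp only: mult.assoc)
  moreover have "cg 1 (x * inverse (h * g)) (x * 1)"
    using cg_mult_left[of 1 _ 1] i assms(4) UU_iff by blast
  ultimately show ?thesis using cg_add[OF cg_refl cg_w_mult[of 1 _ _ n]] by simp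
qed

lemma commutator_UU: "g \<in> UU 1 \<Longrightarrow> h \<in> UU 1 \<Longrightarrow> commutator g h \<in> UU 1"
  unfolding commutator_def by (intro UU_mult UU_inverse) simp_all

lemma teich_elt_commutator:
  "cg 3 (commutator (teich_elt a) (teich_elt b)) (1 + w ^ 2 * tau (a ^ p * b - b ^ p * a))"
proof -
  have m: "w * tau a * (w * tau b) = w ^ 2 * tau (a ^ p * b)" for a b
  proof -
    have "w * tau a * (w * tau b) = w * (tau a * w) * tau b" by (simp only: mult.assoc)
    then show ?thesis by (simp only: tau_w tau_mult power2_eq_square mult.assoc)
  qed
  let ?x = "tau (a ^ p * b) - tau (b ^ p * a)"
  have "teich_elt a * teich_elt b = teich_elt b * teich_elt a + w ^ 2 * ?x"
  proof -
    have "teich_elt a * teich_elt b = 1 + w * tau a + w * tau b + w * tau a * (w * tau b)" for a b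
      by (simp add: teich_elt_def algebra_simps)
    then show ?thesis unfolding m by (simp add: algebra_simps)
  qed
  then have "cg (2 + 1) (commutator (teich_elt a) (teich_elt b)) (1 + w ^ 2 * ?x)"
    by (intro commutator_cong teich_elt_UU) (simp_all add: OD_diff)
  also have "cg (2 + 1) (1 + w ^ 2 * ?x) (1 + w ^ 2 * tau (a ^ p * b - b ^ p * a))"
    by (intro cg_add cg_w_mult) (simp_all add: cg_1_iff cg_Suc_0_iff OD_diff res_diff)
  finally show ?thesis by simp
qed

text \<open>The two products first differ in degree 3: \<open>tau b\<close> passing \<open>w\<close>
  becomes the lift of \<open>b\<^sup>p\<close>, while \<open>tau c\<close> passes
  \<open>w\<^sup>2\<close> unchanged. The unknown tail of \<open>u\<close> affects only degree
  4.\<close>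

lemma commutator_level_2:
  assumes "cg 3 u (1 + w ^ 2 * tau b)"
  shows "cg 4 (commutator u (teich_elt c)) (1 + w ^ 3 * tau ((b ^ p - b) * c))"
proof -
  obtain x where x: "x \<in> OD" "u = 1 + w ^ 2 * tau b + w ^ 3 * x" using assms cgE by blast
  have u: "u \<in> UU 1"
  proof -
    have "u = 1 + w ^ 1 * (w * tau b + w ^ 2 * x)"
      unfolding x(2) by (simp add: algebra_simps power_numeral_reduce)
    then show ?thesis using UU_intro[of "w * tau b + w ^ 2 * x" 1] x
      by (simp only: OD_add OD_mult OD_power tau_OD w_OD)
  qed
  obtain x' where x': "x' \<in> OD" "x * w = w * x'" using OD_w_swap[OF x(1)] .
  have ww3: "w * w ^ 2 = w ^ 3" "w ^ 2 * w = w ^ 3" "w ^ 3 * w = w ^ 4" "w * w ^ 3 = w ^ 4"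
    by (simp_all add: numeral_eq_Suc mult.assoc)
  have A: "w ^ 2 * tau b * (w * tau c) = w ^ 3 * tau (b ^ p * c)"
  proof -
    have "w ^ 2 * tau b * (w * tau c) = w ^ 2 * (tau b * w) * tau c" by (simp only: mult.assoc)
    then show ?thesis by (simp only: tau_w tau_mult mult.assoc flip: ww3(2))
  qed
  have B: "w * tau c * (w ^ 2 * tau b) = w ^ 3 * tau (c * b)"
  proof -
    have t: "tau c * w ^ 2 = w ^ 2 * tau c" using tau_w_power[of c 2] by simp
    have "w * tau c * (w ^ 2 * tau b) = w * (tau c * w ^ 2) * tau b" by (simp only: mult.assoc)
    then show ?thesis by (simp only: t tau_mult mult.assoc flip: ww3(1))
  qed
  obtain y where y: "y \<in> OD" "tau c * w ^ 3 = w ^ 3 * y" using OD_w_power_swap[of "tau c" 3] by auto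
  have C: "w ^ 3 * x * (w * tau c) = w ^ 4 * (x' * tau c)"
  proof -
    have "w ^ 3 * x * (w * tau c) = w ^ 3 * (x * w) * tau c" by (simp only: mult.assoc)
    then show ?thesis by (simp only: x'(2) mult.assoc flip: ww3(3))
  qed
  have D: "w * tau c * (w ^ 3 * x) = w ^ 4 * (y * x)"
  proof -
    have "w * tau c * (w ^ 3 * x) = w * (tau c * w ^ 3) * x" by (simp only: mult.assoc)
    then show ?thesis by (simp only: y(2) mult.assoc flip: ww3(4))
  qed
  let ?z = "tau (b ^ p * c) - tau (c * b) + w * (x' * tau c - y * x)"
  have z: "?z \<in> OD" using x x' y by (intro OD_add OD_diff OD_mult) simp_all
  have "u * teich_elt c - teich_elt c * u =
      w ^ 2 * tau b * (w * tau c) - w * tau c * (w ^ 2 * tau b) + (w ^ 3 * x * (w * tau c) - w * tau c * (w ^ 3 * x))"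
    unfolding x(2) teich_elt_def by (simp add: algebra_simps)
  also have "\<dots> = w ^ 3 * ?z"
    unfolding A B C D by (simp add: right_diff_distrib distrib_left mult.assoc[symmetric] ww3)
  finally have "u * teich_elt c = teich_elt c * u + w ^ 3 * ?z" by (simp add: algebra_simps)
  then have "cg (3 + 1) (commutator u (teich_elt c)) (1 + w ^ 3 * ?z)"
    using u z by (intro commutator_cong teich_elt_UU)
  also have "cg (3 + 1) (1 + w ^ 3 * ?z) (1 + w ^ 3 * tau ((b ^ p - b) * c))"
  proof -
    have "res ?z = (b ^ p - b) * c"
      using x x' y by (simp add: OD_diff OD_mult res_diff res_add left_diff_distrib mult.commute[of c b])
    then show ?thesis using z by (intro cg_add cg_w_mult) (simp_all add: cg_1_iff cg_Suc_0_iff)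
  qed
  finally show ?thesis by simp
qed

lemma central_one_plus_p: "1 + w ^ 2 * of_nat n \<in> centre - {0}" "1 + w ^ 2 * of_nat n \<in> UU 2"
proof -
  show u: "1 + w ^ 2 * of_nat n \<in> UU 2" by (rule UU_intro) simp
  have "1 + w ^ 2 * of_nat n = (of_nat (1 + p * n) :: 'd)" by (simp add: w_square)
  then have "1 + w ^ 2 * of_nat n \<in> centre"
    unfolding centre_def mem_Collect_eq by (metis mult_of_nat_commute)
  then show "1 + w ^ 2 * of_nat n \<in> centre - {0}" using UU_unit(2)[OF _ u] by simp
qed

text \<open>Successive approximation, one congruence level at a time. It stops at a finite level
  \<open>N\<close>, because each vector of a smooth representation is fixed by some
  \<open>UU N\<close>; no limit has to be formed.\<close>

lemma UU_approximation:
  assumes one: "1 \<in> S" and mult: "\<And>g h. g \<in> S \<Longrightarrow> h \<in> S \<Longrightarrow> g * h \<in> S" and S: "S \<subseteq> UU 1"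
    and step: "\<And>n g. n \<ge> m \<Longrightarrow> g \<in> UU n \<Longrightarrow> \<exists>s\<in>S. inverse s * g \<in> UU (n + 1)"
    and g: "g \<in> UU m"
  shows "\<exists>s\<in>S. inverse s * g \<in> UU N"
proof -
  have "\<exists>s\<in>S. inverse s * g \<in> UU (m + k)" for k
  proof (induction k)
    case 0
    show ?case using one g by (intro bexI[of _ 1]) simp_all
  next
    case (Suc k)
    then obtain s where s: "s \<in> S" "inverse s * g \<in> UU (m + k)" by (elim bexE)
    obtain s' where s': "s' \<in> S" "inverse s' * (inverse s * g) \<in> UU (m + k + 1)"
      using step[OF _ s(2)] by auto
    have "s \<noteq> 0" "s' \<noteq> 0" using s s' S UU_unit(2)[of 1] by auto
    then have "inverse (s * s') * g = inverse s' * (inverse s * g)"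
      by (simp add: nonzero_inverse_mult_distrib mult.assoc)
    then show ?case using mult[OF s(1) s'(1)] s'(2) by (metis add_Suc_right Suc_eq_plus1)
  qed
  then obtain s where "s \<in> S" "inverse s * g \<in> UU (m + N)" by blast
  then show ?thesis using UU_mono[of N "m + N"] by (metis le_add2 subsetD)
qed

end

context quaternion_setup_ge5
begin

lemma q_two: "(2 :: 'q) \<noteq> 0"
proof -
  have "\<not> p dvd 2" using p_ge_5 by (simp add: dvd_imp_le nat_dvd_not_less)
  then show ?thesis using q_of_nat_eq_0_iff[of 2] by simp
qed

text \<open>The linear term \<open>p * y = w ^ (n + 2) * x\<close> dominates. For
  \<open>1 < k < p\<close> the binomial coefficient contributes a further \<open>w\<^sup>2\<close>,
  so the degree is at least \<open>2 + 2 * n\<close>; for \<open>k = p\<close> it is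
  \<open>n * p\<close>, which is at least \<open>n + 3\<close> by \<open>p \<ge> 5\<close>.\<close>

lemma UU_p_power:
  assumes n: "n \<ge> 1" and x: "x \<in> OD"
  shows "cg (n + 3) ((1 + w ^ n * x) ^ p) (1 + w ^ (n + 2) * x)"
proof -
  define y where "y = w ^ n * x"
  have yk: "\<exists>z\<in>OD. y ^ k = w ^ (n * k) * z" for k
  proof (induction k)
    case (Suc k)
    then obtain z where z: "z \<in> OD" "y ^ k = w ^ (n * k) * z" by (elim bexE)
    obtain x' where x': "x' \<in> OD" "x * w ^ (n * k) = w ^ (n * k) * x'" using OD_w_power_swap[OF x] .
    have "y ^ Suc k = w ^ n * x * (w ^ (n * k) * z)" using z(2) by (simp add: y_def)
    also have "\<dots> = w ^ n * (x * w ^ (n * k)) * z" by (simp only: mult.assoc)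
    also have "\<dots> = w ^ (n * Suc k) * (x' * z)" unfolding x' by (simp add: power_add mult.assoc)
    finally show ?case using x' z OD_mult by (intro bexI[of _ "x' * z"])
  qed (auto intro: bexI[of _ 1])
  have kk: "cg (n + 3) (of_nat (p choose k) * y ^ k) 0" if k: "k \<in> {2..p}" for k
  proof -
    obtain z where z: "z \<in> OD" "y ^ k = w ^ (n * k) * z" using yk[of k] by (elim bexE)
    show ?thesis
    proof (cases "k = p")
      case True
      have "n * 4 \<le> n * (p - 1)" using p_ge_5 by (intro mult_left_mono) simp_all
      then have "n + 3 \<le> n + n * (p - 1)" using n by linarith
      also have "\<dots> = n * k" unfolding True using p_ge_5 by (simp add: algebra_simps)
      finally show ?thesis unfolding z using True z cg_w_power[of "n + 3" "n * k" z] by simp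
    next
      case False
      then have "p dvd p choose k" using k p_prime by (intro dvd_choose_prime) auto
      then obtain m where m: "p choose k = p * m" by (elim dvdE)
      have "n * 2 \<le> n * k" using k by (intro mult_left_mono) simp_all
      then have le: "n + 3 \<le> 2 + n * k" using n by linarith
      have "of_nat m * w ^ (n * k) = w ^ (n * k) * of_nat m" by (rule mult_of_nat_commute)
      then have "of_nat (p choose k) * y ^ k = w ^ (2 + n * k) * (of_nat m * z)"
        unfolding m z(2) power_add w_square of_nat_mult by (simp only: mult.assoc[symmetric]) (simp only: mult.assoc)
      then show ?thesis using cg_w_power[OF le, of "of_nat m * z"] z by (simp add: OD_mult)
    qed
  qed
  have sum0: "cg (n + 3) (\<Sum>k\<in>A. of_nat (p choose k) * y ^ k) 0" if "finite A" "A \<subseteq> {2..p}" for A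
    using that
  proof (induction A rule: finite_induct)
    case (insert a A)
    then show ?case using cg_add[OF kk[of a] insert(3)] by simp
  qed simp
  have "{..p} = insert 0 (insert 1 {2..p})" using p_gt_1 by auto
  then have "(1 + y) ^ p = 1 + of_nat p * y + (\<Sum>k\<in>{2..p}. of_nat (p choose k) * y ^ k)"
    unfolding one_plus_power by (simp add: algebra_simps)
  moreover have "of_nat p * y = w ^ (n + 2) * x"
    unfolding y_def w_square[symmetric] by (simp add: power_add[symmetric] mult.assoc[symmetric] add.commute)
  ultimately show ?thesis
    using cg_add[OF cg_refl sum0[of "{2..p}"], of "1 + w ^ (n + 2) * x"] by (simp add: y_def)
qed

lemma UU_p_power_surj:
  assumes n: "n \<ge> 1" and g: "g \<in> UU (n + 2)"
  obtains h where "h \<in> UU n" "inverse (h ^ p) * g \<in> UU (n + 3)"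
proof -
  obtain x where x: "x \<in> OD" "g = 1 + w ^ (n + 2) * x" using g UU_iff cgE by blast
  define h where "h = 1 + w ^ n * x"
  have h: "h \<in> UU n" unfolding h_def using x(1) by (rule UU_intro)
  have "cg (n + 3) g (h ^ p)" unfolding x(2) h_def using UU_p_power[OF n x(1)] by (rule cg_sym)
  then have "inverse (h ^ p) * g \<in> UU (n + 3)"
    using cg_left_quotient UU_unit[OF n UU_power[OF h]] by blast
  then show ?thesis using that h by blast
qed

text \<open>The digit splits into half its trace and a part of trace zero. The former lies in the
  prime field and is realized by the central element \<open>1 + p * n\<close>, the latter is the
  digit of a commutator.\<close>

lemma UU_2_digit:
  assumes "g \<in> UU 2"
  obtains m n where
    "inverse (commutator (teich_elt 1) (teich_elt m) * (1 + w ^ 2 * of_nat n)) * g \<in> UU 3"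
proof -
  obtain c where c: "cg (2 + 1) g (1 + w ^ 2 * tau c)" using UU_digit[OF assms] .
  define t where "t = (c - c ^ p) / 2"
  have two: "(2 :: 'q) ^ p = 2" using q_of_nat_frob[of 2] by simp
  have neg: "(- x) ^ p = - (x ^ p)" for x :: 'q
  proof -
    have "odd p" using p_ge_5 p_prime prime_odd_nat by auto
    then show ?thesis by simp
  qed
  have dif: "(x - y) ^ p = x ^ p - y ^ p" for x y :: 'q
    using q_frob_add[of x "- y"] neg[of y] by simp
  have tp: "t ^ p = - t" unfolding t_def power_divide two dif q_frob_frob by (simp add: field_simps)
  have "((c + c ^ p) / 2) ^ p = (c + c ^ p) / 2"
    unfolding power_divide two q_frob_add q_frob_frob by (simp add: add.commute)
  then obtain n where n: "(c + c ^ p) / 2 = of_nat n" using q_frob_fixed by metis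
  have n': "c - of_nat n = t" unfolding n[symmetric] t_def using q_two by (simp add: field_simps)
  \<comment> \<open>By \<open>teich_elt_commutator\<close>, \<open>teich_elt 1\<close> and
    \<open>teich_elt m\<close> have a commutator with digit \<open>m - m\<^sup>p\<close>. As
    \<open>t\<^sup>p = - t\<close>, the choice \<open>m = t / 2\<close> produces
    \<open>t\<close>.\<close>
  have m: "t / 2 - (t / 2) ^ p = t" unfolding power_divide two tp using q_two by (simp add: field_simps)
  define k where "k = commutator (teich_elt 1) (teich_elt (t / 2))"
  have k: "cg 3 k (1 + w ^ 2 * tau t)" using teich_elt_commutator[of 1 "t / 2"] m by (simp add: k_def)
  have z: "1 + w ^ 2 * of_nat n \<in> OD" using central_one_plus_p(2)[of n] UU_OD by blast
  have "cg 3 (k * (1 + w ^ 2 * of_nat n)) ((1 + w ^ 2 * tau t) * (1 + w ^ 2 * of_nat n))"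
    using k z by (rule cg_mult_right)
  also have "(1 + w ^ 2 * tau t) * (1 + w ^ 2 * of_nat n) = 1 + w ^ 2 * (tau t + of_nat n) + w ^ 4 * (tau t * of_nat n)"
  proof -
    have "w ^ 2 * tau t * (w ^ 2 * of_nat n) = w ^ 4 * (tau t * of_nat n)"
      using tau_w_power[of t 2] by (simp add: mult.assoc) (simp add: mult.assoc[symmetric] power_add[symmetric])
    then show ?thesis by (simp add: algebra_simps)
  qed
  also have "cg 3 \<dots> (1 + w ^ 2 * (tau t + of_nat n) + 0)"
    by (intro cg_add[OF cg_refl] cg_w_power) (simp_all add: OD_mult)
  also have "cg 3 (1 + w ^ 2 * (tau t + of_nat n) + 0) (1 + w ^ 2 * tau c)"
  proof -
    have "cg (2 + 1) (w ^ 2 * (tau t + of_nat n)) (w ^ 2 * tau c)"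
      using n' by (intro cg_w_mult) (simp add: cg_1_iff cg_Suc_0_iff OD_add res_add algebra_simps)
    then show ?thesis using cg_add[OF cg_refl] by simp
  qed
  also have "cg 3 (1 + w ^ 2 * tau c) g" using cg_sym[OF c] by simp
  finally have "cg 3 g (k * (1 + w ^ 2 * of_nat n))" by (rule cg_sym)
  moreover have "k * (1 + w ^ 2 * of_nat n) \<in> UU 1"
    unfolding k_def using UU_mono[of 1 2] central_one_plus_p(2)
    by (intro UU_mult commutator_UU teich_elt_UU) auto
  ultimately have "inverse (k * (1 + w ^ 2 * of_nat n)) * g \<in> UU 3"
    using cg_left_quotient UU_unit[of 1] by blast
  then show ?thesis using that unfolding k_def by blast
qed

end

section \<open>Operators on a filtered vector space\<close>

locale linear_filtration = vector_space s
  for s :: "'f::field \<Rightarrow> 'm::ab_group_add \<Rightarrow> 'm" +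
  fixes F :: "nat \<Rightarrow> 'm set"
  assumes F_sub: "subspace (F n)" and F_Suc: "F (Suc n) \<subseteq> F n"
begin

lemma F_mono: "m \<le> n \<Longrightarrow> F n \<subseteq> F m"
  by (induction n rule: dec_induct) (use F_Suc in auto)

lemma F_le: "x \<in> F n \<Longrightarrow> m \<le> n \<Longrightarrow> x \<in> F m"
  using F_mono by blast

lemma F_zero [simp]: "0 \<in> F n"
  and F_add: "x \<in> F n \<Longrightarrow> y \<in> F n \<Longrightarrow> x + y \<in> F n"
  and F_diff: "x \<in> F n \<Longrightarrow> y \<in> F n \<Longrightarrow> x - y \<in> F n"
  and F_scale: "x \<in> F n \<Longrightarrow> s c x \<in> F n"
  and F_sum: "(\<And>i. i \<in> A \<Longrightarrow> f i \<in> F n) \<Longrightarrow> sum f A \<in> F n"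
  using F_sub by (auto intro: subspace_0 subspace_add subspace_diff subspace_scale subspace_sum)

lemma F_cancel: "x + y \<in> F n \<Longrightarrow> y \<in> F n \<Longrightarrow> x \<in> F n"
  using F_diff[of "x + y" n y] by simp

lemma F_diff_sym: "x - y \<in> F n \<Longrightarrow> y - x \<in> F n"
  using F_diff[of 0 n "x - y"] by simp

end

text \<open>The situation on the dual without the group. In the application \<open>h\<close> is the
  action of \<open>zeta\<close> and \<open>N = p\<^sup>2 - 1\<close>; \<open>Y\<close> and
  \<open>Z\<close> have weights \<open>a\<close> and \<open>inverse a\<close> under
  \<open>h\<close>, and \<open>a\<close> has exact order \<open>p + 1\<close>. The last assumption
  records the leading term of \<open>T Z - Z T\<close> on \<open>v0\<close>.\<close>

locale filtered_operators = linear_filtration s F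
  for s :: "'f::field \<Rightarrow> 'm::ab_group_add \<Rightarrow> 'm" and F +
  fixes Y Z T h :: "'m \<Rightarrow> 'm" and v0 v1 :: 'm and p :: nat and a \<delta> :: 'f and N :: nat
  assumes Y_lin: "Vector_Spaces.linear s s Y" and Z_lin: "Vector_Spaces.linear s s Z"
    and T_lin: "Vector_Spaces.linear s s T" and h_lin: "Vector_Spaces.linear s s h"
    and Y_F: "x \<in> F n \<Longrightarrow> Y x \<in> F (Suc n)" and Z_F: "x \<in> F n \<Longrightarrow> Z x \<in> F (Suc n)"
    and T_F: "x \<in> F n \<Longrightarrow> T x \<in> F (n + 2)" and h_F: "x \<in> F n \<Longrightarrow> h x \<in> F n"
    and hY: "h (Y x) = s a (Y (h x))" and hZ: "h (Z x) = s (inverse a) (Z (h x))"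
    and h_order: "(h ^^ N) x = x" and N_nonzero: "(of_nat N :: 'f) \<noteq> 0"
    and a_order: "a ^ (p + 1) = 1" "\<And>i. 0 < i \<Longrightarrow> i \<le> p \<Longrightarrow> a ^ i \<noteq> 1" and a_N: "a ^ N = 1"
    and p2: "p \<ge> 2" and delta: "\<delta> \<noteq> 0"
    and v01: "v0 \<in> F 0" "v1 \<in> F 0"
    and span0: "x \<in> F 0 \<Longrightarrow> \<exists>c d. x - (s c v0 + s d v1) \<in> F 1"
    and spanS: "x \<in> F (Suc n) \<Longrightarrow> \<exists>y\<in>F n. \<exists>z\<in>F n. x - (Y y + Z z) \<in> F (n + 2)"
    and ZY: "Z ((Y ^^ i) v0) \<in> F (i + 2)" and YZ: "Y ((Z ^^ i) v1) \<in> F (i + 2)"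
    and free: "n \<le> p \<Longrightarrow> s c ((Y ^^ n) v0) + s d ((Z ^^ n) v1) \<in> F (Suc n) \<Longrightarrow> c = 0 \<and> d = 0"
    and Tv: "T v0 \<in> F 3" "T v1 \<in> F 3"
    and TZ: "x \<in> F n \<Longrightarrow> T (Z x) - Z (T x) \<in> F (n + p)"
    and TZv0: "T (Z v0) - Z (T v0) - s \<delta> ((Y ^^ p) v0) \<in> F (p + 1)"
begin

lemma Y_add: "Y (x + y) = Y x + Y y" and Y_scale: "Y (s c x) = s c (Y x)"
  and Z_add: "Z (x + y) = Z x + Z y" and Z_scale: "Z (s c x) = s c (Z x)"
  and T_add: "T (x + y) = T x + T y" and T_scale: "T (s c x) = s c (T x)"
  and h_add: "h (x + y) = h x + h y" and h_scale: "h (s c x) = s c (h x)"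
  using Y_lin Z_lin T_lin h_lin
  by (simp_all add: Vector_Spaces.linear_iff)

lemma lin_facts:
  fixes f :: "'m \<Rightarrow> 'm"
  assumes "\<And>x y. f (x + y) = f x + f y"
  shows "f 0 = 0" "f (x - y) = f x - f y" "f (sum g A) = (\<Sum>i\<in>A. f (g i))"
proof -
  show z: "f 0 = 0" using assms[of 0 0] by simp
  show "f (x - y) = f x - f y" using assms[of "x - y" y] by simp
  show "f (sum g A) = (\<Sum>i\<in>A. f (g i))"
    by (induction A rule: infinite_finite_induct) (simp_all add: z assms)
qed

lemmas Y_facts = lin_facts[of Y, OF Y_add] and Z_facts = lin_facts[of Z, OF Z_add]
  and T_facts = lin_facts[of T, OF T_add] and h_facts = lin_facts[of h, OF h_add]

lemma a_nonzero: "a \<noteq> 0"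
  using a_order(1) by auto

lemma Yi_F: "x \<in> F n \<Longrightarrow> (Y ^^ i) x \<in> F (n + i)"
  by (induction i) (simp_all add: Y_F)

lemma Zi_F: "x \<in> F n \<Longrightarrow> (Z ^^ i) x \<in> F (n + i)"
  by (induction i) (simp_all add: Z_F)

lemma hi_F: "x \<in> F n \<Longrightarrow> (h ^^ i) x \<in> F n"
  by (induction i) (simp_all add: h_F)

text \<open>For \<open>c ^ N = 1\<close>, the projector to the eigenspace of \<open>h\<close> with
  eigenvalue \<open>c\<close>, as an average over the powers of \<open>h\<close>; this is possible
  since \<open>N\<close> is invertible in the field.\<close>

definition P :: "'f \<Rightarrow> 'm \<Rightarrow> 'm" where
  "P c x = s (inverse (of_nat N)) (\<Sum>i<N. s (inverse c ^ i) ((h ^^ i) x))"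

lemma hi_add: "(h ^^ i) (x + y) = (h ^^ i) x + (h ^^ i) y"
  by (induction i) (simp_all add: h_add)

lemma hi_scale: "(h ^^ i) (s c x) = s c ((h ^^ i) x)"
  by (induction i) (simp_all add: h_scale)

lemma P_add: "P c (x + y) = P c x + P c y"
  by (simp add: P_def hi_add scale_right_distrib sum.distrib)

lemma P_scale: "P c (s d x) = s d (P c x)"
  by (simp add: P_def hi_scale scale_sum_right mult_ac)

lemmas P_facts = lin_facts[of "P c" for c, OF P_add]

lemma P_F: "x \<in> F n \<Longrightarrow> P c x \<in> F n"
  unfolding P_def by (intro F_scale F_sum hi_F)

lemma hi_eigen: "h x = s d x \<Longrightarrow> (h ^^ i) x = s (d ^ i) x"
  by (induction i) (simp_all add: h_scale mult_ac)

lemma N_pos: "N > 0"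
  using N_nonzero by (cases N) simp_all

lemma h_P:
  assumes "c ^ N = 1" shows "h (P c x) = s c (P c x)"
proof -
  have c0: "c \<noteq> 0" using assms N_pos by (metis power_0_left less_irrefl zero_neq_one)
  let ?t = "\<lambda>i. s (inverse c ^ i) ((h ^^ i) x)"
  have "(\<Sum>i<N. ?t (Suc i)) + ?t 0 = (\<Sum>i<N. ?t i) + ?t N"
    using sum.lessThan_Suc_shift[of ?t N] sum.lessThan_Suc[of ?t N] by (simp add: add.commute)
  moreover have "?t N = ?t 0" using assms h_order by (simp add: power_inverse)
  ultimately have shift: "(\<Sum>i<N. ?t (Suc i)) = (\<Sum>i<N. ?t i)" by simp
  have "h (\<Sum>i<N. ?t i) = (\<Sum>i<N. s c (?t (Suc i)))"
    unfolding h_facts using c0 by (intro sum.cong) (simp_all add: h_scale)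
  also have "\<dots> = s c (\<Sum>i<N. ?t i)" by (simp only: scale_sum_right[symmetric] shift)
  finally show ?thesis unfolding P_def h_scale by (simp add: mult.commute)
qed

lemma P_eigen:
  assumes "h x = s d x" "d ^ N = 1" "c ^ N = 1"
  shows "P c x = (if c = d then x else 0)"
proof -
  have c0: "c \<noteq> 0" using assms N_pos by (metis power_0_left less_irrefl zero_neq_one)
  have "(\<Sum>i<N. s (inverse c ^ i) ((h ^^ i) x)) = s (\<Sum>i<N. (d / c) ^ i) x"
    by (simp add: hi_eigen[OF assms(1)] scale_sum_left power_divide field_simps)
  moreover have "(\<Sum>i<N. (d / c) ^ i) = (if c = d then of_nat N else 0)"
  proof (cases "c = d")
    case False
    then have "d / c \<noteq> 1" using c0 by simp
    then have "(\<Sum>i<N. (d / c) ^ i) = ((d / c) ^ N - 1) / (d / c - 1)" by (rule geometric_sum)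
    also have "(d / c) ^ N = 1" unfolding power_divide using assms by simp
    finally show ?thesis using False by simp
  qed (use c0 in simp)
  ultimately show ?thesis unfolding P_def using N_nonzero by simp
qed

text \<open>\<open>Z\<close> multiplies eigenvalues by \<open>inverse a\<close>, so the part of
  \<open>Z x\<close> with eigenvalue \<open>c\<close> comes from the part of \<open>x\<close> with
  eigenvalue \<open>c * a\<close>.\<close>

lemma P_Z: "c \<noteq> 0 \<Longrightarrow> P c (Z x) = Z (P (c * a) x)"
proof -
  assume c: "c \<noteq> 0"
  have hi: "(h ^^ i) (Z x) = s (inverse a ^ i) (Z ((h ^^ i) x))" for i
    by (induction i) (simp_all add: h_scale hZ mult_ac)
  show ?thesis
    unfolding P_def Z_scale Z_facts hi by (simp add: inverse_mult_distrib power_mult_distrib mult_ac)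
qed

text \<open>An error in \<open>F 1\<close> is raised by every operator at least as far as the
  respective claim requires. The properties thus depend only on the class modulo \<open>F 1\<close>,
  and \<open>v0\<close> may be replaced by an eigenvector.\<close>

lemma v0_cong:
  assumes "x - v0 \<in> F 1"
  shows "x \<in> F 0" "Z ((Y ^^ i) x) \<in> F (i + 2)" "T x \<in> F 3"
    "T (Z x) - Z (T x) - s \<delta> ((Y ^^ p) x) \<in> F (p + 1)" "(Y ^^ i) x - (Y ^^ i) v0 \<in> F (Suc i)"
proof -
  define r where "r = x - v0"
  have r: "r \<in> F 1" and x: "x = v0 + r" using assms by (simp_all add: r_def)
  have Yi: "(Y ^^ i) (u + v) = (Y ^^ i) u + (Y ^^ i) v" for i u v by (induction i) (simp_all add: Y_add)
  show "x \<in> F 0" unfolding x using v01 F_le[OF r] by (intro F_add) simp_all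
  have "Z ((Y ^^ i) r) \<in> F (i + 2)" using Z_F[OF Yi_F[OF r]] by simp
  then show "Z ((Y ^^ i) x) \<in> F (i + 2)" unfolding x Yi Z_add using ZY F_add by blast
  show "T x \<in> F 3" unfolding x T_add using Tv(1) T_F[OF r] by (intro F_add) (simp_all add: numeral_3_eq_3)
  show "(Y ^^ i) x - (Y ^^ i) v0 \<in> F (Suc i)" unfolding x Yi using Yi_F[OF r, of i] by simp
  have "T (Z r) - Z (T r) \<in> F (p + 1)" using TZ[OF r] by (simp add: add.commute)
  moreover have "s \<delta> ((Y ^^ p) r) \<in> F (p + 1)" using F_scale[OF Yi_F[OF r, of p]] by simp
  ultimately have "(T (Z v0) - Z (T v0) - s \<delta> ((Y ^^ p) v0)) + ((T (Z r) - Z (T r)) - s \<delta> ((Y ^^ p) r)) \<in> F (p + 1)"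
    using F_add[OF TZv0 F_diff] by blast
  then show "T (Z x) - Z (T x) - s \<delta> ((Y ^^ p) x) \<in> F (p + 1)"
    unfolding x Yi Z_add T_add scale_right_distrib by (simp add: algebra_simps)
qed

lemma v1_cong:
  assumes "x - v1 \<in> F 1"
  shows "x \<in> F 0" "Y ((Z ^^ i) x) \<in> F (i + 2)" "T x \<in> F 3" "(Z ^^ i) x - (Z ^^ i) v1 \<in> F (Suc i)"
proof -
  define r where "r = x - v1"
  have r: "r \<in> F 1" and x: "x = v1 + r" using assms by (simp_all add: r_def)
  have Zi: "(Z ^^ i) (u + v) = (Z ^^ i) u + (Z ^^ i) v" for i u v by (induction i) (simp_all add: Z_add)
  show "x \<in> F 0" unfolding x using v01 F_le[OF r] by (intro F_add) simp_all
  have "Y ((Z ^^ i) r) \<in> F (i + 2)" using Y_F[OF Zi_F[OF r]] by simp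
  then show "Y ((Z ^^ i) x) \<in> F (i + 2)" unfolding x Zi Y_add using YZ F_add by blast
  show "T x \<in> F 3" unfolding x T_add using Tv(2) T_F[OF r] by (intro F_add) (simp_all add: numeral_3_eq_3)
  show "(Z ^^ i) x - (Z ^^ i) v1 \<in> F (Suc i)" unfolding x Zi using Zi_F[OF r, of i] by simp
qed

lemma sum_const_scale: "(\<Sum>i<n. v) = s (of_nat n) v"
  by (induction n) (simp_all add: scale_left_distrib add.commute)

lemma one_le_p: "1 \<le> p" "0 \<le> p"
  using p2 by simp_all

text \<open>The property of being sent to \<open>F 2\<close> by \<open>Z\<close> is stable under
  \<open>h\<close> and holds for \<open>v0\<close>, but freeness excludes it for \<open>v1\<close>.
  So \<open>v1\<close> does not occur in \<open>h v0\<close> modulo \<open>F 1\<close>. The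
  projector then turns the eigenvector modulo \<open>F 1\<close> into a true one.\<close>

lemma eigenvector_0: "\<exists>x c. x - v0 \<in> F 1 \<and> h x = s c x \<and> c ^ N = 1"
proof -
  obtain c d where cd: "h v0 - (s c v0 + s d v1) \<in> F 1" using span0[OF h_F[OF v01(1)]] by blast
  have "Z (h v0) = s a (h (Z v0))" using hZ[of v0] a_nonzero by simp
  moreover have "Z v0 \<in> F 2" using ZY[of 0] by (simp add: numeral_2_eq_2)
  ultimately have "Z (h v0) \<in> F 2" using F_scale h_F by metis
  moreover have "Z (h v0 - (s c v0 + s d v1)) \<in> F 2" using Z_F[OF cd] by (simp add: numeral_2_eq_2)
  ultimately have "Z (s c v0 + s d v1) \<in> F 2"
    using F_diff[of "Z (h v0)" 2 "Z (h v0 - (s c v0 + s d v1))"] by (simp add: Z_facts)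
  then have "s c (Z v0) + s d (Z v1) \<in> F 2" by (simp add: Z_add Z_scale)
  then have "s d (Z v1) \<in> F 2"
    using F_cancel[of "s d (Z v1)" "s c (Z v0)" 2] F_scale[OF \<open>Z v0 \<in> F 2\<close>] by (simp add: add.commute)
  then have "d = 0" using free[OF one_le_p(1), of 0 d] by (simp add: numeral_2_eq_2)
  with cd have h1: "h v0 - s c v0 \<in> F 1" by simp
  have hi: "(h ^^ i) v0 - s (c ^ i) v0 \<in> F 1" for i
  proof (induction i)
    case (Suc i)
    have "h ((h ^^ i) v0 - s (c ^ i) v0) + s (c ^ i) (h v0 - s c v0) \<in> F 1"
      using Suc h1 by (intro F_add h_F F_scale)
    then show ?case by (simp add: h_facts h_scale scale_right_diff_distrib mult_ac)
  qed simp
  have "s (1 - c ^ N) v0 \<in> F 1" using hi[of N] by (simp add: h_order scale_left_diff_distrib)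
  then have cN: "c ^ N = 1" using free[OF one_le_p(2), of "1 - c ^ N" 0] by simp
  have c0: "c \<noteq> 0" using cN N_pos by (metis power_0_left less_irrefl zero_neq_one)
  have "s (inverse c ^ i) ((h ^^ i) v0) - v0 \<in> F 1" for i
  proof -
    have "s (inverse c ^ i) ((h ^^ i) v0 - s (c ^ i) v0) \<in> F 1" using hi by (rule F_scale)
    then show ?thesis using c0 by (simp add: scale_right_diff_distrib power_inverse)
  qed
  then have "(\<Sum>i<N. s (inverse c ^ i) ((h ^^ i) v0) - v0) \<in> F 1" by (intro F_sum)
  then have "s (inverse (of_nat N)) ((\<Sum>i<N. s (inverse c ^ i) ((h ^^ i) v0)) - (\<Sum>i<N. v0)) \<in> F 1"
    unfolding sum_subtractf by (rule F_scale)
  moreover have "(\<Sum>i<N. v0) = s (of_nat N) v0"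
    by (rule sum_const_scale)
  ultimately have "P c v0 - v0 \<in> F 1"
    using N_nonzero by (simp add: P_def scale_right_diff_distrib)
  then show ?thesis using h_P[OF cN] cN by blast
qed

lemma eigenvector_1: "\<exists>x c. x - v1 \<in> F 1 \<and> h x = s c x \<and> c ^ N = 1"
proof -
  obtain c d where cd: "h v1 - (s c v0 + s d v1) \<in> F 1" using span0[OF h_F[OF v01(2)]] by blast
  have "h (Y v1) = s a (Y (h v1))" by (rule hY)
  then have "Y (h v1) = s (inverse a) (h (Y v1))" using a_nonzero by simp
  moreover have "Y v1 \<in> F 2" using YZ[of 0] by (simp add: numeral_2_eq_2)
  ultimately have "Y (h v1) \<in> F 2" using F_scale h_F by metis
  moreover have "Y (h v1 - (s c v0 + s d v1)) \<in> F 2" using Y_F[OF cd] by (simp add: numeral_2_eq_2)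
  ultimately have "Y (s c v0 + s d v1) \<in> F 2"
    using F_diff[of "Y (h v1)" 2 "Y (h v1 - (s c v0 + s d v1))"] by (simp add: Y_facts)
  then have "s c (Y v0) + s d (Y v1) \<in> F 2" by (simp add: Y_add Y_scale)
  then have "s c (Y v0) \<in> F 2"
    using F_cancel[of "s c (Y v0)" "s d (Y v1)" 2] F_scale[OF \<open>Y v1 \<in> F 2\<close>] by simp
  then have "c = 0" using free[OF one_le_p(1), of c 0] by (simp add: numeral_2_eq_2)
  with cd have h1: "h v1 - s d v1 \<in> F 1" by simp
  have hi: "(h ^^ i) v1 - s (d ^ i) v1 \<in> F 1" for i
  proof (induction i)
    case (Suc i)
    have "h ((h ^^ i) v1 - s (d ^ i) v1) + s (d ^ i) (h v1 - s d v1) \<in> F 1"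
      using Suc h1 by (intro F_add h_F F_scale)
    then show ?case by (simp add: h_facts h_scale scale_right_diff_distrib mult_ac)
  qed simp
  have "s (1 - d ^ N) v1 \<in> F 1" using hi[of N] by (simp add: h_order scale_left_diff_distrib)
  then have dN: "d ^ N = 1" using free[OF one_le_p(2), of 0 "1 - d ^ N"] by simp
  have d0: "d \<noteq> 0" using dN N_pos by (metis power_0_left less_irrefl zero_neq_one)
  have "s (inverse d ^ i) ((h ^^ i) v1) - v1 \<in> F 1" for i
  proof -
    have "s (inverse d ^ i) ((h ^^ i) v1 - s (d ^ i) v1) \<in> F 1" using hi by (rule F_scale)
    then show ?thesis using d0 by (simp add: scale_right_diff_distrib power_inverse)
  qed
  then have "(\<Sum>i<N. s (inverse d ^ i) ((h ^^ i) v1) - v1) \<in> F 1" by (intro F_sum)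
  then have "s (inverse (of_nat N)) ((\<Sum>i<N. s (inverse d ^ i) ((h ^^ i) v1)) - (\<Sum>i<N. v1)) \<in> F 1"
    unfolding sum_subtractf by (rule F_scale)
  moreover have "(\<Sum>i<N. v1) = s (of_nat N) v1"
    by (rule sum_const_scale)
  ultimately have "P d v1 - v1 \<in> F 1"
    using N_nonzero by (simp add: P_def scale_right_diff_distrib)
  then show ?thesis using h_P[OF dN] dN by blast
qed

text \<open>The commutator relation writes \<open>Y\<^sup>p v0\<close>, up to \<open>F (p + 1)\<close>, as \<open>Z\<close> applied to an element of
  \<open>F 3\<close>. Comparing \<open>h\<close>-eigenvalues, only powers of \<open>Z\<close> applied to \<open>v1\<close> can contribute to the right
  hand side, contradicting the independence of \<open>Y\<^sup>p v0\<close> and \<open>Z\<^sup>p v1\<close>.\<close>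

lemma contradiction: False
proof -
  obtain x0 c0 where x0: "x0 - v0 \<in> F 1" "h x0 = s c0 x0" "c0 ^ N = 1" using eigenvector_0 by blast
  obtain x1 c1 where x1: "x1 - v1 \<in> F 1" "h x1 = s c1 x1" "c1 ^ N = 1" using eigenvector_1 by blast
  define A where "A i = (Y ^^ i) x0" for i
  define B where "B i = (Z ^^ i) x1" for i
  note A0 = v0_cong[OF x0(1)] and B0 = v1_cong[OF x1(1)]
  have AF: "A i \<in> F i" for i using Yi_F[OF A0(1), of i] by (simp add: A_def)
  have BF: "B i \<in> F i" for i using Zi_F[OF B0(1), of i] by (simp add: B_def)
  have ZA: "Z (A i) \<in> F (i + 2)" and YB: "Y (B i) \<in> F (i + 2)" for i
    using A0(2) B0(2) by (simp_all add: A_def B_def)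
  have YA: "Y (A i) = A (Suc i)" and ZB: "Z (B i) = B (Suc i)" for i by (simp_all add: A_def B_def)
  have free': "c = 0 \<and> d = 0" if "n \<le> p" "s c (A n) + s d (B n) \<in> F (Suc n)" for n c d
  proof (rule free[OF that(1)])
    have "s c (A n - (Y ^^ n) v0) + s d (B n - (Z ^^ n) v1) \<in> F (Suc n)"
      unfolding A_def B_def using A0(5) B0(4) by (intro F_add F_scale)
    from F_diff[OF that(2) this] show "s c ((Y ^^ n) v0) + s d ((Z ^^ n) v1) \<in> F (Suc n)"
      by (simp add: scale_right_diff_distrib add.commute)
  qed
  have hA: "h (A i) = s (c0 * a ^ i) (A i)" for i
    by (induction i) (simp_all add: A_def x0 hY Y_scale mult_ac)
  have hB: "h (B i) = s (c1 * inverse a ^ i) (B i)" for i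
    by (induction i) (simp_all add: B_def x1 hZ Z_scale mult_ac)
  have aiN: "(a ^ i) ^ N = 1" "(inverse a ^ i) ^ N = 1" for i
    using a_N by (metis power_commutes power_mult power_one mult.commute)
      (metis a_N inverse_1 power_inverse power_mult power_one mult.commute)
  \<comment> \<open>The mixed terms \<open>Y (B n)\<close> and \<open>Z (A n)\<close> fall into
    \<open>F (n + 2)\<close>, so each graded piece is spanned by one power of \<open>Y\<close> on
    \<open>x0\<close> and one power of \<open>Z\<close> on \<open>x1\<close>.\<close>
  have span: "\<exists>c d. x - (s c (A n) + s d (B n)) \<in> F (Suc n)" if "x \<in> F n" for x n
    using that
  proof (induction n arbitrary: x)
    case 0
    obtain c d where cd: "x - (s c v0 + s d v1) \<in> F 1" using span0[OF 0] by blast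
    have "s c (x0 - v0) + s d (x1 - v1) \<in> F 1" using x0 x1 by (intro F_add F_scale)
    from F_diff[OF cd this] show ?case
      by (intro exI[of _ c] exI[of _ d]) (simp add: A_def B_def scale_right_diff_distrib algebra_simps)
  next
    case (Suc n)
    obtain y z where yz: "y \<in> F n" "z \<in> F n" "x - (Y y + Z z) \<in> F (n + 2)" using spanS[OF Suc.prems] by blast
    obtain c d where cd: "y - (s c (A n) + s d (B n)) \<in> F (Suc n)" using Suc.IH[OF yz(1)] by blast
    obtain c' d' where cd': "z - (s c' (A n) + s d' (B n)) \<in> F (Suc n)" using Suc.IH[OF yz(2)] by blast
    have "Y (y - (s c (A n) + s d (B n))) + Z (z - (s c' (A n) + s d' (B n))) \<in> F (n + 2)"
      using Y_F[OF cd] Z_F[OF cd'] by (intro F_add) simp_all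
    from F_add[OF yz(3) this]
    have "x - (s c (A (Suc n)) + s d (Y (B n)) + (s c' (Z (A n)) + s d' (B (Suc n)))) \<in> F (n + 2)"
      by (simp add: Y_facts Z_facts Y_add Z_add Y_scale Z_scale YA ZB algebra_simps)
    moreover have "s d (Y (B n)) + s c' (Z (A n)) \<in> F (n + 2)" using YB ZA by (intro F_add F_scale)
    ultimately have "x - (s c (A (Suc n)) + s d (Y (B n)) + (s c' (Z (A n)) + s d' (B (Suc n))))
        + (s d (Y (B n)) + s c' (Z (A n))) \<in> F (n + 2)" by (rule F_add)
    then have "x - (s c (A (Suc n)) + s d' (B (Suc n))) \<in> F (Suc (Suc n))" by (simp add: algebra_simps)
    then show ?case by blast
  qed
  have expand: "\<exists>\<alpha> \<beta>. x - (\<Sum>i=m..<m + k. s (\<alpha> i) (A i) + s (\<beta> i) (B i)) \<in> F (m + k)"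
    if "x \<in> F m" for x m k
  proof (induction k)
    case (Suc k)
    then obtain \<alpha> \<beta> where ab: "x - (\<Sum>i=m..<m + k. s (\<alpha> i) (A i) + s (\<beta> i) (B i)) \<in> F (m + k)" by blast
    obtain c d where cd: "x - (\<Sum>i=m..<m + k. s (\<alpha> i) (A i) + s (\<beta> i) (B i)) - (s c (A (m + k)) + s d (B (m + k))) \<in> F (Suc (m + k))"
      using span[OF ab] by blast
    have "(\<Sum>i=m..<m + Suc k. s ((\<alpha>(m + k := c)) i) (A i) + s ((\<beta>(m + k := d)) i) (B i)) =
        (\<Sum>i=m..<m + k. s (\<alpha> i) (A i) + s (\<beta> i) (B i)) + (s c (A (m + k)) + s d (B (m + k)))"
      by simp
    then show ?case using cd
      by (intro exI[of _ "\<alpha>(m + k := c)"] exI[of _ "\<beta>(m + k := d)"]) (simp only: add_Suc_right diff_diff_eq)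
  qed (use that in simp)
  have PA: "P c (A i) = (if c = c0 * a ^ i then A i else 0)" if "c ^ N = 1" for c i
    using P_eigen[OF hA _ that, of i] x0(3) aiN(1) by (simp add: power_mult_distrib)
  have PB: "\<exists>\<epsilon>. P c (B i) = s \<epsilon> (B i)" if "c ^ N = 1" for c i
  proof -
    have "P c (B i) = (if c = c1 * inverse a ^ i then B i else 0)"
      using P_eigen[OF hB _ that, of i] x1(3) aiN(2) by (simp add: power_mult_distrib)
    then have "P c (B i) = s (if c = c1 * inverse a ^ i then 1 else 0) (B i)" by simp
    then show ?thesis by blast
  qed
  have ainj: "a ^ i = 1 \<Longrightarrow> i \<le> p \<Longrightarrow> i = 0" for i using a_order(2)[of i] by blast
  have ai: "inverse a = a ^ p" using a_order(1) by (simp add: inverse_unique mult.commute)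
  have ca: "c0 * inverse a \<noteq> 0" "(c0 * inverse a) ^ N = 1"
    using x0(3) a_N a_nonzero N_pos by (auto simp: power_mult_distrib power_inverse power_0_left)
  \<comment> \<open>The eigenvalues \<open>c0 * a ^ i\<close> with \<open>3 \<le> i \<le> p\<close>
    all differ from \<open>c0\<close> because \<open>a\<close> has order \<open>p + 1\<close>. So
    the projection of an element of \<open>F 3\<close> involves only the \<open>B i\<close>, up to
    \<open>F (p + 1)\<close>.\<close>
  have weight0: "\<exists>\<beta>. P c0 x - (\<Sum>i=3..p. s (\<beta> i) (B i)) \<in> F (p + 1)" if x: "x \<in> F 3" for x
  proof (cases "p = 2")
    case True
    then show ?thesis using P_F[OF x] by (simp add: numeral_3_eq_3)
  next
    case False
    then have pk: "3 + (p + 1 - 3) = p + 1" using p2 by simp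
    obtain \<alpha> \<beta> where ab: "x - (\<Sum>i=3..<3 + (p + 1 - 3). s (\<alpha> i) (A i) + s (\<beta> i) (B i)) \<in> F (3 + (p + 1 - 3))"
      using expand[OF x] by blast
    have iv: "{3..<p + 1} = {3..p}" by auto
    have ab: "x - (\<Sum>i=3..p. s (\<alpha> i) (A i) + s (\<beta> i) (B i)) \<in> F (p + 1)"
      using ab by (simp only: pk iv)
    obtain \<epsilon> where e: "\<And>i. P c0 (B i) = s (\<epsilon> i) (B i)" using PB[OF x0(3)] by metis
    have PA0: "P c0 (A i) = 0" if "i \<in> {3..p}" for i
      using PA[OF x0(3), of i] ainj[of i] that x0(3) N_pos by (auto simp: power_0_left)
    have "P c0 x - (\<Sum>i=3..p. s (\<beta> i * \<epsilon> i) (B i)) \<in> F (p + 1)"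
      using P_F[OF ab, of c0] by (simp add: P_facts P_add P_scale e PA0)
    then show ?thesis by (intro exI[of _ "\<lambda>i. \<beta> i * \<epsilon> i"])
  qed
  have "Z x0 \<in> F 2" using ZA[of 0] by (simp add: A_def numeral_2_eq_2)
  moreover have pk: "2 + (p + 1 - 2) = p + 1" "{2..<p + 1} = {2..p}" using p2 by auto
  ultimately obtain \<alpha> \<beta> where ab: "Z x0 - (\<Sum>i=2..p. s (\<alpha> i) (A i) + s (\<beta> i) (B i)) \<in> F (p + 1)"
    using expand[of "Z x0" 2 "p + 1 - 2"] by (metis (no_types, lifting))
  obtain \<epsilon> where e: "\<And>i. P (c0 * inverse a) (B i) = s (\<epsilon> i) (B i)" using PB[OF ca(2)] by metis
  have caa: "c0 * inverse a * a = c0" using a_nonzero by simp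
  have "P (c0 * inverse a) (Z x0) = Z (P c0 x0)" unfolding P_Z[OF ca(1)] caa ..
  also have "P c0 x0 = x0" using P_eigen[OF x0(2,3,3)] by simp
  finally have PZ: "P (c0 * inverse a) (Z x0) = Z x0" .
  \<comment> \<open>\<open>Z x0\<close> has eigenvalue \<open>c0 * inverse a = c0 * a ^ p\<close>.
    Among the \<open>A i\<close> with \<open>2 \<le> i \<le> p\<close> only \<open>A p\<close>
    shares it, so \<open>A p\<close> has to be carried along.\<close>
  have PAp: "P (c0 * inverse a) (A i) = (if i = p then A p else 0)" if "i \<in> {2..p}" for i
  proof (cases "i = p")
    case False
    have c00: "c0 \<noteq> 0" using ca by auto
    have "c0 * inverse a \<noteq> c0 * a ^ i"
    proof
      assume "c0 * inverse a = c0 * a ^ i"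
      then have "inverse a = a ^ i" using c00 by simp
      then have "a ^ Suc i = 1" using a_nonzero by (metis power_Suc right_inverse)
      then show False using ainj[of "Suc i"] that False by simp
    qed
    then show ?thesis using PA[OF ca(2), of i] False by simp
  qed (use PA[OF ca(2), of p] ai in simp)
  define x where "x = (\<Sum>i=2..p. s (\<beta> i * \<epsilon> i) (B i))"
  have "(\<Sum>i=2..p. P (c0 * inverse a) (s (\<alpha> i) (A i) + s (\<beta> i) (B i))) = s (\<alpha> p) (A p) + x"
  proof -
    have "(\<Sum>i=2..p. P (c0 * inverse a) (s (\<alpha> i) (A i) + s (\<beta> i) (B i))) =
        (\<Sum>i=2..p. (if i = p then s (\<alpha> p) (A p) else 0) + s (\<beta> i * \<epsilon> i) (B i))"
      by (intro sum.cong) (auto simp: P_add P_scale e PAp)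
    then show ?thesis using p2 by (simp add: sum.distrib x_def)
  qed
  then have Zx0: "Z x0 - (s (\<alpha> p) (A p) + x) \<in> F (p + 1)"
    using P_F[OF ab, of "c0 * inverse a"] by (simp only: P_facts PZ)
  \<comment> \<open>Moving \<open>T\<close> past \<open>i\<close> factors \<open>Z\<close> costs
    \<open>i\<close> commutators, each of which raises degrees by \<open>p\<close> in place of one
    factor \<open>Z\<close>. For \<open>i \<ge> 2\<close> the error lies in
    \<open>F (p + 1)\<close>, the precision needed.\<close>
  have TB: "T (B i) - (Z ^^ i) (T x1) \<in> F (i + p - 1)" if "i \<ge> 1" for i
    using that
  proof (induction i rule: dec_induct)
    case base
    show ?case using TZ[OF B0(1)] by (simp add: B_def)
  next
    case (step n)
    have "Z (T (B n) - (Z ^^ n) (T x1)) \<in> F (Suc n + p - 1)" using Z_F[OF step.IH] step.hyps by simp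
    moreover have "T (Z (B n)) - Z (T (B n)) \<in> F (Suc n + p - 1)" using TZ[OF BF[of n]] by simp
    ultimately show ?case using F_add by (fastforce simp: Z_facts ZB)
  qed
  define y where "y = (\<Sum>i=2..p. s (\<beta> i * \<epsilon> i) ((Z ^^ (i - 1)) (T x1)))"
  have "T x - Z y \<in> F (p + 1)"
  proof -
    have "T x - Z y = (\<Sum>i=2..p. s (\<beta> i * \<epsilon> i) (T (B i) - (Z ^^ i) (T x1)))"
    proof -
      have "Z y = (\<Sum>i=2..p. s (\<beta> i * \<epsilon> i) ((Z ^^ i) (T x1)))"
      proof -
        have "Z ((Z ^^ (i - 1)) u) = (Z ^^ i) u" if "i \<in> {2..p}" for i u
          using that by (cases i) simp_all
        then show ?thesis unfolding y_def Z_facts Z_scale by (intro sum.cong) simp_all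
      qed
      then show ?thesis
        by (simp only: x_def T_facts T_scale scale_right_diff_distrib sum_subtractf)
    qed
    also have "\<dots> \<in> F (p + 1)"
    proof (intro F_sum F_scale)
      fix i assume "i \<in> {2..p}"
      then have "1 \<le> i" "p + 1 \<le> i + p - 1" by auto
      then show "T (B i) - (Z ^^ i) (T x1) \<in> F (p + 1)" by (rule F_le[OF TB])
    qed
    finally show ?thesis .
  qed
  moreover have "T (Z x0 - (s (\<alpha> p) (A p) + x)) \<in> F (p + 1)" "T (A p) \<in> F (p + 1)"
    using F_le[OF T_F[OF Zx0]] F_le[OF T_F[OF AF[of p]]] by simp_all
  ultimately have "(T x - Z y) + (T (Z x0 - (s (\<alpha> p) (A p) + x)) + s (\<alpha> p) (T (A p))) \<in> F (p + 1)"
    by (intro F_add F_scale)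
  then have TZx0: "T (Z x0) - Z y \<in> F (p + 1)"
    by (simp add: T_facts T_add T_scale algebra_simps)
  \<comment> \<open>Everything is collected under one \<open>Z\<close>: the commutator relation
    becomes \<open>\<delta> Y\<^sup>p x0 = Z u\<close> modulo \<open>F (p + 1)\<close>, with
    \<open>u\<close> in \<open>F 3\<close>.\<close>
  define u where "u = y - T x0"
  have uF: "u \<in> F 3"
  proof -
    have "y \<in> F 3" unfolding y_def using F_le[OF Zi_F[OF B0(3)]] by (intro F_sum F_scale) simp
    then show ?thesis unfolding u_def using A0(3) by (rule F_diff)
  qed
  have Zu: "s \<delta> (A p) - Z u \<in> F (p + 1)"
  proof -
    have "(T (Z x0) - Z y) - (T (Z x0) - Z (T x0) - s \<delta> (A p)) \<in> F (p + 1)"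
      using TZx0 A0(4) unfolding A_def by (rule F_diff)
    then show ?thesis by (simp add: u_def Z_facts algebra_simps)
  qed
  have "P (c0 * inverse a) (s \<delta> (A p) - Z u) = s \<delta> (A p) - Z (P c0 u)"
    using PAp[of p] p2 by (simp add: P_facts P_scale P_Z[OF ca(1)] caa)
  then have Zu': "s \<delta> (A p) - Z (P c0 u) \<in> F (p + 1)" using P_F[OF Zu, of "c0 * inverse a"] by simp
  obtain \<beta>' where b': "P c0 u - (\<Sum>i=3..p. s (\<beta>' i) (B i)) \<in> F (p + 1)" using weight0[OF uF] by blast
  have "Z (P c0 u - (\<Sum>i=3..p. s (\<beta>' i) (B i))) \<in> F (p + 1)" using F_le[OF Z_F[OF b']] by simp
  from F_add[OF Zu' this]
  have fin: "s \<delta> (A p) - (\<Sum>i=3..p. s (\<beta>' i) (B (Suc i))) \<in> F (p + 1)"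
    by (simp add: Z_facts Z_scale ZB)
  \<comment> \<open>Freeness removes the coefficients of the \<open>B (Suc i)\<close> one degree at
    a time, from the lowest upwards. Once the remaining sum lies in \<open>F (p + 1)\<close>,
    freeness in degree \<open>p\<close> gives \<open>\<delta>' = 0\<close>.\<close>
  have key: "\<delta>' = 0" if "s \<delta>' (A p) - (\<Sum>i=m..p. s (\<beta>' i) (B (Suc i))) \<in> F (p + 1)" for \<delta>' m \<beta>'
    using that
  proof (induction "p - m" arbitrary: m)
    case 0
    have "(\<Sum>i=m..p. s (\<beta>' i) (B (Suc i))) \<in> F (p + 1)"
      using 0 by (intro F_sum F_scale F_le[OF BF]) simp
    from F_add[OF 0(2) this] have "s \<delta>' (A p) + s 0 (B p) \<in> F (Suc p)" by simp
    then show ?case using free'[of p \<delta>' 0] by simp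
  next
    case (Suc k)
    then have m: "m < p" by simp
    have split: "(\<Sum>i=m..p. s (\<beta>' i) (B (Suc i))) = s (\<beta>' m) (B (Suc m)) + (\<Sum>i=Suc m..p. s (\<beta>' i) (B (Suc i)))"
      using m by (simp add: sum.atLeast_Suc_atMost)
    have tail: "(\<Sum>i=Suc m..p. s (\<beta>' i) (B (Suc i))) \<in> F (Suc (Suc m))"
      by (intro F_sum F_scale F_le[OF BF]) simp
    have "s \<delta>' (A p) - s (\<beta>' m) (B (Suc m)) \<in> F (Suc (Suc m))"
      using F_add[OF F_le[OF Suc.prems, of "Suc (Suc m)"] tail] m unfolding split by (simp add: algebra_simps)
    then have bm: "s (if Suc m = p then \<delta>' else 0) (A (Suc m)) + s (- \<beta>' m) (B (Suc m)) \<in> F (Suc (Suc m))"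
    proof (cases "Suc m = p")
      case False
      then have "A p \<in> F (Suc (Suc m))" using F_le[OF AF[of p]] m by simp
      then show ?thesis
        using False F_diff[OF \<open>s \<delta>' (A p) - s (\<beta>' m) (B (Suc m)) \<in> F (Suc (Suc m))\<close> F_scale[of "A p" _ \<delta>']] by simp
    qed simp
    have "\<beta>' m = 0" using free'[OF _ bm] m by simp
    then have "s \<delta>' (A p) - (\<Sum>i=Suc m..p. s (\<beta>' i) (B (Suc i))) \<in> F (p + 1)"
      using Suc.prems split by simp
    then show ?case using Suc.hyps(1)[of "Suc m"] Suc.hyps(2) by simp
  qed
  show False using key[OF fin] delta by simp
qed

end

section \<open>Associated graded rings and modules\<close>

text \<open>One setting for two products, multiplication in \<open>gr_ring\<close> and the action on
  \<open>gr_module\<close>. Both are defined by convolving chosen representatives of cosets.\<close>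

locale filtered_pairing = R: abelian_group R + M: abelian_group M
  for R :: "('a, 'r) ring_scheme" (structure) and M :: "('m, 's) ring_scheme" (structure) +
  fixes op :: "'a \<Rightarrow> 'm \<Rightarrow> 'm" and A :: "nat \<Rightarrow> 'a set" and G :: "nat \<Rightarrow> 'm set"
  assumes A_sub: "additive_subgroup (A n) R" and G_sub: "additive_subgroup (G n) M"
    and A_Suc: "A (Suc n) \<subseteq> A n" and G_Suc: "G (Suc n) \<subseteq> G n"
    and op_closed: "a \<in> carrier R \<Longrightarrow> x \<in> carrier M \<Longrightarrow> op a x \<in> carrier M"
    and op_add_left: "a \<in> carrier R \<Longrightarrow> b \<in> carrier R \<Longrightarrow> x \<in> carrier M \<Longrightarrow>
      op (a \<oplus>\<^bsub>R\<^esub> b) x = op a x \<oplus>\<^bsub>M\<^esub> op b x"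
    and op_add_right: "a \<in> carrier R \<Longrightarrow> x \<in> carrier M \<Longrightarrow> y \<in> carrier M \<Longrightarrow>
      op a (x \<oplus>\<^bsub>M\<^esub> y) = op a x \<oplus>\<^bsub>M\<^esub> op a y"
    and op_filtered: "a \<in> A m \<Longrightarrow> x \<in> G n \<Longrightarrow> op a x \<in> G (m + n)"
begin

lemma A_carrier: "a \<in> A n \<Longrightarrow> a \<in> carrier R"
  using additive_subgroup.a_Hcarr[OF A_sub] .

lemma G_carrier: "x \<in> G n \<Longrightarrow> x \<in> carrier M"
  using additive_subgroup.a_Hcarr[OF G_sub] .

lemma op_zero_left: "x \<in> carrier M \<Longrightarrow> op \<zero>\<^bsub>R\<^esub> x = \<zero>\<^bsub>M\<^esub>"
  using op_add_left[of "\<zero>\<^bsub>R\<^esub>" "\<zero>\<^bsub>R\<^esub>" x] op_closed[of "\<zero>\<^bsub>R\<^esub>" x]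
  by (metis M.add.r_cancel_one' R.add.one_closed R.l_zero)

lemma op_zero_right: "a \<in> carrier R \<Longrightarrow> op a \<zero>\<^bsub>M\<^esub> = \<zero>\<^bsub>M\<^esub>"
  using op_add_right[of a "\<zero>\<^bsub>M\<^esub>" "\<zero>\<^bsub>M\<^esub>"] op_closed[of a "\<zero>\<^bsub>M\<^esub>"]
  by (metis M.add.r_cancel_one' M.add.one_closed M.l_zero)

definition cong_G :: "nat \<Rightarrow> 'm \<Rightarrow> 'm \<Rightarrow> bool" where
  "cong_G n x y \<longleftrightarrow> (\<exists>d\<in>G n. x = d \<oplus>\<^bsub>M\<^esub> y)"

lemma cong_G_coset:
  assumes "cong_G n x y" "y \<in> carrier M" shows "G n +>\<^bsub>M\<^esub> x = G n +>\<^bsub>M\<^esub> y"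
proof -
  have "x \<in> G n +>\<^bsub>M\<^esub> y" using assms(1) by (auto simp: cong_G_def a_r_coset_def')
  then show ?thesis
    using M.a_repr_independence[OF _ assms(2)] additive_subgroup.a_subgroup[OF G_sub] by metis
qed

lemma op_cong:
  assumes "a \<in> A i" "x \<in> G k" "d \<in> A (Suc i)" "e \<in> G (Suc k)"
  shows "cong_G (Suc (i + k)) (op (d \<oplus>\<^bsub>R\<^esub> a) (e \<oplus>\<^bsub>M\<^esub> x)) (op a x)"
proof -
  have c: "a \<in> carrier R" "d \<in> carrier R" "x \<in> carrier M" "e \<in> carrier M"
    using assms A_carrier G_carrier by blast+
  have xe: "e \<oplus>\<^bsub>M\<^esub> x \<in> G k"
    using assms G_Suc additive_subgroup.a_closed[OF G_sub] by blast
  have 1: "op d (e \<oplus>\<^bsub>M\<^esub> x) \<in> G (Suc (i + k))" using op_filtered[OF assms(3) xe] by simp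
  have 2: "op a e \<in> G (Suc (i + k))" using op_filtered[OF assms(1,4)] by simp
  have "op (d \<oplus>\<^bsub>R\<^esub> a) (e \<oplus>\<^bsub>M\<^esub> x) = (op d (e \<oplus>\<^bsub>M\<^esub> x) \<oplus>\<^bsub>M\<^esub> op a e) \<oplus>\<^bsub>M\<^esub> op a x"
    using c by (simp add: op_add_left op_add_right op_closed M.a_ac)
  moreover have "op d (e \<oplus>\<^bsub>M\<^esub> x) \<oplus>\<^bsub>M\<^esub> op a e \<in> G (Suc (i + k))"
    using additive_subgroup.a_closed[OF G_sub 1 2] .
  ultimately show ?thesis unfolding cong_G_def by blast
qed

lemma cong_G_finsum:
  assumes "finite I" "\<And>i. i \<in> I \<Longrightarrow> cong_G n (f i) (g i)" "\<And>i. i \<in> I \<Longrightarrow> g i \<in> carrier M"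
  shows "cong_G n (finsum M f I) (finsum M g I)"
  using assms
proof (induction I rule: finite_induct)
  case empty
  have "\<zero>\<^bsub>M\<^esub> \<in> G n" using additive_subgroup.zero_closed[OF G_sub] .
  then show ?case unfolding cong_G_def by (intro bexI[of _ "\<zero>\<^bsub>M\<^esub>"]) simp_all
next
  case (insert a I)
  have fc: "f i \<in> carrier M" if "i \<in> insert a I" for i
    using insert.prems[OF that] G_carrier by (auto simp: cong_G_def)
  obtain d where d: "d \<in> G n" "f a = d \<oplus>\<^bsub>M\<^esub> g a" using insert.prems(1)[of a] by (auto simp: cong_G_def)
  have "cong_G n (finsum M f I) (finsum M g I)"
    using insert.prems by (intro insert.IH) simp_all
  then obtain e where e: "e \<in> G n" "finsum M f I = e \<oplus>\<^bsub>M\<^esub> finsum M g I" by (auto simp: cong_G_def)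
  have gI: "finsum M g I \<in> carrier M" using insert.prems by (intro M.finsum_closed) auto
  have "finsum M f (insert a I) = f a \<oplus>\<^bsub>M\<^esub> finsum M f I"
    using insert.hyps fc by (intro M.finsum_insert) auto
  also have "\<dots> = (d \<oplus>\<^bsub>M\<^esub> e) \<oplus>\<^bsub>M\<^esub> (g a \<oplus>\<^bsub>M\<^esub> finsum M g I)"
    unfolding d(2) e(2) using d(1) e(1) gI insert.prems(2)[of a] G_carrier
    by (simp add: M.a_ac)
  also have "g a \<oplus>\<^bsub>M\<^esub> finsum M g I = finsum M g (insert a I)"
    using insert.hyps insert.prems(2) by (intro M.finsum_insert[symmetric]) auto
  finally show ?case
    unfolding cong_G_def using additive_subgroup.a_closed[OF G_sub d(1) e(1)] by blast
qed

text \<open>Changing a representative by an element one step deeper in the filtration changes each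
  product by an element of \<open>G (Suc n)\<close> (\<open>op_cong\<close>), so the choices made by
  \<open>rep\<close> do not affect the coset.\<close>

lemma conv_representatives:
  assumes a: "\<And>i. a i \<in> A i" and x: "\<And>i. x i \<in> G i"
    and X: "\<And>i. X i = A (Suc i) +>\<^bsub>R\<^esub> a i" and Y: "\<And>i. Y i = G (Suc i) +>\<^bsub>M\<^esub> x i"
  shows "G (Suc n) +>\<^bsub>M\<^esub> (\<Oplus>\<^bsub>M\<^esub>i\<in>{..n}. op (rep (X i)) (rep (Y (n - i)))) =
    G (Suc n) +>\<^bsub>M\<^esub> (\<Oplus>\<^bsub>M\<^esub>i\<in>{..n}. op (a i) (x (n - i)))"
proof (rule cong_G_coset)
  have "cong_G (Suc n) (op (rep (X i)) (rep (Y (n - i)))) (op (a i) (x (n - i)))" if "i \<in> {..n}" for i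
  proof -
    have "a i \<in> X i"
      unfolding X using additive_subgroup.zero_closed[OF A_sub] R.l_zero[OF A_carrier[OF a]]
      by (auto simp: a_r_coset_def' intro!: bexI[of _ "\<zero>\<^bsub>R\<^esub>"])
    then have "rep (X i) \<in> X i" unfolding rep_def by (rule someI)
    then obtain d where d: "d \<in> A (Suc i)" "rep (X i) = d \<oplus>\<^bsub>R\<^esub> a i"
      unfolding X by (auto simp: a_r_coset_def')
    have "x (n - i) \<in> Y (n - i)"
      unfolding Y using additive_subgroup.zero_closed[OF G_sub] M.l_zero[OF G_carrier[OF x]]
      by (auto simp: a_r_coset_def' intro!: bexI[of _ "\<zero>\<^bsub>M\<^esub>"])
    then have "rep (Y (n - i)) \<in> Y (n - i)" unfolding rep_def by (rule someI)
    then obtain e where e: "e \<in> G (Suc (n - i))" "rep (Y (n - i)) = e \<oplus>\<^bsub>M\<^esub> x (n - i)"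
      unfolding Y by (auto simp: a_r_coset_def')
    show ?thesis unfolding d(2) e(2) using op_cong[OF a x d(1) e(1)] that by simp
  qed
  moreover have c: "op (a i) (x (n - i)) \<in> carrier M" for i
    using op_closed A_carrier[OF a] G_carrier[OF x] by blast
  ultimately show "cong_G (Suc n) (\<Oplus>\<^bsub>M\<^esub>i\<in>{..n}. op (rep (X i)) (rep (Y (n - i))))
      (\<Oplus>\<^bsub>M\<^esub>i\<in>{..n}. op (a i) (x (n - i)))" by (intro cong_G_finsum) simp_all
  show "(\<Oplus>\<^bsub>M\<^esub>i\<in>{..n}. op (a i) (x (n - i))) \<in> carrier M" using c by (intro M.finsum_closed) simp
qed

lemma conv_homogeneous:
  assumes a: "a \<in> A m" and x: "x \<in> G n"
  shows "G (Suc k) +>\<^bsub>M\<^esub> (\<Oplus>\<^bsub>M\<^esub>i\<in>{..k}. op (rep (A (Suc i) +>\<^bsub>R\<^esub> (if i = m then a else \<zero>\<^bsub>R\<^esub>)))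
      (rep (G (Suc (k - i)) +>\<^bsub>M\<^esub> (if k - i = n then x else \<zero>\<^bsub>M\<^esub>)))) =
    G (Suc k) +>\<^bsub>M\<^esub> (if k = m + n then op a x else \<zero>\<^bsub>M\<^esub>)"
proof -
  have c: "a \<in> carrier R" "x \<in> carrier M" using A_carrier[OF a] G_carrier[OF x] .
  have "G (Suc k) +>\<^bsub>M\<^esub> (\<Oplus>\<^bsub>M\<^esub>i\<in>{..k}. op (rep (A (Suc i) +>\<^bsub>R\<^esub> (if i = m then a else \<zero>\<^bsub>R\<^esub>)))
      (rep (G (Suc (k - i)) +>\<^bsub>M\<^esub> (if k - i = n then x else \<zero>\<^bsub>M\<^esub>)))) =
    G (Suc k) +>\<^bsub>M\<^esub> (\<Oplus>\<^bsub>M\<^esub>i\<in>{..k}. op (if i = m then a else \<zero>\<^bsub>R\<^esub>) (if k - i = n then x else \<zero>\<^bsub>M\<^esub>))"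
    by (rule conv_representatives[where X = "\<lambda>i. A (Suc i) +>\<^bsub>R\<^esub> (if i = m then a else \<zero>\<^bsub>R\<^esub>)"
          and Y = "\<lambda>i. G (Suc i) +>\<^bsub>M\<^esub> (if i = n then x else \<zero>\<^bsub>M\<^esub>)"])
      (use a x additive_subgroup.zero_closed[OF A_sub] additive_subgroup.zero_closed[OF G_sub] in auto)
  also have "(\<Oplus>\<^bsub>M\<^esub>i\<in>{..k}. op (if i = m then a else \<zero>\<^bsub>R\<^esub>) (if k - i = n then x else \<zero>\<^bsub>M\<^esub>)) =
      (\<Oplus>\<^bsub>M\<^esub>i\<in>{..k}. if m = i then (if k = m + n then op a x else \<zero>\<^bsub>M\<^esub>) else \<zero>\<^bsub>M\<^esub>)"
    using c by (intro M.finsum_cong') (auto simp: op_zero_left op_zero_right op_closed)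
  also have "\<dots> = (if k = m + n then op a x else \<zero>\<^bsub>M\<^esub>)"
  proof (cases "m \<le> k")
    case True
    then show ?thesis
      using M.add.finprod_singleton[of m "{..k}" "\<lambda>_. if k = m + n then op a x else \<zero>\<^bsub>M\<^esub>"] c
      by (auto simp: op_closed finsum_def)
  next
    case False
    then have "(\<Oplus>\<^bsub>M\<^esub>i\<in>{..k}. if m = i then (if k = m + n then op a x else \<zero>\<^bsub>M\<^esub>) else \<zero>\<^bsub>M\<^esub>) = (\<Oplus>\<^bsub>M\<^esub>i\<in>{..k}. \<zero>\<^bsub>M\<^esub>)"
      by (intro M.finsum_cong') auto
    then show ?thesis using False by simp
  qed
  finally show ?thesis .
qed

end

context ring
begin

lemma ideal_pow_ideal: "ideal I R \<Longrightarrow> ideal (ideal_pow R I n) R"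
  by (induction n) (simp_all add: oneideal ideal_prod_is_ideal)

lemma ideal_pow_additive: "ideal I R \<Longrightarrow> additive_subgroup (ideal_pow R I n) R"
  by (rule ideal.axioms(1)) (rule ideal_pow_ideal)

lemma ideal_pow_carrier: "ideal I R \<Longrightarrow> ideal_pow R I n \<subseteq> carrier R"
  using additive_subgroup.a_subset[OF ideal_pow_additive] .

lemma ideal_pow_Suc: 
  assumes "ideal I R" shows "ideal_pow R I (Suc n) \<subseteq> ideal_pow R I n"
  using ideal_prod_inter[OF assms ideal_pow_ideal[OF assms, of n]] by simp

lemma ideal_pow_mult:
  assumes I: "ideal I R" and a: "a \<in> ideal_pow R I m" and b: "b \<in> ideal_pow R I n"
  shows "a \<otimes> b \<in> ideal_pow R I (m + n)"
  using a
proof (induction m arbitrary: a)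
  case 0
  then show ?case using ideal.I_l_closed[OF ideal_pow_ideal[OF I, of n] b] by simp
next
  case (Suc m)
  have bc: "b \<in> carrier R" using ideal_pow_carrier[OF I] b by blast
  from Suc.prems have "a \<in> ideal_prod R I (ideal_pow R I m)" by simp
  then show ?case
  proof (induction rule: ideal_prod.induct)
    case (prod i j)
    have "i \<in> carrier R" "j \<in> carrier R"
      using prod ideal.Icarr[OF I] ideal_pow_carrier[OF I] by blast+
    then have "i \<otimes> j \<otimes> b = i \<otimes> (j \<otimes> b)" using bc by (simp add: m_assoc)
    then show ?case using ideal_prod.prod[OF prod(1) Suc.IH[OF prod(2)], of R] by simp
  next
    case (sum s t)
    have "s \<in> carrier R" "t \<in> carrier R"
      using sum(1,2) ideal_prod_in_carrier[OF I ideal_pow_ideal[OF I]] by blast+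
    then have "(s \<oplus> t) \<otimes> b = s \<otimes> b \<oplus> t \<otimes> b" using bc by (simp add: l_distr)
    then show ?case
      using additive_subgroup.a_closed[OF ideal_pow_additive[OF I] sum(3,4)] by simp
  qed
qed

lemma ring_filtered_pairing:
  "ideal I R \<Longrightarrow> filtered_pairing R R (\<otimes>) (ideal_pow R I) (ideal_pow R I)"
  by (intro filtered_pairing.intro filtered_pairing_axioms.intro is_abelian_group)
    (simp_all add: ideal_pow_additive l_distr r_distr ideal_pow_mult ideal_pow_Suc del: ideal_pow.simps)

text \<open>The axioms are transported rather than checked on cosets. Polynomials whose
  \<open>n\<close>-th coefficient lies in the \<open>n\<close>-th power of \<open>I\<close> (the
  Rees algebra) form a subring of the polynomial ring, and \<open>gr_ring\<close> is its image under
  coefficientwise reduction, a homomorphism by \<open>conv_representatives\<close>.\<close>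

lemma gr_ring_is_ring:
  assumes I: "ideal I R" shows "ring (gr_ring R I)"
proof -
  interpret fp: filtered_pairing R R "(\<otimes>)" "ideal_pow R I" "ideal_pow R I"
    by (rule ring_filtered_pairing[OF I])
  interpret UP: UP_ring R "UP R" by unfold_locales simp
  let ?F = "ideal_pow R I"
  define S where "S = {a \<in> up R. \<forall>n. a n \<in> ?F n}"
  have S_up: "S \<subseteq> carrier (UP R)" by (auto simp: S_def UP_def)
  have plus: "(a \<oplus>\<^bsub>UP R\<^esub> b) = (\<lambda>n. a n \<oplus> b n)" if "a \<in> S" "b \<in> S" for a b
    using that by (simp add: S_def UP_def)
  have times: "(a \<otimes>\<^bsub>UP R\<^esub> b) = (\<lambda>n. \<Oplus>i\<in>{..n}. a i \<otimes> b (n - i))" if "a \<in> S" "b \<in> S" for a b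
    using that by (simp add: S_def UP_def)
  have Fsum: "(\<Oplus>i\<in>J. f i) \<in> ?F n" if "finite J" "\<And>i. i \<in> J \<Longrightarrow> f i \<in> ?F n" for f n and J :: "nat set"
    using that
  proof (induction J rule: finite_induct)
    case empty
    then show ?case using additive_subgroup.zero_closed[OF fp.A_sub] by simp
  next
    case (insert i J)
    have "(\<Oplus>i\<in>insert i J. f i) = f i \<oplus> (\<Oplus>i\<in>J. f i)"
      using insert fp.A_carrier by (intro finsum_insert) auto
    then show ?case using insert additive_subgroup.a_closed[OF fp.A_sub] by simp
  qed
  have sub: "subring S (UP R)"
  proof (rule ring.subringI[OF UP.UP_ring])
    show "S \<subseteq> carrier (UP R)" by (fact S_up)
    show "\<one>\<^bsub>UP R\<^esub> \<in> S"
      using UP.UP_one_closed additive_subgroup.zero_closed[OF fp.A_sub]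
      by (auto simp: S_def UP_def)
  next
    fix a assume a: "a \<in> S"
    have "\<ominus>\<^bsub>UP R\<^esub> a = (\<lambda>n. \<ominus> (a n))"
    proof -
      have m1: "(\<lambda>n. \<ominus> (a n)) \<in> carrier (UP R)" using a by (simp add: S_def UP_def up_a_inv_closed)
      have m2: "(\<lambda>n. \<ominus> (a n)) \<oplus>\<^bsub>UP R\<^esub> a = \<zero>\<^bsub>UP R\<^esub>"
        using a mem_upD[of a R] by (auto simp: S_def UP_def up_a_inv_closed l_neg)
      show ?thesis
        by (rule abelian_group.minus_equality[OF ring.is_abelian_group[OF UP.UP_ring] m2 subsetD[OF S_up a] m1])
    qed
    then show "\<ominus>\<^bsub>UP R\<^esub> a \<in> S"
      using a additive_subgroup.a_inv_closed[OF fp.A_sub] by (simp add: S_def up_a_inv_closed)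
  next
    fix a b assume ab: "a \<in> S" "b \<in> S"
    have up: "a \<otimes>\<^bsub>UP R\<^esub> b \<in> up R" "a \<oplus>\<^bsub>UP R\<^esub> b \<in> up R"
      using UP.UP_mult_closed[of a b] UP.UP_a_closed[of a b] ab S_up by (auto simp: UP_def)
    have FF: "a i \<otimes> b (n - i) \<in> ?F n" if "i \<in> {..n}" for i n
      using fp.op_filtered[of "a i" i "b (n - i)" "n - i"] ab that by (simp add: S_def)
    have "\<forall>n. (\<Oplus>i\<in>{..n}. a i \<otimes> b (n - i)) \<in> ?F n"
    proof
      fix n show "(\<Oplus>i\<in>{..n}. a i \<otimes> b (n - i)) \<in> ?F n" by (rule Fsum[OF finite_atMost FF])
    qed
    then show "a \<otimes>\<^bsub>UP R\<^esub> b \<in> S" using up(1) unfolding S_def times[OF ab] by simp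
    show "a \<oplus>\<^bsub>UP R\<^esub> b \<in> S"
      using up(2) ab additive_subgroup.a_closed[OF fp.A_sub] unfolding S_def plus[OF ab] by simp
  qed
  interpret S: ring "UP R\<lparr>carrier := S\<rparr>" by (rule ring.subring_is_ring[OF UP.UP_ring sub])
  define h where "h a = (\<lambda>n. ?F (Suc n) +> a n)" for a :: "nat \<Rightarrow> 'a"
  have zero_coset: "?F n +> \<zero> = ?F n" for n
    using a_coset_add_zero[OF ideal_pow_carrier[OF I]] .
  have h_car: "h ` S = gr_carrier R ?F"
  proof
    show "h ` S \<subseteq> gr_carrier R ?F"
    proof
      fix x assume "x \<in> h ` S"
      then obtain a where a: "a \<in> S" "x = h a" by blast
      obtain N where N: "bound \<zero> N a" using a(1) unfolding S_def by auto
      have "{n. x n \<noteq> ?F (Suc n)} \<subseteq> {..N}"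
      proof (rule subsetI, rule ccontr)
        fix n assume "n \<in> {n. x n \<noteq> ?F (Suc n)}" "n \<notin> {..N}"
        then show False using bound.bound[OF N, of n] a(2) zero_coset[of "Suc n"] by (simp add: h_def del: ideal_pow.simps)
      qed
      then have "finite {n. x n \<noteq> ?F (Suc n)}" using finite_subset by blast
      then show "x \<in> gr_carrier R ?F" using a by (auto simp: gr_carrier_def h_def S_def simp del: ideal_pow.simps)
    qed
    show "gr_carrier R ?F \<subseteq> h ` S"
    proof
      fix x assume x: "x \<in> gr_carrier R ?F"
      then have fin: "finite {n. x n \<noteq> ?F (Suc n)}" by (simp add: gr_carrier_def del: ideal_pow.simps)
      obtain b where b: "\<And>n. b n \<in> ?F n" "\<And>n. x n = ?F (Suc n) +> b n"
        using x unfolding gr_carrier_def by (auto simp del: ideal_pow.simps) metis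
      \<comment> \<open>Choosing the representative zero for every trivial coset makes the lifted
        sequence finitely supported, so that it is a polynomial.\<close>
      define a where "a n = (if x n = ?F (Suc n) then \<zero> else b n)" for n
      have aF: "a n \<in> ?F n" for n using b additive_subgroup.zero_closed[OF fp.A_sub] by (simp add: a_def del: ideal_pow.simps)
      obtain N where N: "{n. x n \<noteq> ?F (Suc n)} \<subseteq> {..N}"
        using fin finite_nat_iff_bounded_le by metis
      have "bound \<zero> N a"
      proof
        fix n assume "N < n"
        then have "x n = ?F (Suc n)" using N by (force simp del: ideal_pow.simps)
        then show "a n = \<zero>" by (simp add: a_def del: ideal_pow.simps)
      qed
      then have "a \<in> S" using aF fp.A_carrier[OF aF] by (auto simp: S_def)
      moreover have "h a = x"
      proof
        fix n
        show "h a n = x n"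
        proof (cases "x n = ?F (Suc n)")
          case True
          then show ?thesis unfolding h_def a_def using zero_coset[of "Suc n"] by presburger
        next
          case False
          then show ?thesis unfolding h_def a_def using b(2)[of n] by presburger
        qed
      qed
      ultimately show "x \<in> h ` S" by blast
    qed
  qed
  have "h \<in> ring_hom (UP R\<lparr>carrier := S\<rparr>) (gr_ring R I)"
  proof (rule ring_hom_memI)
    fix a assume "a \<in> carrier (UP R\<lparr>carrier := S\<rparr>)"
    then show "h a \<in> carrier (gr_ring R I)" using h_car by (auto simp: gr_ring_def)
  next
    fix a b assume "a \<in> carrier (UP R\<lparr>carrier := S\<rparr>)" "b \<in> carrier (UP R\<lparr>carrier := S\<rparr>)"
    then have ab: "a \<in> S" "b \<in> S" by simp_all
    then have F: "a n \<in> ?F n" "b n \<in> ?F n" for n by (simp_all add: S_def)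
    have "h (a \<otimes>\<^bsub>UP R\<^esub> b) = h a \<otimes>\<^bsub>gr_ring R I\<^esub> h b"
      unfolding times[OF ab] gr_ring_def monoid.simps ring.simps
      by (rule ext) (simp only: h_def, rule fp.conv_representatives[symmetric], simp_all add: F del: ideal_pow.simps)
    then show "h (a \<otimes>\<^bsub>UP R\<lparr>carrier := S\<rparr>\<^esub> b) = h a \<otimes>\<^bsub>gr_ring R I\<^esub> h b" by simp
    have "h (a \<oplus>\<^bsub>UP R\<^esub> b) = h a \<oplus>\<^bsub>gr_ring R I\<^esub> h b"
      unfolding plus[OF ab] gr_ring_def monoid.simps ring.simps
    proof
      fix n
      have "abelian_subgroup (?F (Suc n)) R"
        by (rule abelian_subgroupI3[OF fp.A_sub]) (rule is_abelian_group)
      from abelian_subgroup.a_rcos_sum[OF this fp.A_carrier[OF F(1)] fp.A_carrier[OF F(2)]]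
      show "h (\<lambda>n. a n \<oplus> b n) n = h a n <+> h b n" unfolding h_def by simp
    qed
    then show "h (a \<oplus>\<^bsub>UP R\<lparr>carrier := S\<rparr>\<^esub> b) = h a \<oplus>\<^bsub>gr_ring R I\<^esub> h b" by simp
  next
    show "h \<one>\<^bsub>UP R\<lparr>carrier := S\<rparr>\<^esub> = \<one>\<^bsub>gr_ring R I\<^esub>"
      by (simp add: h_def gr_ring_def UP_def del: ideal_pow.simps)
  qed
  from S.ring_hom_imp_img_ring[OF this]
  have r: "ring (gr_ring R I\<lparr>carrier := h ` S, zero := h \<zero>\<^bsub>UP R\<^esub>\<rparr>)" by simp
  have "h \<zero>\<^bsub>UP R\<^esub> = \<zero>\<^bsub>gr_ring R I\<^esub>"
    by (simp add: h_def gr_ring_def UP_def zero_coset del: ideal_pow.simps)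
  then have "gr_ring R I\<lparr>carrier := h ` S, zero := h \<zero>\<^bsub>UP R\<^esub>\<rparr> = gr_ring R I"
    by (simp add: h_car) (simp add: gr_ring_def)
  with r show ?thesis by simp
qed

lemma gr_class_closed:
  assumes I: "ideal I R" and a: "a \<in> ideal_pow R I n"
  shows "gr_class R I n a \<in> gr_piece R (ideal_pow R I) n" "gr_class R I n a \<in> carrier (gr_ring R I)"
proof -
  interpret fp: filtered_pairing R R "(\<otimes>)" "ideal_pow R I" "ideal_pow R I"
    by (rule ring_filtered_pairing[OF I])
  have z: "ideal_pow R I (Suc k) +> \<zero> = ideal_pow R I (Suc k)" for k
    using a_coset_add_zero[OF ideal_pow_carrier[OF I]] .
  have "{k. gr_class R I n a k \<noteq> ideal_pow R I (Suc k)} \<subseteq> {n}"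
    using z by (auto simp: gr_class_def simp del: ideal_pow.simps)
  then have fin: "finite {k. gr_class R I n a k \<noteq> ideal_pow R I (Suc k)}"
    using finite_subset by blast
  have "\<exists>b\<in>ideal_pow R I k. gr_class R I n a k = ideal_pow R I (Suc k) +> b" for k
    using a additive_subgroup.zero_closed[OF fp.A_sub, of k] unfolding gr_class_def by (cases "k = n") auto
  then have c: "gr_class R I n a \<in> gr_carrier R (ideal_pow R I)"
    using fin by (simp add: gr_carrier_def del: ideal_pow.simps)
  then show "gr_class R I n a \<in> carrier (gr_ring R I)" by (simp add: gr_ring_def)
  show "gr_class R I n a \<in> gr_piece R (ideal_pow R I) n"
    using c z by (simp add: gr_piece_def gr_class_def del: ideal_pow.simps)
qed

lemma gr_class_mult:
  assumes I: "ideal I R" and a: "a \<in> ideal_pow R I m" and b: "b \<in> ideal_pow R I n"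
  shows "gr_class R I m a \<otimes>\<^bsub>gr_ring R I\<^esub> gr_class R I n b = gr_class R I (m + n) (a \<otimes> b)"
proof -
  interpret fp: filtered_pairing R R "(\<otimes>)" "ideal_pow R I" "ideal_pow R I"
    by (rule ring_filtered_pairing[OF I])
  show ?thesis
    unfolding gr_ring_def gr_class_def monoid.simps ring.simps
    by (rule ext) (rule fp.conv_homogeneous[OF a b])
qed

end

section \<open>The Iwasawa algebra as an algebra of functionals\<close>

lemma nscale_fun: "nscale n (\<phi> :: 'a \<Rightarrow> 'f::field) x = of_nat n * \<phi> x"
  by (induction n) (simp_all add: algebra_simps)

context quaternion_setup_ge5
begin

lemma nscale_p_fun [simp]: "nscale p (\<phi> :: 'a \<Rightarrow> 'f) = 0"
proof
  fix x show "nscale p \<phi> x = 0 x"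
    unfolding nscale_fun char_f[symmetric] by simp
qed

lemma UU_commute_mod:
  assumes "n \<ge> 1" "g \<in> UU n" "h \<in> UU n" obtains c where "c \<in> UU (n + 1)" "h * g = g * h * c"
proof -
  obtain x where x: "x \<in> OD" "g = 1 + w ^ n * x" using assms(2) UU_iff cgE by blast
  obtain y where y: "y \<in> OD" "h = 1 + w ^ n * y" using assms(3) UU_iff cgE by blast
  obtain x' where x': "x' \<in> OD" "x * w ^ n = w ^ n * x'" using OD_w_power_swap[OF x(1)] .
  obtain y' where y': "y' \<in> OD" "y * w ^ n = w ^ n * y'" using OD_w_power_swap[OF y(1)] .
  have a: "w ^ n * x * (w ^ n * y) = w ^ (n + n) * (x' * y)"
  proof -
    have "w ^ n * x * (w ^ n * y) = w ^ n * (x * w ^ n) * y" by (simp only: mult.assoc)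
    then show ?thesis by (simp only: x' power_add mult.assoc)
  qed
  have b: "w ^ n * y * (w ^ n * x) = w ^ (n + n) * (y' * x)"
  proof -
    have "w ^ n * y * (w ^ n * x) = w ^ n * (y * w ^ n) * x" by (simp only: mult.assoc)
    then show ?thesis by (simp only: y' power_add mult.assoc)
  qed
  have "h * g = g * h + w ^ (n + n) * (y' * x - x' * y)"
    unfolding x(2) y(2) using a b by (simp add: algebra_simps)
  then have "cg (n + n) (h * g) (g * h)" using x y x' y' by (intro cgI) (simp_all add: OD_diff OD_mult)
  then have cg: "cg (n + 1) (h * g) (g * h)" using assms(1) cg_mono by simp
  have gh: "g * h \<in> UU n" using assms UU_mult by blast
  have "inverse (g * h) * (h * g) \<in> UU (n + 1)"
    using cg_left_quotient[OF cg] UU_unit[OF assms(1) gh] by blast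
  moreover have "g * h * (inverse (g * h) * (h * g)) = h * g"
    using right_inverse[OF UU_unit(2)[OF assms(1) gh]] by (simp only: mult.assoc[symmetric]) simp
  ultimately show ?thesis using that by metis
qed

lemma UU_p_power_mem:
  assumes "n \<ge> 1" "g \<in> UU n" shows "g ^ p \<in> UU (n + 1)"
proof -
  obtain x where x: "x \<in> OD" "g = 1 + w ^ n * x" using assms(2) UU_iff cgE by blast
  have "cg (n + 1) (g ^ p) (1 + w ^ (n + 2) * x)"
    unfolding x(2) using UU_p_power[OF assms(1) x(1)] by (rule cg_mono) simp
  also have "cg (n + 1) (1 + w ^ (n + 2) * x) (1 + 0)"
    using x(1) by (intro cg_add cg_w_power) simp_all
  finally show ?thesis by (simp add: UU_iff)
qed

text \<open>The fixed point theorem for a \<open>p\<close>-group in characteristic \<open>p\<close>,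
  by descent from \<open>UU (Suc n)\<close> to \<open>UU n\<close>. Stating it for a set
  \<open>W\<close> with closure properties lets it apply to translation-stable sets of
  functions.\<close>

lemma nonzero_fixed_vector:
  fixes \<rho> :: "'d \<Rightarrow> 'v::ab_group_add \<Rightarrow> 'v"
  assumes add: "\<And>g x y. g \<in> UU 1 \<Longrightarrow> \<rho> g (x + y) = \<rho> g x + \<rho> g y"
    and mult: "\<And>g h v. g \<in> UU 1 \<Longrightarrow> h \<in> UU 1 \<Longrightarrow> v \<in> W \<Longrightarrow> \<rho> (g * h) v = \<rho> g (\<rho> h v)"
    and kill: "\<And>v. nscale p (v :: 'v) = 0"
    and stable: "\<And>g v. g \<in> UU 1 \<Longrightarrow> v \<in> W \<Longrightarrow> \<rho> g v \<in> W"
    and diff: "\<And>v u. v \<in> W \<Longrightarrow> u \<in> W \<Longrightarrow> v - u \<in> W"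
    and v: "v \<in> W" "v \<noteq> 0" "m \<ge> 1" "\<And>g. g \<in> UU m \<Longrightarrow> \<rho> g v = v"
  shows "\<exists>v\<in>W. v \<noteq> 0 \<and> (\<forall>g\<in>UU 1. \<rho> g v = v)"
proof -
  let ?P = "\<lambda>n. \<exists>v\<in>W. v \<noteq> 0 \<and> (\<forall>g\<in>UU n. \<rho> g v = v)"
  have step: "?P n" if n: "n \<ge> 1" and P: "?P (Suc n)" for n
  proof -
    have sub: "UU n \<subseteq> UU 1" "UU (Suc n) \<subseteq> UU 1" using n UU_mono by simp_all
    have ex: "\<exists>v\<in>W. v \<noteq> 0 \<and> (\<forall>g\<in>UU (Suc n). \<rho> g v = v) \<and> (\<forall>g\<in>A. \<rho> g v = v)"
      if "finite A" "A \<subseteq> UU n" for A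
      using that
    proof (induction A rule: finite_induct)
      case empty
      then show ?case using P by simp
    next
      case (insert g A)
      then obtain v where v: "v \<in> W" "v \<noteq> 0" "\<forall>g\<in>UU (Suc n). \<rho> g v = v" "\<forall>g\<in>A. \<rho> g v = v" by auto
      have g: "g \<in> UU n" "g \<in> UU 1" using insert.prems sub by auto
      define f where "f x = \<rho> g x - x" for x
      define V where "V = {v \<in> W. (\<forall>g\<in>UU (Suc n). \<rho> g v = v) \<and> (\<forall>g\<in>A. \<rho> g v = v)}"
      have r_diff: "\<rho> h (x - y) = \<rho> h x - \<rho> h y" if "h \<in> UU 1" for h x y
        using add[OF that, of "x - y" y] by simp
      \<comment> \<open>\<open>UU n\<close> is commutative modulo \<open>UU (n + 1)\<close>, which
        acts trivially on \<open>V\<close>. So \<open>f\<close> preserves the invariance under the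
        elements of \<open>A\<close> treated before.\<close>
      have fV: "f u \<in> V" if u: "u \<in> V" for u
      proof -
        have uW: "u \<in> W" using u by (simp add: V_def)
        have swap: "\<rho> h (\<rho> g u) = \<rho> g u" if h: "h \<in> UU n" "\<rho> h u = u" for h
        proof -
          obtain c where c: "c \<in> UU (n + 1)" "h * g = g * h * c" using UU_commute_mod[OF n g(1) h(1)] .
          have h1: "h \<in> UU 1" and c1: "c \<in> UU 1" using h(1) c(1) sub by auto
          have "\<rho> h (\<rho> g u) = \<rho> (h * g) u" using mult[OF h1 g(2) uW] by simp
          also have "\<dots> = \<rho> (g * h) (\<rho> c u)" unfolding c(2) using mult[OF UU_mult[OF g(2) h1] c1 uW] .
          also have "\<rho> c u = u" using u c(1) by (simp add: V_def)
          also have "\<rho> (g * h) u = \<rho> g u" using mult[OF g(2) h1 uW] h(2) by simp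
          finally show ?thesis .
        qed
        have "\<rho> h (f u) = f u" if h: "h \<in> UU n" "\<rho> h u = u" for h
          unfolding f_def using r_diff[of h] swap[OF h] h sub by (simp add: subset_iff)
        moreover have "UU (Suc n) \<subseteq> UU n" using UU_mono by simp
        moreover have "f u \<in> W" unfolding f_def using diff[OF stable[OF g(2) uW] uW] .
        ultimately show ?thesis using u insert.prems unfolding V_def by (auto simp: subset_iff)
      qed
      have vV: "v \<in> V" using v by (simp add: V_def)
      have iV: "(f ^^ i) v \<in> V" for i by (induction i) (simp_all add: vV fV)
      have rp: "(\<rho> g ^^ i) v = \<rho> (g ^ i) v \<and> \<rho> (g ^ i) v \<in> W" for i
      proof (induction i)
        case 0
        have "\<rho> 1 v = v" using v(3) UU_one by blast
        then show ?case using v by simp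
      next
        case (Suc i)
        then show ?case using mult[OF g(2) UU_power[OF g(2)] v(1)] stable[OF UU_power[OF g(2), of "Suc i"] v(1)] by simp
      qed
      have fa: "f (x + y) = f x + f y" for x y unfolding f_def add[OF g(2)] by simp
      have "((\<lambda>x. x + f x) ^^ p) v = v + (f ^^ p) v"
        using funpow_prime_binomial[OF fa p_prime kill] .
      moreover have "(\<lambda>x. x + f x) = \<rho> g" by (simp add: f_def)
      moreover have "g ^ p \<in> UU (Suc n)" using UU_p_power_mem[OF n g(1)] by simp
      \<comment> \<open>\<open>g ^ p\<close> lies in \<open>UU (Suc n)\<close> and fixes
        \<open>v\<close>, so \<open>f\<close> is nilpotent on \<open>v\<close>; its last nonzero
        iterate is fixed by \<open>g\<close>.\<close>
      ultimately have z: "(f ^^ p) v = 0" using rp[of p] v(3) by simp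
      define i where "i = (LEAST i. (f ^^ i) v = 0)"
      have i: "(f ^^ i) v = 0" unfolding i_def using z by (rule LeastI)
      then obtain k where k: "i = Suc k" using v(2) by (cases i) simp_all
      have "(f ^^ k) v \<noteq> 0" using not_less_Least[of k "\<lambda>i. (f ^^ i) v = 0"] k i_def by simp
      moreover have "\<rho> g ((f ^^ k) v) = (f ^^ k) v" using i k by (simp add: f_def)
      ultimately show ?case using iV[of k] unfolding V_def by blast
    qed
    define A where "A = range (\<lambda>c. 1 + w ^ n * tau c)"
    have "finite A" "A \<subseteq> UU n" by (auto simp: A_def intro: UU_intro)
    then obtain v where v: "v \<in> W" "v \<noteq> 0" "\<forall>g\<in>UU (Suc n). \<rho> g v = v" "\<forall>g\<in>A. \<rho> g v = v" using ex by blast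
    have "\<rho> g v = v" if g: "g \<in> UU n" for g
    proof -
      obtain c where c: "cg (n + 1) g (1 + w ^ n * tau c)" using UU_digit[OF g] .
      let ?t = "1 + w ^ n * tau c"
      have t: "?t \<in> UU n" by (rule UU_intro) simp
      have u: "inverse ?t * g \<in> UU (Suc n)" using cg_left_quotient[OF c] UU_unit[OF n t] by simp
      have "g = ?t * (inverse ?t * g)"
        unfolding mult.assoc[symmetric] right_inverse[OF UU_unit(2)[OF n t]] by simp
      then have "\<rho> g v = \<rho> ?t (\<rho> (inverse ?t * g) v)"
        using mult[of ?t "inverse ?t * g" v] t u sub v(1) by (metis subsetD)
      also have "\<rho> (inverse ?t * g) v = v" using v(3) u by blast
      also have "\<rho> ?t v = v" using v(4) by (simp add: A_def)
      finally show ?thesis .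
    qed
    then show ?thesis using v by blast
  qed
  have "?P m" using v by blast
  with v(3) have "?P 1"
  proof (induction m rule: dec_induct)
    case base
    then show ?case .
  next
    case (step n)
    then show ?case using \<open>\<And>n. n \<ge> 1 \<Longrightarrow> ?P (Suc n) \<Longrightarrow> ?P n\<close> by blast
  qed
  then show ?thesis .
qed

section \<open>Open normal subgroups and their cosets\<close>

abbreviation rc :: "'d set \<Rightarrow> 'd set set" where
  "rc N \<equiv> rcosets\<^bsub>U1 OD w\<^esub> N"

abbreviation ON :: "'d set set" where
  "ON \<equiv> open_normal OD w"

definition cs :: "'d set \<Rightarrow> 'd \<Rightarrow> 'd set" where
  "cs N g = N #>\<^bsub>U1 OD w\<^esub> g"

lemma U1_simps: "carrier (U1 OD w) = UU 1" "mult (U1 OD w) = (*)" "one (U1 OD w) = 1"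
  by (auto simp: U1_def UU_iff cg_def)

lemma U1_group: "group (U1 OD w)"
proof (rule groupI)
  fix x assume "x \<in> carrier (U1 OD w)"
  then have x: "x \<in> UU 1" by (simp add: U1_simps)
  show "\<exists>y\<in>carrier (U1 OD w). y \<otimes>\<^bsub>U1 OD w\<^esub> x = \<one>\<^bsub>U1 OD w\<^esub>"
    using UU_inverse[OF _ x] UU_unit(2)[OF _ x] by (intro bexI[of _ "inverse x"]) (simp_all add: U1_simps)
qed (simp_all add: U1_simps UU_mult mult.assoc)

lemma U1_inv: "g \<in> UU 1 \<Longrightarrow> inv\<^bsub>U1 OD w\<^esub> g = inverse g"
  by (rule group.inv_equality[OF U1_group])
    (simp_all only: U1_simps UU_inverse[OF order_refl] left_inverse[OF UU_unit(2)[OF order_refl]])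

lemma UU1_inv_simps:
  assumes "g \<in> UU 1"
  shows "g * inverse g = 1" "inverse g * g = 1" "inverse g * (g * x) = x" "g * (inverse g * x) = x"
proof -
  have "g \<noteq> 0" using UU_unit(2)[OF _ assms] by simp
  then show "g * inverse g = 1" "inverse g * g = 1" by simp_all
  then show "inverse g * (g * x) = x" "g * (inverse g * x) = x" by (simp_all flip: mult.assoc)
qed

lemma UU1_inverse: "g \<in> UU 1 \<Longrightarrow> inverse g \<in> UU 1"
  using UU_inverse by simp

lemma UU1_inverse_mult: "g \<in> UU 1 \<Longrightarrow> h \<in> UU 1 \<Longrightarrow> inverse (g * h) = inverse h * inverse g"
  using UU_unit(2)[of 1] by (simp add: nonzero_inverse_mult_distrib)

lemma ON_D:
  assumes "N \<in> ON"
  shows "N \<lhd> U1 OD w" "subgroup N (U1 OD w)" "N \<subseteq> UU 1" "1 \<in> N" "Z1 OD w \<subseteq> N"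
    "\<And>g h. g \<in> N \<Longrightarrow> h \<in> N \<Longrightarrow> g * h \<in> N" "\<And>g. g \<in> N \<Longrightarrow> inverse g \<in> N"
    "\<And>g n. g \<in> UU 1 \<Longrightarrow> n \<in> N \<Longrightarrow> g * n * inverse g \<in> N" "\<exists>m\<ge>1. UU m \<subseteq> N"
proof -
  show n: "N \<lhd> U1 OD w" and z: "Z1 OD w \<subseteq> N" using assms by (simp_all add: open_normal_def)
  then show s: "subgroup N (U1 OD w)" using normal.axioms(1) by blast
  show sub: "N \<subseteq> UU 1" using subgroup.subset[OF s] by (simp add: U1_simps)
  show one: "1 \<in> N" using subgroup.one_closed[OF s] by (simp add: U1_simps)
  show "g * h \<in> N" if "g \<in> N" "h \<in> N" for g h using subgroup.m_closed[OF s that] by (simp add: U1_simps)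
  show "inverse g \<in> N" if "g \<in> N" for g
    using subgroup.m_inv_closed[OF s that] U1_inv[of g] that sub by (simp add: subset_iff)
  show "g * n * inverse g \<in> N" if "g \<in> UU 1" "n \<in> N" for g n
    using normal.inv_op_closed2[OF n, of g n] that by (simp add: U1_simps U1_inv)
  have "D_open OD w N" using assms by (simp add: open_normal_def)
  then obtain m where "\<forall>y\<in>OD. 1 + w ^ m * y \<in> N" using one unfolding D_open_def by blast
  then have "UU m \<subseteq> N" by (auto simp: UU_iff cg_def)
  then have "UU (m + 1) \<subseteq> N" using UU_mono[of m "m + 1"] by simp
  then show "\<exists>m\<ge>1. UU m \<subseteq> N" by (intro exI[of _ "m + 1"]) simp
qed

lemma ON_I:
  assumes sub: "N \<subseteq> UU 1" and one: "1 \<in> N" and z: "Z1 OD w \<subseteq> N"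
    and mult: "\<And>g h. g \<in> N \<Longrightarrow> h \<in> N \<Longrightarrow> g * h \<in> N" and inv: "\<And>g. g \<in> N \<Longrightarrow> inverse g \<in> N"
    and conj: "\<And>g n. g \<in> UU 1 \<Longrightarrow> n \<in> N \<Longrightarrow> g * n * inverse g \<in> N" and m: "UU m \<subseteq> N"
  shows "N \<in> ON"
proof -
  have "subgroup N (U1 OD w)"
  proof (rule group.subgroupI[OF U1_group])
    show "inv\<^bsub>U1 OD w\<^esub> g \<in> N" if g: "g \<in> N" for g
      using U1_inv[OF subsetD[OF sub g]] inv[OF g] by simp
  qed (use sub one mult in \<open>auto simp: U1_simps\<close>)
  then have n: "N \<lhd> U1 OD w"
    unfolding group.normal_inv_iff[OF U1_group] using conj by (simp add: U1_simps U1_inv)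
  have "D_open OD w N"
    unfolding D_open_def
  proof (intro ballI exI[of _ m])
    fix x y assume x: "x \<in> N" and y: "y \<in> OD"
    have x1: "x \<in> UU 1" using x sub by blast
    have "inverse x \<in> OD" using UU_unit(1)[OF _ x1] by simp
    then obtain x' where x': "x' \<in> OD" "inverse x * w ^ m = w ^ m * x'" using OD_w_power_swap by blast
    have "x * (w ^ m * (x' * y)) = x * (inverse x * w ^ m) * y" unfolding x' by (simp only: mult.assoc)
    also have "\<dots> = x * inverse x * (w ^ m * y)" by (simp only: mult.assoc)
    also have "\<dots> = w ^ m * y" using UU1_inv_simps(1)[OF x1] by simp
    finally have "x + w ^ m * y = x * (1 + w ^ m * (x' * y))" by (simp only: distrib_left mult_1_right)
    moreover have "1 + w ^ m * (x' * y) \<in> N" using m UU_intro[OF OD_mult[OF x'(1) y]] by blast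
    ultimately show "x + w ^ m * y \<in> N" using mult[OF x] by simp
  qed
  then show ?thesis using n z by (simp add: open_normal_def)
qed

lemma ON_Int: "N \<in> ON \<Longrightarrow> M \<in> ON \<Longrightarrow> N \<inter> M \<in> ON"
proof -
  assume N: "N \<in> ON" and M: "M \<in> ON"
  obtain n where n: "UU n \<subseteq> N" using ON_D(9)[OF N] by blast
  obtain m where m: "UU m \<subseteq> M" using ON_D(9)[OF M] by blast
  have "UU (n + m) \<subseteq> N \<inter> M" using n m UU_mono[of n "n + m"] UU_mono[of m "n + m"] by auto
  then show ?thesis
    using ON_D[OF N] ON_D[OF M] by (intro ON_I) (auto simp: subset_iff)
qed

lemma Z1_iff: "z \<in> Z1 OD w \<longleftrightarrow> z \<in> UU 1 \<and> (\<forall>x. z * x = x * z)"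
  using UU_unit(2)[of 1 z] by (auto simp: Z1_def U1_simps centre_def)

lemma Z1_inverse: "z \<in> Z1 OD w \<Longrightarrow> inverse z \<in> Z1 OD w"
proof -
  assume z: "z \<in> Z1 OD w"
  then have u: "z \<in> UU 1" by (simp add: Z1_iff)
  have "inverse z * x = x * inverse z" for x
  proof -
    have "inverse z * x = inverse z * (x * z) * inverse z" using UU1_inv_simps[OF u] by (simp add: mult.assoc)
    also have "x * z = z * x" using z by (simp add: Z1_iff)
    finally show ?thesis using UU1_inv_simps[OF u] by (simp add: mult.assoc)
  qed
  then show ?thesis using UU1_inverse[OF u] by (simp add: Z1_iff)
qed

text \<open>The concrete members of \<open>ON\<close>: every member contains some
  \<open>UU m\<close> and \<open>Z1\<close>, hence one of these products.\<close>

definition UZ :: "nat \<Rightarrow> 'd set" where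
  "UZ m = {g * z |g z. g \<in> UU m \<and> z \<in> Z1 OD w}"

lemma UZ_ON:
  assumes m: "m \<ge> 1" shows "UZ m \<in> ON"
proof (rule ON_I)
  have sub: "UU m \<subseteq> UU 1" using UU_mono[OF m] .
  have z1: "1 \<in> Z1 OD w" by (simp add: Z1_iff)
  show "UZ m \<subseteq> UU 1" using sub UU_mult by (auto simp: UZ_def Z1_iff)
  show "1 \<in> UZ m" using z1 by (force simp: UZ_def)
  show "Z1 OD w \<subseteq> UZ m" using UU_one[of m] by (force simp: UZ_def)
  show "UU m \<subseteq> UZ m" using z1 by (force simp: UZ_def)
  fix g assume "g \<in> UZ m"
  then obtain g1 z where g: "g1 \<in> UU m" "z \<in> Z1 OD w" "g = g1 * z" by (auto simp: UZ_def)
  have zc: "z * x = x * z" and zu: "z \<in> UU 1" for x using g(2) by (simp_all add: Z1_iff)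
  have g1u: "g1 \<in> UU 1" using g(1) sub by blast
  show "inverse g \<in> UZ m"
  proof -
    have "inverse g = inverse g1 * inverse z"
      unfolding g(3) using zc[of g1] UU1_inverse_mult[OF zu g1u] by simp
    then show ?thesis using Z1_inverse[OF g(2)] UU_inverse[OF m g(1)] by (auto simp: UZ_def)
  qed
  show "g * h \<in> UZ m" if hm: "h \<in> UZ m" for h
  proof -
    obtain h1 y where h: "h1 \<in> UU m" "y \<in> Z1 OD w" "h = h1 * y" using hm by (auto simp: UZ_def)
    have "g * h = g1 * (z * h1) * y" unfolding g h by (simp only: mult.assoc)
    also have "\<dots> = (g1 * h1) * (z * y)" unfolding zc[of h1] by (simp only: mult.assoc)
    finally have "g * h = (g1 * h1) * (z * y)" .
    moreover have "z * y \<in> Z1 OD w"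
    proof -
      have "z * y * x = x * (z * y)" for x
        using h(2) zc unfolding Z1_iff by (metis mult.assoc)
      then show ?thesis using h(2) zu UU_mult unfolding Z1_iff by blast
    qed
    ultimately show ?thesis using UU_mult[OF g(1) h(1)] by (auto simp: UZ_def)
  qed
  show "h * g * inverse h \<in> UZ m" if h: "h \<in> UU 1" for h
  proof -
    have "h * g * inverse h = h * g1 * (z * inverse h)" unfolding g by (simp only: mult.assoc)
    also have "\<dots> = h * g1 * inverse h * z" unfolding zc[of "inverse h"] by (simp only: mult.assoc)
    finally have "h * g * inverse h = h * g1 * inverse h * z" .
    moreover have "h * g1 * inverse h \<in> UU m"
      using UU_conj[OF g(1) UU_OD[OF h]] UU_unit[OF _ h] by simp
    ultimately show ?thesis using g(2) by (auto simp: UZ_def)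
  qed
qed

lemma mem_cs: "g \<in> UU 1 \<Longrightarrow> N \<subseteq> UU 1 \<Longrightarrow> h \<in> cs N g \<longleftrightarrow> h \<in> UU 1 \<and> h * inverse g \<in> N"
proof
  assume g: "g \<in> UU 1" and N: "N \<subseteq> UU 1"
  {
    assume "h \<in> cs N g"
    then obtain n where n: "n \<in> N" "h = n * g" by (auto simp: cs_def r_coset_def U1_simps)
    then show "h \<in> UU 1 \<and> h * inverse g \<in> N" using N g UU_mult UU1_inv_simps[OF g] by (auto simp: mult.assoc)
  }
  assume "h \<in> UU 1 \<and> h * inverse g \<in> N"
  then show "h \<in> cs N g"
    using UU1_inv_simps[OF g] by (auto simp: cs_def r_coset_def U1_simps mult.assoc intro!: bexI[of _ "h * inverse g"])
qed

lemma cs_self: "N \<in> ON \<Longrightarrow> g \<in> UU 1 \<Longrightarrow> g \<in> cs N g"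
  using mem_cs[of g N g] ON_D(3,4) UU1_inv_simps(1) by simp

lemma cs_eqI:
  assumes N: "N \<in> ON" and "g \<in> UU 1" "h \<in> cs N g" shows "cs N h = cs N g"
  using group.repr_independence[OF U1_group, of h N g] assms(2,3) ON_D(2)[OF N]
  by (simp add: cs_def U1_simps)

lemma cs_subset: "N \<in> ON \<Longrightarrow> g \<in> UU 1 \<Longrightarrow> cs N g \<subseteq> UU 1"
  using mem_cs ON_D(3) by blast

lemma rc_iff: "c \<in> rc N \<longleftrightarrow> (\<exists>g\<in>UU 1. c = cs N g)"
  by (auto simp: RCOSETS_def cs_def U1_simps)

lemma cs_rc: "g \<in> UU 1 \<Longrightarrow> cs N g \<in> rc N"
  using rc_iff by blast

lemma rep_rc:
  assumes "N \<in> ON" "c \<in> rc N" shows "rep c \<in> c" "rep c \<in> UU 1" "cs N (rep c) = c"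
proof -
  obtain g where g: "g \<in> UU 1" "c = cs N g" using assms rc_iff by blast
  then have "g \<in> c" using cs_self assms by blast
  then show r: "rep c \<in> c" unfolding rep_def by (rule someI)
  show "cs N (rep c) = c" using cs_eqI[OF assms(1) g(1)] r g(2) by simp
  show "rep c \<in> UU 1" using r cs_subset[OF assms(1) g(1)] g(2) by blast
qed

lemma rc_mem: "N \<in> ON \<Longrightarrow> c \<in> rc N \<Longrightarrow> g \<in> c \<Longrightarrow> c = cs N g \<and> g \<in> UU 1"
  using cs_eqI[of N "rep c" g] rep_rc[of N c] cs_subset[of N "rep c"] by auto

text \<open>Representatives for level \<open>Suc n\<close> are products of a digit
  \<open>1 + w ^ n * tau c\<close> with representatives for level \<open>n\<close>, and the residue
  field supplies finitely many digits.\<close>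

lemma finite_rc: assumes N: "N \<in> ON" shows "finite (rc N)"
proof -
  obtain m where m: "m \<ge> 1" "UU m \<subseteq> N" using ON_D(9)[OF N] by blast
  have "\<exists>R. finite R \<and> R \<subseteq> UU 1 \<and> (\<forall>g\<in>UU 1. \<exists>r\<in>R. g * inverse r \<in> UU m)"
    using m(1)
  proof (induction m rule: dec_induct)
    case base
    show ?case by (intro exI[of _ "{1}"]) simp
  next
    case (step n)
    then obtain R where R: "finite R" "R \<subseteq> UU 1" "\<forall>g\<in>UU 1. \<exists>r\<in>R. g * inverse r \<in> UU n" by blast
    let ?t = "\<lambda>c. 1 + w ^ n * tau c"
    have tu: "?t c \<in> UU n" for c by (rule UU_intro) simp
    have t1: "?t c \<in> UU 1" for c using tu UU_mono[of 1 n] step by blast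
    let ?R = "(\<lambda>(c, r). ?t c * r) ` (UNIV \<times> R)"
    have "\<exists>r\<in>?R. g * inverse r \<in> UU (Suc n)" if g: "g \<in> UU 1" for g
    proof -
      obtain r where r: "r \<in> R" "g * inverse r \<in> UU n" using R g by blast
      obtain c where c: "cg (n + 1) (g * inverse r) (?t c)" using UU_digit[OF r(2)] .
      have "g * inverse r * inverse (?t c) \<in> UU (Suc n)"
        using cg_right_quotient[OF c] UU_unit[OF step(1) tu] by simp
      moreover have "inverse (?t c * r) = inverse r * inverse (?t c)"
        using UU1_inverse_mult[OF t1] r R by blast
      ultimately show ?thesis using r(1) by (intro bexI[of _ "?t c * r"]) (auto simp: mult.assoc)
    qed
    moreover have "finite ?R" using R by simp
    moreover have "?R \<subseteq> UU 1" using R t1 UU_mult by auto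
    ultimately show ?case by blast
  qed
  then obtain R where R: "finite R" "R \<subseteq> UU 1" "\<forall>g\<in>UU 1. \<exists>r\<in>R. g * inverse r \<in> UU m" by blast
  have "rc N \<subseteq> cs N ` R"
  proof
    fix c assume "c \<in> rc N"
    then obtain g where g: "g \<in> UU 1" "c = cs N g" using rc_iff by blast
    then obtain r where r: "r \<in> R" "g * inverse r \<in> UU m" using R by blast
    then have "g \<in> cs N r" using mem_cs[of r N g] R m ON_D(3)[OF N] g by blast
    then show "c \<in> cs N ` R" using cs_eqI[OF N] r R g by blast
  qed
  then show ?thesis using R(1) finite_surj by blast
qed

lemma cs_mult:
  "N \<in> ON \<Longrightarrow> g \<in> UU 1 \<Longrightarrow> h \<in> UU 1 \<Longrightarrow> cs N g <#>\<^bsub>U1 OD w\<^esub> cs N h = cs N (g * h)"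
  using normal.rcos_sum[OF ON_D(1), of N g h] by (simp add: cs_def U1_simps)

section \<open>Locally constant functions and their pairing with the Iwasawa algebra\<close>

definition lc :: "'d set \<Rightarrow> ('d \<Rightarrow> 'f) \<Rightarrow> bool" where
  "lc N \<phi> \<longleftrightarrow> (\<forall>n\<in>N. \<forall>g\<in>UU 1. \<phi> (n * g) = \<phi> g)"

lemma lc_cs:
  assumes N: "N \<in> ON" and "lc N \<phi>" "g \<in> UU 1" "h \<in> cs N g" shows "\<phi> h = \<phi> g"
proof -
  obtain n where n: "n \<in> N" "h = n * g"
    using assms(4) by (auto simp: cs_def r_coset_def U1_simps)
  then show ?thesis using assms by (simp add: lc_def)
qed

lemma lc_rep: "N \<in> ON \<Longrightarrow> lc N \<phi> \<Longrightarrow> g \<in> UU 1 \<Longrightarrow> \<phi> (rep (cs N g)) = \<phi> g"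
  using lc_cs rep_rc(1) cs_rc by blast

lemma lc_mono: "N \<subseteq> M \<Longrightarrow> lc M \<phi> \<Longrightarrow> lc N \<phi>"
  by (auto simp: lc_def)

lemma lc_left_translate:
  assumes N: "N \<in> ON" and "lc N \<phi>" "x \<in> UU 1" shows "lc N (\<lambda>y. \<phi> (x * y))"
  unfolding lc_def
proof (intro ballI)
  fix n g assume n: "n \<in> N" and g: "g \<in> UU 1"
  have "x * (n * g) = (x * n * inverse x) * (x * g)" using UU1_inv_simps[OF assms(3)] by (simp add: mult.assoc)
  then show "\<phi> (x * (n * g)) = \<phi> (x * g)"
    using assms(2) ON_D(8)[OF N assms(3) n] UU_mult[OF assms(3) g] unfolding lc_def by metis
qed

definition ind :: "'d set \<Rightarrow> 'd \<Rightarrow> 'f" where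
  "ind c = (\<lambda>g. if g \<in> c then 1 else 0)"

lemma lc_ind:
  assumes N: "N \<in> ON" and c: "c \<in> rc N" shows "lc N (ind c)"
  unfolding lc_def
proof (intro ballI)
  fix n g assume n: "n \<in> N" and g: "g \<in> UU 1"
  have ng: "n * g \<in> UU 1" using n g ON_D(3)[OF N] UU_mult by blast
  have "n * g \<in> cs N g" using n by (auto simp: cs_def r_coset_def U1_simps)
  then have e: "cs N (n * g) = cs N g" using cs_eqI[OF N g] by blast
  have "x \<in> c \<longleftrightarrow> c = cs N x" if "x \<in> UU 1" for x
    using rc_mem[OF N c, of x] cs_self[OF N that] by blast
  then have "n * g \<in> c \<longleftrightarrow> g \<in> c" using g ng e by simp
  then show "ind c (n * g) = ind c g" by (simp add: ind_def)
qed

lemma mem_coset_iff: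
  assumes "N \<in> ON" "c \<in> rc N" "g \<in> UU 1" shows "g \<in> c \<longleftrightarrow> c = cs N g"
  using rc_mem[OF assms(1,2), of g] cs_self[OF assms(1,3)] by blast

lemma ind_coset:
  assumes "N \<in> ON" "c \<in> rc N" "g \<in> UU 1" shows "ind c g = (if c = cs N g then 1 else 0)"
  using mem_coset_iff[OF assms] unfolding ind_def by presburger

lemma lc_expand:
  assumes N: "N \<in> ON" and "lc N \<phi>" "g \<in> UU 1"
  shows "\<phi> g = (\<Sum>c\<in>rc N. \<phi> (rep c) * ind c g)"
proof -
  have *: "ind c g = (if c = cs N g then 1 else 0)" if "c \<in> rc N" for c
    using ind_coset[OF N that assms(3)] .
  have "(\<Sum>c\<in>rc N. \<phi> (rep c) * ind c g) = (\<Sum>c\<in>rc N. if c = cs N g then \<phi> (rep c) else 0)"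
    by (intro sum.cong) (simp_all add: *)
  also have "\<dots> = \<phi> g" using finite_rc[OF N] cs_rc[OF assms(3), of N] lc_rep[OF N assms(2,3)] by simp
  finally show ?thesis by simp
qed

definition ev :: "'d set \<Rightarrow> ('d \<Rightarrow> 'f) \<Rightarrow> ('d, 'f) iw \<Rightarrow> 'f" where
  "ev N \<phi> a = (\<Sum>c\<in>rc N. a N c * \<phi> (rep c))"

abbreviation IW :: "('d, 'f) iw ring" where
  "IW \<equiv> iwasawa OD w"

lemma IW_carrier_iff:
  "a \<in> carrier IW \<longleftrightarrow> (\<forall>N c. \<not> (N \<in> ON \<and> c \<in> rc N) \<longrightarrow> a N c = 0) \<and>
    (\<forall>N\<in>ON. \<forall>M\<in>ON. N \<subseteq> M \<longrightarrow> (\<forall>c\<in>rc M. a M c = (\<Sum>c'\<in>{c' \<in> rc N. c' \<subseteq> c}. a N c')))"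
  by (simp add: iwasawa_def)

lemma subcosets:
  assumes N: "N \<in> ON" and M: "M \<in> ON" and "N \<subseteq> M" "c \<in> rc M"
  shows "{c' \<in> rc N. c' \<subseteq> c} = {c' \<in> rc N. cs M (rep c') = c}"
proof -
  have "c' \<subseteq> c \<longleftrightarrow> cs M (rep c') = c" if c': "c' \<in> rc N" for c'
  proof
    assume "c' \<subseteq> c"
    then show "cs M (rep c') = c" using rep_rc(1)[OF N c'] rc_mem[OF M assms(4)] by blast
  next
    assume "cs M (rep c') = c"
    moreover have "cs N (rep c') \<subseteq> cs M (rep c')" using assms(3) by (auto simp: cs_def r_coset_def)
    ultimately show "c' \<subseteq> c" using rep_rc(3)[OF N c'] by simp
  qed
  then show ?thesis by blast
qed

text \<open>The cosets of \<open>N\<close> are grouped by the coset of \<open>M\<close> containing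
  them; on it the function is constant and the coefficients of \<open>a\<close> add up by
  compatibility.\<close>

lemma ev_compat:
  assumes N: "N \<in> ON" and M: "M \<in> ON" and "N \<subseteq> M" "lc M \<phi>" "a \<in> carrier IW"
  shows "ev M \<phi> a = ev N \<phi> a"
proof -
  have "ev M \<phi> a = (\<Sum>c\<in>rc M. \<Sum>c'\<in>{c' \<in> rc N. cs M (rep c') = c}. a N c' * \<phi> (rep c'))"
    unfolding ev_def
  proof (rule sum.cong[OF refl])
    fix c assume c: "c \<in> rc M"
    have "a M c = (\<Sum>c'\<in>{c' \<in> rc N. cs M (rep c') = c}. a N c')"
      using assms c subcosets[OF assms(1,2,3) c] unfolding IW_carrier_iff by simp
    then have "a M c * \<phi> (rep c) = (\<Sum>c'\<in>{c' \<in> rc N. cs M (rep c') = c}. a N c' * \<phi> (rep c))"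
      by (simp add: sum_distrib_right)
    also have "\<dots> = (\<Sum>c'\<in>{c' \<in> rc N. cs M (rep c') = c}. a N c' * \<phi> (rep c'))"
    proof (rule sum.cong[OF refl])
      fix c' assume "c' \<in> {c' \<in> rc N. cs M (rep c') = c}"
      then have "c' \<in> rc N" "cs M (rep c') = c" by simp_all
      then show "a N c' * \<phi> (rep c) = a N c' * \<phi> (rep c')"
        using lc_rep[OF M assms(4), of "rep c'"] rep_rc(2)[OF N] by simp
    qed
    finally show "a M c * \<phi> (rep c) = (\<Sum>c'\<in>{c' \<in> rc N. cs M (rep c') = c}. a N c' * \<phi> (rep c'))" .
  qed
  also have "\<dots> = ev N \<phi> a"
    unfolding ev_def using rep_rc(2)[OF N] cs_rc by (intro sum.group finite_rc N M) blast
  finally show ?thesis .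
qed

definition smooth_fun :: "('d \<Rightarrow> 'f) \<Rightarrow> bool" where
  "smooth_fun \<phi> \<longleftrightarrow> (\<exists>N\<in>ON. lc N \<phi>)"

text \<open>Integration of a locally constant function against the measure given by
  \<open>a\<close>. With \<open>IW_eqI\<close> and \<open>iw_of_closed\<close>, the Iwasawa algebra
  becomes the full dual of the locally constant functions.\<close>

definition pair :: "('d, 'f) iw \<Rightarrow> ('d \<Rightarrow> 'f) \<Rightarrow> 'f" where
  "pair a \<phi> = ev (SOME N. N \<in> ON \<and> lc N \<phi>) \<phi> a"

lemma pair_eq:
  assumes "N \<in> ON" "lc N \<phi>" "a \<in> carrier IW" shows "pair a \<phi> = ev N \<phi> a"
proof -
  define M where "M = (SOME N. N \<in> ON \<and> lc N \<phi>)"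
  have M: "M \<in> ON \<and> lc M \<phi>" unfolding M_def by (rule someI[of _ N]) (use assms in simp)
  have "N \<inter> M \<in> ON" using M assms ON_Int by blast
  then have "ev M \<phi> a = ev (N \<inter> M) \<phi> a" "ev N \<phi> a = ev (N \<inter> M) \<phi> a"
    using ev_compat[of "N \<inter> M" M \<phi> a] ev_compat[of "N \<inter> M" N \<phi> a] M assms by simp_all
  then show ?thesis by (simp add: pair_def M_def)
qed

lemma smooth_common:
  assumes "smooth_fun \<phi>" "smooth_fun \<psi>" obtains N where "N \<in> ON" "lc N \<phi>" "lc N \<psi>"
proof -
  obtain N M where "N \<in> ON" "lc N \<phi>" "M \<in> ON" "lc M \<psi>" using assms by (auto simp: smooth_fun_def)
  then show ?thesis using that[of "N \<inter> M"] ON_Int lc_mono[of "N \<inter> M" N] lc_mono[of "N \<inter> M" M] by simp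
qed

lemma lc_add: "lc N \<phi> \<Longrightarrow> lc N \<psi> \<Longrightarrow> lc N (\<lambda>x. \<phi> x + \<psi> x)"
  and lc_scale: "lc N \<phi> \<Longrightarrow> lc N (\<lambda>x. k * \<phi> x)"
  and lc_times: "lc N \<phi> \<Longrightarrow> lc N \<psi> \<Longrightarrow> lc N (\<lambda>x. \<phi> x * \<psi> x)"
  and lc_const: "lc N (\<lambda>x. k)"
  by (simp_all add: lc_def)

lemma pair_add:
  assumes "smooth_fun \<phi>" "smooth_fun \<psi>" "a \<in> carrier IW"
  shows "pair a (\<lambda>x. \<phi> x + \<psi> x) = pair a \<phi> + pair a \<psi>"
proof -
  obtain N where N: "N \<in> ON" "lc N \<phi>" "lc N \<psi>" using smooth_common[OF assms(1,2)] .
  show ?thesis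
    unfolding pair_eq[OF N(1) lc_add[OF N(2,3)] assms(3)] pair_eq[OF N(1,2) assms(3)] pair_eq[OF N(1,3) assms(3)]
    by (simp add: ev_def distrib_left sum.distrib)
qed

lemma pair_scale:
  assumes "smooth_fun \<phi>" "a \<in> carrier IW"
  shows "pair a (\<lambda>x. k * \<phi> x) = k * pair a \<phi>"
proof -
  obtain N where N: "N \<in> ON" "lc N \<phi>" using assms(1) by (auto simp: smooth_fun_def)
  show ?thesis
    unfolding pair_eq[OF N(1) lc_scale[OF N(2)] assms(2)] pair_eq[OF N(1,2) assms(2)]
    by (simp add: ev_def sum_distrib_left mult_ac)
qed

lemma lc_cong:
  assumes N: "N \<in> ON" and "lc N \<phi>" "\<And>g. g \<in> UU 1 \<Longrightarrow> \<phi> g = \<psi> g" shows "lc N \<psi>"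
  unfolding lc_def
proof (intro ballI)
  fix n g assume "n \<in> N" "g \<in> UU 1"
  moreover from this have "n * g \<in> UU 1" using ON_D(3)[OF N] UU_mult by blast
  moreover have "\<phi> (n * g) = \<phi> g" using assms(2) calculation by (simp add: lc_def)
  ultimately show "\<psi> (n * g) = \<psi> g" using assms(3)[of g] assms(3)[of "n * g"] by simp
qed

lemma pair_cong:
  assumes "smooth_fun \<phi>" "a \<in> carrier IW" "\<And>g. g \<in> UU 1 \<Longrightarrow> \<phi> g = \<psi> g"
  shows "pair a \<phi> = pair a \<psi>"
proof -
  obtain N where N: "N \<in> ON" "lc N \<phi>" using assms(1) by (auto simp: smooth_fun_def)
  have "lc N \<psi>" using lc_cong[OF N assms(3)] .
  then show ?thesis unfolding pair_eq[OF N assms(2)] pair_eq[OF N(1) \<open>lc N \<psi>\<close> assms(2)] ev_def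
    using assms(3) rep_rc(2)[OF N(1)] by (intro sum.cong) auto
qed

lemma smooth_cong: "smooth_fun \<phi> \<Longrightarrow> (\<And>g. g \<in> UU 1 \<Longrightarrow> \<phi> g = \<psi> g) \<Longrightarrow> smooth_fun \<psi>"
  using lc_cong unfolding smooth_fun_def by blast

lemma pair_ind:
  assumes N: "N \<in> ON" and c: "c \<in> rc N" and a: "a \<in> carrier IW" shows "pair a (ind c) = a N c"
proof -
  have *: "ind c (rep c') = (if c' = c then 1 else 0)" if "c' \<in> rc N" for c'
    using ind_coset[OF N c rep_rc(2)[OF N that]] rep_rc(3)[OF N that] by presburger
  have "pair a (ind c) = (\<Sum>c'\<in>rc N. a N c' * ind c (rep c'))"
    unfolding pair_eq[OF N lc_ind[OF N c] a] ev_def ..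
  also have "\<dots> = (\<Sum>c'\<in>rc N. if c' = c then a N c' else 0)"
    by (intro sum.cong) (simp_all add: *)
  also have "\<dots> = a N c" using finite_rc[OF N] c by simp
  finally show ?thesis .
qed

lemma IW_eqI:
  assumes "a \<in> carrier IW" "b \<in> carrier IW" "\<And>\<phi>. smooth_fun \<phi> \<Longrightarrow> pair a \<phi> = pair b \<phi>"
  shows "a = b"
proof (intro ext)
  fix N c
  show "a N c = b N c"
  proof (cases "N \<in> ON \<and> c \<in> rc N")
    case True
    then show ?thesis
      using pair_ind[of N c a] pair_ind[of N c b] assms(1,2) assms(3)[of "ind c"] lc_ind[of N c]
      unfolding smooth_fun_def by auto
  next
    case False
    then have "a N c = 0" "b N c = 0" using assms(1,2) unfolding IW_carrier_iff by blast+
    then show ?thesis by simp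
  qed
qed

text \<open>Functions live on the whole division ring, but only their values on \<open>UU 1\<close>
  have a meaning; the last clause makes a functional insensitive to the others.\<close>

definition lin_functional :: "(('d \<Rightarrow> 'f) \<Rightarrow> 'f) \<Rightarrow> bool" where
  "lin_functional f \<longleftrightarrow>
    (\<forall>\<phi> \<psi>. smooth_fun \<phi> \<longrightarrow> smooth_fun \<psi> \<longrightarrow> f (\<lambda>x. \<phi> x + \<psi> x) = f \<phi> + f \<psi>) \<and>
    (\<forall>\<phi> k. smooth_fun \<phi> \<longrightarrow> f (\<lambda>x. k * \<phi> x) = k * f \<phi>) \<and>
    (\<forall>\<phi> \<psi>. smooth_fun \<phi> \<longrightarrow> (\<forall>g\<in>UU 1. \<phi> g = \<psi> g) \<longrightarrow> f \<phi> = f \<psi>)"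

definition iw_of :: "(('d \<Rightarrow> 'f) \<Rightarrow> 'f) \<Rightarrow> ('d, 'f) iw" where
  "iw_of f = (\<lambda>N c. if N \<in> ON \<and> c \<in> rc N then f (ind c) else 0)"

lemma smooth_sum:
  assumes N: "N \<in> ON" and "\<And>i. i \<in> A \<Longrightarrow> lc N (\<phi> i)" shows "lc N (\<lambda>x. \<Sum>i\<in>A. \<phi> i x)"
  using assms by (simp add: lc_def)

lemma lin_functional_sum:
  assumes f: "lin_functional f" and N: "N \<in> ON" and A: "finite A" "\<And>i. i \<in> A \<Longrightarrow> lc N (\<phi> i)"
  shows "f (\<lambda>x. \<Sum>i\<in>A. \<phi> i x) = (\<Sum>i\<in>A. f (\<phi> i))"
  using A
proof (induction A rule: finite_induct)
  case empty
  have "smooth_fun (\<lambda>x. 0)" using N lc_const by (auto simp: smooth_fun_def)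
  then have "f (\<lambda>x. 0 * (0 :: 'f)) = 0 * f (\<lambda>x. 0)" using f unfolding lin_functional_def by blast
  then show ?case by simp
next
  case (insert i A)
  have "smooth_fun (\<phi> i)" "smooth_fun (\<lambda>x. \<Sum>i\<in>A. \<phi> i x)"
    using N insert.prems smooth_sum[OF N, of A \<phi>] by (auto simp: smooth_fun_def)
  then have "f (\<lambda>x. \<phi> i x + (\<Sum>i\<in>A. \<phi> i x)) = f (\<phi> i) + f (\<lambda>x. \<Sum>i\<in>A. \<phi> i x)"
    using f unfolding lin_functional_def by blast
  then show ?case using insert by simp
qed

lemma iw_of_closed:
  assumes f: "lin_functional f" shows "iw_of f \<in> carrier IW"
  unfolding IW_carrier_iff
proof (intro conjI allI impI ballI)
  fix N M c assume N: "N \<in> ON" and M: "M \<in> ON" and NM: "N \<subseteq> M" and c: "c \<in> rc M"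
  let ?A = "{c' \<in> rc N. c' \<subseteq> c}"
  have fin: "finite ?A" using finite_rc[OF N] by simp
  have "(\<Sum>c'\<in>?A. iw_of f N c') = (\<Sum>c'\<in>?A. f (ind c'))"
    using N by (intro sum.cong) (simp_all add: iw_of_def)
  also have "\<dots> = f (\<lambda>x. \<Sum>c'\<in>?A. ind c' x)"
    using lin_functional_sum[OF f N fin, of ind] lc_ind[OF N] by simp
  also have "\<dots> = f (ind c)"
  proof -
    have "(\<Sum>c'\<in>?A. ind c' x) = ind c x" if x: "x \<in> UU 1" for x
    proof -
      have "(\<Sum>c'\<in>?A. ind c' x) = (\<Sum>c'\<in>?A. if c' = cs N x then 1 else 0)"
        using ind_coset[OF N _ x] by (intro sum.cong refl) blast
      also have "\<dots> = (if cs N x \<in> ?A then 1 else 0)" using fin by simp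
      also have "cs N x \<in> ?A \<longleftrightarrow> x \<in> c"
      proof
        assume "x \<in> c"
        then have "c = cs M x" using rc_mem[OF M c] by blast
        moreover have "cs N x \<subseteq> cs M x" using NM by (auto simp: cs_def r_coset_def)
        ultimately show "cs N x \<in> ?A" using cs_rc[OF x] by blast
      qed (use cs_self[OF N x] in blast)
      finally show ?thesis by (simp add: ind_def)
    qed
    moreover have "smooth_fun (\<lambda>x. \<Sum>c'\<in>?A. ind c' x)"
      using smooth_sum[OF N, of ?A ind] lc_ind[OF N] N by (auto simp: smooth_fun_def)
    ultimately show ?thesis using f unfolding lin_functional_def by blast
  qed
  finally show "iw_of f M c = (\<Sum>c'\<in>?A. iw_of f N c')" using M c by (simp add: iw_of_def)
qed (auto simp: iw_of_def)

lemma pair_iw_of: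
  assumes f: "lin_functional f" and "smooth_fun \<phi>" shows "pair (iw_of f) \<phi> = f \<phi>"
proof -
  obtain N where N: "N \<in> ON" "lc N \<phi>" using assms(2) by (auto simp: smooth_fun_def)
  have s: "smooth_fun (\<lambda>x. \<Sum>c\<in>rc N. \<phi> (rep c) * ind c x)"
    using smooth_sum[OF N(1), of "rc N" "\<lambda>c x. \<phi> (rep c) * ind c x"] lc_scale lc_ind[OF N(1)] N(1)
    unfolding smooth_fun_def by blast
  have "f (\<lambda>x. \<Sum>c\<in>rc N. \<phi> (rep c) * ind c x) = f \<phi>"
  proof -
    have "\<forall>g\<in>UU 1. (\<Sum>c\<in>rc N. \<phi> (rep c) * ind c g) = \<phi> g"
      using lc_expand[OF N] by simp
    then show ?thesis using f s unfolding lin_functional_def by blast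
  qed
  moreover have "f (\<lambda>x. \<Sum>c\<in>rc N. \<phi> (rep c) * ind c x) = (\<Sum>c\<in>rc N. f (\<lambda>x. \<phi> (rep c) * ind c x))"
    using lc_scale lc_ind[OF N(1)] by (intro lin_functional_sum[OF f N(1) finite_rc[OF N(1)]]) blast
  moreover have "f (\<lambda>x. k * ind c x) = k * f (ind c)" if "c \<in> rc N" for c k
    using f lc_ind[OF N(1) that] N(1) unfolding lin_functional_def smooth_fun_def by blast
  ultimately have "f \<phi> = (\<Sum>c\<in>rc N. \<phi> (rep c) * f (ind c))" by (simp cong: sum.cong)
  also have "\<dots> = ev N \<phi> (iw_of f)"
    unfolding ev_def using N(1) by (intro sum.cong) (simp_all add: iw_of_def)
  finally show ?thesis using pair_eq[OF N iw_of_closed[OF f]] by simp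
qed

lemma smooth_left_translate: "smooth_fun \<phi> \<Longrightarrow> x \<in> UU 1 \<Longrightarrow> smooth_fun (\<lambda>y. \<phi> (x * y))"
  using lc_left_translate unfolding smooth_fun_def by blast

lemma smooth_const: "smooth_fun (\<lambda>x. k)"
  using UZ_ON[of 1] lc_const unfolding smooth_fun_def by blast

lemma smooth_add: "smooth_fun \<phi> \<Longrightarrow> smooth_fun \<psi> \<Longrightarrow> smooth_fun (\<lambda>x. \<phi> x + \<psi> x)"
  using smooth_common[of \<phi> \<psi>] lc_add unfolding smooth_fun_def by metis

lemma smooth_times: "smooth_fun \<phi> \<Longrightarrow> smooth_fun \<psi> \<Longrightarrow> smooth_fun (\<lambda>x. \<phi> x * \<psi> x)"
  using smooth_common[of \<phi> \<psi>] lc_times unfolding smooth_fun_def by metis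

lemma smooth_scale: "smooth_fun \<phi> \<Longrightarrow> smooth_fun (\<lambda>x. k * \<phi> x)"
  using lc_scale unfolding smooth_fun_def by blast

lemma smooth_diff: "smooth_fun \<phi> \<Longrightarrow> smooth_fun \<psi> \<Longrightarrow> smooth_fun (\<lambda>x. \<phi> x - \<psi> x)"
  using smooth_add[of \<phi> "\<lambda>x. - 1 * \<psi> x"] smooth_scale[of \<psi> "- 1"] by simp

lemma pair_diff:
  assumes "smooth_fun \<phi>" "smooth_fun \<psi>" "a \<in> carrier IW"
  shows "pair a (\<lambda>x. \<phi> x - \<psi> x) = pair a \<phi> - pair a \<psi>"
  using pair_add[OF smooth_diff[OF assms(1,2)] assms(2,3)] by (simp add: algebra_simps)

lemma lc_pair:
  assumes N: "N \<in> ON" and "lc N \<phi>" and b: "b \<in> carrier IW"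
  shows "lc N (\<lambda>x. pair b (\<lambda>y. \<phi> (x * y)))"
  unfolding lc_def
proof (intro ballI)
  fix n g assume n: "n \<in> N" and g: "g \<in> UU 1"
  have "n * g \<in> UU 1" using n g ON_D(3)[OF N] UU_mult by blast
  then have "smooth_fun (\<lambda>y. \<phi> (n * g * y))"
    using lc_left_translate[OF N assms(2)] N unfolding smooth_fun_def by blast
  then show "pair b (\<lambda>y. \<phi> (n * g * y)) = pair b (\<lambda>y. \<phi> (g * y))"
  proof (rule pair_cong[OF _ b])
    fix y assume "y \<in> UU 1"
    then have "g * y \<in> UU 1" using g UU_mult by blast
    then show "\<phi> (n * g * y) = \<phi> (g * y)" using assms(2) n by (simp add: lc_def mult.assoc)
  qed
qed

lemma smooth_pair:
  assumes "smooth_fun \<phi>" "b \<in> carrier IW" shows "smooth_fun (\<lambda>x. pair b (\<lambda>y. \<phi> (x * y)))"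
  using assms lc_pair unfolding smooth_fun_def by blast

section \<open>Multiplication as convolution of measures\<close>

lemma lin_functional_convolution:
  assumes a: "a \<in> carrier IW" and b: "b \<in> carrier IW"
  shows "lin_functional (\<lambda>\<phi>. pair a (\<lambda>x. pair b (\<lambda>y. \<phi> (x * y))))"
  unfolding lin_functional_def
proof (intro conjI allI impI)
  fix \<phi> \<psi> :: "'d \<Rightarrow> 'f" assume s: "smooth_fun \<phi>" "smooth_fun \<psi>"
  have "pair a (\<lambda>x. pair b (\<lambda>y. \<phi> (x * y) + \<psi> (x * y))) =
      pair a (\<lambda>x. pair b (\<lambda>y. \<phi> (x * y)) + pair b (\<lambda>y. \<psi> (x * y)))"
    by (rule pair_cong[OF smooth_pair[OF smooth_add[OF s] b] a])
      (intro pair_add smooth_left_translate s b)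
  then show "pair a (\<lambda>x. pair b (\<lambda>y. \<phi> (x * y) + \<psi> (x * y))) =
      pair a (\<lambda>x. pair b (\<lambda>y. \<phi> (x * y))) + pair a (\<lambda>x. pair b (\<lambda>y. \<psi> (x * y)))"
    using pair_add[OF smooth_pair[OF s(1) b] smooth_pair[OF s(2) b] a] by simp
next
  fix \<phi> :: "'d \<Rightarrow> 'f" and k assume s: "smooth_fun \<phi>"
  have "pair a (\<lambda>x. pair b (\<lambda>y. k * \<phi> (x * y))) = pair a (\<lambda>x. k * pair b (\<lambda>y. \<phi> (x * y)))"
    by (rule pair_cong[OF smooth_pair[OF smooth_scale[OF s] b] a])
      (intro pair_scale smooth_left_translate s b)
  then show "pair a (\<lambda>x. pair b (\<lambda>y. k * \<phi> (x * y))) = k * pair a (\<lambda>x. pair b (\<lambda>y. \<phi> (x * y)))"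
    using pair_scale[OF smooth_pair[OF s b] a] by simp
next
  fix \<phi> \<psi> :: "'d \<Rightarrow> 'f" assume s: "smooth_fun \<phi>" and e: "\<forall>g\<in>UU 1. \<phi> g = \<psi> g"
  show "pair a (\<lambda>x. pair b (\<lambda>y. \<phi> (x * y))) = pair a (\<lambda>x. pair b (\<lambda>y. \<psi> (x * y)))"
  proof (rule pair_cong[OF smooth_pair[OF s b] a])
    fix x assume x: "x \<in> UU 1"
    show "pair b (\<lambda>y. \<phi> (x * y)) = pair b (\<lambda>y. \<psi> (x * y))"
      by (rule pair_cong[OF smooth_left_translate[OF s x] b]) (use e UU_mult[OF x] in simp)
  qed
qed

text \<open>It suffices to compare coefficients at a coset \<open>c\<close>, that is values on
  \<open>ind c\<close>. The product of two cosets is \<open>c\<close> exactly if the product of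
  their representatives lies in \<open>c\<close>.\<close>

lemma iw_mult_eq:
  assumes a: "a \<in> carrier IW" and b: "b \<in> carrier IW"
  shows "a \<otimes>\<^bsub>IW\<^esub> b = iw_of (\<lambda>\<phi>. pair a (\<lambda>x. pair b (\<lambda>y. \<phi> (x * y))))"
proof (intro ext)
  fix N c
  let ?S = "{(r, s). r \<in> rc N \<and> s \<in> rc N \<and> r <#>\<^bsub>U1 OD w\<^esub> s = c}"
  have m: "(a \<otimes>\<^bsub>IW\<^esub> b) N c = (\<Sum>(r, s)\<in>?S. a N r * b N s)" by (simp add: iwasawa_def)
  show "(a \<otimes>\<^bsub>IW\<^esub> b) N c = iw_of (\<lambda>\<phi>. pair a (\<lambda>x. pair b (\<lambda>y. \<phi> (x * y)))) N c"
  proof (cases "N \<in> ON")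
    case False
    then have "a N r = 0" for r using a unfolding IW_carrier_iff by blast
    then have "(\<Sum>(r, s)\<in>?S. a N r * b N s) = 0" by (intro sum.neutral) auto
    then show ?thesis unfolding m using False by (simp add: iw_of_def)
  next
    case N: True
    have prod: "r <#>\<^bsub>U1 OD w\<^esub> s = cs N (rep r * rep s)" if "r \<in> rc N" "s \<in> rc N" for r s
      using cs_mult[OF N rep_rc(2)[OF N that(1)] rep_rc(2)[OF N that(2)]] rep_rc(3)[OF N] that by simp
    show ?thesis
    proof (cases "c \<in> rc N")
      case False
      have "?S = {}" using prod rep_rc(2)[OF N] UU_mult cs_rc False by auto
      then show ?thesis unfolding m using False by (simp only: iw_of_def sum.empty simp_thms if_False)
    next
      case c: True
      have l: "lc N (ind c)" using lc_ind[OF N c] .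
      have "pair a (\<lambda>x. pair b (\<lambda>y. ind c (x * y))) = (\<Sum>r\<in>rc N. a N r * pair b (\<lambda>y. ind c (rep r * y)))"
        unfolding pair_eq[OF N lc_pair[OF N l b] a] ev_def ..
      also have "\<dots> = (\<Sum>r\<in>rc N. \<Sum>s\<in>rc N. if r <#>\<^bsub>U1 OD w\<^esub> s = c then a N r * b N s else 0)"
      proof (rule sum.cong[OF refl])
        fix r assume r: "r \<in> rc N"
        have ru: "rep r \<in> UU 1" using rep_rc(2)[OF N r] .
        have "pair b (\<lambda>y. ind c (rep r * y)) = (\<Sum>s\<in>rc N. b N s * ind c (rep r * rep s))"
          unfolding pair_eq[OF N lc_left_translate[OF N l ru] b] ev_def ..
        also have "\<dots> = (\<Sum>s\<in>rc N. if r <#>\<^bsub>U1 OD w\<^esub> s = c then b N s else 0)"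
        proof (rule sum.cong[OF refl])
          fix s assume s: "s \<in> rc N"
          have "rep r * rep s \<in> UU 1" using ru rep_rc(2)[OF N s] UU_mult by blast
          then show "b N s * ind c (rep r * rep s) = (if r <#>\<^bsub>U1 OD w\<^esub> s = c then b N s else 0)"
            using ind_coset[OF N c] prod[OF r s] by auto
        qed
        finally show "a N r * pair b (\<lambda>y. ind c (rep r * y)) =
            (\<Sum>s\<in>rc N. if r <#>\<^bsub>U1 OD w\<^esub> s = c then a N r * b N s else 0)"
          by (simp add: sum_distrib_left if_distrib[of "\<lambda>x. a N r * x"] cong: if_cong)
      qed
      also have "\<dots> = (\<Sum>(r, s)\<in>rc N \<times> rc N. if r <#>\<^bsub>U1 OD w\<^esub> s = c then a N r * b N s else 0)"
        by (rule sum.cartesian_product)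
      also have "\<dots> = (\<Sum>(r, s)\<in>?S. a N r * b N s)"
        using finite_rc[OF N] by (intro sum.mono_neutral_cong_right) (auto split: if_splits)
      finally show ?thesis unfolding m using N c by (simp add: iw_of_def)
    qed
  qed
qed

lemma pair_mult:
  assumes "a \<in> carrier IW" "b \<in> carrier IW" "smooth_fun \<phi>"
  shows "pair (a \<otimes>\<^bsub>IW\<^esub> b) \<phi> = pair a (\<lambda>x. pair b (\<lambda>y. \<phi> (x * y)))"
  unfolding iw_mult_eq[OF assms(1,2)] using pair_iw_of[OF lin_functional_convolution[OF assms(1,2)] assms(3)] .

lemma iw_mult_closed: "a \<in> carrier IW \<Longrightarrow> b \<in> carrier IW \<Longrightarrow> a \<otimes>\<^bsub>IW\<^esub> b \<in> carrier IW"
  by (simp only: iw_mult_eq iw_of_closed lin_functional_convolution)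

lemma iw_eq_iw_of:
  assumes "\<And>N c. N \<in> ON \<Longrightarrow> c \<in> rc N \<Longrightarrow> a N c = f (ind c)"
    and "\<And>N c. \<not> (N \<in> ON \<and> c \<in> rc N) \<Longrightarrow> a N c = 0"
  shows "a = iw_of f"
  using assms by (intro ext) (simp add: iw_of_def)

lemma iw_zero_outside: "a \<in> carrier IW \<Longrightarrow> \<not> (N \<in> ON \<and> c \<in> rc N) \<Longrightarrow> a N c = 0"
  unfolding IW_carrier_iff by blast

lemma iw_linear_combination:
  assumes a: "a \<in> carrier IW" and b: "b \<in> carrier IW"
  shows "(\<lambda>N c. k * a N c + l * b N c) \<in> carrier IW"
    "smooth_fun \<phi> \<Longrightarrow> pair (\<lambda>N c. k * a N c + l * b N c) \<phi> = k * pair a \<phi> + l * pair b \<phi>"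
proof -
  let ?f = "\<lambda>\<phi>. k * pair a \<phi> + l * pair b \<phi>"
  have f: "lin_functional ?f"
    unfolding lin_functional_def
  proof (intro conjI allI impI)
    fix \<phi> \<psi> :: "'d \<Rightarrow> 'f" assume s: "smooth_fun \<phi>" "smooth_fun \<psi>"
    show "?f (\<lambda>x. \<phi> x + \<psi> x) = ?f \<phi> + ?f \<psi>"
      unfolding pair_add[OF s a] pair_add[OF s b] by (simp add: algebra_simps)
  next
    fix \<phi> :: "'d \<Rightarrow> 'f" and r assume s: "smooth_fun \<phi>"
    show "?f (\<lambda>x. r * \<phi> x) = r * ?f \<phi>"
      unfolding pair_scale[OF s a] pair_scale[OF s b] by (simp add: algebra_simps)
  next
    fix \<phi> \<psi> :: "'d \<Rightarrow> 'f" assume s: "smooth_fun \<phi>" and e: "\<forall>g\<in>UU 1. \<phi> g = \<psi> g"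
    have "pair a \<phi> = pair a \<psi>" "pair b \<phi> = pair b \<psi>" using e by (auto intro!: pair_cong s a b)
    then show "?f \<phi> = ?f \<psi>" by simp
  qed
  have e: "(\<lambda>N c. k * a N c + l * b N c) = iw_of ?f"
    by (rule iw_eq_iw_of) (simp_all only: pair_ind[OF _ _ a] pair_ind[OF _ _ b]
        iw_zero_outside[OF a] iw_zero_outside[OF b] mult_zero_right add_0_right not_False_eq_True)
  show "(\<lambda>N c. k * a N c + l * b N c) \<in> carrier IW" unfolding e by (rule iw_of_closed[OF f])
  show "smooth_fun \<phi> \<Longrightarrow> pair (\<lambda>N c. k * a N c + l * b N c) \<phi> = k * pair a \<phi> + l * pair b \<phi>"
    unfolding e by (rule pair_iw_of[OF f])
qed

lemma iw_add: "a \<oplus>\<^bsub>IW\<^esub> b = (\<lambda>N c. a N c + b N c)"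
  by (simp add: iwasawa_def)

lemma iw_add_closed: "a \<in> carrier IW \<Longrightarrow> b \<in> carrier IW \<Longrightarrow> a \<oplus>\<^bsub>IW\<^esub> b \<in> carrier IW"
  using iw_linear_combination(1)[of a b 1 1] by (simp add: iw_add)

lemma pair_plus:
  "a \<in> carrier IW \<Longrightarrow> b \<in> carrier IW \<Longrightarrow> smooth_fun \<phi> \<Longrightarrow> pair (a \<oplus>\<^bsub>IW\<^esub> b) \<phi> = pair a \<phi> + pair b \<phi>"
  using iw_linear_combination(2)[of a b \<phi> 1 1] by (simp add: iw_add)

definition iw_scale :: "'f \<Rightarrow> ('d, 'f) iw \<Rightarrow> ('d, 'f) iw" where
  "iw_scale k a = (\<lambda>N c. k * a N c)"

lemma iw_scale_closed: "a \<in> carrier IW \<Longrightarrow> iw_scale k a \<in> carrier IW"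
  using iw_linear_combination(1)[of a a k 0] by (simp add: iw_scale_def)

lemma pair_iw_scale: "a \<in> carrier IW \<Longrightarrow> smooth_fun \<phi> \<Longrightarrow> pair (iw_scale k a) \<phi> = k * pair a \<phi>"
  using iw_linear_combination(2)[of a a \<phi> k 0] by (simp add: iw_scale_def)

lemma lin_functional_dirac: "g \<in> UU 1 \<Longrightarrow> lin_functional (\<lambda>\<phi>. \<phi> g)"
  by (simp add: lin_functional_def)

lemma group_elt_iw_of: "group_elt OD w g = iw_of (\<lambda>\<phi>. \<phi> g)"
  by (intro ext) (simp add: group_elt_def iw_of_def ind_def)

lemma group_elt_closed: "g \<in> UU 1 \<Longrightarrow> group_elt OD w g \<in> carrier IW"
  unfolding group_elt_iw_of by (intro iw_of_closed lin_functional_dirac)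

lemma pair_group_elt: "g \<in> UU 1 \<Longrightarrow> smooth_fun \<phi> \<Longrightarrow> pair (group_elt OD w g) \<phi> = \<phi> g"
  unfolding group_elt_iw_of using pair_iw_of[OF lin_functional_dirac] .

lemma iw_one: "\<one>\<^bsub>IW\<^esub> = group_elt OD w 1"
proof (intro ext)
  fix N c
  have "cs N 1 = N" by (auto simp: cs_def r_coset_def U1_simps)
  then have "N \<in> ON \<Longrightarrow> c \<in> rc N \<and> 1 \<in> c \<longleftrightarrow> c = N"
    using mem_coset_iff[of N c 1] cs_rc[of 1 N] ON_D(4)[of N] by auto
  then show "\<one>\<^bsub>IW\<^esub> N c = group_elt OD w 1 N c" by (auto simp: iwasawa_def group_elt_def)
qed

lemma iw_one_closed: "\<one>\<^bsub>IW\<^esub> \<in> carrier IW"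
  unfolding iw_one by (rule group_elt_closed) simp

lemma pair_one: "smooth_fun \<phi> \<Longrightarrow> pair \<one>\<^bsub>IW\<^esub> \<phi> = \<phi> 1"
  unfolding iw_one by (rule pair_group_elt) simp_all

lemma iw_zero: "\<zero>\<^bsub>IW\<^esub> = iw_scale 0 \<one>\<^bsub>IW\<^esub>"
  by (simp add: iwasawa_def iw_scale_def)

lemma iw_zero_closed: "\<zero>\<^bsub>IW\<^esub> \<in> carrier IW"
  unfolding iw_zero by (intro iw_scale_closed iw_one_closed)

lemma pair_zero: "smooth_fun \<phi> \<Longrightarrow> pair \<zero>\<^bsub>IW\<^esub> \<phi> = 0"
  unfolding iw_zero by (simp add: pair_iw_scale iw_one_closed)

lemma iw_abelian_group: "abelian_group IW"
proof (rule abelian_groupI)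
  fix a assume a: "a \<in> carrier IW"
  show "\<exists>b\<in>carrier IW. b \<oplus>\<^bsub>IW\<^esub> a = \<zero>\<^bsub>IW\<^esub>"
  proof (rule bexI)
    show "iw_scale (- 1) a \<oplus>\<^bsub>IW\<^esub> a = \<zero>\<^bsub>IW\<^esub>" by (simp add: iwasawa_def iw_scale_def)
  qed (rule iw_scale_closed[OF a])
next
  show "\<zero>\<^bsub>IW\<^esub> \<oplus>\<^bsub>IW\<^esub> a = a" for a by (simp add: iwasawa_def)
next
  show "a \<oplus>\<^bsub>IW\<^esub> b = b \<oplus>\<^bsub>IW\<^esub> a" for a b by (simp add: iwasawa_def add.commute)
next
  show "a \<oplus>\<^bsub>IW\<^esub> b \<oplus>\<^bsub>IW\<^esub> c = a \<oplus>\<^bsub>IW\<^esub> (b \<oplus>\<^bsub>IW\<^esub> c)" for a b c by (simp add: iwasawa_def add.assoc)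
qed (simp_all only: iw_add_closed iw_zero_closed)

lemma pair_pointwise_cong:
  assumes "smooth_fun \<phi>" "b \<in> carrier IW" "a \<in> carrier IW"
    and "\<And>x. x \<in> UU 1 \<Longrightarrow> pair b (\<lambda>y. \<phi> (x * y)) = f x"
  shows "pair a (\<lambda>x. pair b (\<lambda>y. \<phi> (x * y))) = pair a f"
  using pair_cong[OF smooth_pair[OF assms(1,2)] assms(3)] assms(4) .

text \<open>Elements are determined by their pairings, so associativity reduces to associativity in
  the group, and distributivity to linearity of the pairing.\<close>

lemma iw_ring: "ring IW"
proof (rule ringI)
  show "Group.monoid IW"
  proof (rule monoidI)
    fix a b c assume abc: "a \<in> carrier IW" "b \<in> carrier IW" "c \<in> carrier IW"
    show "a \<otimes>\<^bsub>IW\<^esub> b \<otimes>\<^bsub>IW\<^esub> c = a \<otimes>\<^bsub>IW\<^esub> (b \<otimes>\<^bsub>IW\<^esub> c)"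
    proof (rule IW_eqI)
      fix \<phi> :: "'d \<Rightarrow> 'f" assume s: "smooth_fun \<phi>"
      have "pair (a \<otimes>\<^bsub>IW\<^esub> (b \<otimes>\<^bsub>IW\<^esub> c)) \<phi> = pair a (\<lambda>x. pair (b \<otimes>\<^bsub>IW\<^esub> c) (\<lambda>y. \<phi> (x * y)))"
        by (intro pair_mult abc iw_mult_closed s)
      also have "\<dots> = pair a (\<lambda>x. pair b (\<lambda>y. pair c (\<lambda>z. \<phi> (x * (y * z)))))"
        by (intro pair_pointwise_cong s iw_mult_closed abc pair_mult smooth_left_translate)
      also have "\<dots> = pair a (\<lambda>x. pair b (\<lambda>y. pair c (\<lambda>z. \<phi> (x * y * z))))" by (simp only: mult.assoc)
      also have "\<dots> = pair (a \<otimes>\<^bsub>IW\<^esub> b) (\<lambda>y. pair c (\<lambda>z. \<phi> (y * z)))"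
        by (intro pair_mult[symmetric] abc smooth_pair s)
      also have "\<dots> = pair (a \<otimes>\<^bsub>IW\<^esub> b \<otimes>\<^bsub>IW\<^esub> c) \<phi>"
        by (intro pair_mult[symmetric] abc iw_mult_closed s)
      finally show "pair (a \<otimes>\<^bsub>IW\<^esub> b \<otimes>\<^bsub>IW\<^esub> c) \<phi> = pair (a \<otimes>\<^bsub>IW\<^esub> (b \<otimes>\<^bsub>IW\<^esub> c)) \<phi>" by (rule sym)
    qed (intro iw_mult_closed abc)+
  next
    fix a assume a: "a \<in> carrier IW"
    show "\<one>\<^bsub>IW\<^esub> \<otimes>\<^bsub>IW\<^esub> a = a"
    proof (rule IW_eqI)
      fix \<phi> :: "'d \<Rightarrow> 'f" assume s: "smooth_fun \<phi>"
      show "pair (\<one>\<^bsub>IW\<^esub> \<otimes>\<^bsub>IW\<^esub> a) \<phi> = pair a \<phi>"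
        by (simp add: pair_mult iw_one_closed a s pair_one smooth_pair)
    qed (intro iw_mult_closed iw_one_closed a)+
    show "a \<otimes>\<^bsub>IW\<^esub> \<one>\<^bsub>IW\<^esub> = a"
    proof (rule IW_eqI)
      fix \<phi> :: "'d \<Rightarrow> 'f" assume s: "smooth_fun \<phi>"
      have "pair (a \<otimes>\<^bsub>IW\<^esub> \<one>\<^bsub>IW\<^esub>) \<phi> = pair a (\<lambda>x. pair \<one>\<^bsub>IW\<^esub> (\<lambda>y. \<phi> (x * y)))"
        by (intro pair_mult iw_one_closed a s)
      also have "\<dots> = pair a (\<lambda>x. \<phi> x)"
        by (intro pair_pointwise_cong s iw_one_closed a) (simp add: pair_one smooth_left_translate[OF s, simplified])
      finally show "pair (a \<otimes>\<^bsub>IW\<^esub> \<one>\<^bsub>IW\<^esub>) \<phi> = pair a \<phi>" .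
    qed (intro iw_mult_closed iw_one_closed a)+
  qed (simp_all only: iw_mult_closed iw_one_closed)
next
  fix a b c assume abc: "a \<in> carrier IW" "b \<in> carrier IW" "c \<in> carrier IW"
  show "(a \<oplus>\<^bsub>IW\<^esub> b) \<otimes>\<^bsub>IW\<^esub> c = a \<otimes>\<^bsub>IW\<^esub> c \<oplus>\<^bsub>IW\<^esub> b \<otimes>\<^bsub>IW\<^esub> c"
    by (rule IW_eqI) (simp_all only: iw_mult_closed iw_add_closed abc pair_mult pair_plus smooth_pair)
  show "c \<otimes>\<^bsub>IW\<^esub> (a \<oplus>\<^bsub>IW\<^esub> b) = c \<otimes>\<^bsub>IW\<^esub> a \<oplus>\<^bsub>IW\<^esub> c \<otimes>\<^bsub>IW\<^esub> b"
  proof (rule IW_eqI)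
    fix \<phi> :: "'d \<Rightarrow> 'f" assume s: "smooth_fun \<phi>"
    have "pair (c \<otimes>\<^bsub>IW\<^esub> (a \<oplus>\<^bsub>IW\<^esub> b)) \<phi> = pair c (\<lambda>x. pair (a \<oplus>\<^bsub>IW\<^esub> b) (\<lambda>y. \<phi> (x * y)))"
      by (intro pair_mult iw_add_closed abc s)
    also have "\<dots> = pair c (\<lambda>x. pair a (\<lambda>y. \<phi> (x * y)) + pair b (\<lambda>y. \<phi> (x * y)))"
      by (intro pair_pointwise_cong s iw_add_closed abc pair_plus smooth_left_translate)
    also have "\<dots> = pair c (\<lambda>x. pair a (\<lambda>y. \<phi> (x * y))) + pair c (\<lambda>x. pair b (\<lambda>y. \<phi> (x * y)))"
      by (intro pair_add smooth_pair s abc)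
    also have "\<dots> = pair (c \<otimes>\<^bsub>IW\<^esub> a \<oplus>\<^bsub>IW\<^esub> c \<otimes>\<^bsub>IW\<^esub> b) \<phi>"
      by (simp only: iw_mult_closed abc pair_mult pair_plus s)
    finally show "pair (c \<otimes>\<^bsub>IW\<^esub> (a \<oplus>\<^bsub>IW\<^esub> b)) \<phi> = pair (c \<otimes>\<^bsub>IW\<^esub> a \<oplus>\<^bsub>IW\<^esub> c \<otimes>\<^bsub>IW\<^esub> b) \<phi>" .
  qed (simp_all only: iw_mult_closed iw_add_closed abc)
qed (rule iw_abelian_group)

definition aug :: "('d, 'f) iw \<Rightarrow> 'f" where
  "aug a = pair a (\<lambda>x. 1)"

definition I0 :: "('d, 'f) iw set" where
  "I0 = {a \<in> carrier IW. aug a = 0}"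

lemma pair_const: "a \<in> carrier IW \<Longrightarrow> pair a (\<lambda>x. k) = k * aug a"
  using pair_scale[OF smooth_const, of a k 1] by (simp add: aug_def)

lemma aug_mult: "a \<in> carrier IW \<Longrightarrow> b \<in> carrier IW \<Longrightarrow> aug (a \<otimes>\<^bsub>IW\<^esub> b) = aug a * aug b"
  using pair_mult[of a b "\<lambda>x. 1"] smooth_const pair_const[of a "aug b"] by (simp add: aug_def)

lemma aug_add: "a \<in> carrier IW \<Longrightarrow> b \<in> carrier IW \<Longrightarrow> aug (a \<oplus>\<^bsub>IW\<^esub> b) = aug a + aug b"
  using pair_plus smooth_const by (simp add: aug_def)

lemma aug_one: "aug \<one>\<^bsub>IW\<^esub> = 1"
  using pair_one smooth_const by (simp add: aug_def)

lemma aug_scale: "a \<in> carrier IW \<Longrightarrow> aug (iw_scale k a) = k * aug a"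
  using pair_iw_scale smooth_const by (simp add: aug_def)

lemma iw_a_inv:
  assumes a: "a \<in> carrier IW" shows "\<ominus>\<^bsub>IW\<^esub> a = iw_scale (- 1) a"
proof (rule abelian_group.minus_equality[OF iw_abelian_group _ a iw_scale_closed[OF a]])
  show "iw_scale (- 1) a \<oplus>\<^bsub>IW\<^esub> a = \<zero>\<^bsub>IW\<^esub>" by (simp add: iwasawa_def iw_scale_def)
qed

lemma I0_ideal: "ideal I0 IW"
proof (rule idealI[OF iw_ring])
  show "subgroup I0 (add_monoid IW)"
  proof (rule group.subgroupI[OF abelian_group.a_group[OF iw_abelian_group]])
    show "I0 \<noteq> {}" using iw_zero_closed pair_zero[OF smooth_const] by (auto simp: I0_def aug_def)
    show "inv\<^bsub>add_monoid IW\<^esub> a \<in> I0" if "a \<in> I0" for a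
      using that iw_a_inv[of a] unfolding a_inv_def I0_def by (simp add: iw_scale_closed aug_scale)
  qed (auto simp: I0_def iw_add_closed aug_add)
qed (auto simp: I0_def iw_mult_closed aug_mult)

section \<open>The augmentation ideal\<close>
definition supp :: "('d \<Rightarrow> 'f) \<Rightarrow> bool" where
  "supp \<phi> \<longleftrightarrow> (\<forall>g. g \<notin> UU 1 \<longrightarrow> \<phi> g = 0)"

definition rmul :: "('d, 'f) iw \<Rightarrow> ('d \<Rightarrow> 'f) \<Rightarrow> 'd \<Rightarrow> 'f" where
  "rmul a \<phi> = (\<lambda>g. if g \<in> UU 1 then pair a (\<lambda>y. \<phi> (g * y)) else 0)"

text \<open>The support condition fixes the meaningless values outside \<open>UU 1\<close>. This
  makes the set finite and lets equality of functions be tested on \<open>UU 1\<close>.\<close>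

definition VN :: "'d set \<Rightarrow> ('d \<Rightarrow> 'f) set" where
  "VN N = {\<phi>. lc N \<phi> \<and> supp \<phi>}"

lemma VN_smooth: "N \<in> ON \<Longrightarrow> \<phi> \<in> VN N \<Longrightarrow> smooth_fun \<phi>"
  by (auto simp: VN_def smooth_fun_def)

lemma finite_VN: assumes N: "N \<in> ON" shows "finite (VN N)"
proof -
  let ?h = "\<lambda>h g. if g \<in> UU 1 then h (cs N g) else (0 :: 'f)"
  have "VN N \<subseteq> ?h ` (rc N \<rightarrow>\<^sub>E UNIV)"
  proof
    fix \<phi> assume p: "\<phi> \<in> VN N"
    have "\<phi> = ?h (restrict (\<lambda>c. \<phi> (rep c)) (rc N))"
    proof
      fix g show "\<phi> g = ?h (restrict (\<lambda>c. \<phi> (rep c)) (rc N)) g"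
        using p lc_rep[OF N, of \<phi> g] cs_rc[of g N] by (auto simp: VN_def supp_def)
    qed
    then show "\<phi> \<in> ?h ` (rc N \<rightarrow>\<^sub>E UNIV)"
      by (rule image_eqI[where f = ?h]) (simp only: restrict_PiE_iff, simp)
  qed
  moreover have "finite (rc N \<rightarrow>\<^sub>E (UNIV :: 'f set))" using finite_rc[OF N] by (intro finite_PiE) simp_all
  ultimately show ?thesis using finite_surj by blast
qed

lemma rmul_VN:
  assumes "N \<in> ON" "a \<in> carrier IW" "\<phi> \<in> VN N" shows "rmul a \<phi> \<in> VN N"
proof -
  have "lc N (\<lambda>x. pair a (\<lambda>y. \<phi> (x * y)))" using lc_pair assms by (simp add: VN_def)
  then have "lc N (rmul a \<phi>)" by (rule lc_cong[OF assms(1)]) (simp add: rmul_def)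
  then show ?thesis by (simp add: VN_def supp_def rmul_def)
qed

lemma VN_diff: "\<phi> \<in> VN N \<Longrightarrow> \<psi> \<in> VN N \<Longrightarrow> \<phi> - \<psi> \<in> VN N"
  by (simp add: VN_def lc_def supp_def)

lemma rmul_diff:
  assumes "smooth_fun \<phi>" "smooth_fun \<psi>" "a \<in> carrier IW"
  shows "rmul a (\<phi> - \<psi>) = rmul a \<phi> - rmul a \<psi>"
  using pair_diff[OF smooth_left_translate[OF assms(1)] smooth_left_translate[OF assms(2)] assms(3)]
  by (intro ext) (simp add: rmul_def)

text \<open>The kernel of convolution by \<open>a\<close> is stable under translation, so if it were nonzero, it would
  contain a nonzero constant, on which convolution acts by the augmentation of \<open>a\<close>.\<close>

lemma rmul_injective:
  assumes N: "N \<in> ON" and a: "a \<in> carrier IW" and aug: "aug a \<noteq> 0"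
    and \<phi>: "\<phi> \<in> VN N" "rmul a \<phi> = 0"
  shows "\<phi> = 0"
proof (rule ccontr)
  assume nz: "\<phi> \<noteq> 0"
  define W where "W = {\<phi> \<in> VN N. rmul a \<phi> = 0}"
  define \<rho> where "\<rho> h \<phi> = (\<lambda>g. if g \<in> UU 1 then \<phi> (inverse h * g) else (0 :: 'f))" for h and \<phi> :: "'d \<Rightarrow> 'f"
  obtain m where m: "m \<ge> 1" "UU m \<subseteq> N" using ON_D(9)[OF N] by blast
  have iu: "inverse h * g \<in> UU 1" if "h \<in> UU 1" "g \<in> UU 1" for h g
    using that UU1_inverse UU_mult by blast
  have "\<exists>v\<in>W. v \<noteq> 0 \<and> (\<forall>g\<in>UU 1. \<rho> g v = v)"
  proof (rule nonzero_fixed_vector[of \<rho> W \<phi> m])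
    show "\<rho> g (x + y) = \<rho> g x + \<rho> g y" for g x y by (intro ext) (simp add: \<rho>_def)
    show "\<rho> (g * h) v = \<rho> g (\<rho> h v)" if "g \<in> UU 1" "h \<in> UU 1" for g h v
      using that iu by (intro ext) (simp add: \<rho>_def UU1_inverse_mult[OF that] mult.assoc)
    show "nscale p v = 0" for v :: "'d \<Rightarrow> 'f" by simp
    show "\<rho> h v \<in> W" if h: "h \<in> UU 1" and v: "v \<in> W" for h v
    proof -
      have v': "lc N v" "rmul a v = 0" "smooth_fun v" using v VN_smooth[OF N] by (auto simp: W_def VN_def)
      have hi: "inverse h \<in> UU 1" using UU1_inverse[OF h] .
      have "lc N (\<rho> h v)"
        by (rule lc_cong[OF N lc_left_translate[OF N v'(1) hi]]) (simp add: \<rho>_def)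
      then have V: "\<rho> h v \<in> VN N" by (simp add: VN_def supp_def \<rho>_def)
      have "rmul a (\<rho> h v) g = 0" for g
      proof (cases "g \<in> UU 1")
        case g: True
        have "pair a (\<lambda>y. \<rho> h v (g * y)) = pair a (\<lambda>y. v (inverse h * g * y))"
          using UU_mult[OF g] by (intro pair_cong[OF _ a] smooth_left_translate[OF VN_smooth[OF N V] g])
            (simp add: \<rho>_def mult.assoc)
        also have "\<dots> = rmul a v (inverse h * g)" using iu[OF h g] by (simp add: rmul_def)
        also have "\<dots> = 0" unfolding v'(2) by simp
        finally show ?thesis by (simp add: rmul_def)
      qed (simp add: rmul_def)
      then have "rmul a (\<rho> h v) = 0" by (intro ext) simp
      then show ?thesis using V by (simp add: W_def)
    qed
    show "v - u \<in> W" if "v \<in> W" "u \<in> W" for v u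
      using that VN_diff rmul_diff[OF VN_smooth[OF N] VN_smooth[OF N] a] by (simp add: W_def)
    show "\<phi> \<in> W" using \<phi> by (simp add: W_def)
    show "\<rho> g \<phi> = \<phi>" if "g \<in> UU m" for g
    proof -
      have "inverse g \<in> N" using UU_inverse[OF m(1) that] m(2) by blast
      then show ?thesis using \<phi>(1) by (intro ext) (simp add: \<rho>_def VN_def lc_def supp_def)
    qed
  qed (use nz m in simp_all)
  then obtain v where v: "v \<in> W" "v \<noteq> 0" "\<And>g. g \<in> UU 1 \<Longrightarrow> \<rho> g v = v" by blast
  have c: "v h = v 1" if h: "h \<in> UU 1" for h
    using fun_cong[OF v(3)[OF h], of h] h UU1_inv_simps(2)[OF h] by (simp add: \<rho>_def)
  have "v 1 \<noteq> 0"
  proof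
    assume "v 1 = 0"
    then have "v g = 0" for g using c[of g] v(1) by (cases "g \<in> UU 1") (auto simp: W_def VN_def supp_def)
    then show False using v(2) by (simp add: fun_eq_iff)
  qed
  have "rmul a v 1 = pair a v" by (simp add: rmul_def)
  also have "\<dots> = pair a (\<lambda>x. v 1)"
  proof (rule pair_cong[OF _ a])
    show "smooth_fun v" using v(1) VN_smooth[OF N] by (simp add: W_def)
  qed (rule c)
  also have "\<dots> = v 1 * aug a" by (rule pair_const[OF a])
  finally show False using v(1) \<open>v 1 \<noteq> 0\<close> aug by (simp add: W_def)
qed

text \<open>Convolution by \<open>a\<close> is an injective map of the finite set
  \<open>VN N\<close> into itself; finiteness rests on that of the coefficient field.\<close>

lemma rmul_surjective:
  assumes N: "N \<in> ON" and a: "a \<in> carrier IW" and aug: "aug a \<noteq> 0" and \<phi>: "\<phi> \<in> VN N"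
  shows "\<exists>\<psi>\<in>VN N. rmul a \<psi> = \<phi>"
proof -
  have "inj_on (rmul a) (VN N)"
  proof (rule inj_onI)
    fix \<phi> \<psi> assume v: "\<phi> \<in> VN N" "\<psi> \<in> VN N" "rmul a \<phi> = rmul a \<psi>"
    then have "\<phi> - \<psi> = 0"
      using rmul_diff[OF VN_smooth[OF N] VN_smooth[OF N] a]
      by (intro rmul_injective[OF N a aug VN_diff]) simp_all
    then show "\<phi> = \<psi>" by simp
  qed
  then have "rmul a ` VN N = VN N"
    using endo_inj_surj[OF finite_VN[OF N]] rmul_VN[OF N a] by blast
  then have "\<phi> \<in> rmul a ` VN N" using \<phi> by simp
  then show ?thesis by (elim imageE) (intro bexI, rule sym)
qed

text \<open>Convolution by \<open>a\<close> can be inverted on locally constant functions. The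
  functional which evaluates the unique solution at \<open>1\<close> is an element of the Iwasawa
  algebra, and it is the inverse.\<close>

lemma iw_right_inverse:
  assumes a: "a \<in> carrier IW" and aug: "aug a \<noteq> 0"
  shows "\<exists>b\<in>carrier IW. a \<otimes>\<^bsub>IW\<^esub> b = \<one>\<^bsub>IW\<^esub>"
proof -
  define sol where "sol \<phi> \<psi> \<longleftrightarrow> smooth_fun \<psi> \<and> supp \<psi> \<and> (\<forall>g\<in>UU 1. pair a (\<lambda>y. \<psi> (g * y)) = \<phi> g)" for \<phi> \<psi>
  have ex: "\<exists>\<psi>. sol \<phi> \<psi>" if s: "smooth_fun \<phi>" for \<phi>
  proof -
    obtain N where N: "N \<in> ON" "lc N \<phi>" using s by (auto simp: smooth_fun_def)
    let ?\<phi> = "\<lambda>g. if g \<in> UU 1 then \<phi> g else 0"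
    have "lc N ?\<phi>" by (rule lc_cong[OF N]) simp
    then have "?\<phi> \<in> VN N" by (simp add: VN_def supp_def)
    then obtain \<psi> where \<psi>: "\<psi> \<in> VN N" "rmul a \<psi> = ?\<phi>" using rmul_surjective[OF N(1) a aug] by blast
    have "pair a (\<lambda>y. \<psi> (g * y)) = \<phi> g" if "g \<in> UU 1" for g
      using fun_cong[OF \<psi>(2), of g] that by (simp add: rmul_def)
    then show ?thesis using \<psi>(1) VN_smooth[OF N(1)] by (auto simp: sol_def VN_def)
  qed
  have uniq: "\<psi>1 = \<psi>2" if s: "sol \<phi> \<psi>1" "sol \<phi> \<psi>2" for \<phi> \<psi>1 \<psi>2
  proof -
    obtain N where N: "N \<in> ON" "lc N \<psi>1" "lc N \<psi>2" using smooth_common[of \<psi>1 \<psi>2] s by (auto simp: sol_def)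
    then have V: "\<psi>1 \<in> VN N" "\<psi>2 \<in> VN N" using s by (simp_all add: VN_def sol_def)
    have "rmul a \<psi>1 = rmul a \<psi>2" using s by (intro ext) (simp add: rmul_def sol_def)
    then have "\<psi>1 - \<psi>2 = 0"
      using rmul_diff[OF VN_smooth[OF N(1)] VN_smooth[OF N(1)] a, of \<psi>1 \<psi>2] V
      by (intro rmul_injective[OF N(1) a aug VN_diff[OF V]]) simp
    then show ?thesis by simp
  qed
  define S where "S \<phi> = (THE \<psi>. sol \<phi> \<psi>)" for \<phi>
  have S_eq: "S \<phi> = \<psi>" if "sol \<phi> \<psi>" for \<phi> \<psi>
    unfolding S_def using that uniq by (intro the_equality)
  have S_sol: "sol \<phi> (S \<phi>)" if "smooth_fun \<phi>" for \<phi>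
    using ex[OF that] S_eq by metis
  have sD: "smooth_fun \<psi>" "supp \<psi>" "\<And>g. g \<in> UU 1 \<Longrightarrow> pair a (\<lambda>y. \<psi> (g * y)) = \<phi> g" if "sol \<phi> \<psi>" for \<phi> \<psi>
    using that by (simp_all add: sol_def)
  let ?f = "\<lambda>\<phi>. S \<phi> 1"
  have f: "lin_functional ?f"
    unfolding lin_functional_def
  proof (intro conjI allI impI)
    fix \<phi> \<psi> :: "'d \<Rightarrow> 'f" assume s: "smooth_fun \<phi>" "smooth_fun \<psi>"
    note 1 = sD[OF S_sol[OF s(1)]] and 2 = sD[OF S_sol[OF s(2)]]
    have "sol (\<lambda>x. \<phi> x + \<psi> x) (\<lambda>x. S \<phi> x + S \<psi> x)"
      using 1 2 pair_add[OF smooth_left_translate[OF 1(1)] smooth_left_translate[OF 2(1)] a]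
      by (auto simp: sol_def supp_def smooth_add)
    from S_eq[OF this] show "S (\<lambda>x. \<phi> x + \<psi> x) 1 = S \<phi> 1 + S \<psi> 1" by simp
  next
    fix \<phi> :: "'d \<Rightarrow> 'f" and k assume s: "smooth_fun \<phi>"
    note 1 = sD[OF S_sol[OF s]]
    have "sol (\<lambda>x. k * \<phi> x) (\<lambda>x. k * S \<phi> x)"
      using 1 pair_scale[OF smooth_left_translate[OF 1(1)] a]
      by (auto simp: sol_def supp_def smooth_scale)
    from S_eq[OF this] show "S (\<lambda>x. k * \<phi> x) 1 = k * S \<phi> 1" by simp
  next
    fix \<phi> \<psi> :: "'d \<Rightarrow> 'f" assume s: "smooth_fun \<phi>" and e: "\<forall>g\<in>UU 1. \<phi> g = \<psi> g"
    have "sol \<psi> (S \<phi>)" using S_sol[OF s] e by (simp add: sol_def)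
    from S_eq[OF this] show "S \<phi> 1 = S \<psi> 1" by simp
  qed
  define b where "b = iw_of ?f"
  have b: "b \<in> carrier IW" unfolding b_def by (rule iw_of_closed[OF f])
  have "a \<otimes>\<^bsub>IW\<^esub> b = \<one>\<^bsub>IW\<^esub>"
  proof (rule IW_eqI)
    fix \<phi> :: "'d \<Rightarrow> 'f" assume s: "smooth_fun \<phi>"
    note 1 = sD[OF S_sol[OF s]]
    have "pair (a \<otimes>\<^bsub>IW\<^esub> b) \<phi> = pair a (\<lambda>x. pair b (\<lambda>y. \<phi> (x * y)))" by (rule pair_mult[OF a b s])
    also have "\<dots> = pair a (S \<phi>)"
    proof (rule pair_pointwise_cong[OF s b a])
      fix x assume x: "x \<in> UU 1"
      have "pair b (\<lambda>y. \<phi> (x * y)) = S (\<lambda>y. \<phi> (x * y)) 1"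
        unfolding b_def by (rule pair_iw_of[OF f smooth_left_translate[OF s x]])
      also have "S (\<lambda>y. \<phi> (x * y)) = (\<lambda>g. if g \<in> UU 1 then S \<phi> (x * g) else 0)" (is "_ = ?t")
      proof (rule S_eq)
        have st: "smooth_fun ?t" by (rule smooth_cong[OF smooth_left_translate[OF 1(1) x]]) simp
        have "pair a (\<lambda>y. ?t (g * y)) = \<phi> (x * g)" if g: "g \<in> UU 1" for g
        proof -
          have "pair a (\<lambda>y. ?t (g * y)) = pair a (\<lambda>y. S \<phi> (x * g * y))"
            by (intro pair_cong[OF _ a] smooth_left_translate[OF st g]) (simp add: UU_mult[OF g, simplified] mult.assoc)
          also have "\<dots> = \<phi> (x * g)" using 1(3) UU_mult[OF x g] by blast
          finally show ?thesis .
        qed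
        then show "sol (\<lambda>y. \<phi> (x * y)) ?t" using st by (simp add: sol_def supp_def)
      qed
      finally show "pair b (\<lambda>y. \<phi> (x * y)) = S \<phi> x" by simp
    qed
    also have "\<dots> = \<phi> 1" using 1(3)[of 1] by simp
    also have "\<dots> = pair \<one>\<^bsub>IW\<^esub> \<phi>" by (rule pair_one[OF s, symmetric])
    finally show "pair (a \<otimes>\<^bsub>IW\<^esub> b) \<phi> = pair \<one>\<^bsub>IW\<^esub> \<phi>" .
  qed (intro iw_mult_closed iw_one_closed a b)+
  then show ?thesis using b by blast
qed

lemma one_notin_I0: "\<one>\<^bsub>IW\<^esub> \<notin> I0"
  by (simp add: I0_def aug_one)

lemma iw_scale_eq_mult:
  "a \<in> carrier IW \<Longrightarrow> iw_scale k a = iw_scale k \<one>\<^bsub>IW\<^esub> \<otimes>\<^bsub>IW\<^esub> a"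
  by (rule IW_eqI) (simp_all add: iw_scale_closed iw_mult_closed iw_one_closed pair_mult pair_iw_scale pair_one smooth_pair)

lemma I0_maximal: "maximalideal I0 IW"
proof (rule maximalidealI[OF I0_ideal])
  show "carrier IW \<noteq> I0" using one_notin_I0 iw_one_closed by blast
  fix J assume J: "ideal J IW" "I0 \<subseteq> J" "J \<subseteq> carrier IW"
  show "J = I0 \<or> J = carrier IW"
  proof (cases "J \<subseteq> I0")
    case False
    then obtain a where a: "a \<in> J" "aug a \<noteq> 0" "a \<in> carrier IW" using J by (auto simp: I0_def)
    obtain b where b: "b \<in> carrier IW" "a \<otimes>\<^bsub>IW\<^esub> b = \<one>\<^bsub>IW\<^esub>" using iw_right_inverse a by blast
    have "\<one>\<^bsub>IW\<^esub> \<in> J" using ideal.I_r_closed[OF J(1) a(1) b(1)] b(2) by simp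
    then show ?thesis using ideal.one_imp_carrier[OF J(1)] by blast
  qed (use J in blast)
qed

text \<open>An element of nonzero augmentation has a right inverse, hence lies in no proper ideal.
  So \<open>I0\<close> contains every proper ideal, and the definite description in
  \<open>max_ideal\<close> has a unique referent.\<close>

lemma max_ideal_eq: "max_ideal OD w = I0"
  unfolding max_ideal_def
proof (rule the_equality)
  show "maximalideal I0 IW" by (rule I0_maximal)
  fix I assume I: "maximalideal I IW"
  then have i: "ideal I IW" by (rule maximalideal.axioms(1))
  have sub: "I \<subseteq> carrier IW" using ideal.Icarr[OF i] by blast
  have "I \<subseteq> I0"
  proof
    fix a assume a: "a \<in> I"
    show "a \<in> I0"
    proof (rule ccontr)
      assume "a \<notin> I0"
      then have ac: "a \<in> carrier IW" "aug a \<noteq> 0" using a sub by (auto simp: I0_def)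
      obtain b where b: "b \<in> carrier IW" "a \<otimes>\<^bsub>IW\<^esub> b = \<one>\<^bsub>IW\<^esub>" using iw_right_inverse[OF ac] by blast
      have "\<one>\<^bsub>IW\<^esub> \<in> I" using ideal.I_r_closed[OF i a b(1)] b(2) by simp
      then show False using ideal.one_imp_carrier[OF i] maximalideal.I_notcarr[OF I] by blast
    qed
  qed
  moreover have "I0 \<subseteq> carrier IW" "I0 \<noteq> carrier IW"
    using one_notin_I0 iw_one_closed by (auto simp: I0_def)
  ultimately show "I = I0" using maximalideal.I_maximal[OF I I0_ideal] by blast
qed

end

section \<open>Powers of y and z in the graded Iwasawa algebra\<close>

text \<open>For \<open>y \<noteq> 0\<close> the sum factors as \<open>(1 + z) * y\<close> with
  \<open>z = x * inverse y\<close> commuting with \<open>y\<close>, which reduces the claim to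
  \<open>one_plus_power\<close>.\<close>

lemma division_ring_binomial:
  fixes x y :: "'a::division_ring"
  assumes c: "x * y = y * x"
  shows "(x + y) ^ n = (\<Sum>k\<le>n. of_nat (n choose k) * x ^ k * y ^ (n - k))"
proof (cases "y = 0")
  case True
  have "(\<Sum>k\<le>n. of_nat (n choose k) * x ^ k * y ^ (n - k)) = (\<Sum>k\<le>n. if k = n then x ^ n else 0)"
    using True by (intro sum.cong) (auto simp: power_0_left)
  then show ?thesis using True by simp
next
  case y: False
  define z where "z = x * inverse y"
  have zy: "z * y = x" using y by (simp add: z_def mult.assoc)
  have yz: "y * z = x" unfolding z_def using c y by (metis mult.assoc mult.right_neutral right_inverse)
  have zy': "z * y = y * z" using zy yz by simp
  have "(x + y) ^ n = ((1 + z) * y) ^ n" by (simp add: distrib_right zy add.commute)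
  also have "\<dots> = (1 + z) ^ n * y ^ n" by (rule commuting_power_mult) (simp add: distrib_left distrib_right zy')
  also have "\<dots> = (\<Sum>k\<le>n. of_nat (n choose k) * z ^ k * y ^ n)"
    by (simp add: one_plus_power sum_distrib_right)
  also have "\<dots> = (\<Sum>k\<le>n. of_nat (n choose k) * x ^ k * y ^ (n - k))"
  proof (rule sum.cong[OF refl])
    fix k assume "k \<in> {..n}"
    then have "y ^ n = y ^ k * y ^ (n - k)" by (simp flip: power_add)
    moreover have "x ^ k = z ^ k * y ^ k" using commuting_power_mult[OF zy', of k] zy by simp
    ultimately show "of_nat (n choose k) * z ^ k * y ^ n = of_nat (n choose k) * x ^ k * y ^ (n - k)"
      by (simp add: mult.assoc)
  qed
  finally show ?thesis .
qed

context quaternion_setup_ge5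
begin

section \<open>Teichmueller digits of group elements and the Witt carry\<close>

lemma cg_w_cancel: "cg (m + n) (w ^ m * x) (w ^ m * y) \<Longrightarrow> cg n x y"
proof (elim cgE)
  fix z assume z: "z \<in> OD" "w ^ m * x = w ^ m * y + w ^ (m + n) * z"
  have "w ^ m * x = w ^ m * (y + w ^ n * z)" using z(2) by (simp add: power_add distrib_left mult.assoc)
  then have "x = y + w ^ n * z" by simp
  then show "cg n x y" using z(1) by (intro cgI)
qed

lemma cg_add_cancel: "cg n (x + y) (x + z) \<Longrightarrow> cg n y z"
  using cg_diff[of n "x + y" "x + z" x x] by simp

text \<open>The first carry in the addition of Witt vectors: the divided form of
  \<open>a\<^sup>p + b\<^sup>p - (a + b)\<^sup>p\<close>, evaluated at \<open>p\<close>-th roots. In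
  a field with \<open>p\<^sup>2\<close> elements the \<open>p\<close>-th root is the
  \<open>p\<close>-th power, hence the inner exponents.\<close>

definition kappa :: "'q \<Rightarrow> 'q \<Rightarrow> 'q" where
  "kappa a b = - (\<Sum>k\<in>{1..<p}. of_nat ((p choose k) div p) * (a ^ p) ^ k * (b ^ p) ^ (p - k))"

lemma p_dvd_choose: "k \<in> {1..<p} \<Longrightarrow> p * ((p choose k) div p) = p choose k"
  using dvd_choose_prime[of k p] p_prime by auto

lemma of_nat_p_w: "of_nat p = w ^ 2" by (simp add: w_square)

lemma cg_sum: "(\<And>i. i \<in> A \<Longrightarrow> cg n (f i) (g i)) \<Longrightarrow> cg n (sum f A) (sum g A)"
  by (induction A rule: infinite_finite_induct) (auto intro: cg_add)

text \<open>The \<open>p\<close>-th power of \<open>tau s + tau t\<close>, with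
  \<open>s = a\<^sup>p\<close> and \<open>t = b\<^sup>p\<close>, is computed twice. Since the sum
  agrees with \<open>tau (s + t)\<close> modulo \<open>p\<close>, its \<open>p\<close>-th power
  agrees with \<open>tau (a + b)\<close> modulo \<open>p\<^sup>2\<close>; direct expansion gives
  \<open>tau a + tau b\<close> and the multiples of \<open>p\<close> that form
  \<open>kappa\<close>.\<close>

lemma tau_add_kappa: "cg 3 (tau a + tau b) (tau (a + b) + w ^ 2 * tau (kappa a b))"
proof -
  define s t where "s = a ^ p" and "t = b ^ p"
  have sp: "s ^ p = a" "t ^ p = b" by (simp_all add: s_def t_def q_frob_frob)
  obtain z where z: "z \<in> OD" "tau s + tau t = tau (s + t) + w * w * z" using tau_add_cong .
  let ?u = "tau (s + t)"
  have "?u * (tau s + tau t) = (tau s + tau t) * ?u" by (simp add: distrib_left distrib_right tau_commute)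
  then have "?u * (w * w * z) = w * w * z * ?u" unfolding z(2) by (simp add: distrib_left distrib_right)
  then have comm: "(w * w * z) * ?u = ?u * (w * w * z)" by simp
  have S: "cg 4 ((tau s + tau t) ^ p) (?u ^ p)"
  proof -
    let ?r = "w * w * z"
    have "(tau s + tau t) ^ p = (?r + ?u) ^ p" unfolding z(2) by (simp add: add.commute)
    also have "\<dots> = (\<Sum>k\<le>p. of_nat (p choose k) * ?r ^ k * ?u ^ (p - k))"
      by (rule division_ring_binomial[OF comm])
    also have "{..p} = insert 0 {1..p}" by auto
    also have "(\<Sum>k\<in>insert 0 {1..p}. of_nat (p choose k) * ?r ^ k * ?u ^ (p - k)) =
        ?u ^ p + (\<Sum>k\<in>{1..p}. of_nat (p choose k) * ?r ^ k * ?u ^ (p - k))" by simp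
    also have "cg 4 \<dots> (?u ^ p + (\<Sum>k\<in>{1..p}. 0))"
    proof (intro cg_add cg_sum cg_refl)
      fix k assume k: "k \<in> {1..p}"
      have rk: "?r ^ k = w ^ (2 * k) * z ^ k"
      proof -
        have "(w * w) * z = z * (w * w)" by (rule ww_commute[symmetric])
        from commuting_power_mult[OF this, of k] show ?thesis by (simp add: power_mult power2_eq_square)
      qed
      have zk: "z ^ k \<in> OD" using z by (rule_tac OD_power)
      show "cg 4 (of_nat (p choose k) * ?r ^ k * ?u ^ (p - k)) 0"
      proof (cases "k = 1")
        case True
        have "of_nat (p choose k) * ?r ^ k * ?u ^ (p - k) = w ^ 4 * (z * ?u ^ (p - 1))"
          unfolding True using of_nat_p_w by (simp add: mult.assoc[symmetric] power_numeral_reduce)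
        then show ?thesis using cg_w_power[of 4 4 "z * ?u ^ (p - 1)"] z by (simp add: OD_mult OD_power)
      next
        case False
        then have "4 \<le> 2 * k" using k by simp
        then have "cg 4 (?r ^ k * ?u ^ (p - k)) 0"
          unfolding rk by (subst mult.assoc) (use zk z in \<open>intro cg_w_power OD_mult OD_power; simp\<close>)
        from cg_mult_left[OF this, of "of_nat (p choose k)"] show ?thesis by (simp add: mult.assoc)
      qed
    qed
    finally show ?thesis by simp
  qed
  have T: "(tau s + tau t) ^ p = tau a + tau b + w ^ 2 * (\<Sum>k\<in>{1..<p}. of_nat ((p choose k) div p) * tau (s ^ k * t ^ (p - k)))"
  proof -
    have "(tau s + tau t) ^ p = (\<Sum>k\<le>p. of_nat (p choose k) * tau s ^ k * tau t ^ (p - k))"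
      by (rule division_ring_binomial[OF tau_commute])
    also have "{..p} = insert 0 (insert p {1..<p})" using p_gt_1 by auto
    also have "(\<Sum>k\<in>insert 0 (insert p {1..<p}). of_nat (p choose k) * tau s ^ k * tau t ^ (p - k)) =
        tau t ^ p + (tau s ^ p + (\<Sum>k\<in>{1..<p}. of_nat (p choose k) * tau s ^ k * tau t ^ (p - k)))"
      using p_gt_1 by simp
    also have "(\<Sum>k\<in>{1..<p}. of_nat (p choose k) * tau s ^ k * tau t ^ (p - k)) =
        w ^ 2 * (\<Sum>k\<in>{1..<p}. of_nat ((p choose k) div p) * tau (s ^ k * t ^ (p - k)))"
      unfolding sum_distrib_left
    proof (rule sum.cong[OF refl])
      fix k assume "k \<in> {1..<p}"
      then have "(of_nat (p choose k) :: 'd) = of_nat p * of_nat ((p choose k) div p)"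
        using p_dvd_choose by (metis of_nat_mult)
      then show "of_nat (p choose k) * tau s ^ k * tau t ^ (p - k) =
          w ^ 2 * (of_nat ((p choose k) div p) * tau (s ^ k * t ^ (p - k)))"
        by (simp add: of_nat_p_w tau_mult tau_power mult.assoc)
    qed
    also have "tau s ^ p = tau a" by (simp add: sp flip: tau_power)
    also have "tau t ^ p = tau b" by (simp add: sp flip: tau_power)
    finally show ?thesis by (simp add: add_ac)
  qed
  have U: "?u ^ p = tau (a + b)" by (simp add: q_frob_add sp flip: tau_power)
  have K: "cg (2 + 1) (w ^ 2 * (\<Sum>k\<in>{1..<p}. of_nat ((p choose k) div p) * tau (s ^ k * t ^ (p - k)))) (w ^ 2 * (- tau (kappa a b)))"
  proof (rule cg_w_mult)
    have "res (\<Sum>k\<in>{1..<p}. of_nat ((p choose k) div p) * tau (s ^ k * t ^ (p - k))) = - kappa a b"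
      by (simp add: res_sum OD_mult res_mult kappa_def s_def t_def mult.assoc)
    then show "cg 1 (\<Sum>k\<in>{1..<p}. of_nat ((p choose k) div p) * tau (s ^ k * t ^ (p - k))) (- tau (kappa a b))"
      by (simp add: cg_1_iff cg_Suc_0_iff OD_sum OD_mult OD_uminus res_uminus)
  qed
  have "cg 3 (tau a + tau b + w ^ 2 * (\<Sum>k\<in>{1..<p}. of_nat ((p choose k) div p) * tau (s ^ k * t ^ (p - k)))) (tau (a + b))"
    using cg_mono[OF S, of 3] unfolding T U by simp
  from cg_diff[OF this K[simplified]] show ?thesis by simp
qed

lemma kappa_frob: "kappa a b ^ p = - (\<Sum>k\<in>{1..<p}. of_nat ((p choose k) div p) * a ^ k * b ^ (p - k))"
proof -
  have odd: "odd p" using p_ge_5 p_prime prime_odd_nat by auto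
  have "(\<Sum>k\<in>A. f k) ^ p = (\<Sum>k\<in>A. f k ^ p)" for f :: "nat \<Rightarrow> 'q" and A
    using p_gt_1 by (induction A rule: infinite_finite_induct) (simp_all add: q_frob_add)
  moreover have "((x ^ p) ^ k) ^ p = (x :: 'q) ^ k" for x k
    by (metis mult.commute power_mult q_frob_frob)
  ultimately show ?thesis
    unfolding kappa_def by (simp add: odd power_mult_distrib q_of_nat_frob)
qed

lemma kappa_zero: "kappa 0 b = 0"
  unfolding kappa_def using p_gt_1 by (simp add: power_0_left)

text \<open>The first three Teichmueller digits of an element of \<open>UU 1\<close>. The third one
  will supply the test function for the \<open>p\<close>-th power of \<open>Y\<close>.\<close>

definition dg :: "'d \<Rightarrow> 'q \<Rightarrow> 'q \<Rightarrow> 'q \<Rightarrow> bool" where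
  "dg g a b c \<longleftrightarrow> cg 4 g (1 + w * tau a + w ^ 2 * tau b + w ^ 3 * tau c)"

lemma dg_exists:
  assumes "g \<in> UU 1" obtains a b c where "dg g a b c"
proof -
  obtain x where x: "x \<in> OD" "g = 1 + w ^ 1 * x" using assms UU_iff cgE by blast
  have split: "\<exists>c y. y \<in> OD \<and> x = tau c + w * y" if "x \<in> OD" for x
    using cg_tau_res[OF that] by (elim cgE) (metis power_one_right)
  obtain a y where a: "y \<in> OD" "x = tau a + w * y" using split[OF x(1)] by blast
  obtain b u where b: "u \<in> OD" "y = tau b + w * u" using split[OF a(1)] by blast
  obtain c v where c: "v \<in> OD" "u = tau c + w * v" using split[OF b(1)] by blast
  have "g = 1 + w * tau a + w ^ 2 * tau b + w ^ 3 * tau c + w ^ 4 * v"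
    unfolding x a b c by (simp add: distrib_left numeral_eq_Suc mult.assoc add.assoc)
  then show ?thesis using that c(1) unfolding dg_def by (blast intro: cgI)
qed

lemma cg_tau_cancel: "cg 1 (tau a) (tau b) \<Longrightarrow> a = b"
  by (simp add: cg_1_iff cg_Suc_0_iff)

lemma dg_unique:
  assumes "dg g a b c" "dg g a' b' c'" shows "a = a'" "b = b'" "c = c'"
proof -
  have A: "cg 4 (1 + (w * tau a + w ^ 2 * tau b + w ^ 3 * tau c)) (1 + (w * tau a' + w ^ 2 * tau b' + w ^ 3 * tau c'))"
    using cg_trans[OF cg_sym[OF assms(1)[unfolded dg_def]] assms(2)[unfolded dg_def]] by (simp add: add.assoc)
  have "w * tau a + w ^ 2 * tau b + w ^ 3 * tau c = w ^ 1 * (tau a + w * (tau b + w * tau c))" for a b c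
    by (simp add: distrib_left numeral_eq_Suc mult.assoc add.assoc)
  with cg_add_cancel[OF A] have B: "cg (1 + 3) (w ^ 1 * (tau a + w * (tau b + w * tau c))) (w ^ 1 * (tau a' + w * (tau b' + w * tau c')))"
    by simp
  note B = cg_w_cancel[OF B]
  have z: "cg 1 (w * x) 0" if "x \<in> OD" for x using cg_w_power[of 1 1 x] that by simp
  have head: "cg 1 (tau a + w * x) (tau a)" if "x \<in> OD" for a x
    using cg_add[OF cg_refl z[OF that]] by simp
  have od: "tau b + w * tau c \<in> OD" for b c by (simp add: OD_add OD_mult)
  have "cg 1 (tau a) (tau a')"
    using cg_trans[OF cg_sym[OF head[OF od]] cg_trans[OF cg_mono[OF B] head[OF od]]] by simp
  then show a: "a = a'" by (rule cg_tau_cancel)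
  have C: "cg (1 + 2) (w ^ 1 * (tau b + w * tau c)) (w ^ 1 * (tau b' + w * tau c'))"
    using cg_add_cancel[OF B[unfolded a]] by (simp add: eval_nat_numeral)
  note C = cg_w_cancel[OF C]
  have "cg 1 (tau b) (tau b')"
    using cg_trans[OF cg_sym[OF head[OF tau_OD]] cg_trans[OF cg_mono[OF C] head[OF tau_OD]]] by simp
  then show b: "b = b'" by (rule cg_tau_cancel)
  have D: "cg (1 + 1) (w ^ 1 * tau c) (w ^ 1 * tau c')"
    using cg_add_cancel[OF C[unfolded b]] by (simp add: numeral_2_eq_2)
  show "c = c'" using cg_tau_cancel[OF cg_w_cancel[OF D]] .
qed

text \<open>A digit passing an odd power of \<open>w\<close> is raised to the \<open>p\<close>-th
  power, and the carry of the first digits lands two places further because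
  \<open>p = w\<^sup>2\<close>. All other products have degree at least 4.\<close>

lemma dg_mult:
  assumes g: "dg g a b c" and h: "dg h a' b' c'"
  shows "dg (g * h) (a + a') (b + b' + a ^ p * a') (c + c' + kappa a a' + b ^ p * a' + a * b')"
proof -
  let ?g = "1 + w * tau a + w ^ 2 * tau b + w ^ 3 * tau c"
  let ?h = "1 + w * tau a' + w ^ 2 * tau b' + w ^ 3 * tau c'"
  have od: "1 + w * tau a + w ^ 2 * tau b + w ^ 3 * tau c \<in> OD" for a b c
    by (intro OD_add OD_mult OD_power) simp_all
  have gh: "cg 4 (g * h) (?g * ?h)"
    using cg_mult[OF g[unfolded dg_def] h[unfolded dg_def] od od] .
  have move: "w ^ i * tau x * (w ^ k * tau y) = w ^ (i + k) * tau ((if even k then x else x ^ p) * y)" for i k x y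
  proof -
    have "w ^ i * tau x * (w ^ k * tau y) = w ^ i * (tau x * w ^ k) * tau y" by (simp only: mult.assoc)
    then show ?thesis by (simp only: tau_w_power power_add tau_mult mult.assoc)
  qed
  have m11: "w * tau a * (w * tau a') = w ^ 2 * tau (a ^ p * a')" using move[of 1 a 1 a'] by (simp add: numeral_2_eq_2)
  have m12: "w * tau a * (w ^ 2 * tau b') = w ^ 3 * tau (a * b')" using move[of 1 a 2 b'] by (simp add: numeral_eq_Suc mult.assoc)
  have m21: "w ^ 2 * tau b * (w * tau a') = w ^ 3 * tau (b ^ p * a')" using move[of 2 b 1 a'] by (simp add: numeral_eq_Suc mult.assoc)
  have m0: "cg 4 (w ^ i * tau x * (w ^ k * tau y)) 0" if "4 \<le> i + k" for i k x y
    unfolding move using that by (intro cg_w_power) simp_all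
  have "cg (1 + 3) (w ^ 1 * (tau a + tau a')) (w ^ 1 * (tau (a + a') + w ^ 2 * tau (kappa a a')))"
    by (intro cg_w_mult tau_add_kappa)
  then have P: "cg 4 (w * (tau a + tau a')) (w * tau (a + a') + w ^ 3 * tau (kappa a a'))"
    by (simp add: distrib_left eval_nat_numeral mult.assoc)
  have "cg 2 (tau b + tau b' + tau (a ^ p * a')) (tau (b + b' + a ^ p * a'))"
    using cg_trans[OF cg_add[OF cg_tau_add cg_refl] cg_tau_add] .
  from cg_w_mult[OF this, of 2]
  have Q: "cg 4 (w ^ 2 * (tau b + tau b' + tau (a ^ p * a'))) (w ^ 2 * tau (b + b' + a ^ p * a'))"
    by simp
  have "cg 1 (tau c + tau c' + tau (b ^ p * a') + tau (a * b'))
      (tau (c + c' + kappa a a' + b ^ p * a' + a * b') - tau (kappa a a'))"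
    by (simp add: cg_1_iff cg_Suc_0_iff OD_add OD_diff res_add res_diff)
  from cg_w_mult[OF this, of 3] have R: "cg 4 (w ^ 3 * (tau c + tau c' + tau (b ^ p * a') + tau (a * b')))
      (w ^ 3 * (tau (c + c' + kappa a a' + b ^ p * a' + a * b') - tau (kappa a a')))" by simp
  let ?X = "1 + w * (tau a + tau a') + w ^ 2 * (tau b + tau b' + tau (a ^ p * a'))
      + w ^ 3 * (tau c + tau c' + tau (b ^ p * a') + tau (a * b'))"
  let ?X' = "1 + (w * tau (a + a') + w ^ 3 * tau (kappa a a')) + w ^ 2 * tau (b + b' + a ^ p * a')
      + w ^ 3 * (tau (c + c' + kappa a a' + b ^ p * a' + a * b') - tau (kappa a a'))"
  let ?Z = "w ^ 1 * tau a * (w ^ 3 * tau c') + w ^ 2 * tau b * (w ^ 2 * tau b') + w ^ 2 * tau b * (w ^ 3 * tau c')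
        + w ^ 3 * tau c * (w ^ 1 * tau a') + w ^ 3 * tau c * (w ^ 2 * tau b') + w ^ 3 * tau c * (w ^ 3 * tau c')"
  have e: "?g * ?h = ?X + ?Z"
    by (simp add: distrib_left distrib_right m11 m12 m21 add_ac)
  have X: "cg 4 ?X ?X'" by (rule cg_add[OF cg_add[OF cg_add[OF cg_refl P] Q] R])
  have add0: "cg 4 (x + y) 0" if "cg 4 x 0" "cg 4 y 0" for x y using cg_add[OF that] by simp
  have Z: "cg 4 ?Z 0" by (intro add0 m0) simp_all
  have X': "?X' + 0 = 1 + w * tau (a + a') + w ^ 2 * tau (b + b' + a ^ p * a') + w ^ 3 * tau (c + c' + kappa a a' + b ^ p * a' + a * b')"
    by (simp add: right_diff_distrib add_ac)
  show ?thesis unfolding dg_def X'[symmetric]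
    by (rule cg_trans[OF gh]) (unfold e, rule cg_add[OF X Z])
qed

lemma dg_teich_elt: "dg (teich_elt l) l 0 0"
  by (simp add: dg_def teich_elt_def)

lemma dg_UU4: "u \<in> UU 4 \<Longrightarrow> dg u 0 0 0"
  by (simp add: dg_def UU_iff)

text \<open>Commuting with \<open>zeta\<close> removes the digits in odd degree, and commuting with
  \<open>w\<close> makes the remaining one invariant under Frobenius.\<close>

lemma dg_Z1:
  assumes z: "z \<in> Z1 OD w" obtains b where "dg z 0 b 0" "b ^ p = b"
proof -
  have zu: "z \<in> UU 1" using z by (simp add: Z1_iff)
  have zc: "z * x = x * z" for x using z by (simp add: Z1_iff)
  have D: "z - 1 \<in> OD" "res (z - 1) = 0" using UU_OD[OF zu] UU_res[OF _ zu] by (simp_all add: OD_diff res_diff)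
  have "(z - 1) * zeta = zeta * (z - 1)" using zc[of zeta] by (simp add: algebra_simps)
  then obtain y where y: "y \<in> OD" "z - 1 = w * w * y" "y * zeta = zeta * y" using commute_zeta_div_p D by metis
  define b where "b = res y"
  have "(y - tau b) * zeta = zeta * (y - tau b)" using y(3) by (simp add: algebra_simps tau_commute_zeta)
  then obtain u where u: "u \<in> OD" "y - tau b = w * w * u"
    using commute_zeta_div_p[of "y - tau b"] y(1) by (auto simp: b_def OD_diff res_diff)
  have ye: "y = tau b + w * w * u" using u(2) by (simp add: algebra_simps)
  have "z = 1 + w * w * y" using y(2) by (simp add: algebra_simps)
  then have ze: "z = 1 + w ^ 2 * tau b + w ^ 4 * u"
    unfolding ye by (simp add: distrib_left numeral_eq_Suc mult.assoc add.assoc)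
  have dz: "dg z 0 b 0" unfolding dg_def ze using u(1) by (intro cgI) simp_all
  have "w * w * (y * w) = w * w * (w * y)"
  proof -
    have "w * w * (y * w) = (z - 1) * w" unfolding y(2) by (simp only: mult.assoc)
    also have "\<dots> = w * (z - 1)" using zc[of w] by (simp add: algebra_simps)
    finally show ?thesis unfolding y(2) by (simp only: mult.assoc)
  qed
  then have yw: "y * w = w * y" by simp
  have "inverse w * y * w = y"
    using yw by (simp add: mult.assoc) (simp flip: mult.assoc)
  then have "b ^ p = b" using theta_res[OF y(1)] by (simp add: b_def theta_frob)
  then show ?thesis using that dz by blast
qed

definition dA :: "'d \<Rightarrow> 'q" where "dA g = (THE a. \<exists>b c. dg g a b c)"
definition dB :: "'d \<Rightarrow> 'q" where "dB g = (THE b. \<exists>a c. dg g a b c)"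
definition dC :: "'d \<Rightarrow> 'q" where "dC g = (THE c. \<exists>a b. dg g a b c)"

lemma digits_eq:
  assumes "dg g a b c" shows "dA g = a" "dB g = b" "dC g = c"
proof -
  show "dA g = a" unfolding dA_def
    by (rule the_equality) (use assms in blast, elim exE, rule dg_unique(1)[OF _ assms])
  show "dB g = b" unfolding dB_def
    by (rule the_equality) (use assms in blast, elim exE, rule dg_unique(2)[OF _ assms])
  show "dC g = c" unfolding dC_def
    by (rule the_equality) (use assms in blast, elim exE, rule dg_unique(3)[OF _ assms])
qed

lemma dg_digits: "g \<in> UU 1 \<Longrightarrow> dg g (dA g) (dB g) (dC g)"
proof (elim dg_exists)
  fix a b c assume "dg g a b c"
  then show "dg g (dA g) (dB g) (dC g)" using digits_eq[of g a b c] by simp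
qed

lemma digits_mult:
  assumes "g \<in> UU 1" "h \<in> UU 1"
  shows "dA (g * h) = dA g + dA h" "dB (g * h) = dB g + dB h + dA g ^ p * dA h"
    "dC (g * h) = dC g + dC h + kappa (dA g) (dA h) + dB g ^ p * dA h + dA g * dB h"
  using digits_eq[OF dg_mult[OF dg_digits[OF assms(1)] dg_digits[OF assms(2)]]] .

text \<open>\<open>fD\<close> and \<open>fC\<close> are combinations of digits that descend modulo
  \<open>Z1\<close>. A central factor with digit \<open>b = b\<^sup>p\<close> adds \<open>b\<close>
  to \<open>dB\<close> and \<open>b * dA\<close> to \<open>dC\<close>; these changes cancel in
  both.\<close>

definition fD :: "'d \<Rightarrow> 'q" where "fD g = dB g ^ p - dB g"
definition fC :: "'d \<Rightarrow> 'q" where "fC g = dC g ^ p - dA g ^ p * dB g"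

lemma fD_mult:
  assumes "g \<in> UU 1" "h \<in> UU 1"
  shows "fD (g * h) = fD g + fD h + dA g * dA h ^ p - dA g ^ p * dA h"
  unfolding fD_def digits_mult[OF assms] by (simp add: q_frob_add power_mult_distrib q_frob_frob)

lemma fC_mult:
  assumes "g \<in> UU 1" "h \<in> UU 1"
  shows "fC (g * h) = fC g + fC h - (\<Sum>k\<in>{1..<p}. of_nat ((p choose k) div p) * dA g ^ k * dA h ^ (p - k))
    + dA g ^ p * (fD h - dA h ^ (p + 1)) - (dA g ^ p) ^ 2 * dA h"
  unfolding fC_def fD_def digits_mult[OF assms]
  by (simp add: q_frob_add power_mult_distrib q_frob_frob kappa_frob algebra_simps power2_eq_square)

lemma UZ4_invariant:
  assumes n: "n \<in> UZ 4" and g: "g \<in> UU 1"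
  shows "dA (n * g) = dA g" "fD (n * g) = fD g" "fC (n * g) = fC g"
proof -
  obtain u z where uz: "u \<in> UU 4" "z \<in> Z1 OD w" "n = u * z" using n by (auto simp: UZ_def)
  obtain b where b: "dg z 0 b 0" "b ^ p = b" using dg_Z1[OF uz(2)] .
  have "dg n 0 b 0" using dg_mult[OF dg_UU4[OF uz(1)] b(1)] uz(3) kappa_zero p_gt_1 by (simp add: power_0_left)
  note d = digits_eq[OF this]
  have nu: "n \<in> UU 1" using n ON_D(3)[OF UZ_ON[of 4]] by auto
  show "dA (n * g) = dA g" using digits_mult[OF nu g] d by simp
  show "fD (n * g) = fD g" using fD_mult[OF nu g] d b(2) p_gt_1 by (simp add: fD_def power_0_left)
  have "(\<Sum>k\<in>{1..<p}. of_nat ((p choose k) div p) * (0 :: 'q) ^ k * dA g ^ (p - k)) = 0"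
    by (intro sum.neutral) (simp add: power_0_left)
  then show "fC (n * g) = fC g"
    using fC_mult[OF nu g] d p_gt_1 by (simp add: fC_def[of n] power_0_left)
qed

section \<open>Functions annihilated by powers of the maximal ideal\<close>

abbreviation mm :: "nat \<Rightarrow> ('d, 'f) iw set" where
  "mm n \<equiv> ideal_pow IW I0 n"

lemmas mm_carrier = ring.ideal_pow_carrier[OF iw_ring I0_ideal]
  and mm_additive = ring.ideal_pow_additive[OF iw_ring I0_ideal]
  and mm_mult = ring.ideal_pow_mult[OF iw_ring I0_ideal]

lemma mm_closed: "a \<in> mm n \<Longrightarrow> a \<in> carrier IW"
  using mm_carrier by (simp add: subset_iff)

lemma mm_le: "m \<le> n \<Longrightarrow> a \<in> mm n \<Longrightarrow> a \<in> mm m"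
proof (induction n rule: dec_induct)
  case (step n)
  have "a \<in> mm n" using ring.ideal_pow_Suc[OF iw_ring I0_ideal, of n] step.prems by blast
  then show ?case by (rule step.IH)
qed

lemma mm_1: "a \<in> I0 \<Longrightarrow> a \<in> mm 1"
proof -
  assume a: "a \<in> I0"
  then have c: "a \<in> carrier IW" by (simp add: I0_def)
  have "a \<otimes>\<^bsub>IW\<^esub> \<one>\<^bsub>IW\<^esub> \<in> ideal_prod IW I0 (carrier IW)" using a iw_one_closed by (rule ideal_prod.prod)
  moreover have "a \<otimes>\<^bsub>IW\<^esub> \<one>\<^bsub>IW\<^esub> = a" using iw_ring c by (simp add: ring.is_monoid monoid.r_one)
  ultimately show "a \<in> mm 1" by simp
qed

definition kills :: "nat \<Rightarrow> ('d \<Rightarrow> 'f) \<Rightarrow> bool" where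
  "kills k \<phi> \<longleftrightarrow> smooth_fun \<phi> \<and> (\<forall>a\<in>mm k. pair a \<phi> = 0)"

lemma killsD: "kills k \<phi> \<Longrightarrow> smooth_fun \<phi>" "kills k \<phi> \<Longrightarrow> a \<in> mm k \<Longrightarrow> pair a \<phi> = 0"
  by (simp_all add: kills_def)

lemma kills_mono: "kills k \<phi> \<Longrightarrow> k \<le> l \<Longrightarrow> kills l \<phi>"
  unfolding kills_def using mm_le by blast

lemma kills_add: "kills k \<phi> \<Longrightarrow> kills k \<psi> \<Longrightarrow> kills k (\<lambda>x. \<phi> x + \<psi> x)"
  by (simp add: kills_def smooth_add pair_add mm_closed)

lemma kills_diff: "kills k \<phi> \<Longrightarrow> kills k \<psi> \<Longrightarrow> kills k (\<lambda>x. \<phi> x - \<psi> x)"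
  by (simp add: kills_def smooth_diff pair_diff mm_closed)

lemma kills_scale: "kills k \<phi> \<Longrightarrow> kills k (\<lambda>x. r * \<phi> x)"
  by (simp add: kills_def smooth_scale pair_scale mm_closed)

lemma kills_cong:
  assumes "kills k \<phi>" "\<And>g. g \<in> UU 1 \<Longrightarrow> \<phi> g = \<psi> g" shows "kills k \<psi>"
  unfolding kills_def
proof (intro conjI ballI)
  show "smooth_fun \<psi>" using smooth_cong[OF killsD(1)[OF assms(1)] assms(2)] .
  show "pair a \<psi> = 0" if "a \<in> mm k" for a
    using pair_cong[OF killsD(1)[OF assms(1)] mm_closed[OF that] assms(2)] killsD(2)[OF assms(1) that] by simp
qed

lemma kills_zero: "kills k (\<lambda>x. 0)"
  using pair_const[OF mm_closed, of _ k 0] smooth_const by (simp add: kills_def)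

lemma kills_sum:
  assumes "finite A" "\<And>i. i \<in> A \<Longrightarrow> kills k (\<phi> i)" shows "kills k (\<lambda>x. \<Sum>i\<in>A. \<phi> i x)"
  using assms by (induction A rule: finite_induct) (simp_all add: kills_zero kills_add)

text \<open>A product \<open>i \<otimes> b\<close> pairs with \<open>\<phi>\<close> by applying
  \<open>i\<close> to \<open>\<lambda>x. pair b (\<lambda>y. \<phi> (x * y))\<close>. By hypothesis
  this is constant on \<open>UU 1\<close>, and \<open>i\<close> has augmentation zero. So degrees of
  functions are found by taking differences, as for polynomials.\<close>

lemma kills_step:
  assumes s: "smooth_fun \<phi>" and k: "\<And>x. x \<in> UU 1 \<Longrightarrow> kills k (\<lambda>y. \<phi> (x * y) - \<phi> y)"
  shows "kills (Suc k) \<phi>"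
  unfolding kills_def
proof (intro conjI s ballI)
  fix a assume "a \<in> mm (Suc k)"
  then have "a \<in> ideal_prod IW I0 (mm k)" by simp
  then have "a \<in> carrier IW \<and> pair a \<phi> = 0"
  proof (induction rule: ideal_prod.induct)
    case (prod i b)
    have i: "i \<in> carrier IW" "aug i = 0" using prod(1) by (simp_all add: I0_def)
    have b: "b \<in> carrier IW" using mm_closed[OF prod(2)] .
    have "pair (i \<otimes>\<^bsub>IW\<^esub> b) \<phi> = pair i (\<lambda>x. pair b (\<lambda>y. \<phi> (x * y)))" by (rule pair_mult[OF i(1) b s])
    also have "\<dots> = pair i (\<lambda>x. pair b \<phi>)"
    proof (rule pair_pointwise_cong[OF s b i(1)])
      fix x assume x: "x \<in> UU 1"
      show "pair b (\<lambda>y. \<phi> (x * y)) = pair b \<phi>"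
        using killsD(2)[OF k[OF x] prod(2)] pair_diff[OF smooth_left_translate[OF s x] s b] by simp
    qed
    also have "\<dots> = 0" using pair_const[OF i(1)] i(2) by simp
    finally show ?case using iw_mult_closed[OF i(1) b] by simp
  next
    case (sum a b)
    then show ?case using iw_add_closed pair_plus s by simp
  qed
  then show "pair a \<phi> = 0" by simp
qed

lemma kills_const: "kills 1 (\<lambda>x. r)"
  using kills_step[OF smooth_const, of 0 r] kills_zero by simp

text \<open>An additive function behaves like a coordinate: translating the argument changes its
  \<open>n\<close>-th power by a polynomial of smaller degree in it.\<close>

lemma kills_additive_power:
  assumes s: "smooth_fun u" and add: "\<And>x y. x \<in> UU 1 \<Longrightarrow> y \<in> UU 1 \<Longrightarrow> u (x * y) = u x + u y"
  shows "kills (Suc n) (\<lambda>g. u g ^ n)"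
proof (induction n rule: less_induct)
  case (less n)
  have sn: "smooth_fun (\<lambda>g. u g ^ n)" for n
    by (induction n) (simp_all add: smooth_const smooth_times s)
  show ?case
  proof (rule kills_step[OF sn])
    fix x assume x: "x \<in> UU 1"
    have "kills n (\<lambda>y. \<Sum>i\<in>{..<n}. (of_nat (n choose i) * u x ^ (n - i)) * u y ^ i)"
      by (intro kills_sum kills_scale kills_mono[OF less.IH]) simp_all
    then show "kills n (\<lambda>y. u (x * y) ^ n - u y ^ n)"
    proof (rule kills_cong)
      fix y assume y: "y \<in> UU 1"
      have "u (x * y) ^ n = (\<Sum>i\<le>n. of_nat (n choose i) * u y ^ i * u x ^ (n - i))"
        using binomial_ring[of "u y" "u x" n] add[OF x y] by (simp add: add.commute)
      also have "{..n} = insert n {..<n}" by auto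
      finally show "(\<Sum>i\<in>{..<n}. (of_nat (n choose i) * u x ^ (n - i)) * u y ^ i) = u (x * y) ^ n - u y ^ n"
        by (simp add: mult_ac)
    qed
  qed
qed

lemma j_add: "j (x + y) = j x + j y" and j_mult: "j (x * y) = j x * j y" and j_one [simp]: "j 1 = 1"
  using j_hom unfolding ring_hom_on_def by auto

lemma j_zero [simp]: "j 0 = 0"
proof -
  have "j 0 + j 0 = j 0 + 0" using j_add[of 0 0] by simp
  then show ?thesis by (rule add_left_imp_eq)
qed

lemma j_uminus: "j (- x) = - j x"
  using j_add[of x "- x"] by (simp add: eq_neg_iff_add_eq_0 add.commute)

lemma j_diff: "j (x - y) = j x - j y"
  using j_add[of x "- y"] j_uminus[of y] by simp

lemma j_power: "j (x ^ n) = j x ^ n"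
  by (induction n) (simp_all add: j_mult)

lemma j_of_nat: "j (of_nat n) = of_nat n"
  by (induction n) (simp_all add: j_add)

lemma j_sum: "j (sum f A) = (\<Sum>i\<in>A. j (f i))"
  by (induction A rule: infinite_finite_induct) (simp_all add: j_add)

lemma j_eq_0_iff [simp]: "j x = 0 \<longleftrightarrow> x = 0"
proof
  assume "j x = 0"
  show "x = 0"
  proof (rule ccontr)
    assume "x \<noteq> 0"
    then have "j x * j (inverse x) = 1" by (simp flip: j_mult)
    then show False using \<open>j x = 0\<close> by simp
  qed
qed simp

lemma j_inj: "j x = j y \<Longrightarrow> x = y"
  using j_diff[of x y] j_eq_0_iff[of "x - y"] by simp

definition uA :: "'d \<Rightarrow> 'f" where "uA g = j (dA g)"
definition uD :: "'d \<Rightarrow> 'f" where "uD g = j (fD g)"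
definition uC :: "'d \<Rightarrow> 'f" where "uC g = j (fC g)"
text \<open>The factor that accompanies \<open>uA x ^ p\<close> in \<open>uC_mult\<close>.\<close>

definition uH :: "'d \<Rightarrow> 'f" where "uH g = uD g - uA g ^ (p + 1)"

lemma f_frob_add: "(x + y :: 'f) ^ p = x ^ p + y ^ p"
  using freshmans_dream[where ?'a = 'f] char_f p_prime by auto

lemma u_smooth: "smooth_fun uA" "smooth_fun uD" "smooth_fun uC"
  using UZ_ON[of 4] UZ4_invariant
  by (auto simp: smooth_fun_def lc_def uA_def uD_def uC_def intro!: bexI[of _ "UZ 4"])

lemma uA_mult: "x \<in> UU 1 \<Longrightarrow> y \<in> UU 1 \<Longrightarrow> uA (x * y) = uA x + uA y"
  unfolding uA_def using digits_mult(1)[of x y] by (simp add: j_add)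

lemma uD_mult: "x \<in> UU 1 \<Longrightarrow> y \<in> UU 1 \<Longrightarrow> uD (x * y) = uD x + uD y + uA x * uA y ^ p - uA x ^ p * uA y"
  unfolding uA_def uD_def using fD_mult[of x y] by (simp add: j_add j_diff j_mult j_power)

lemma uC_mult: "x \<in> UU 1 \<Longrightarrow> y \<in> UU 1 \<Longrightarrow> uC (x * y) = uC x + uC y
    - (\<Sum>k\<in>{1..<p}. of_nat ((p choose k) div p) * uA x ^ k * uA y ^ (p - k))
    + uA x ^ p * uH y - (uA x ^ p) ^ 2 * uA y"
  unfolding uA_def uC_def uD_def uH_def using fC_mult[of x y]
  by (simp only: j_add j_diff j_mult j_power j_sum j_of_nat)

lemma kills_uA_power: "kills (Suc n) (\<lambda>g. uA g ^ n)"
  by (rule kills_additive_power[OF u_smooth(1) uA_mult])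

lemma kills_uA: "kills 2 uA"
  using kills_uA_power[of 1] by (simp add: numeral_2_eq_2)

lemma smooth_uA_power: "smooth_fun (\<lambda>g. uA g ^ n)"
  using kills_uA_power killsD(1) by blast

lemma kills_uAp: "kills (Suc n) (\<lambda>g. (uA g ^ p) ^ n)"
  by (rule kills_additive_power[OF smooth_uA_power]) (simp add: uA_mult f_frob_add)

lemma kills_uH: "kills 3 uH"
proof -
  have s: "smooth_fun uH" using smooth_diff[OF u_smooth(2) smooth_uA_power[of "p + 1"]] unfolding uH_def .
  have "kills (Suc 2) uH"
  proof (rule kills_step[OF s])
    fix x assume x: "x \<in> UU 1"
    have "kills 2 (\<lambda>y. (uD x - uA x ^ (p + 1)) - (2 * uA x ^ p) * uA y)"
      by (intro kills_diff kills_scale kills_uA kills_mono[OF kills_const]) simp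
    then show "kills 2 (\<lambda>y. uH (x * y) - uH y)"
    proof (rule kills_cong)
      fix y assume y: "y \<in> UU 1"
      have "(uA x + uA y) ^ (p + 1) = (uA x + uA y) * (uA x ^ p + uA y ^ p)" by (simp add: f_frob_add)
      then show "(uD x - uA x ^ (p + 1)) - (2 * uA x ^ p) * uA y = uH (x * y) - uH y"
        unfolding uH_def uD_mult[OF x y] uA_mult[OF x y] by (simp add: algebra_simps)
    qed
  qed
  then show ?thesis by (simp add: numeral_3_eq_3 numeral_2_eq_2)
qed

text \<open>Every term of \<open>uC (x * y) - uC y\<close> has degree below \<open>p\<close> in
  \<open>y\<close>: the carry involves \<open>uA y\<close> with exponents from \<open>1\<close> to
  \<open>p - 1\<close>, and \<open>uH\<close> is killed by the third power of the ideal.\<close>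

lemma kills_uC: "kills (Suc p) uC"
proof (rule kills_step[OF u_smooth(3)])
  fix x assume x: "x \<in> UU 1"
  have "kills p (\<lambda>y. uC x - (\<Sum>k\<in>{1..<p}. (of_nat ((p choose k) div p) * uA x ^ k) * uA y ^ (p - k))
    + uA x ^ p * uH y - (uA x ^ p) ^ 2 * uA y)"
    using p_ge_5
    by (intro kills_diff kills_add kills_sum kills_scale kills_mono[OF kills_const] kills_mono[OF kills_uA]
        kills_mono[OF kills_uH] kills_mono[OF kills_uA_power]) auto
  then show "kills p (\<lambda>y. uC (x * y) - uC y)"
    by (rule kills_cong) (simp add: uC_mult[OF x])
qed

lemma pair_sum:
  assumes "finite A" "\<And>i. i \<in> A \<Longrightarrow> smooth_fun (\<phi> i)" "a \<in> carrier IW"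
  shows "smooth_fun (\<lambda>x. \<Sum>i\<in>A. \<phi> i x)" "pair a (\<lambda>x. \<Sum>i\<in>A. \<phi> i x) = (\<Sum>i\<in>A. pair a (\<phi> i))"
proof -
  have "smooth_fun (\<lambda>x. \<Sum>i\<in>A. \<phi> i x) \<and> pair a (\<lambda>x. \<Sum>i\<in>A. \<phi> i x) = (\<Sum>i\<in>A. pair a (\<phi> i))"
    using assms(1,2)
  proof (induction A rule: finite_induct)
    case empty
    then show ?case using smooth_const pair_const[OF assms(3), of 0] by simp
  next
    case (insert i A)
    then show ?case using smooth_add pair_add[OF _ _ assms(3)] by simp
  qed
  then show "smooth_fun (\<lambda>x. \<Sum>i\<in>A. \<phi> i x)" "pair a (\<lambda>x. \<Sum>i\<in>A. \<phi> i x) = (\<Sum>i\<in>A. pair a (\<phi> i))"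
    by simp_all
qed

text \<open>Multiplication is dual to the comultiplication \<open>\<phi> (x * y)\<close>; when this
  is a finite sum of separated products, so is the pairing.\<close>

lemma pair_mult_separable:
  assumes a: "a \<in> carrier IW" and b: "b \<in> carrier IW" and s: "smooth_fun \<phi>" and A: "finite A"
    and \<alpha>: "\<And>i. i \<in> A \<Longrightarrow> smooth_fun (\<alpha> i)" and \<beta>: "\<And>i. i \<in> A \<Longrightarrow> smooth_fun (\<beta> i)"
    and e: "\<And>x y. x \<in> UU 1 \<Longrightarrow> y \<in> UU 1 \<Longrightarrow> \<phi> (x * y) = (\<Sum>i\<in>A. \<alpha> i x * \<beta> i y)"
  shows "pair (a \<otimes>\<^bsub>IW\<^esub> b) \<phi> = (\<Sum>i\<in>A. pair a (\<alpha> i) * pair b (\<beta> i))"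
proof -
  have "pair (a \<otimes>\<^bsub>IW\<^esub> b) \<phi> = pair a (\<lambda>x. pair b (\<lambda>y. \<phi> (x * y)))" by (rule pair_mult[OF a b s])
  also have "\<dots> = pair a (\<lambda>x. \<Sum>i\<in>A. pair b (\<beta> i) * \<alpha> i x)"
  proof (rule pair_pointwise_cong[OF s b a])
    fix x assume x: "x \<in> UU 1"
    have "pair b (\<lambda>y. \<phi> (x * y)) = pair b (\<lambda>y. \<Sum>i\<in>A. \<alpha> i x * \<beta> i y)"
      by (rule pair_cong[OF smooth_left_translate[OF s x] b]) (rule e[OF x])
    also have "\<dots> = (\<Sum>i\<in>A. pair b (\<lambda>y. \<alpha> i x * \<beta> i y))"
      by (rule pair_sum(2)[OF A smooth_scale[OF \<beta>] b])
    also have "\<dots> = (\<Sum>i\<in>A. pair b (\<beta> i) * \<alpha> i x)"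
      by (intro sum.cong refl) (simp add: pair_scale[OF \<beta> b] mult.commute)
    finally show "pair b (\<lambda>y. \<phi> (x * y)) = (\<Sum>i\<in>A. pair b (\<beta> i) * \<alpha> i x)" .
  qed
  also have "\<dots> = (\<Sum>i\<in>A. pair a (\<lambda>x. pair b (\<beta> i) * \<alpha> i x))"
    by (rule pair_sum(2)[OF A smooth_scale[OF \<alpha>] a])
  also have "\<dots> = (\<Sum>i\<in>A. pair a (\<alpha> i) * pair b (\<beta> i))"
  proof (rule sum.cong[OF refl])
    fix i assume "i \<in> A"
    then show "pair a (\<lambda>x. pair b (\<beta> i) * \<alpha> i x) = pair a (\<alpha> i) * pair b (\<beta> i)"
      using pair_scale[OF \<alpha> a] by simp
  qed
  finally show ?thesis .
qed

text \<open>The functions dual to the powers of \<open>y\<close>. In degree \<open>p\<close> the \<open>p\<close>-th power of the additive function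
  \<open>uA\<close> is again additive; its place is taken by \<open>uC\<close>, whose coboundary is the carry cocycle of the Witt
  vectors, up to terms which vanish on products of the relevant degrees.\<close>

definition psi :: "nat \<Rightarrow> 'd \<Rightarrow> 'f" where
  "psi n = (if n < p then (\<lambda>g. uA g ^ n) else uC)"

text \<open>The structure constants for \<open>psi\<close>. The binomial coefficients would vanish
  in degree \<open>p\<close>; the carry of \<open>uC\<close> contributes them divided by
  \<open>p\<close>, with a minus sign, and these remain nonzero.\<close>

definition coef :: "nat \<Rightarrow> nat \<Rightarrow> 'f" where
  "coef n i = (if n < p then of_nat (n choose i) else if i = 0 \<or> i = p then 1 else - of_nat ((p choose i) div p))"

lemma kills_psi: "n \<le> p \<Longrightarrow> kills (Suc n) (psi n)"
  using kills_uA_power kills_uC by (cases "n = p") (simp_all add: psi_def)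

lemma psi_mult:
  assumes a: "a \<in> mm i" and b: "b \<in> mm k" and p: "i + k \<le> p"
  shows "pair (a \<otimes>\<^bsub>IW\<^esub> b) (psi (i + k)) = coef (i + k) i * pair a (psi i) * pair b (psi k)"
proof -
  note ac = mm_closed[OF a] and bc = mm_closed[OF b]
  have za: "pair a \<phi> = 0" if "kills m \<phi>" "m \<le> i" for m \<phi> using killsD(2)[OF kills_mono[OF that] a] .
  have zb: "pair b \<phi> = 0" if "kills m \<phi>" "m \<le> k" for m \<phi> using killsD(2)[OF kills_mono[OF that] b] .
  show ?thesis
  proof (cases "i + k < p")
    case True
    let ?n = "i + k"
    have "pair (a \<otimes>\<^bsub>IW\<^esub> b) (\<lambda>g. uA g ^ ?n) =
        (\<Sum>l\<in>{..?n}. pair a (\<lambda>x. of_nat (?n choose l) * uA x ^ l) * pair b (\<lambda>y. uA y ^ (?n - l)))"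
      by (rule pair_mult_separable[OF ac bc smooth_uA_power])
        (simp_all add: smooth_scale smooth_uA_power uA_mult binomial_ring)
    also have "\<dots> = (\<Sum>l\<in>{..?n}. if l = i then of_nat (?n choose i) * pair a (\<lambda>x. uA x ^ i) * pair b (\<lambda>y. uA y ^ k) else 0)"
    proof (rule sum.cong[OF refl])
      fix l assume l: "l \<in> {..?n}"
      show "pair a (\<lambda>x. of_nat (?n choose l) * uA x ^ l) * pair b (\<lambda>y. uA y ^ (?n - l)) =
          (if l = i then of_nat (?n choose i) * pair a (\<lambda>x. uA x ^ i) * pair b (\<lambda>y. uA y ^ k) else 0)"
        using za[OF kills_uA_power[of l]] zb[OF kills_uA_power[of "?n - l"]] l
        by (cases l i rule: linorder_cases) (simp_all add: pair_scale[OF smooth_uA_power ac])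
    qed
    also have "\<dots> = of_nat (?n choose i) * pair a (\<lambda>x. uA x ^ i) * pair b (\<lambda>y. uA y ^ k)" by simp
    finally show ?thesis using True by (simp add: psi_def coef_def)
  next
    case False
    then have ik: "i + k = p" using p by simp
    \<comment> \<open>The terms of \<open>uC_mult\<close> as products: indices \<open>0\<close> and
      \<open>p\<close> are the two copies of \<open>uC\<close>, the carry occupies \<open>1\<close>
      to \<open>p - 1\<close>, and the two remaining terms get the indices \<open>p + 1\<close> and
      \<open>p + 2\<close>.\<close>
    define \<alpha> where "\<alpha> l = (if l = 0 then (\<lambda>x. 1) else if l < p then (\<lambda>x. (- of_nat ((p choose l) div p)) * uA x ^ l)
      else if l = p then uC else if l = p + 1 then (\<lambda>x. uA x ^ p) else (\<lambda>x. (- 1) * (uA x ^ p) ^ 2))" for l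
    define \<beta> where "\<beta> l = (if l = 0 then uC else if l < p then (\<lambda>x. uA x ^ (p - l))
      else if l = p then (\<lambda>x. 1) else if l = p + 1 then uH else uA)" for l
    have sa: "smooth_fun (\<alpha> l)" for l
      unfolding \<alpha>_def
      by (simp only: smooth_const u_smooth smooth_scale smooth_uA_power killsD(1)[OF kills_uAp] simp_thms split: if_split)
    have pa: "pair a (\<alpha> l) = (- of_nat ((p choose l) div p)) * pair a (\<lambda>x. uA x ^ l)" if "0 < l" "l < p" for l
    proof -
      have "\<alpha> l = (\<lambda>x. (- of_nat ((p choose l) div p)) * uA x ^ l)" using that by (simp add: \<alpha>_def)
      then show ?thesis by (simp only: pair_scale[OF smooth_uA_power ac])
    qed
    have pa': "pair a (\<alpha> (p + 2)) = (- 1) * pair a (\<lambda>x. (uA x ^ p) ^ 2)"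
    proof -
      have "\<alpha> (p + 2) = (\<lambda>x. (- 1) * (uA x ^ p) ^ 2)" by (simp add: \<alpha>_def)
      then show ?thesis by (simp only: pair_scale[OF killsD(1)[OF kills_uAp] ac])
    qed
    have sb: "smooth_fun (\<beta> l)" for l
      unfolding \<beta>_def using smooth_const u_smooth smooth_uA_power killsD(1)[OF kills_uH] by simp
    have set: "{..p + 2} = insert 0 (insert p (insert (p + 1) (insert (p + 2) {1..<p})))" using p_gt_1 by auto
    have sum_eq: "uC (x * y) = (\<Sum>l\<in>{..p + 2}. \<alpha> l x * \<beta> l y)" if "x \<in> UU 1" "y \<in> UU 1" for x y
    proof -
      have "(\<Sum>l\<in>{1..<p}. \<alpha> l x * \<beta> l y) = - (\<Sum>l\<in>{1..<p}. of_nat ((p choose l) div p) * uA x ^ l * uA y ^ (p - l))"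
        unfolding sum_negf[symmetric] by (intro sum.cong) (simp_all add: \<alpha>_def \<beta>_def)
      then show ?thesis
        unfolding set uC_mult[OF that] using p_gt_1 by (simp add: \<alpha>_def \<beta>_def)
    qed
    have "pair (a \<otimes>\<^bsub>IW\<^esub> b) uC = (\<Sum>l\<in>{..p + 2}. pair a (\<alpha> l) * pair b (\<beta> l))"
      by (rule pair_mult_separable[OF ac bc u_smooth(3) finite_atMost sa sb sum_eq])
    also have "\<dots> = (\<Sum>l\<in>{..p + 2}. if l = i then pair a (\<alpha> i) * pair b (\<beta> i) else 0)"
    proof (rule sum.cong[OF refl])
      fix l assume l: "l \<in> {..p + 2}"
      \<comment> \<open>If \<open>l \<noteq> i\<close>, one factor has too small a degree to be seen
        by \<open>a\<close> or \<open>b\<close>. For the last two terms this holds because the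
        degrees of their factors add up to 3, which is less than \<open>i + k = p\<close>.\<close>
      have "pair a (\<alpha> l) * pair b (\<beta> l) = 0" if li: "l \<noteq> i"
      proof -
        consider "l = 0" | "0 < l" "l < p" | "l = p" | "l = p + 1" | "l = p + 2" using l by fastforce
        then show ?thesis
        proof cases
          case 1
          then show ?thesis using za[OF kills_const[of 1]] li by (simp add: \<alpha>_def)
        next
          case 2
          then have "l < i \<or> p - l < k" using li ik by auto
          then show ?thesis
            using za[OF kills_uA_power[of l]] zb[OF kills_uA_power[of "p - l"]] 2
            by (auto simp: pa \<beta>_def)
        next
          case 3
          then show ?thesis using zb[OF kills_const[of 1]] li ik p_gt_1 by (simp add: \<beta>_def)
        next
          case 4
          show ?thesis
          proof (cases "2 \<le> i")
            case True
            then show ?thesis using za[OF kills_uAp[of 1]] 4 by (simp add: \<alpha>_def)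
          next
            case False
            then show ?thesis using zb[OF kills_uH] 4 ik p_ge_5 by (simp add: \<beta>_def)
          qed
        next
          case 5
          show ?thesis
          proof (cases "3 \<le> i")
            case True
            then show ?thesis using za[OF kills_uAp[of 2]] 5 by (simp add: pa'[simplified])
          next
            case False
            then show ?thesis using zb[OF kills_uA] 5 ik p_ge_5 by (simp add: \<beta>_def)
          qed
        qed
      qed
      then show "pair a (\<alpha> l) * pair b (\<beta> l) = (if l = i then pair a (\<alpha> i) * pair b (\<beta> i) else 0)" by simp
    qed
    also have "\<dots> = pair a (\<alpha> i) * pair b (\<beta> i)" using ik by simp
    also have "\<dots> = coef p i * pair a (psi i) * pair b (psi k)"
    proof -
      consider "i = 0" | "0 < i" "i < p" | "i = p" using ik by linarith
      then show ?thesis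
      proof cases
        case 1
        then show ?thesis using ik p_gt_1 by (simp add: \<alpha>_def \<beta>_def coef_def psi_def)
      next
        case 2
        then have "p - i = k" "k < p" using ik by auto
        then show ?thesis using 2
          by (simp add: pa \<beta>_def coef_def psi_def)
      next
        case 3
        then show ?thesis using ik p_gt_1 by (simp add: \<alpha>_def \<beta>_def coef_def psi_def)
      qed
    qed
    finally show ?thesis using ik by (simp add: psi_def)
  qed
qed

end

lemma sum_nontrivial_character:
  fixes \<chi> :: "'q::{field,finite} \<Rightarrow> 'f::field"
  assumes mult: "\<And>x y. \<chi> (x * y) = \<chi> x * \<chi> y" and y: "y \<noteq> 0" "\<chi> y \<noteq> 1"
  shows "(\<Sum>x\<in>UNIV - {0}. \<chi> x) = 0"
proof -
  have "(\<Sum>x\<in>UNIV - {0}. \<chi> x) = (\<Sum>x\<in>UNIV - {0}. \<chi> (y * x))"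
    by (rule sum.reindex_bij_witness[of _ "\<lambda>x. y * x" "\<lambda>x. x / y"]) (use y in auto)
  also have "\<dots> = \<chi> y * (\<Sum>x\<in>UNIV - {0}. \<chi> x)" by (simp add: mult sum_distrib_left)
  finally have "(1 - \<chi> y) * (\<Sum>x\<in>UNIV - {0}. \<chi> x) = 0" by (simp add: algebra_simps)
  then show ?thesis using y by simp
qed

context quaternion_setup_ge5
begin

section \<open>Values of \<open>Y\<close> and \<open>Z\<close> on the test functions\<close>

abbreviation eltY :: "nat \<Rightarrow> ('d, 'f) iw" where
  "eltY k \<equiv> elt_YZ p L OD w res j k"

lemma eltY_iw_of: "eltY k = iw_of (\<lambda>\<phi>. \<Sum>l\<in>UNIV - {0}. inverse (j l ^ k) * \<phi> (teich_elt l))"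
proof (rule iw_eq_iw_of)
  fix N c assume "N \<in> ON" "c \<in> rc N"
  then show "eltY k N c = (\<Sum>l\<in>UNIV - {0}. inverse (j l ^ k) * ind c (teich_elt l))"
    unfolding elt_YZ_def teich_elt_def group_elt_def ind_def by (intro sum.cong) auto
next
  fix N c assume "\<not> (N \<in> ON \<and> c \<in> rc N)"
  then show "eltY k N c = 0"
    unfolding elt_YZ_def group_elt_def by (intro sum.neutral) auto
qed

lemma eltY_closed: "eltY k \<in> carrier IW"
  and pair_eltY: "smooth_fun \<phi> \<Longrightarrow> pair (eltY k) \<phi> = (\<Sum>l\<in>UNIV - {0}. inverse (j l ^ k) * \<phi> (teich_elt l))"
proof -
  let ?f = "\<lambda>\<phi> :: 'd \<Rightarrow> 'f. \<Sum>l\<in>UNIV - {0}. inverse (j l ^ k) * \<phi> (teich_elt l)"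
  have f: "lin_functional ?f"
    unfolding lin_functional_def using teich_elt_UU
    by (auto simp: distrib_left sum.distrib sum_distrib_left mult_ac)
  show "eltY k \<in> carrier IW" unfolding eltY_iw_of by (rule iw_of_closed[OF f])
  show "smooth_fun \<phi> \<Longrightarrow> pair (eltY k) \<phi> = ?f \<phi>" unfolding eltY_iw_of by (rule pair_iw_of[OF f])
qed

lemma frob_zeta_not_1: "res zeta ^ p \<noteq> 1" "res zeta \<noteq> 1"
  using res_zeta_frob by (metis q_frob_frob power_one)+

lemma aug_eltY: "k = 1 \<or> k = p \<Longrightarrow> aug (eltY k) = 0"
proof -
  assume k: "k = 1 \<or> k = p"
  have "(\<Sum>l\<in>UNIV - {0}. inverse (j l ^ k)) = 0"
  proof (rule sum_nontrivial_character)
    show "inverse (j (x * y) ^ k) = inverse (j x ^ k) * inverse (j y ^ k)" for x y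
      by (simp add: j_mult power_mult_distrib)
    show "res zeta \<noteq> 0" by (rule res_zeta_nonzero)
    have "j (res zeta ^ k) \<noteq> j 1" using k frob_zeta_not_1 j_inj by (metis power_one_right)
    then show "inverse (j (res zeta) ^ k) \<noteq> 1" by (simp add: j_power)
  qed
  then show ?thesis unfolding aug_def by (simp add: pair_eltY smooth_const)
qed

lemma eltY_I0: "k = 1 \<or> k = p \<Longrightarrow> eltY k \<in> I0"
  by (simp add: I0_def eltY_closed aug_eltY)

lemma f_of_nat_order: "(of_nat (p\<^sup>2 - 1) :: 'f) = - 1"
proof -
  have "(of_nat (p\<^sup>2) :: 'f) = 0" unfolding of_nat_eq_0_iff_char_dvd char_f by simp
  then show ?thesis using p_sq_gt_1 by (simp add: of_nat_diff)
qed

lemma uA_teich_elt: "uA (teich_elt l) = j l"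
  using digits_eq(1)[OF dg_teich_elt] by (simp add: uA_def)

lemma psi_1: "psi 1 = uA"
  using p_gt_1 by (simp add: psi_def)

lemma pair_Y_psi: "pair (eltY 1) (psi 1) = - 1"
proof -
  have "pair (eltY 1) (psi 1) = (\<Sum>l\<in>UNIV - {0 :: 'q}. 1)"
    unfolding psi_1 pair_eltY[OF u_smooth(1)] by (intro sum.cong) (auto simp: uA_teich_elt)
  also have "\<dots> = of_nat (p\<^sup>2 - 1)" by (simp add: card_Diff_singleton card_q)
  finally show ?thesis unfolding f_of_nat_order .
qed

text \<open>The summands form a character of the multiplicative group of the residue field,
  nontrivial because Frobenius moves the residue of \<open>zeta\<close>. For \<open>Y\<close> the
  same summands are all \<open>1\<close>, which gives \<open>p\<^sup>2 - 1 = - 1\<close>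
  instead.\<close>

lemma pair_Z_psi: "pair (eltY p) (psi 1) = 0"
proof -
  have "(\<Sum>l\<in>UNIV - {0}. inverse (j l ^ p) * j l) = 0"
  proof (rule sum_nontrivial_character)
    show "inverse (j (x * y) ^ p) * j (x * y) = inverse (j x ^ p) * j x * (inverse (j y ^ p) * j y)" for x y
      by (simp add: j_mult power_mult_distrib)
    show "res zeta \<noteq> 0" by (rule res_zeta_nonzero)
    have "j (res zeta ^ p) \<noteq> j (res zeta)" using res_zeta_frob j_inj by blast
    then show "inverse (j (res zeta) ^ p) * j (res zeta) \<noteq> 1"
      using res_zeta_nonzero by (simp add: j_power field_simps)
  qed
  then show ?thesis unfolding psi_1 pair_eltY[OF u_smooth(1)] by (simp add: uA_teich_elt)
qed

lemma eltY_power: "k = 1 \<or> k = p \<Longrightarrow> eltY k [^]\<^bsub>IW\<^esub> n \<in> mm n"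
proof (induction n)
  case 0
  have "\<one>\<^bsub>IW\<^esub> \<in> mm 0" using iw_one_closed by simp
  then show ?case by (simp add: nat_pow_def)
next
  case (Suc n)
  then have "eltY k [^]\<^bsub>IW\<^esub> n \<otimes>\<^bsub>IW\<^esub> eltY k \<in> mm (n + 1)" using mm_1[OF eltY_I0] by (intro mm_mult) simp_all
  then show ?case by (simp add: nat_pow_def)
qed

lemma f_of_nat_nonzero: "0 < n \<Longrightarrow> n < p \<Longrightarrow> (of_nat n :: 'f) \<noteq> 0"
  unfolding of_nat_eq_0_iff_char_dvd char_f by (simp add: nat_dvd_not_less)

text \<open>By \<open>psi_mult\<close>, each further factor \<open>Y\<close> multiplies the value by
  \<open>- coef (n + 1) n\<close>. The coefficient is \<open>n + 1\<close> below degree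
  \<open>p\<close> and \<open>- 1\<close> in degree \<open>p\<close>, where
  \<open>p choose (p - 1)\<close> divided by \<open>p\<close> is \<open>1\<close>.\<close>

lemma pair_Y_power_psi: "n \<le> p \<Longrightarrow> pair (eltY 1 [^]\<^bsub>IW\<^esub> n) (psi n) \<noteq> 0"
proof (induction n)
  case 0
  have "psi 0 = (\<lambda>x. 1)" using p_gt_1 by (simp add: psi_def)
  then show ?case by (simp add: nat_pow_def pair_one smooth_const)
next
  case (Suc n)
  have "pair (eltY 1 [^]\<^bsub>IW\<^esub> n \<otimes>\<^bsub>IW\<^esub> eltY 1) (psi (n + 1)) =
      coef (n + 1) n * pair (eltY 1 [^]\<^bsub>IW\<^esub> n) (psi n) * pair (eltY 1) (psi 1)"
    using Suc.prems mm_1[OF eltY_I0] eltY_power[of 1 n] by (intro psi_mult) simp_all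
  moreover have "coef (n + 1) n \<noteq> 0"
  proof (cases "n + 1 < p")
    case True
    then show ?thesis using f_of_nat_nonzero[of "n + 1"] by (simp add: coef_def)
  next
    case False
    then have n: "p = Suc n" using Suc.prems by simp
    have "p choose n = p" using n by (metis binomial_Suc_n)
    then have "(p choose n) div p = 1" using p_gt_1 by simp
    moreover have "n \<noteq> 0" "n \<noteq> p" using n p_gt_1 by simp_all
    ultimately show ?thesis using False unfolding coef_def by simp
  qed
  ultimately show ?case using Suc pair_Y_psi by (simp add: nat_pow_def)
qed

section \<open>Evaluation of the test functions on the graded algebra\<close>

abbreviation GR :: "(nat \<Rightarrow> ('d, 'f) iw set) ring" where
  "GR \<equiv> gr_iwasawa OD w"

lemma GR_eq: "GR = gr_ring IW I0"
  by (simp add: gr_iwasawa_def max_ideal_eq)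

lemma GR_ring: "ring GR"
  unfolding GR_eq by (rule ring.gr_ring_is_ring[OF iw_ring I0_ideal])

lemma GR_carrier: "carrier GR = gr_carrier IW mm"
  by (simp add: GR_eq gr_ring_def)

text \<open>For \<open>n \<le> p\<close> the value does not depend on the representative of the
  coset, because \<open>psi n\<close> vanishes on the next power of the ideal
  (\<open>evf_coset\<close>).\<close>

definition evf :: "nat \<Rightarrow> ('d, 'f) iw set \<Rightarrow> 'f" where
  "evf n X = pair (rep X) (psi n)"

lemma rep_coset:
  assumes "a \<in> mm n" obtains d where "d \<in> mm (Suc n)" "rep (mm (Suc n) +>\<^bsub>IW\<^esub> a) = d \<oplus>\<^bsub>IW\<^esub> a"
proof -
  have "\<zero>\<^bsub>IW\<^esub> \<oplus>\<^bsub>IW\<^esub> a = a" by (simp add: iwasawa_def)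
  then have "a \<in> mm (Suc n) +>\<^bsub>IW\<^esub> a"
    using additive_subgroup.zero_closed[OF mm_additive[of "Suc n"]] unfolding a_r_coset_def' by (metis UN_I singletonI)
  then have "rep (mm (Suc n) +>\<^bsub>IW\<^esub> a) \<in> mm (Suc n) +>\<^bsub>IW\<^esub> a" 
    unfolding rep_def by (rule someI[where P = "\<lambda>b. b \<in> mm (Suc n) +>\<^bsub>IW\<^esub> a"])
  then show ?thesis using that unfolding a_r_coset_def' by (auto simp del: ideal_pow.simps)
qed

lemma evf_coset:
  assumes "n \<le> p" "a \<in> mm n" shows "evf n (mm (Suc n) +>\<^bsub>IW\<^esub> a) = pair a (psi n)"
proof -
  obtain d where d: "d \<in> mm (Suc n)" "rep (mm (Suc n) +>\<^bsub>IW\<^esub> a) = d \<oplus>\<^bsub>IW\<^esub> a" using rep_coset[OF assms(2)] .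
  note k = kills_psi[OF assms(1)]
  show ?thesis
    unfolding evf_def d(2) pair_plus[OF mm_closed[OF d(1)] mm_closed[OF assms(2)] killsD(1)[OF k]]
    using killsD(2)[OF k d(1)] by simp
qed

lemma gr_component:
  assumes "x \<in> carrier GR" obtains a where "a \<in> mm n" "x n = mm (Suc n) +>\<^bsub>IW\<^esub> a"
  using assms unfolding GR_carrier gr_carrier_def by blast

lemma rep_gr_component: "x \<in> carrier GR \<Longrightarrow> rep (x n) \<in> mm n"
proof (elim gr_component[of x n])
  fix a assume a: "a \<in> mm n" "x n = mm (Suc n) +>\<^bsub>IW\<^esub> a"
  obtain d where d: "d \<in> mm (Suc n)" "rep (x n) = d \<oplus>\<^bsub>IW\<^esub> a" using rep_coset[OF a(1)] a(2) by metis
  then show "rep (x n) \<in> mm n"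
    using additive_subgroup.a_closed[OF mm_additive mm_le[of n "Suc n" d] a(1)] by simp
qed

lemma pair_finsum:
  assumes "finite A" "\<And>i. i \<in> A \<Longrightarrow> f i \<in> carrier IW" "smooth_fun \<phi>"
  shows "pair (finsum IW f A) \<phi> = (\<Sum>i\<in>A. pair (f i) \<phi>)"
  using assms(1,2)
proof (induction A rule: finite_induct)
  case empty
  then show ?case
    by (simp add: abelian_monoid.finsum_empty[OF abelian_group.axioms(1)[OF iw_abelian_group]] pair_zero[OF assms(3)])
next
  case (insert i A)
  have "finsum IW f (insert i A) = f i \<oplus>\<^bsub>IW\<^esub> finsum IW f A"
    using insert by (intro abelian_monoid.finsum_insert[OF abelian_group.axioms(1)[OF iw_abelian_group]]) auto
  moreover have "finsum IW f A \<in> carrier IW"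
    using insert by (intro abelian_monoid.finsum_closed[OF abelian_group.axioms(1)[OF iw_abelian_group]]) auto
  ultimately show ?case using insert pair_plus assms(3) by simp
qed

lemma evf_add:
  assumes "n \<le> p" "x \<in> carrier GR" "y \<in> carrier GR"
  shows "evf n ((x \<oplus>\<^bsub>GR\<^esub> y) n) = evf n (x n) + evf n (y n)"
proof -
  obtain a where a: "a \<in> mm n" "x n = mm (Suc n) +>\<^bsub>IW\<^esub> a" using gr_component[OF assms(2)] .
  obtain b where b: "b \<in> mm n" "y n = mm (Suc n) +>\<^bsub>IW\<^esub> b" using gr_component[OF assms(3)] .
  have "abelian_subgroup (mm (Suc n)) IW"
    by (rule abelian_subgroupI3[OF mm_additive iw_abelian_group])
  from abelian_subgroup.a_rcos_sum[OF this mm_closed[OF a(1)] mm_closed[OF b(1)]]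
  have "(x \<oplus>\<^bsub>GR\<^esub> y) n = mm (Suc n) +>\<^bsub>IW\<^esub> (a \<oplus>\<^bsub>IW\<^esub> b)"
    unfolding GR_eq gr_ring_def a(2)[symmetric] b(2)[symmetric] by simp
  then show ?thesis
    unfolding a(2) b(2) using evf_coset[OF assms(1)] a(1) b(1) additive_subgroup.a_closed[OF mm_additive a(1) b(1)]
      pair_plus mm_closed killsD(1)[OF kills_psi[OF assms(1)]] by simp
qed

lemma evf_mult:
  assumes "n \<le> p" "x \<in> carrier GR" "y \<in> carrier GR"
  shows "evf n ((x \<otimes>\<^bsub>GR\<^esub> y) n) = (\<Sum>i\<le>n. coef n i * evf i (x i) * evf (n - i) (y (n - i)))"
proof -
  let ?f = "\<lambda>i. rep (x i) \<otimes>\<^bsub>IW\<^esub> rep (y (n - i))"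
  have m: "?f i \<in> mm n" if "i \<in> {..n}" for i
    using mm_mult[OF rep_gr_component[OF assms(2), of i] rep_gr_component[OF assms(3), of "n - i"]] that by simp
  have s: "finsum IW ?f {..n} \<in> mm n"
  proof -
    have "finsum IW ?f A \<in> mm n" if "finite A" "A \<subseteq> {..n}" for A
      using that
    proof (induction A rule: finite_induct)
      case empty
      then show ?case
        by (simp add: abelian_monoid.finsum_empty[OF abelian_group.axioms(1)[OF iw_abelian_group]]
          additive_subgroup.zero_closed[OF mm_additive])
    next
      case (insert i A)
      have "finsum IW ?f (insert i A) = ?f i \<oplus>\<^bsub>IW\<^esub> finsum IW ?f A"
        using insert m mm_closed by (intro abelian_monoid.finsum_insert[OF abelian_group.axioms(1)[OF iw_abelian_group]]) auto
      then show ?case using insert m additive_subgroup.a_closed[OF mm_additive] by simp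
    qed
    then show ?thesis by simp
  qed
  have "(x \<otimes>\<^bsub>GR\<^esub> y) n = mm (Suc n) +>\<^bsub>IW\<^esub> finsum IW ?f {..n}" by (simp add: GR_eq gr_ring_def)
  then have "evf n ((x \<otimes>\<^bsub>GR\<^esub> y) n) = pair (finsum IW ?f {..n}) (psi n)" using evf_coset[OF assms(1) s] by simp
  also have "\<dots> = (\<Sum>i\<le>n. pair (?f i) (psi n))"
    using m mm_closed by (intro pair_finsum killsD(1)[OF kills_psi[OF assms(1)]]) auto
  also have "\<dots> = (\<Sum>i\<le>n. coef n i * evf i (x i) * evf (n - i) (y (n - i)))"
  proof (rule sum.cong[OF refl])
    fix i assume "i \<in> {..n}"
    then show "pair (?f i) (psi n) = coef n i * evf i (x i) * evf (n - i) (y (n - i))"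
      using psi_mult[OF rep_gr_component[OF assms(2), of i] rep_gr_component[OF assms(3), of "n - i"]] assms(1)
      by (simp add: evf_def)
  qed
  finally show ?thesis .
qed

text \<open>A two-sided ideal, since \<open>evf_mult\<close> expresses the values of a product
  bilinearly through values of the factors. It contains \<open>z\<close> and
  \<open>y ^ (p + 3)\<close> but no \<open>y ^ n\<close> with \<open>n \<le> p\<close>, so it
  separates these powers from the ideal defining the truncated module.\<close>

definition ker_ev :: "(nat \<Rightarrow> ('d, 'f) iw set) set" where
  "ker_ev = {x \<in> carrier GR. \<forall>n\<le>p. evf n (x n) = 0}"

lemma ker_ev_ideal: "ideal ker_ev GR"
proof -
  interpret GR: ring GR by (rule GR_ring)
  have l: "x \<otimes>\<^bsub>GR\<^esub> a \<in> ker_ev" if "a \<in> ker_ev" "x \<in> carrier GR" for a x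
    using that by (simp add: ker_ev_def evf_mult)
  show ?thesis
  proof (rule idealI[OF GR_ring _ l])
    show "a \<otimes>\<^bsub>GR\<^esub> x \<in> ker_ev" if "a \<in> ker_ev" "x \<in> carrier GR" for a x
      using that by (simp add: ker_ev_def evf_mult)
    show "subgroup ker_ev (add_monoid GR)"
    proof (rule GR.add.subgroupI)
      show "ker_ev \<subseteq> carrier GR" by (auto simp: ker_ev_def)
      have "evf n (\<zero>\<^bsub>GR\<^esub> n) = 0" if "n \<le> p" for n
      proof -
        have "evf n (\<zero>\<^bsub>GR\<^esub> n) + evf n (\<zero>\<^bsub>GR\<^esub> n) = evf n (\<zero>\<^bsub>GR\<^esub> n) + 0"
          using evf_add[OF that GR.zero_closed GR.zero_closed] by simp
        then show ?thesis by (rule add_left_imp_eq)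
      qed
      then have "\<zero>\<^bsub>GR\<^esub> \<in> ker_ev" by (simp add: ker_ev_def)
      then show "ker_ev \<noteq> {}" by blast
      fix a assume a: "a \<in> ker_ev"
      then have ac: "a \<in> carrier GR" by (simp add: ker_ev_def)
      have "\<ominus>\<^bsub>GR\<^esub> a = (\<ominus>\<^bsub>GR\<^esub> \<one>\<^bsub>GR\<^esub>) \<otimes>\<^bsub>GR\<^esub> a" using ac by (simp add: GR.l_minus)
      then have "\<ominus>\<^bsub>GR\<^esub> a \<in> ker_ev" using l[OF a, of "\<ominus>\<^bsub>GR\<^esub> \<one>\<^bsub>GR\<^esub>"] by simp
      then show "\<ominus>\<^bsub>GR\<^esub> a \<in> ker_ev" .
    next
      fix a b assume "a \<in> ker_ev" "b \<in> ker_ev"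
      then show "a \<oplus>\<^bsub>GR\<^esub> b \<in> ker_ev" by (simp add: ker_ev_def evf_add)
    qed
  qed
qed

abbreviation gcl :: "nat \<Rightarrow> ('d, 'f) iw \<Rightarrow> nat \<Rightarrow> ('d, 'f) iw set" where
  "gcl n a \<equiv> gr_class IW I0 n a"

lemma gcl_closed: "a \<in> mm n \<Longrightarrow> gcl n a \<in> carrier GR"
  unfolding GR_eq by (rule ring.gr_class_closed(2)[OF iw_ring I0_ideal])

lemma gcl_piece: "a \<in> mm n \<Longrightarrow> gcl n a \<in> gr_piece IW mm n"
  by (rule ring.gr_class_closed(1)[OF iw_ring I0_ideal])

lemma gcl_mult: "a \<in> mm m \<Longrightarrow> b \<in> mm n \<Longrightarrow> gcl m a \<otimes>\<^bsub>GR\<^esub> gcl n b = gcl (m + n) (a \<otimes>\<^bsub>IW\<^esub> b)"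
  unfolding GR_eq by (rule ring.gr_class_mult[OF iw_ring I0_ideal])

lemma evf_gcl:
  assumes "n \<le> p" "a \<in> mm k" shows "evf n (gcl k a n) = (if n = k then pair a (psi n) else 0)"
proof -
  have "\<zero>\<^bsub>IW\<^esub> \<in> mm n" using additive_subgroup.zero_closed[OF mm_additive] .
  from evf_coset[OF assms(1) this] evf_coset[OF assms(1), of a] assms(2) show ?thesis
    using pair_zero[OF killsD(1)[OF kills_psi[OF assms(1)]]]
    by (auto simp: gr_class_def simp del: ideal_pow.simps)
qed

lemma gcl_power:
  assumes "a \<in> mm 1" shows "gcl 1 a [^]\<^bsub>GR\<^esub> n = gcl n (a [^]\<^bsub>IW\<^esub> n) \<and> a [^]\<^bsub>IW\<^esub> n \<in> mm n"
proof (induction n)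
  case 0
  have "\<one>\<^bsub>GR\<^esub> = gcl 0 \<one>\<^bsub>IW\<^esub>" by (simp add: GR_eq gr_ring_def gr_class_def)
  then show ?case using iw_one_closed by (simp add: nat_pow_def)
next
  case (Suc n)
  have "gcl 1 a [^]\<^bsub>GR\<^esub> Suc n = gcl n (a [^]\<^bsub>IW\<^esub> n) \<otimes>\<^bsub>GR\<^esub> gcl 1 a" using Suc by (simp add: nat_pow_def)
  also have "\<dots> = gcl (n + 1) (a [^]\<^bsub>IW\<^esub> n \<otimes>\<^bsub>IW\<^esub> a)" using Suc assms by (intro gcl_mult) simp_all
  finally show ?case using Suc mm_mult[of "a [^]\<^bsub>IW\<^esub> n" n a 1] assms by (simp add: nat_pow_def)
qed

lemma gr_y_eq: "gr_y p L OD w res j = gcl 1 (eltY 1)" and gr_z_eq: "gr_z p L OD w res j = gcl 1 (eltY p)"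
  by (simp_all add: gr_y_def gr_z_def max_ideal_eq)

lemma gr_const_eq: "gr_const OD w r = gcl 0 (iw_scale r \<one>\<^bsub>IW\<^esub>)"
  by (simp add: gr_const_def max_ideal_eq iw_scale_def)

lemma y_power_survives:
  assumes n: "n \<le> p" and J: "gr_const OD w r \<otimes>\<^bsub>GR\<^esub> (gr_y p L OD w res j [^]\<^bsub>GR\<^esub> n)
      \<in> Idl\<^bsub>GR\<^esub> {gr_z p L OD w res j, gr_y p L OD w res j [^]\<^bsub>GR\<^esub> (p + 3)}"
  shows "r = 0"
proof -
  have Y1: "eltY 1 \<in> mm 1" "eltY p \<in> mm 1" using mm_1[OF eltY_I0] by simp_all
  note Yn = gcl_power[OF Y1(1)]
  have "gcl 1 (eltY p) \<in> ker_ev"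
  proof -
    have "evf m (gcl 1 (eltY p) m) = 0" if "m \<le> p" for m
      using evf_gcl[OF that Y1(2)] pair_Z_psi by simp
    then show ?thesis using gcl_closed[OF Y1(2)] by (simp add: ker_ev_def)
  qed
  moreover have "gcl (p + 3) (eltY 1 [^]\<^bsub>IW\<^esub> (p + 3)) \<in> ker_ev"
  proof -
    have "evf m (gcl (p + 3) (eltY 1 [^]\<^bsub>IW\<^esub> (p + 3)) m) = 0" if "m \<le> p" for m
      using evf_gcl[OF that conjunct2[OF Yn[of "p + 3"]]] that by simp
    then show ?thesis using gcl_closed[OF conjunct2[OF Yn[of "p + 3"]]] by (simp add: ker_ev_def)
  qed
  ultimately have "{gcl 1 (eltY p), gcl (p + 3) (eltY 1 [^]\<^bsub>IW\<^esub> (p + 3))} \<subseteq> ker_ev" by simp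
  then have "Idl\<^bsub>GR\<^esub> {gcl 1 (eltY p), gcl (p + 3) (eltY 1 [^]\<^bsub>IW\<^esub> (p + 3))} \<subseteq> ker_ev"
    by (rule ring.genideal_minimal[OF GR_ring ker_ev_ideal])
  moreover have "gr_const OD w r \<otimes>\<^bsub>GR\<^esub> gcl n (eltY 1 [^]\<^bsub>IW\<^esub> n)
      \<in> Idl\<^bsub>GR\<^esub> {gcl 1 (eltY p), gcl (p + 3) (eltY 1 [^]\<^bsub>IW\<^esub> (p + 3))}"
    using J Yn unfolding gr_y_eq gr_z_eq by simp
  ultimately have k: "gr_const OD w r \<otimes>\<^bsub>GR\<^esub> gcl n (eltY 1 [^]\<^bsub>IW\<^esub> n) \<in> ker_ev" by blast
  have c: "iw_scale r \<one>\<^bsub>IW\<^esub> \<in> mm 0" using iw_scale_closed[OF iw_one_closed] by simp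
  have yn: "eltY 1 [^]\<^bsub>IW\<^esub> n \<in> mm n" using Yn by blast
  have e: "iw_scale r \<one>\<^bsub>IW\<^esub> \<otimes>\<^bsub>IW\<^esub> (eltY 1 [^]\<^bsub>IW\<^esub> n) = iw_scale r (eltY 1 [^]\<^bsub>IW\<^esub> n)"
    using iw_scale_eq_mult[OF mm_closed[OF yn]] by simp
  have "gr_const OD w r \<otimes>\<^bsub>GR\<^esub> gcl n (eltY 1 [^]\<^bsub>IW\<^esub> n) = gcl n (iw_scale r (eltY 1 [^]\<^bsub>IW\<^esub> n))"
    unfolding gr_const_eq gcl_mult[OF c yn] e by simp
  moreover have "iw_scale r (eltY 1 [^]\<^bsub>IW\<^esub> n) \<in> mm n" using mm_mult[OF c yn] e by simp
  ultimately have "pair (iw_scale r (eltY 1 [^]\<^bsub>IW\<^esub> n)) (psi n) = 0"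
    using k evf_gcl[OF n] n unfolding ker_ev_def by auto
  then have "r * pair (eltY 1 [^]\<^bsub>IW\<^esub> n) (psi n) = 0"
    using pair_iw_scale[OF mm_closed[OF yn] killsD(1)[OF kills_psi[OF n]]] by simp
  then show "r = 0" using pair_Y_power_psi[OF n] by simp
qed

text \<open>Precomposing the embedding \<open>j\<close> with the Frobenius interchanges \<open>y\<close> and \<open>z\<close>.\<close>

lemma frobenius_twist: "quaternion_setup_ge5 p e emb L \<sigma> OD w res (\<lambda>x. j (x ^ p))"
proof -
  have "ring_hom_on UNIV (\<lambda>x. j (x ^ p))"
    unfolding ring_hom_on_def by (simp add: j_add j_mult q_frob_add power_mult_distrib)
  then have "quaternion_setup p e emb L \<sigma> OD w res (\<lambda>x. j (x ^ p))"
    using quaternion_setup_axioms unfolding quaternion_setup_def by (elim conjE) (intro conjI; assumption)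
  then show ?thesis
    using p_ge_5 by (simp add: quaternion_setup_ge5_def quaternion_setup_ge5_axioms_def)
qed

lemma z_power_survives:
  assumes n: "n \<le> p" and J: "gr_const OD w r \<otimes>\<^bsub>GR\<^esub> (gr_z p L OD w res j [^]\<^bsub>GR\<^esub> n)
      \<in> Idl\<^bsub>GR\<^esub> {gr_y p L OD w res j, gr_z p L OD w res j [^]\<^bsub>GR\<^esub> (p + 3)}"
  shows "r = 0"
proof -
  have "elt_YZ p L OD w res (\<lambda>x. j (x ^ p)) 1 = eltY p" "elt_YZ p L OD w res (\<lambda>x. j (x ^ p)) p = eltY 1"
  proof -
    have "j (l ^ p) ^ p = j l" for l by (simp only: j_power[symmetric] q_frob_frob)
    then show "elt_YZ p L OD w res (\<lambda>x. j (x ^ p)) p = eltY 1" by (simp add: elt_YZ_def)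
    show "elt_YZ p L OD w res (\<lambda>x. j (x ^ p)) 1 = eltY p" by (simp add: elt_YZ_def j_power)
  qed
  then have e: "gr_y p L OD w res (\<lambda>x. j (x ^ p)) = gr_z p L OD w res j"
    "gr_z p L OD w res (\<lambda>x. j (x ^ p)) = gr_y p L OD w res j"
    by (simp_all add: gr_y_def gr_z_def)
  show ?thesis
    by (rule quaternion_setup_ge5.y_power_survives[OF frobenius_twist n, unfolded e]) (rule J)
qed

end

section \<open>The filtration of a smooth representation\<close>

locale quat_rep = quaternion_setup_ge5 p e emb L \<sigma> OD w res j
  for p :: nat
    and e :: "(nat \<Rightarrow> int) \<Rightarrow> 'k::field"
    and emb :: "'k \<Rightarrow> 'd::division_ring"
    and L :: "'d set"
    and \<sigma> :: "'d \<Rightarrow> 'd"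
    and OD :: "'d set"
    and w :: 'd
    and res :: "'d \<Rightarrow> 'q::{field,finite}"
    and j :: "'q \<Rightarrow> 'f::{field,finite}" +
  fixes scl :: "'f \<Rightarrow> 'v::ab_group_add \<Rightarrow> 'v" and \<rho> :: "'d \<Rightarrow> 'v \<Rightarrow> 'v"
  assumes smooth_rep: "smooth_representation OD w scl \<rho>"
    and central_char: "has_central_character scl \<rho>"
begin

lemma vs: "vector_space scl"
  and rho_linear: "g \<noteq> 0 \<Longrightarrow> Vector_Spaces.linear scl scl (\<rho> g)"
  and rho_one [simp]: "\<rho> 1 v = v"
  and rho_mult: "g \<noteq> 0 \<Longrightarrow> h \<noteq> 0 \<Longrightarrow> \<rho> (g * h) v = \<rho> g (\<rho> h v)"
  and rho_open: "D_open OD w {g. g \<noteq> 0 \<and> \<rho> g v = v}"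
  using smooth_rep unfolding smooth_representation_def by simp_all

sublocale VS: vector_space scl
  by (rule vs)

lemma rho_add: "g \<noteq> 0 \<Longrightarrow> \<rho> g (x + y) = \<rho> g x + \<rho> g y"
  and rho_scl: "g \<noteq> 0 \<Longrightarrow> \<rho> g (scl c x) = scl c (\<rho> g x)"
  using rho_linear[of g] by (simp_all add: Vector_Spaces.linear_iff)

lemma rho_zero [simp]: "g \<noteq> 0 \<Longrightarrow> \<rho> g 0 = 0"
  using rho_add[of g 0 0] by simp

lemma rho_diff: "g \<noteq> 0 \<Longrightarrow> \<rho> g (x - y) = \<rho> g x - \<rho> g y"
  using rho_add[of g "x - y" y] by simp

lemma UU1_nonzero: "g \<in> UU 1 \<Longrightarrow> g \<noteq> 0"
  using UU_unit(2)[of 1] by simp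

lemma rho_inverse:
  assumes "g \<noteq> 0" shows "\<rho> g (\<rho> (inverse g) v) = v" "\<rho> (inverse g) (\<rho> g v) = v"
  using rho_mult[OF assms, of "inverse g" v] rho_mult[of "inverse g" g v] assms by simp_all

lemma rho_fixed:
  obtains m where "m \<ge> 1" "\<And>g. g \<in> UU m \<Longrightarrow> \<rho> g v = v"
proof -
  have "1 \<in> {g. g \<noteq> 0 \<and> \<rho> g v = v}" by simp
  then obtain n where "\<forall>y\<in>OD. 1 + w ^ n * y \<in> {g. g \<noteq> 0 \<and> \<rho> g v = v}"
    using rho_open[of v] unfolding D_open_def by blast
  then have n: "UU n \<subseteq> {g. \<rho> g v = v}" by (auto simp: UU_iff cg_def)
  have "UU (n + 1) \<subseteq> UU n" by (rule UU_mono) simp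
  with n have "\<And>g. g \<in> UU (n + 1) \<Longrightarrow> \<rho> g v = v" by blast
  then show ?thesis using that[of "n + 1"] by simp
qed

lemma nscale_scl: "nscale n v = scl (of_nat n) v"
proof -
  show ?thesis by (induction n) (simp_all add: VS.scale_left_distrib add.commute)
qed

lemma nscale_p_V [simp]: "nscale p (v :: 'v) = 0"
proof -
  have "(of_nat p :: 'f) = 0" unfolding char_f[symmetric] by simp
  then show ?thesis unfolding nscale_scl by simp
qed

text \<open>The central character is trivial on \<open>Z1\<close>: its values are \<open>p\<close>-power roots of unity in a
  field of characteristic \<open>p\<close>.\<close>

lemma rho_Z1:
  assumes z: "z \<in> Z1 OD w" shows "\<rho> z v = v"
proof -
  have "\<exists>\<psi>. \<forall>z\<in>centre - {0}. \<forall>v. \<rho> z v = scl (\<psi> z) v"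
    using central_char unfolding has_central_character_def by (elim exE conjE) (rule exI)
  then obtain \<psi> where \<psi>': "\<forall>z\<in>centre - {0}. \<forall>v. \<rho> z v = scl (\<psi> z) v" by (elim exE)
  have \<psi>: "\<And>z v. z \<in> centre - {0} \<Longrightarrow> \<rho> z v = scl (\<psi> z) v" using \<psi>' by simp
  have zc: "z \<in> centre - {0}" and zu: "z \<in> UU 1" using z by (auto simp: Z1_def U1_simps)
  note rz = \<psi>[OF zc]
  obtain m where m: "m \<ge> 1" "\<And>g. g \<in> UU m \<Longrightarrow> \<rho> g v = v" using rho_fixed[of v] by blast
  have pw: "z ^ (p ^ k) \<in> UU (k + 1)" for k
  proof (induction k)
    case (Suc k)
    have "z ^ (p ^ Suc k) = (z ^ (p ^ k)) ^ p" by (simp add: mult.commute flip: power_mult)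
    then show ?case using UU_p_power_mem[OF _ Suc] by simp
  qed (use zu in simp)
  have "\<rho> (z ^ n) v = scl (\<psi> z ^ n) v" for n
  proof (induction n)
    case (Suc n)
    have "z \<noteq> 0" using zc by simp
    then show ?case using rho_mult[of z "z ^ n" v] Suc rz by simp
  qed simp
  moreover have "z ^ (p ^ m) \<in> UU m" using pw[of m] UU_mono[of m "m + 1"] by auto
  ultimately have fx: "scl (\<psi> z ^ (p ^ m)) v = v" using m(2) by metis
  show ?thesis
  proof (cases "v = 0")
    case False
    have "scl (\<psi> z ^ (p ^ m) - 1) v = 0" using fx by (simp add: VS.scale_left_diff_distrib)
    then have one: "\<psi> z ^ (p ^ m) = 1" using False by simp
    have frob: "x = 1" if "x ^ (p ^ k) = 1" for x :: 'f and k
      using that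
    proof (induction k arbitrary: x)
      case (Suc k)
      have "(x ^ p) ^ (p ^ k) = 1" using Suc.prems by (simp flip: power_mult)
      then have xp: "x ^ p = 1" by (rule Suc.IH)
      have "(x - 1) ^ p + 1 ^ p = x ^ p" using f_frob_add[of "x - 1" 1] by simp
      then have "(x - 1) ^ p = 0" using xp by simp
      then show ?case by simp
    qed simp
    show ?thesis using rz frob[OF one] by simp
  qed (use zc in simp)
qed

text \<open>The socle filtration: vectors that are fixed by \<open>UU 1\<close> modulo the previous
  step. On the dual, it is orthogonal to the filtration by powers of the maximal ideal.\<close>

primrec K :: "nat \<Rightarrow> 'v set" where
  "K 0 = {0}"
| "K (Suc n) = {v. \<forall>g\<in>UU 1. \<rho> g v - v \<in> K n}"

lemma K_zero [simp]: "0 \<in> K n"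
  by (induction n) (simp_all add: UU1_nonzero[simplified])

lemma K_add: "v \<in> K n \<Longrightarrow> u \<in> K n \<Longrightarrow> v + u \<in> K n"
proof (induction n arbitrary: v u)
  case (Suc n)
  have "\<rho> g (v + u) - (v + u) \<in> K n" if g: "g \<in> UU 1" for g
  proof -
    have "(\<rho> g v - v) + (\<rho> g u - u) \<in> K n" using Suc.prems g by (intro Suc.IH) simp_all
    moreover have "\<rho> g (v + u) - (v + u) = (\<rho> g v - v) + (\<rho> g u - u)"
      using rho_add[OF UU1_nonzero[OF g]] by (simp add: algebra_simps)
    ultimately show ?thesis by (simp only:)
  qed
  then show ?case by simp
qed simp

lemma K_scl: "v \<in> K n \<Longrightarrow> scl c v \<in> K n"
proof (induction n arbitrary: v)
  case 0
  then show ?case by simp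
next
  case (Suc n)
  have "\<rho> g (scl c v) - scl c v \<in> K n" if g: "g \<in> UU 1" for g
  proof -
    have "scl c (\<rho> g v - v) \<in> K n" using Suc.prems g by (intro Suc.IH) simp
    then show ?thesis using rho_scl[OF UU1_nonzero[OF g]] VS.scale_right_diff_distrib by simp
  qed
  then show ?case by simp
qed

lemma K_uminus: "v \<in> K n \<Longrightarrow> - v \<in> K n"
  using K_scl[of v n "- 1"] by simp

lemma K_diff: "v \<in> K n \<Longrightarrow> u \<in> K n \<Longrightarrow> v - u \<in> K n"
  using K_add[of v n "- u"] K_uminus[of u n] by simp

lemma K_Suc: "v \<in> K n \<Longrightarrow> v \<in> K (Suc n)"
proof (induction n arbitrary: v)
  case 0
  then show ?case by (simp add: UU1_nonzero[simplified])
next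
  case (Suc n)
  have "\<rho> g v - v \<in> K (Suc n)" if g: "g \<in> UU 1" for g
    using Suc.prems g by (intro Suc.IH) simp
  then show ?case unfolding K.simps(2)[of "Suc n"] by blast
qed

lemma K_le: "m \<le> n \<Longrightarrow> v \<in> K m \<Longrightarrow> v \<in> K n"
  by (induction n rule: dec_induct) (auto intro: K_Suc simp del: K.simps)

lemma K_rho: "g \<in> UU 1 \<Longrightarrow> v \<in> K n \<Longrightarrow> \<rho> g v \<in> K n"
proof -
  assume g: "g \<in> UU 1" and v: "v \<in> K n"
  have "\<rho> g v - v \<in> K n"
  proof (cases n)
    case 0
    then show ?thesis using v UU1_nonzero[OF g] by simp
  next
    case (Suc m)
    then have "\<rho> g v - v \<in> K m" using v g by simp
    then show ?thesis unfolding Suc by (rule K_Suc)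
  qed
  from K_add[OF this v] show ?thesis by simp
qed

lemma K_rho_unit:
  assumes h: "h \<in> OD" "inverse h \<in> OD" "h \<noteq> 0" shows "v \<in> K n \<Longrightarrow> \<rho> h v \<in> K n"
proof (induction n arbitrary: v)
  case 0
  then show ?case using h by simp
next
  case (Suc n)
  have "\<rho> g (\<rho> h v) - \<rho> h v \<in> K n" if g: "g \<in> UU 1" for g
  proof -
    have g': "inverse h * g * h \<in> UU 1" using UU_conj[OF g h(2)] h by simp
    have "\<rho> h (\<rho> (inverse h * g * h) v - v) \<in> K n" using Suc.prems g' by (intro Suc.IH) simp
    moreover have "\<rho> h (\<rho> (inverse h * g * h) v) = \<rho> g (\<rho> h v)"
    proof -
      have "h * (inverse h * g * h) = g * h" using h(3) by (simp add: mult.assoc[symmetric])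
      then show ?thesis
        using rho_mult[OF h(3) UU1_nonzero[OF g'], of v] rho_mult[OF UU1_nonzero[OF g] h(3), of v] by simp
    qed
    ultimately show ?thesis using rho_diff[OF h(3)] by simp
  qed
  then show ?case by simp
qed

text \<open>Elements \<open>g\<close> for which \<open>g - 1\<close> lowers the socle filtration by
  \<open>k\<close> steps, the analogue of dimension subgroups for this representation. Truncated
  subtraction is appropriate since \<open>K 0\<close> is zero.\<close>

definition D :: "nat \<Rightarrow> 'd set" where
  "D k = {g \<in> UU 1. \<forall>m. \<forall>v\<in>K m. \<rho> g v - v \<in> K (m - k)}"

lemma D_I: "g \<in> UU 1 \<Longrightarrow> (\<And>m v. v \<in> K m \<Longrightarrow> \<rho> g v - v \<in> K (m - k)) \<Longrightarrow> g \<in> D k"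
  by (simp add: D_def)

lemma D_D: "g \<in> D k \<Longrightarrow> v \<in> K m \<Longrightarrow> \<rho> g v - v \<in> K (m - k)" "g \<in> D k \<Longrightarrow> g \<in> UU 1"
  by (simp_all add: D_def)

lemma D_mono: "k \<le> l \<Longrightarrow> g \<in> D l \<Longrightarrow> g \<in> D k"
  using D_D K_le[of "m - l" "m - k" for m] by (intro D_I) (auto intro: diff_le_mono2)

lemma D_one: "1 \<in> D k"
  by (rule D_I) simp_all

lemma D_mult: "g \<in> D k \<Longrightarrow> h \<in> D k \<Longrightarrow> g * h \<in> D k"
proof (rule D_I)
  assume g: "g \<in> D k" and h: "h \<in> D k"
  show "g * h \<in> UU 1" using g h D_D(2) UU_mult by blast
  fix m v assume v: "v \<in> K m"
  have "(\<rho> g (\<rho> h v) - \<rho> h v) + (\<rho> h v - v) \<in> K (m - k)"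
    using D_D(1)[OF g K_rho[OF D_D(2)[OF h] v]] D_D(1)[OF h v] by (rule K_add)
  then show "\<rho> (g * h) v - v \<in> K (m - k)"
    using rho_mult[OF UU1_nonzero UU1_nonzero] D_D(2)[OF g] D_D(2)[OF h] by simp
qed

lemma UU1_D: "g \<in> UU 1 \<Longrightarrow> g \<in> D 1"
proof (rule D_I)
  fix m v assume g: "g \<in> UU 1" and v: "v \<in> K m"
  show "\<rho> g v - v \<in> K (m - 1)" using v g UU1_nonzero[OF g] by (cases m) simp_all
qed

lemma Z1_D: "z \<in> Z1 OD w \<Longrightarrow> z \<in> D k"
  by (rule D_I) (simp_all add: rho_Z1, simp add: Z1_iff)

text \<open>Writing \<open>v = h g x\<close>, the difference \<open>g h x - h g x\<close> is the
  commutator of the operators \<open>g - 1\<close> and \<open>h - 1\<close> applied to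
  \<open>x\<close>, and either order of these lowers the filtration by \<open>a + b\<close>.\<close>

lemma D_commutator:
  assumes g: "g \<in> D a" and h: "h \<in> D b" shows "commutator g h \<in> D (a + b)"
proof (rule D_I)
  have u: "g \<in> UU 1" "h \<in> UU 1" using g h D_D(2) by blast+
  have hg: "h * g \<in> UU 1" using u UU_mult by blast
  show "commutator g h \<in> UU 1" using commutator_UU u by blast
  fix m v assume v: "v \<in> K m"
  define x where "x = \<rho> (inverse (h * g)) v"
  have x: "x \<in> K m" unfolding x_def by (rule K_rho[OF UU1_inverse[OF hg] v])
  have nz: "g \<noteq> 0" "h \<noteq> 0" "h * g \<noteq> 0" using u hg UU1_nonzero by blast+
  have v': "v = \<rho> h (\<rho> g x)"
    using rho_inverse(1)[OF nz(3), of v] rho_mult[OF nz(2,1), of x] by (simp add: x_def)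
  have "\<rho> (commutator g h) v = \<rho> g (\<rho> h x)"
    unfolding commutator_def x_def using nz rho_mult[of "g * h" "inverse (h * g)" v] rho_mult[OF nz(1,2)] by simp
  then have "\<rho> (commutator g h) v - v = \<rho> g (\<rho> h x) - \<rho> h (\<rho> g x)" using v' by simp
  also have "\<dots> = (\<rho> g (\<rho> h x - x) - (\<rho> h x - x)) - (\<rho> h (\<rho> g x - x) - (\<rho> g x - x))"
    using rho_diff nz by simp
  also have "\<dots> \<in> K (m - (a + b))"
  proof (rule K_diff)
    show "\<rho> g (\<rho> h x - x) - (\<rho> h x - x) \<in> K (m - (a + b))"
      using D_D(1)[OF g D_D(1)[OF h x]] by (simp add: diff_diff_left add.commute)
    show "\<rho> h (\<rho> g x - x) - (\<rho> g x - x) \<in> K (m - (a + b))"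
      using D_D(1)[OF h D_D(1)[OF g x]] by (simp add: diff_diff_left)
  qed
  finally show "\<rho> (commutator g h) v - v \<in> K (m - (a + b))" .
qed

lemma rho_power: "g \<in> UU 1 \<Longrightarrow> \<rho> (g ^ n) v = (\<rho> g ^^ n) v"
proof (induction n)
  case (Suc n)
  then show ?case using rho_mult[OF UU1_nonzero UU1_nonzero, of g "g ^ n" v] UU_power[of g 1 n] by simp
qed simp

lemma rho_p_power:
  assumes g: "g \<in> UU 1" shows "\<rho> (g ^ p) v - v = ((\<lambda>x. \<rho> g x - x) ^^ p) v"
proof -
  let ?f = "\<lambda>x. \<rho> g x - x"
  have "((\<lambda>x. x + ?f x) ^^ p) v = v + (?f ^^ p) v"
    using rho_add[OF UU1_nonzero[OF g]] p_prime by (intro funpow_prime_binomial) simp_all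
  then show ?thesis using rho_power[OF g, of p v] by simp
qed

lemma D_p_power:
  assumes g: "g \<in> D a" shows "g ^ p \<in> D (p * a)"
proof (rule D_I)
  have gu: "g \<in> UU 1" using D_D(2)[OF g] .
  show "g ^ p \<in> UU 1" using UU_power[OF gu] .
  fix m v assume v: "v \<in> K m"
  have "((\<lambda>x. \<rho> g x - x) ^^ i) v \<in> K (m - i * a)" for i
  proof (induction i)
    case (Suc i)
    show ?case using D_D(1)[OF g Suc] by (simp add: diff_diff_left add.commute)
  qed (use v in simp)
  then show "\<rho> (g ^ p) v - v \<in> K (m - p * a)" unfolding rho_p_power[OF gu] .
qed

text \<open>A given vector is fixed by some \<open>UU N\<close>, so \<open>g\<close> acts on it like
  an element of \<open>D k\<close> that approximates \<open>g\<close> to level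
  \<open>N\<close>.\<close>

lemma D_closure:
  assumes step: "\<And>n g. n \<ge> m \<Longrightarrow> g \<in> UU n \<Longrightarrow> \<exists>s\<in>D k. inverse s * g \<in> UU (n + 1)"
    and m: "m \<ge> 1" and g: "g \<in> UU m"
  shows "g \<in> D k"
proof (rule D_I)
  show gu: "g \<in> UU 1" using g UU_mono[OF m] by blast
  fix l v assume v: "v \<in> K l"
  obtain N where N: "N \<ge> 1" "\<And>g. g \<in> UU N \<Longrightarrow> \<rho> g v = v" using rho_fixed[of v] by blast
  have "\<exists>s\<in>D k. inverse s * g \<in> UU N"
    by (rule UU_approximation[where S = "D k" and m = m]) (use D_one D_mult D_D(2) step g in blast)+
  then obtain s where s: "s \<in> D k" "inverse s * g \<in> UU N" by blast
  have nz: "s \<noteq> 0" "inverse s * g \<noteq> 0" using UU1_nonzero D_D(2)[OF s(1)] UU1_nonzero[OF gu] by auto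
  have "\<rho> g v = \<rho> s (\<rho> (inverse s * g) v)"
    using rho_mult[OF nz, of v] nz by (simp add: mult.assoc[symmetric])
  then have "\<rho> g v = \<rho> s v" using N(2)[OF s(2)] by simp
  then show "\<rho> g v - v \<in> K (l - k)" using D_D(1)[OF s(1) v] by simp
qed

lemma p_power_step:
  assumes n: "n \<ge> 3" and g: "g \<in> UU n" and sub: "\<And>h. h \<in> UU (n - 2) \<Longrightarrow> h \<in> D a"
  shows "\<exists>s\<in>D (p * a). inverse s * g \<in> UU (n + 1)"
proof -
  have "n - 2 + 2 = n" using n by simp
  then have "n - 2 \<ge> 1" "g \<in> UU (n - 2 + 2)" using n g by simp_all
  then obtain h where h: "h \<in> UU (n - 2)" "inverse (h ^ p) * g \<in> UU (n - 2 + 3)" using UU_p_power_surj by blast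
  have "n - 2 + 3 = n + 1" using n by simp
  then show ?thesis using D_p_power[OF sub[OF h(1)]] h(2) by auto
qed

lemma UU_D_1: "n \<ge> 1 \<Longrightarrow> g \<in> UU n \<Longrightarrow> g \<in> D 1"
  using UU1_D UU_mono by blast

lemma central_Z1: "1 + w ^ 2 * of_nat n \<in> Z1 OD w"
  using central_one_plus_p[of n] UU_mono[of 1 2] by (auto simp: Z1_def U1_simps)

text \<open>At level 2 an element is approximated by a commutator times a central element, which
  acts trivially. At deeper levels it is approximated by \<open>p\<close>-th powers, which act in
  degree \<open>p\<close>.\<close>

lemma UU_2_D:
  assumes "g \<in> UU 2" shows "g \<in> D 2"
proof (rule D_closure[OF _ _ assms])
  fix n g assume n: "2 \<le> n" and g: "g \<in> UU n"
  show "\<exists>s\<in>D 2. inverse s * g \<in> UU (n + 1)"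
  proof (cases "n = 2")
    case True
    obtain m i where s: "inverse (commutator (teich_elt 1) (teich_elt m) * (1 + w ^ 2 * of_nat i)) * g \<in> UU 3"
      using UU_2_digit g True by blast
    have "commutator (teich_elt 1) (teich_elt m) \<in> D (1 + 1)"
      by (intro D_commutator UU1_D teich_elt_UU)
    then have "commutator (teich_elt 1) (teich_elt m) \<in> D 2" by (simp only: one_add_one)
    then have "commutator (teich_elt 1) (teich_elt m) * (1 + w ^ 2 * of_nat i) \<in> D 2"
      using Z1_D[OF central_Z1] by (rule D_mult)
    then show ?thesis using s True by auto
  next
    case False
    have "\<exists>s\<in>D (p * 1). inverse s * g \<in> UU (n + 1)"
      using n False g by (intro p_power_step UU_D_1[of "n - 2"]) simp_all
    then show ?thesis using D_mono[of 2 "p * 1"] p_ge_5 by fastforce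
  qed
qed simp

text \<open>The decisive jump: from level 3 on, elements are approximated by \<open>p\<close>-th
  powers of elements two levels below, so they act in degree \<open>p\<close> rather than 3. In
  \<open>UU_4_D\<close> the roots lie in \<open>UU 2\<close>, which doubles the degree.\<close>

lemma UU_3_D:
  assumes "g \<in> UU 3" shows "g \<in> D p"
proof (rule D_closure[OF _ _ assms])
  fix n g assume n: "3 \<le> n" and g: "g \<in> UU n"
  have "\<exists>s\<in>D (p * 1). inverse s * g \<in> UU (n + 1)"
    using n g by (intro p_power_step UU_D_1[of "n - 2"]) simp_all
  then show "\<exists>s\<in>D p. inverse s * g \<in> UU (n + 1)" by simp
qed simp

lemma UU_4_D:
  assumes "g \<in> UU 4" shows "g \<in> D (p * 2)"
proof (rule D_closure[OF _ _ assms])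
  fix n g assume n: "4 \<le> n" and g: "g \<in> UU n"
  have "h \<in> D 2" if "h \<in> UU (n - 2)" for h
  proof (rule UU_2_D)
    have "2 \<le> n - 2" using n by simp
    then show "h \<in> UU 2" using that UU_mono by blast
  qed
  then show "\<exists>s\<in>D (p * 2). inverse s * g \<in> UU (n + 1)"
    using n g by (intro p_power_step) simp_all
qed simp

text \<open>The elements \<open>teich_elt l\<close> topologically generate \<open>UU 1\<close> modulo \<open>Z1\<close>.\<close>

lemma K_generation:
  assumes v: "\<And>l. \<rho> (teich_elt l) v - v \<in> K n" shows "v \<in> K (Suc n)"
proof -
  define S where "S = {g \<in> UU 1. \<rho> g v - v \<in> K n}"
  have S_UU: "g \<in> UU 1" if "g \<in> S" for g using that by (simp add: S_def)
  have S_mult: "g * h \<in> S" if gh: "g \<in> S" "h \<in> S" for g h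
  proof -
    have u: "g \<in> UU 1" "h \<in> UU 1" using gh S_UU by blast+
    have "\<rho> g (\<rho> h v - v) + (\<rho> g v - v) \<in> K n"
      using gh by (intro K_add K_rho) (simp_all add: S_def)
    then show ?thesis
      using u UU_mult rho_mult[OF UU1_nonzero[OF u(1)] UU1_nonzero[OF u(2)]] rho_diff[OF UU1_nonzero[OF u(1)]]
      by (simp add: S_def)
  qed
  have S_inv: "inverse g \<in> S" if g: "g \<in> S" for g
  proof -
    have u: "g \<in> UU 1" "inverse g \<in> UU 1" using g S_UU UU1_inverse by blast+
    have "- (\<rho> (inverse g) (\<rho> g v - v)) \<in> K n"
      using g u by (intro K_uminus K_rho) (simp_all add: S_def)
    then show ?thesis
      using u rho_inverse(2)[OF UU1_nonzero[OF u(1)]] rho_diff[OF UU1_nonzero[OF u(2)]] by (simp add: S_def)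
  qed
  have S_one: "1 \<in> S" by (simp add: S_def)
  have S_teich: "teich_elt l \<in> S" for l using v teich_elt_UU by (simp add: S_def)
  have S_comm: "commutator g h \<in> S" if "g \<in> S" "h \<in> S" for g h
    unfolding commutator_def using that by (intro S_mult S_inv)
  \<comment> \<open>\<open>S\<close> is a group containing all \<open>teich_elt l\<close>. It
    reaches level 1 by digits, level 2 by commutators and central elements, and deeper levels by
    \<open>p\<close>-th powers. Requiring \<open>s\<close> in \<open>UU m\<close> makes its
    \<open>p\<close>-th power available two levels further.\<close>
  have step: "m \<ge> 1 \<Longrightarrow> g \<in> UU m \<Longrightarrow> \<exists>s\<in>S. s \<in> UU m \<and> inverse s * g \<in> UU (m + 1)" for m g
  proof (induction m arbitrary: g rule: less_induct)
    case (less m)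
    have suff: "\<exists>s\<in>S. s \<in> UU m \<and> inverse s * g \<in> UU (m + 1)" if s: "s \<in> S" "inverse s * g \<in> UU (m + 1)" for s
    proof -
      have q: "inverse s * g \<in> UU m" using s(2) UU_mono[of m "m + 1"] by auto
      have "s = g * inverse (inverse s * g)"
        using UU1_nonzero[OF S_UU[OF s(1)]] UU_unit(2)[OF less.prems]
        by (simp add: nonzero_inverse_mult_distrib mult.assoc[symmetric])
      then have "s \<in> UU m" using UU_mult[OF less.prems(2) UU_inverse[OF less.prems(1) q]] by simp
      then show ?thesis using s by blast
    qed
    consider "m = 1" | "m = 2" | "m \<ge> 3" using less.prems(1) by linarith
    then show ?case
    proof cases
      case 1
      obtain c where c: "cg (m + 1) g (1 + w ^ m * tau c)" using UU_digit[OF less.prems(2)] .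
      then have c': "cg (m + 1) g (teich_elt c)" using 1 by (simp add: teich_elt_def)
      show ?thesis
        using suff[OF S_teich[of c] cg_left_quotient[OF c']] UU_unit[OF order_refl teich_elt_UU[of c]] by blast
    next
      case 2
      obtain l i where s: "inverse (commutator (teich_elt 1) (teich_elt l) * (1 + w ^ 2 * of_nat i)) * g \<in> UU 3"
        using UU_2_digit less.prems(2) 2 by blast
      have "1 + w ^ 2 * of_nat i \<in> S" using central_Z1[of i] rho_Z1 by (simp add: S_def Z1_iff)
      then have "commutator (teich_elt 1) (teich_elt l) * (1 + w ^ 2 * of_nat i) \<in> S"
        by (intro S_mult S_comm S_teich)
      from suff[OF this] s 2 show ?thesis by simp
    next
      case 3
      define k where "k = m - 2"
      have k: "k \<ge> 1" "m = k + 2" "k < m" using 3 by (simp_all add: k_def)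
      obtain x where x: "x \<in> OD" "g = 1 + w ^ m * x" using less.prems(2) UU_iff cgE by blast
      have hk: "1 + w ^ k * x \<in> UU k" using x(1) by (rule UU_intro)
      obtain s where s: "s \<in> S" "s \<in> UU k" "inverse s * (1 + w ^ k * x) \<in> UU (k + 1)"
        using less.IH[OF k(3,1) hk] by blast
      obtain x' where x': "x' \<in> OD" "s = 1 + w ^ k * x'" using s(2) UU_iff cgE by blast
      have "s * (inverse s * (1 + w ^ k * x)) = 1 + w ^ k * x"
        using UU1_inv_simps(4)[OF S_UU[OF s(1)]] .
      then have "cg (k + 1) (1 + w ^ k * x) (s * 1)"
        using cg_mult_left[OF s(3)[unfolded UU_iff] UU_OD[OF s(2)]] by simp
      then have "cg (k + 1) (w ^ k * x) (w ^ k * x')" unfolding x'(2) using cg_add_cancel[of "k + 1" 1] by simp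
      then have xx: "cg 1 x x'" by (rule cg_w_cancel)
      have "cg (m + 1) g (1 + w ^ (k + 2) * x')"
        unfolding x(2) k(2) by (intro cg_add cg_refl cg_w_mult xx)
      also have "cg (m + 1) (1 + w ^ (k + 2) * x') (s ^ p)"
        using cg_sym[OF UU_p_power[OF k(1) x'(1)]] unfolding x'(2) k(2) by (simp add: eval_nat_numeral)
      finally have c: "cg (m + 1) g (s ^ p)" .
      have sp: "s ^ i \<in> S" for i by (induction i) (simp_all add: S_one S_mult s)
      show ?thesis
        using suff[OF sp cg_left_quotient[OF c]] UU_unit[OF order_refl S_UU[OF sp]] by blast
    qed
  qed
  have "\<rho> g v - v \<in> K n" if g: "g \<in> UU 1" for g
  proof -
    obtain N where N: "N \<ge> 1" "\<And>g. g \<in> UU N \<Longrightarrow> \<rho> g v = v" using rho_fixed[of v] by blast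
    have "\<exists>s\<in>S. inverse s * g \<in> UU N"
      by (rule UU_approximation[OF S_one S_mult _ _ g]) (use S_UU step in blast)+
    then obtain s where s: "s \<in> S" "inverse s * g \<in> UU N" by blast
    have nz: "s \<noteq> 0" "inverse s * g \<noteq> 0" using UU1_nonzero S_UU[OF s(1)] UU1_nonzero[OF g] by auto
    have "\<rho> g v = \<rho> s (\<rho> (inverse s * g) v)"
      using rho_mult[OF nz, of v] nz by (simp add: mult.assoc[symmetric])
    then show ?thesis using N(2)[OF s(2)] s(1) by (simp add: S_def)
  qed
  then show ?thesis by simp
qed

section \<open>The dual module\<close>
definition fscl :: "'f \<Rightarrow> ('v \<Rightarrow> 'f) \<Rightarrow> 'v \<Rightarrow> 'f" where
  "fscl c x = (\<lambda>v. c * x v)"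

sublocale FS: vector_space fscl
  by unfold_locales (simp_all add: fscl_def fun_eq_iff algebra_simps)

definition functionals :: "('v \<Rightarrow> 'f) set" where
  "functionals = {x. Vector_Spaces.linear scl (*) x}"

lemma vs_self: "vector_space ((*) :: 'f \<Rightarrow> 'f \<Rightarrow> 'f)"
  by unfold_locales (simp_all add: algebra_simps)

lemma functionals_iff:
  "x \<in> functionals \<longleftrightarrow> (\<forall>u v. x (u + v) = x u + x v) \<and> (\<forall>c v. x (scl c v) = c * x v)"
  unfolding functionals_def using vs vs_self by (auto simp: Vector_Spaces.linear_iff)

lemma functional_add: "x \<in> functionals \<Longrightarrow> x (u + v) = x u + x v"
  and functional_scl: "x \<in> functionals \<Longrightarrow> x (scl c v) = c * x v"
  by (simp_all add: functionals_iff)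

lemma idem_add_imp_zero: "c = 0" if "c = c + c" for c :: "'b::ab_group_add"
proof (rule add_left_imp_eq)
  show "c + c = c + 0" using that by simp
qed

lemma functional_zero: "x \<in> functionals \<Longrightarrow> x 0 = 0"
  by (rule idem_add_imp_zero) (use functional_add[of x 0 0] in simp)

lemma functional_diff: "x \<in> functionals \<Longrightarrow> x (u - v) = x u - x v"
  using functional_add[of x "u - v" v] by simp

text \<open>Defined by orthogonality, so that degrees on the dual can be read off from the
  representation; \<open>ideal_times_MD\<close> shows that it is the filtration by powers of the
  maximal ideal.\<close>

definition F :: "nat \<Rightarrow> ('v \<Rightarrow> 'f) set" where
  "F n = {x \<in> functionals. \<forall>v\<in>K n. x v = 0}"

lemma F_functional: "x \<in> F n \<Longrightarrow> x \<in> functionals"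
  by (simp add: F_def)

lemma F_0: "F 0 = functionals"
  by (auto simp: F_def functional_zero)

sublocale filt: linear_filtration fscl F
proof
  show "FS.subspace (F n)" for n
    by (rule FS.subspaceI) (auto simp: F_def functionals_iff fscl_def algebra_simps)
  show "F (Suc n) \<subseteq> F n" for n
    using K_Suc by (auto simp: F_def simp del: K.simps)
qed

definition act :: "'d \<Rightarrow> ('v \<Rightarrow> 'f) \<Rightarrow> 'v \<Rightarrow> 'f" where
  "act g x = (\<lambda>v. x (\<rho> (inverse g) v))"

lemma act_linear: "Vector_Spaces.linear fscl fscl (act g)"
  using FS.vector_space_axioms
  by (auto simp: Vector_Spaces.linear_iff act_def fscl_def fun_eq_iff)

lemma act_functional: "g \<noteq> 0 \<Longrightarrow> x \<in> functionals \<Longrightarrow> act g x \<in> functionals"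
  by (simp add: functionals_iff act_def rho_add rho_scl)

lemma act_F:
  assumes "g \<in> OD" "inverse g \<in> OD" "g \<noteq> 0" "x \<in> F n" shows "act g x \<in> F n"
  using assms act_functional K_rho_unit[of "inverse g"] by (simp add: F_def) (simp add: act_def)

lemma act_F_UU1: "g \<in> UU 1 \<Longrightarrow> x \<in> F n \<Longrightarrow> act g x \<in> F n"
  using act_F[OF UU_OD] UU_unit[of 1 g] by simp

lemma act_mult: "g \<noteq> 0 \<Longrightarrow> h \<noteq> 0 \<Longrightarrow> act (g * h) x = act g (act h x)"
  by (simp add: act_def nonzero_inverse_mult_distrib rho_mult)

lemma act_one [simp]: "act 1 x = x"
  by (simp add: act_def)

lemma D_inverse: "g \<in> D k \<Longrightarrow> inverse g \<in> D k"
proof (rule D_I)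
  assume g: "g \<in> D k"
  note u = D_D(2)[OF g]
  show "inverse g \<in> UU 1" using UU1_inverse[OF u] .
  fix m v assume "v \<in> K m"
  then have "\<rho> (inverse g) v \<in> K m" using K_rho[OF UU1_inverse[OF u]] by blast
  from K_uminus[OF D_D(1)[OF g this]]
  show "\<rho> (inverse g) v - v \<in> K (m - k)" using rho_inverse(1)[OF UU1_nonzero[OF u]] by simp
qed

lemma act_D: "g \<in> D k \<Longrightarrow> x \<in> F n \<Longrightarrow> act g x - x \<in> F (n + k)"
proof -
  assume g: "g \<in> D k" and x: "x \<in> F n"
  have "act g x - x \<in> F 0"
    using act_F_UU1[OF D_D(2)[OF g] x] x filt.F_le[of _ n 0] by (intro filt.F_diff) simp_all
  moreover have "(act g x - x) v = 0" if "v \<in> K (n + k)" for v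
  proof -
    have "\<rho> (inverse g) v - v \<in> K n" using D_D(1)[OF D_inverse[OF g] that] by simp
    then have "x (\<rho> (inverse g) v - v) = 0" using x by (simp add: F_def)
    then show ?thesis using functional_diff[OF F_functional[OF x]] by (simp add: act_def)
  qed
  ultimately show ?thesis unfolding F_0 by (simp add: F_def)
qed

text \<open>The functional factors through the family of all \<open>T i v\<close> modulo
  \<open>K n\<close>. The induced functional is extended linearly from the image to all families,
  and its coordinates are the \<open>f i\<close>. The relation \<open>R\<close> expresses equality
  modulo \<open>K n\<close> without forming quotient spaces.\<close>

lemma functional_decomposition:
  fixes T :: "'i::finite \<Rightarrow> 'v \<Rightarrow> 'v"
  assumes T_add: "\<And>i u v. T i (u + v) = T i u + T i v" and T_scl: "\<And>i c v. T i (scl c v) = scl c (T i v)"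
    and x: "x \<in> functionals" and ker: "\<And>v. (\<And>i. T i v \<in> K n) \<Longrightarrow> x v = 0"
  shows "\<exists>f. (\<forall>i. f i \<in> F n) \<and> (\<forall>v. x v = (\<Sum>i\<in>UNIV. f i (T i v)))"
proof -
  define wscl where "wscl c \<phi> = (\<lambda>i. scl c (\<phi> i))" for c and \<phi> :: "'i \<Rightarrow> 'v"
  interpret W: vector_space wscl
    by unfold_locales (simp_all add: wscl_def fun_eq_iff VS.scale_right_distrib VS.scale_left_distrib)
  interpret WP: vector_space_pair wscl "(*) :: 'f \<Rightarrow> 'f \<Rightarrow> 'f"
    using W.vector_space_axioms vs_self by (simp add: vector_space_pair_def)
  define R where "R \<phi> v \<longleftrightarrow> (\<forall>i. \<phi> i - T i v \<in> K n)" for \<phi> v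
  define g0 where "g0 \<phi> = x (SOME v. R \<phi> v)" for \<phi>
  have T_diff: "T i (u - v) = T i u - T i v" for i u v using T_add[of i "u - v" v] by simp
  have g0_eq: "g0 \<phi> = x v" if "R \<phi> v" for \<phi> v
  proof -
    define u where "u = (SOME v. R \<phi> v)"
    have u: "R \<phi> u" unfolding u_def using that by (rule someI)
    have "T i (v - u) \<in> K n" for i
    proof -
      have "(\<phi> i - T i u) - (\<phi> i - T i v) \<in> K n" using u that unfolding R_def by (blast intro: K_diff)
      then show ?thesis by (simp add: T_diff)
    qed
    then have "x (v - u) = 0" by (rule ker)
    then show ?thesis using functional_diff[OF x] by (simp add: g0_def u_def)
  qed
  have R_comb: "R (wscl c \<phi> + \<psi>) (scl c u + v)" if "R \<phi> u" "R \<psi> v" for c \<phi> \<psi> u v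
  proof -
    have "scl c (\<phi> i - T i u) + (\<psi> i - T i v) \<in> K n" for i
      using that unfolding R_def by (blast intro: K_add K_scl)
    then show ?thesis
      by (simp add: R_def wscl_def T_add T_scl VS.scale_right_diff_distrib algebra_simps)
  qed
  define S where "S = {\<phi>. \<exists>v. R \<phi> v}"
  obtain B where B: "B \<subseteq> S" "W.independent B" "S \<subseteq> W.span B" "card B = W.dim S"
    by (rule W.basis_exists[of S])
  obtain g where g: "Vector_Spaces.linear wscl (*) g" "\<forall>\<phi>\<in>B. g \<phi> = g0 \<phi>"
    using WP.linear_independent_extend[OF B(2), of g0] by blast
  have g_add: "g (\<phi> + \<psi>) = g \<phi> + g \<psi>" and g_scl: "g (wscl c \<phi>) = c * g \<phi>" for \<phi> \<psi> c
    using g(1) by (simp_all add: Vector_Spaces.linear_iff)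
  have g_zero: "g 0 = 0" by (rule idem_add_imp_zero) (use g_add[of 0 0] in simp)
  have T0: "T i 0 = 0" for i using T_add[of i 0 0] by simp
  have R0: "R 0 0" by (simp add: R_def T0)
  have gS: "\<exists>v. R \<phi> v \<and> g \<phi> = x v" if "\<phi> \<in> W.span B" for \<phi>
    using that
  proof (induction rule: W.span_induct_alt)
    case base
    have "g 0 = x 0" using g_zero functional_zero[OF x] by (rule trans[OF _ sym])
    with R0 show ?case by blast
  next
    case (step c \<phi> \<psi>)
    obtain u where u: "R \<phi> u" using B(1) step(1) by (auto simp: S_def)
    obtain v where v: "R \<psi> v" "g \<psi> = x v" using step(2) by blast
    have "g (wscl c \<phi> + \<psi>) = x (scl c u + v)"
      using g(2) step(1) g0_eq[OF u] v(2) by (simp add: g_add g_scl functional_add[OF x] functional_scl[OF x])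
    then show ?case using R_comb[OF u v(1)] by blast
  qed
  have gR: "g \<phi> = x v" if r: "R \<phi> v" for \<phi> v
  proof -
    have "\<phi> \<in> W.span B" using r B(3) by (auto simp: S_def)
    then obtain u where "R \<phi> u" "g \<phi> = x u" using gS by blast
    then show ?thesis using g0_eq[of \<phi>] r by metis
  qed
  define single where "single i v = (\<lambda>k. if k = i then v else 0)" for i :: 'i and v :: 'v
  define f where "f i v = g (single i v)" for i v
  have "f i \<in> F n" for i
  proof -
    have "single i (u + v) = single i u + single i v" for u v by (simp add: single_def fun_eq_iff)
    moreover have "single i (scl c v) = wscl c (single i v)" for c v by (simp add: single_def wscl_def fun_eq_iff)
    ultimately have "f i \<in> functionals" by (simp add: functionals_iff f_def g_add g_scl)
    moreover have "f i v = 0" if "v \<in> K n" for v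
    proof -
      have "R (single i v) 0" using that by (simp add: R_def T0 single_def)
      from gR[OF this] show ?thesis using functional_zero[OF x] by (simp add: f_def)
    qed
    ultimately show ?thesis by (simp add: F_def)
  qed
  moreover have "x v = (\<Sum>i\<in>UNIV. f i (T i v))" for v
  proof -
    have "R (\<lambda>i. T i v) v" by (simp add: R_def)
    then have "x v = g (\<lambda>i. T i v)" using gR by simp
    also have "(\<lambda>i. T i v) = (\<Sum>i\<in>UNIV. single i (T i v))"
    proof
      fix k
      have "(\<Sum>i\<in>A. single i (T i v)) k = (\<Sum>i\<in>A. single i (T i v) k)" for A
        by (induction A rule: infinite_finite_induct) simp_all
      then show "T k v = (\<Sum>i\<in>UNIV. single i (T i v)) k" by (simp add: single_def)
    qed
    also have "g (\<Sum>i\<in>UNIV. single i (T i v)) = (\<Sum>i\<in>UNIV. f i (T i v))"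
    proof -
      have "g (\<Sum>i\<in>A. single i (T i v)) = (\<Sum>i\<in>A. f i (T i v))" for A
        by (induction A rule: infinite_finite_induct)
          (simp_all add: g_zero g_add f_def del: func_plus func_zero plus_fun_apply zero_fun_apply)
      then show ?thesis .
    qed
    finally show ?thesis .
  qed
  ultimately show ?thesis by blast
qed

text \<open>By \<open>K_generation\<close>, the vectors that all \<open>teich_elt l - 1\<close> send
  to \<open>K n\<close> form \<open>K (Suc n)\<close>, on which \<open>x\<close> vanishes. So
  \<open>x\<close> decomposes along the operators given by the inverses, which become the action of
  \<open>teich_elt l\<close> on the dual.\<close>

lemma functional_step:
  assumes x: "x \<in> F (Suc n)"
  obtains f where "\<And>l. f l \<in> F n" "x = (\<Sum>l\<in>UNIV. act (teich_elt l) (f l) - f l)"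
proof -
  define T where "T l v = \<rho> (inverse (teich_elt l)) v - v" for l v
  have nz: "inverse (teich_elt l) \<noteq> 0" for l using UU1_nonzero[OF teich_elt_UU] by simp
  have "\<exists>f. (\<forall>i. f i \<in> F n) \<and> (\<forall>v. x v = (\<Sum>i\<in>UNIV. f i (T i v)))"
  proof (rule functional_decomposition)
    show "T i (u + v) = T i u + T i v" for i u v by (simp add: T_def rho_add[OF nz])
    show "T i (scl c v) = scl c (T i v)" for i c v
      by (simp add: T_def rho_scl[OF nz] VS.scale_right_diff_distrib)
    show "x \<in> functionals" using F_functional[OF x] .
    fix v assume v: "\<And>i. T i v \<in> K n"
    have "\<rho> (teich_elt l) v - v \<in> K n" for l
    proof -
      have "- (\<rho> (teich_elt l) (T l v)) \<in> K n" using v teich_elt_UU by (intro K_uminus K_rho)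
      then show ?thesis
        using rho_diff[OF UU1_nonzero[OF teich_elt_UU]] rho_inverse(1)[OF UU1_nonzero[OF teich_elt_UU]]
        by (simp add: T_def)
    qed
    then have "v \<in> K (Suc n)" by (rule K_generation)
    then show "x v = 0" using x by (simp add: F_def del: K.simps)
  qed
  then obtain f where f: "\<And>i. f i \<in> F n" "\<And>v. x v = (\<Sum>i\<in>UNIV. f i (T i v))" by blast
  have "x = (\<Sum>l\<in>UNIV. act (teich_elt l) (f l) - f l)"
  proof
    fix v
    have "(\<Sum>l\<in>A. act (teich_elt l) (f l) - f l) v = (\<Sum>l\<in>A. f l (T l v))" for A
      using functional_diff[OF F_functional[OF f(1)]]
      by (induction A rule: infinite_finite_induct) (simp_all add: T_def act_def)
    then show "x v = (\<Sum>l\<in>UNIV. act (teich_elt l) (f l) - f l) v" using f(2) by simp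
  qed
  then show ?thesis using that f(1) by blast
qed

section \<open>The action of the Iwasawa algebra on functionals\<close>

abbreviation MD :: "(('d, 'f) iw, 'v \<Rightarrow> 'f) module" where
  "MD \<equiv> dual_module OD w scl \<rho>"

text \<open>The matrix coefficient of \<open>x\<close> and \<open>v\<close>. It is locally constant,
  and an element of the Iwasawa algebra acts by integrating it (\<open>smult_eq\<close>), whichever
  subgroup the definition of the module picks.\<close>

definition orb :: "('v \<Rightarrow> 'f) \<Rightarrow> 'v \<Rightarrow> 'd \<Rightarrow> 'f" where
  "orb x v = (\<lambda>g. x (\<rho> (inverse g) v))"

lemma lc_orb:
  assumes N: "N \<in> ON" and fx: "\<forall>g\<in>N. \<rho> g v = v" shows "lc N (orb x v)"
  unfolding lc_def
proof (intro ballI)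
  fix n g assume n: "n \<in> N" and g: "g \<in> UU 1"
  have nu: "n \<in> UU 1" using n ON_D(3)[OF N] by blast
  have nz: "n \<noteq> 0" "g \<noteq> 0" using UU1_nonzero nu g by blast+
  have "\<rho> (inverse (n * g)) v = \<rho> (inverse g) (\<rho> (inverse n) v)"
    using nz rho_mult[of "inverse g" "inverse n"] by (simp add: nonzero_inverse_mult_distrib)
  then show "orb x v (n * g) = orb x v g" using fx ON_D(7)[OF N n] by (simp add: orb_def)
qed

text \<open>Members of \<open>ON\<close> contain \<open>Z1\<close>; triviality of the central
  character there (\<open>rho_Z1\<close>) is what makes a fixing member exist.\<close>

lemma fixing_subgroup: "\<exists>N. N \<in> ON \<and> (\<forall>g\<in>N. \<rho> g v = v)"
proof -
  obtain m where m: "m \<ge> 1" "\<And>g. g \<in> UU m \<Longrightarrow> \<rho> g v = v" using rho_fixed[of v] by blast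
  have "\<rho> g v = v" if gz: "g \<in> UZ m" for g
  proof -
    obtain u z where uz: "u \<in> UU m" "z \<in> Z1 OD w" "g = u * z" using gz by (auto simp: UZ_def)
    have "u \<noteq> 0" "z \<noteq> 0" using UU_unit(2)[OF m(1) uz(1)] UU1_nonzero uz(2) by (auto simp: Z1_iff)
    then show ?thesis using rho_mult[of u z v] rho_Z1[OF uz(2)] m(2)[OF uz(1)] uz(3) by simp
  qed
  then show ?thesis using UZ_ON[OF m(1)] by blast
qed

lemma smooth_orb: "smooth_fun (orb x v)"
  using fixing_subgroup[of v] lc_orb unfolding smooth_fun_def by blast

lemma smult_eq:
  assumes "a \<in> carrier IW" shows "a \<odot>\<^bsub>MD\<^esub> x = (\<lambda>v. pair a (orb x v))"
proof
  fix v
  define N where "N = (SOME N. N \<in> ON \<and> (\<forall>g\<in>N. \<rho> g v = v))"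
  have N: "N \<in> ON \<and> (\<forall>g\<in>N. \<rho> g v = v)" unfolding N_def using fixing_subgroup by (rule someI_ex)
  have "(a \<odot>\<^bsub>MD\<^esub> x) v = (\<Sum>c\<in>rc N. a N c * dual_act \<rho> (rep c) x v)"
    by (simp add: dual_module_def Let_def N_def)
  also have "\<dots> = pair a (orb x v)"
    using pair_eq[of N "orb x v" a] N lc_orb[of N v x] assms by (simp add: ev_def dual_act_def orb_def)
  finally show "(a \<odot>\<^bsub>MD\<^esub> x) v = pair a (orb x v)" .
qed

lemma smult_apply: "a \<in> carrier IW \<Longrightarrow> (a \<odot>\<^bsub>MD\<^esub> x) v = pair a (orb x v)"
  by (simp add: smult_eq)

lemma smult_functional:
  assumes a: "a \<in> carrier IW" and x: "x \<in> functionals" shows "a \<odot>\<^bsub>MD\<^esub> x \<in> functionals"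
  unfolding functionals_iff smult_apply[OF a]
proof (intro conjI allI)
  fix u v c
  have nz: "inverse g \<noteq> 0" if "g \<in> UU 1" for g using UU1_nonzero[OF that] by simp
  have "pair a (orb x (u + v)) = pair a (\<lambda>g. orb x u g + orb x v g)"
    by (rule pair_cong[OF smooth_orb a]) (simp add: orb_def rho_add[OF nz] functional_add[OF x])
  then show "pair a (orb x (u + v)) = pair a (orb x u) + pair a (orb x v)"
    using pair_add[OF smooth_orb smooth_orb a] by simp
  have "pair a (orb x (scl c v)) = pair a (\<lambda>g. c * orb x v g)"
    by (rule pair_cong[OF smooth_orb a]) (simp add: orb_def rho_scl[OF nz] functional_scl[OF x])
  then show "pair a (orb x (scl c v)) = c * pair a (orb x v)"
    using pair_scale[OF smooth_orb a] by simp
qed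

lemma smult_add_left:
  "a \<in> carrier IW \<Longrightarrow> b \<in> carrier IW \<Longrightarrow> (a \<oplus>\<^bsub>IW\<^esub> b) \<odot>\<^bsub>MD\<^esub> x = a \<odot>\<^bsub>MD\<^esub> x + b \<odot>\<^bsub>MD\<^esub> x"
  by (rule ext) (simp add: smult_apply iw_add_closed pair_plus smooth_orb)

lemma smult_add_right: "a \<in> carrier IW \<Longrightarrow> a \<odot>\<^bsub>MD\<^esub> (x + y) = a \<odot>\<^bsub>MD\<^esub> x + a \<odot>\<^bsub>MD\<^esub> y"
proof (rule ext)
  fix v assume a: "a \<in> carrier IW"
  have "orb (x + y) v = (\<lambda>g. orb x v g + orb y v g)" by (simp add: orb_def)
  then show "(a \<odot>\<^bsub>MD\<^esub> (x + y)) v = (a \<odot>\<^bsub>MD\<^esub> x + a \<odot>\<^bsub>MD\<^esub> y) v"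
    using pair_add[OF smooth_orb smooth_orb a] by (simp add: smult_apply[OF a])
qed

lemma smult_assoc:
  assumes a: "a \<in> carrier IW" and b: "b \<in> carrier IW"
  shows "(a \<otimes>\<^bsub>IW\<^esub> b) \<odot>\<^bsub>MD\<^esub> x = a \<odot>\<^bsub>MD\<^esub> (b \<odot>\<^bsub>MD\<^esub> x)"
proof
  fix v
  have "((a \<otimes>\<^bsub>IW\<^esub> b) \<odot>\<^bsub>MD\<^esub> x) v = pair a (\<lambda>g. pair b (\<lambda>h. orb x v (g * h)))"
    by (simp add: smult_apply iw_mult_closed a b pair_mult smooth_orb)
  also have "\<dots> = pair a (orb (b \<odot>\<^bsub>MD\<^esub> x) v)"
  proof (rule pair_pointwise_cong[OF smooth_orb b a])
    fix g assume g: "g \<in> UU 1"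
    have "pair b (\<lambda>h. orb x v (g * h)) = pair b (orb x (\<rho> (inverse g) v))"
    proof (rule pair_cong[OF smooth_left_translate[OF smooth_orb g] b])
      fix h assume h: "h \<in> UU 1"
      show "orb x v (g * h) = orb x (\<rho> (inverse g) v) h"
        using UU1_nonzero[OF g] UU1_nonzero[OF h] rho_mult[of "inverse h" "inverse g" v]
        by (simp add: orb_def nonzero_inverse_mult_distrib)
    qed
    then show "pair b (\<lambda>h. orb x v (g * h)) = orb (b \<odot>\<^bsub>MD\<^esub> x) v g"
      by (simp add: orb_def smult_apply[OF b]) 
  qed
  finally show "((a \<otimes>\<^bsub>IW\<^esub> b) \<odot>\<^bsub>MD\<^esub> x) v = (a \<odot>\<^bsub>MD\<^esub> (b \<odot>\<^bsub>MD\<^esub> x)) v" by (simp add: smult_apply[OF a])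
qed

lemma smult_scale: "a \<in> carrier IW \<Longrightarrow> iw_scale k a \<odot>\<^bsub>MD\<^esub> x = fscl k (a \<odot>\<^bsub>MD\<^esub> x)"
  by (rule ext) (simp add: smult_apply iw_scale_closed pair_iw_scale smooth_orb fscl_def)

lemma smult_group_elt: "g \<in> UU 1 \<Longrightarrow> group_elt OD w g \<odot>\<^bsub>MD\<^esub> x = act g x"
  by (rule ext) (simp add: smult_apply group_elt_closed pair_group_elt smooth_orb, simp add: orb_def act_def)

lemma smult_one: "\<one>\<^bsub>IW\<^esub> \<odot>\<^bsub>MD\<^esub> x = x"
  unfolding iw_one by (simp add: smult_group_elt)

lemma smult_zero_right: "a \<in> carrier IW \<Longrightarrow> a \<odot>\<^bsub>MD\<^esub> 0 = 0"
  using smult_add_right[of a 0 0] by simp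

lemma I0_smult:
  assumes i: "i \<in> I0" and y: "y \<in> F n" shows "i \<odot>\<^bsub>MD\<^esub> y \<in> F (Suc n)"
proof -
  have ic: "i \<in> carrier IW" "aug i = 0" using i by (simp_all add: I0_def)
  have "(i \<odot>\<^bsub>MD\<^esub> y) v = 0" if v: "v \<in> K (Suc n)" for v
  proof -
    have "pair i (orb y v) = pair i (\<lambda>g. y v)"
    proof (rule pair_cong[OF smooth_orb ic(1)])
      fix g assume "g \<in> UU 1"
      then have "\<rho> (inverse g) v - v \<in> K n" using v UU1_inverse by simp
      then have "y (\<rho> (inverse g) v - v) = 0" using y by (simp add: F_def)
      then show "orb y v g = y v" using functional_diff[OF F_functional[OF y]] by (simp add: orb_def)
    qed
    then show ?thesis using pair_const[OF ic(1)] ic(2) by (simp add: smult_apply[OF ic(1)])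
  qed
  then show ?thesis using smult_functional[OF ic(1) F_functional[OF y]] by (simp add: F_def del: K.simps)
qed

lemma smult_filtered: "a \<in> mm i \<Longrightarrow> x \<in> F n \<Longrightarrow> a \<odot>\<^bsub>MD\<^esub> x \<in> F (i + n)"
proof (induction i arbitrary: a)
  case 0
  have a: "a \<in> carrier IW" using 0 by simp
  have "(a \<odot>\<^bsub>MD\<^esub> x) v = 0" if v: "v \<in> K n" for v
  proof -
    have "pair a (orb x v) = pair a (\<lambda>g. 0)"
    proof (rule pair_cong[OF smooth_orb a])
      fix g assume "g \<in> UU 1"
      then have "\<rho> (inverse g) v \<in> K n" using v UU1_inverse K_rho by blast
      then show "orb x v g = 0" using 0(2) by (simp add: F_def orb_def)
    qed
    then show ?thesis using pair_const[OF a, of 0] by (simp add: smult_apply[OF a])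
  qed
  then show ?case using smult_functional[OF a F_functional[OF 0(2)]] by (simp add: F_def)
next
  case (Suc i)
  then have "a \<in> ideal_prod IW I0 (mm i)" by simp
  then have "a \<in> carrier IW \<and> a \<odot>\<^bsub>MD\<^esub> x \<in> F (Suc i + n)"
  proof (induction rule: ideal_prod.induct)
    case (prod k b)
    have c: "k \<in> carrier IW" "b \<in> carrier IW" using prod mm_closed by (simp_all add: I0_def)
    have "k \<odot>\<^bsub>MD\<^esub> (b \<odot>\<^bsub>MD\<^esub> x) \<in> F (Suc (i + n))"
      using I0_smult[OF prod(1) Suc.IH[OF prod(2) Suc.prems(2)]] .
    then show ?case using smult_assoc[OF c] iw_mult_closed[OF c] by simp
  next
    case (sum a b)
    have "a \<odot>\<^bsub>MD\<^esub> x + b \<odot>\<^bsub>MD\<^esub> x \<in> F (Suc i + n)" using sum by (blast intro: filt.F_add)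
    moreover have "(a \<oplus>\<^bsub>IW\<^esub> b) \<odot>\<^bsub>MD\<^esub> x = a \<odot>\<^bsub>MD\<^esub> x + b \<odot>\<^bsub>MD\<^esub> x" using sum smult_add_left by blast
    ultimately show ?case using sum iw_add_closed by metis
  qed
  then show ?case by simp
qed

lemma MD_simps: "carrier MD = functionals" "\<zero>\<^bsub>MD\<^esub> = 0" "x \<oplus>\<^bsub>MD\<^esub> y = x + y"
  by (auto simp: dual_module_def functionals_def fun_eq_iff)

lemma functionals_closed:
  "0 \<in> functionals" "x \<in> functionals \<Longrightarrow> y \<in> functionals \<Longrightarrow> x + y \<in> functionals"
  "x \<in> functionals \<Longrightarrow> - x \<in> functionals"
  by (simp_all add: functionals_iff algebra_simps)

lemma MD_abelian_group: "abelian_group MD"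
proof (rule abelian_groupI)
  fix x assume "x \<in> carrier MD"
  then show "\<exists>y\<in>carrier MD. y \<oplus>\<^bsub>MD\<^esub> x = \<zero>\<^bsub>MD\<^esub>"
    using functionals_closed(3) by (intro bexI[of _ "- x"]) (simp_all add: MD_simps)
qed (simp_all add: MD_simps functionals_closed add.assoc add.commute)

lemma MD_inverse: "x \<in> functionals \<Longrightarrow> inv\<^bsub>add_monoid MD\<^esub> x = - x"
  using abelian_group.minus_equality[OF MD_abelian_group, of "- x" x] functionals_closed
  by (simp add: MD_simps a_inv_def)

lemma F_subgroup: "subgroup (F n) (add_monoid MD)"
proof (rule group.subgroupI[OF abelian_group.a_group[OF MD_abelian_group]])
  show "F n \<subseteq> carrier (add_monoid MD)" using F_functional by (auto simp: MD_simps)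
  show "F n \<noteq> {}" using filt.F_zero by blast
  show "inv\<^bsub>add_monoid MD\<^esub> x \<in> F n" if "x \<in> F n" for x
    using that MD_inverse[OF F_functional[OF that]] filt.F_diff[of 0 n x] by simp
qed (simp add: MD_simps filt.F_add)

text \<open>One inclusion is \<open>smult_filtered\<close>. For the other,
  \<open>functional_step\<close> writes an element of \<open>F (Suc n)\<close> as a sum of elements
  \<open>teich_elt l - 1\<close> of the augmentation ideal applied to \<open>F n\<close>, which
  gives an induction on \<open>n\<close>.\<close>

lemma ideal_times_MD: "ideal_times_module IW I0 MD n = F n"
proof
  let ?H = "\<lambda>n. {a \<odot>\<^bsub>MD\<^esub> x |a x. a \<in> mm n \<and> x \<in> carrier MD}"
  let ?G = "\<lambda>n. generate (add_monoid MD) (?H n)"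
  show "ideal_times_module IW I0 MD n \<subseteq> F n"
    unfolding ideal_times_module_def
  proof (rule group.generate_subgroup_incl[OF abelian_group.a_group[OF MD_abelian_group] _ F_subgroup])
    show "?H n \<subseteq> F n" using smult_filtered[of _ n _ 0] by (auto simp: MD_simps F_0)
  qed
  have G_add: "x + y \<in> ?G n" if "x \<in> ?G n" "y \<in> ?G n" for x y n
    using generate.eng[OF that] by (simp add: MD_simps)
  have G_zero: "0 \<in> ?G n" for n using generate.one[of "add_monoid MD" "?H n"] by (simp add: MD_simps)
  have G_step: "t \<odot>\<^bsub>MD\<^esub> f \<in> ?G (Suc n)" if t: "t \<in> I0" and f: "f \<in> ?G n" for t f n
    using f
  proof (induction rule: generate.induct)
    case one
    have "t \<odot>\<^bsub>MD\<^esub> 0 = 0" using smult_zero_right[of t] t by (simp add: I0_def)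
    then have "t \<odot>\<^bsub>MD\<^esub> \<one>\<^bsub>add_monoid MD\<^esub> = 0" using MD_simps(2) by simp
    then show ?case using G_zero[of "Suc n"] by metis
  next
    case (incl h)
    then obtain b y where h: "b \<in> mm n" "y \<in> functionals" "h = b \<odot>\<^bsub>MD\<^esub> y" by (auto simp: MD_simps)
    have "t \<otimes>\<^bsub>IW\<^esub> b \<in> mm (Suc n)" using ideal_prod.prod[OF t h(1)] by simp
    moreover have "t \<odot>\<^bsub>MD\<^esub> h = (t \<otimes>\<^bsub>IW\<^esub> b) \<odot>\<^bsub>MD\<^esub> y"
      using smult_assoc[OF _ mm_closed[OF h(1)]] t h(3) by (simp add: I0_def)
    ultimately have "t \<odot>\<^bsub>MD\<^esub> h \<in> ?H (Suc n)" using h(2) unfolding MD_simps by blast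
    then show ?case by (rule generate.incl)
  next
    case (inv h)
    then obtain b y where h: "b \<in> mm n" "y \<in> functionals" "h = b \<odot>\<^bsub>MD\<^esub> y" by (auto simp: MD_simps)
    have bc: "b \<in> carrier IW" using mm_closed[OF h(1)] .
    have "b \<odot>\<^bsub>MD\<^esub> (- y) + b \<odot>\<^bsub>MD\<^esub> y = 0"
      using smult_add_right[OF bc, of "- y" y] smult_zero_right[OF bc] by simp
    then have "inv\<^bsub>add_monoid MD\<^esub> h = b \<odot>\<^bsub>MD\<^esub> (- y)"
      using MD_inverse[OF smult_functional[OF bc h(2)]] h(3) minus_unique[of "b \<odot>\<^bsub>MD\<^esub> y"]
      by (simp only: add.commute)
    moreover have "t \<otimes>\<^bsub>IW\<^esub> b \<in> mm (Suc n)" using ideal_prod.prod[OF t h(1)] by simp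
    moreover have "t \<odot>\<^bsub>MD\<^esub> (b \<odot>\<^bsub>MD\<^esub> (- y)) = (t \<otimes>\<^bsub>IW\<^esub> b) \<odot>\<^bsub>MD\<^esub> (- y)"
      using smult_assoc[OF _ bc] t by (simp add: I0_def)
    ultimately have "t \<odot>\<^bsub>MD\<^esub> (inv\<^bsub>add_monoid MD\<^esub> h) \<in> ?H (Suc n)"
      using functionals_closed(3)[OF h(2)] unfolding MD_simps by auto
    then show ?case by (rule generate.incl)
  next
    case (eng f g)
    have "t \<in> carrier IW" using t by (simp add: I0_def)
    from smult_add_right[OF this, of f g] have "t \<odot>\<^bsub>MD\<^esub> (f + g) \<in> ?G (Suc n)"
      using G_add[OF eng(3,4)] by metis
    moreover have "f \<otimes>\<^bsub>add_monoid MD\<^esub> g = f + g" using MD_simps(3)[of f g] by simp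
    ultimately show ?case by metis
  qed
  have "x \<in> ?G n" if "x \<in> F n" for x n
    using that
  proof (induction n arbitrary: x)
    case 0
    have "\<one>\<^bsub>IW\<^esub> \<odot>\<^bsub>MD\<^esub> x \<in> ?H 0" using 0 F_functional iw_one_closed unfolding MD_simps by auto
    then show ?case using generate.incl[of _ "?H 0" "add_monoid MD"] by (simp add: smult_one)
  next
    case (Suc n)
    obtain f where f: "\<And>l. f l \<in> F n" "x = (\<Sum>l\<in>UNIV. act (teich_elt l) (f l) - f l)"
      using functional_step[OF Suc.prems] by blast
    have "act (teich_elt l) (f l) - f l \<in> ?G (Suc n)" for l
    proof -
      let ?t = "group_elt OD w (teich_elt l) \<oplus>\<^bsub>IW\<^esub> iw_scale (- 1) \<one>\<^bsub>IW\<^esub>"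
      have c: "group_elt OD w (teich_elt l) \<in> carrier IW" "iw_scale (- 1) \<one>\<^bsub>IW\<^esub> \<in> carrier IW"
        using group_elt_closed[OF teich_elt_UU] iw_scale_closed[OF iw_one_closed] .
      have "aug ?t = 0"
        using aug_add[OF c] aug_scale[OF iw_one_closed] pair_group_elt[OF teich_elt_UU smooth_const]
        by (simp add: aug_one) (simp add: aug_def)
      then have t: "?t \<in> I0" using iw_add_closed[OF c] by (simp add: I0_def)
      have "?t \<odot>\<^bsub>MD\<^esub> f l = act (teich_elt l) (f l) - f l"
        unfolding smult_add_left[OF c] smult_group_elt[OF teich_elt_UU] smult_scale[OF iw_one_closed] smult_one
        by (simp add: fscl_def fun_eq_iff)
      with G_step[OF t Suc.IH[OF f(1)[of l]]] show ?thesis by (simp only:)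
    qed
    note * = this
    have "(\<Sum>l\<in>A. act (teich_elt l) (f l) - f l) \<in> ?G (Suc n)" for A
    proof (induction A rule: infinite_finite_induct)
      case (insert l A)
      show ?case unfolding sum.insert[OF insert(1,2)] using insert(3) by (rule G_add[OF *])
    qed (simp_all only: sum.empty sum.infinite G_zero not_False_eq_True)
    then show ?case unfolding f(2) .
  qed
  then show "F n \<subseteq> ideal_times_module IW I0 MD n" unfolding ideal_times_module_def by blast
qed

lemma MD_filtered_pairing: "filtered_pairing IW MD (module.smult MD) mm F"
proof (intro filtered_pairing.intro filtered_pairing_axioms.intro)
  show "additive_subgroup (F n) MD" for n by (rule additive_subgroup.intro[OF F_subgroup])
  show "mm (Suc n) \<subseteq> mm n" for n using mm_le[of n "Suc n"] by auto
qed (simp_all add: iw_abelian_group MD_abelian_group mm_additive filt.F_Suc MD_simps smult_functional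
    smult_add_left smult_add_right smult_filtered del: ideal_pow.simps)

end

section \<open>The operators Y, Z and T on the dual\<close>

context quaternion_setup_ge5
begin

lemma sum_id_frob_inverse: "(\<Sum>m\<in>UNIV - {0}. m * inverse (m ^ p)) = (0 :: 'q)"
proof (rule sum_nontrivial_character[of "\<lambda>m :: 'q. m * inverse (m ^ p)" "res zeta"])
  show "res zeta * inverse (res zeta ^ p) \<noteq> 1"
    using res_zeta_frob res_zeta_nonzero by (simp add: field_simps)
qed (simp_all add: power_mult_distrib res_zeta_nonzero)

text \<open>Substituting \<open>\<lambda> = l \<mu>\<close>, the left-hand side becomes the sum of \<open>(\<mu>\<^sup>-\<^sup>1 + \<mu>\<^sup>-\<^sup>p) \<psi>(l \<mu>)\<close>. The
  coefficients are traces, hence lie in the prime field and can be moved into the argument of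
  \<open>\<psi>\<close>.\<close>

lemma additive_function_expansion:
  fixes \<psi> :: "'q \<Rightarrow> 'f"
  assumes add: "\<And>a b. \<psi> (a + b) = \<psi> a + \<psi> b"
  shows "j l * (\<Sum>m\<in>UNIV - {0}. inverse (j m) * \<psi> m) +
    j l ^ p * (\<Sum>m\<in>UNIV - {0}. inverse (j m ^ p) * \<psi> m) = - \<psi> l"
proof (cases "l = 0")
  case True
  have "\<psi> 0 + \<psi> 0 = \<psi> 0 + 0" using add[of 0 0] by simp
  then have "\<psi> 0 = 0" by (rule add_left_imp_eq)
  then show ?thesis using True p_gt_1 by (simp add: power_0_left)
next
  case False
  have "\<psi> 0 + \<psi> 0 = \<psi> 0 + 0" using add[of 0 0] by simp
  then have z: "\<psi> 0 = 0" by (rule add_left_imp_eq)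
  have of_nat_psi: "of_nat n * \<psi> c = \<psi> (of_nat n * c)" for n c
    by (induction n) (simp_all add: z add distrib_right)
  have sum_psi: "(\<Sum>m\<in>A. \<psi> (g m)) = \<psi> (sum g A)" for A and g :: "'q \<Rightarrow> 'q"
    by (induction A rule: infinite_finite_induct) (simp_all add: z add)
  define t :: "'q \<Rightarrow> 'q" where "t m = inverse m + inverse m ^ p" for m
  have t: "j (t m) * \<psi> c = \<psi> (t m * c)" for m c
  proof -
    have "t m ^ p = t m" unfolding t_def q_frob_add by (simp add: q_frob_frob add.commute)
    then obtain n where "t m = of_nat n" using q_frob_fixed by blast
    then show ?thesis by (simp add: j_of_nat of_nat_psi)
  qed
  have shift: "j l ^ k * (\<Sum>m\<in>UNIV - {0}. inverse (j m ^ k) * \<psi> m) =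
      (\<Sum>m\<in>UNIV - {0}. j (inverse m ^ k) * \<psi> (l * m))" for k
  proof -
    have j_inv: "j (inverse m) = inverse (j m)" if "m \<noteq> 0" for m
      using j_mult[of m "inverse m"] that by (simp add: inverse_unique)
    have "(\<Sum>m\<in>UNIV - {0}. inverse (j m ^ k) * \<psi> m) =
        (\<Sum>m\<in>UNIV - {0}. inverse (j (l * m) ^ k) * \<psi> (l * m))"
      by (rule sum.reindex_bij_witness[of _ "\<lambda>x. l * x" "\<lambda>x. x / l"]) (use False in auto)
    also have "j l ^ k * \<dots> = (\<Sum>m\<in>UNIV - {0}. j (inverse m ^ k) * \<psi> (l * m))"
      unfolding sum_distrib_left using False
      by (intro sum.cong) (auto simp: j_mult j_power j_inv power_mult_distrib power_inverse)
    finally show ?thesis .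
  qed
  have "j l ^ 1 * (\<Sum>m\<in>UNIV - {0}. inverse (j m ^ 1) * \<psi> m) +
      j l ^ p * (\<Sum>m\<in>UNIV - {0}. inverse (j m ^ p) * \<psi> m) =
      (\<Sum>m\<in>UNIV - {0}. j (t m) * \<psi> (l * m))"
    unfolding shift by (simp add: t_def j_add j_power distrib_right sum.distrib)
  also have "\<dots> = \<psi> (\<Sum>m\<in>UNIV - {0}. t m * (l * m))" by (simp only: t sum_psi)
  also have "(\<Sum>m\<in>UNIV - {0}. t m * (l * m)) = (\<Sum>m\<in>UNIV - {0}. l * (1 + m * inverse (m ^ p)))"
    by (intro sum.cong) (auto simp: t_def field_simps power_inverse)
  also have "\<dots> = l * ((\<Sum>m\<in>UNIV - {0 :: 'q}. 1) + (\<Sum>m\<in>UNIV - {0}. m * inverse (m ^ p)))"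
    by (simp only: sum_distrib_left[symmetric] sum.distrib[symmetric])
  also have "\<dots> = - l"
    unfolding sum_id_frob_inverse using q_of_nat_order by (simp add: card_Diff_singleton card_q)
  also have "\<psi> (- l) = - \<psi> l"
    using add[of l "- l"] z by (simp add: eq_neg_iff_add_eq_0 add.commute)
  finally show ?thesis by simp
qed

end

context quat_rep
begin

definition opr :: "nat \<Rightarrow> ('v \<Rightarrow> 'f) \<Rightarrow> 'v \<Rightarrow> 'f" where
  "opr k x = (\<Sum>l\<in>UNIV - {0}. fscl (inverse (j l ^ k)) (act (teich_elt l) x))"

lemma act_add: "act g (x + y) = act g x + act g y"
  and act_diff: "act g (x - y) = act g x - act g y"
  and act_fscl: "act g (fscl c x) = fscl c (act g x)"
  by (simp_all add: act_def fscl_def fun_eq_iff)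

lemma act_zero: "act g 0 = 0"
  by (simp add: act_def fun_eq_iff)

lemma act_sum: "act g (\<Sum>i\<in>A. x i) = (\<Sum>i\<in>A. act g (x i))"
proof (induction A rule: infinite_finite_induct)
  case (insert i A)
  show ?case unfolding sum.insert[OF insert(1,2)] act_add insert(3) ..
qed (simp_all only: sum.empty sum.infinite act_zero not_False_eq_True)

lemma sum_fun_apply: "(\<Sum>i\<in>A. x i) v = (\<Sum>i\<in>A. x i v :: 'f)"
  by (induction A rule: infinite_finite_induct) simp_all

lemma opr_apply: "opr k x v = (\<Sum>l\<in>UNIV - {0}. inverse (j l ^ k) * act (teich_elt l) x v)"
  by (simp add: opr_def sum_fun_apply) (simp add: fscl_def)

lemma opr_smult: "eltY k \<odot>\<^bsub>MD\<^esub> x = opr k x"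
  by (rule ext) (simp add: smult_apply eltY_closed pair_eltY smooth_orb opr_apply, simp add: orb_def act_def)

lemma opr_F: "k = 1 \<or> k = p \<Longrightarrow> x \<in> F n \<Longrightarrow> opr k x \<in> F (Suc n)"
  using I0_smult[OF eltY_I0] by (simp only: opr_smult)

lemma opr_linear: "Vector_Spaces.linear fscl fscl (opr k)"
  using FS.vector_space_axioms
  by (auto simp: Vector_Spaces.linear_iff opr_apply act_def fun_eq_iff fscl_def sum.distrib distrib_left
      sum_distrib_left mult_ac)

lemma opr_add: "opr k (x + y) = opr k x + opr k y"
  and opr_fscl: "opr k (fscl c x) = fscl c (opr k x)"
  using opr_linear by (simp_all only: Vector_Spaces.linear_iff)

lemma opr_sum: "opr k (\<Sum>i\<in>A. x i) = (\<Sum>i\<in>A. opr k (x i))"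
proof (induction A rule: infinite_finite_induct)
  case (insert i A)
  show ?case unfolding sum.insert[OF insert(1,2)] opr_add insert(3) ..
qed (simp_all add: opr_def act_zero FS.scale_zero_right del: zero_fun_apply)

text \<open>\<open>teich_elt\<close> is additive up to an element of \<open>UU 2\<close>, which acts
  in degree 2, and \<open>g h - g - h + 1 = (g - 1) (h - 1)\<close> has degree 2 as well.\<close>

lemma act_teich_elt_add:
  assumes x: "x \<in> F n"
  shows "act (teich_elt (a + b)) x - act (teich_elt a) x - act (teich_elt b) x + x \<in> F (n + 2)"
proof -
  let ?g = "teich_elt a" and ?h = "teich_elt b" and ?k = "teich_elt (a + b)"
  define u where "u = inverse ?k * (?g * ?h)"
  have nz: "?g \<noteq> 0" "?h \<noteq> 0" "?k \<noteq> 0" using UU1_nonzero[OF teich_elt_UU] by blast+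
  have u: "u \<in> D 2" unfolding u_def by (rule UU_2_D[OF teich_elt_add])
  have u0: "u \<noteq> 0" using nz by (simp add: u_def)
  have "?k * u = ?g * ?h" using nz by (simp add: u_def mult.assoc[symmetric])
  then have "act ?k (act u x) = act ?g (act ?h x)" using act_mult nz u0 by metis
  then have "act ?k x - act ?g x - act ?h x + x =
      (act ?g (act ?h x - x) - (act ?h x - x)) - act ?k (act u x - x)"
    by (simp add: act_diff)
  moreover have "act ?k (act u x - x) \<in> F (n + 2)" by (rule act_F_UU1[OF teich_elt_UU act_D[OF u x]])
  moreover have "act ?g (act ?h x - x) - (act ?h x - x) \<in> F (n + 2)"
    using act_D[OF UU1_D[OF teich_elt_UU] act_D[OF UU1_D[OF teich_elt_UU] x]] by simp
  ultimately show ?thesis by (simp only: filt.F_diff)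
qed

text \<open>Modulo \<open>F (n + 2)\<close>, \<open>teich_elt l - 1\<close> is additive in
  \<open>l\<close>, hence a combination of \<open>j l\<close> and its Frobenius conjugate. Up to
  sign, \<open>Y\<close> and \<open>Z\<close> are the two Fourier coefficients; the sign comes from
  \<open>p\<^sup>2 - 1 = - 1\<close>.\<close>

lemma act_teich_elt_expansion:
  assumes x: "x \<in> F n"
  shows "act (teich_elt l) x - x + (fscl (j l) (opr 1 x) + fscl (j l ^ p) (opr p x)) \<in> F (n + 2)"
    (is "?y \<in> _")
proof -
  have x0: "x \<in> F 0" using x filt.F_le by blast
  have "?y \<in> F 0"
    using act_F_UU1[OF teich_elt_UU x0] x0 filt.F_le[OF opr_F[OF _ x0]]
    by (intro filt.F_add filt.F_diff filt.F_scale) simp_all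
  moreover have "?y v = 0" if v: "v \<in> K (n + 2)" for v
  proof -
    define \<psi> where "\<psi> l = act (teich_elt l) x v - x v" for l
    have psi: "\<psi> (a + b) = \<psi> a + \<psi> b" for a b
    proof -
      have "(act (teich_elt (a + b)) x - act (teich_elt a) x - act (teich_elt b) x + x) v = 0"
        using act_teich_elt_add[OF x, of a b] v by (simp add: F_def del: K.simps)
      then show ?thesis by (simp add: \<psi>_def algebra_simps)
    qed
    have "opr k x v = (\<Sum>m\<in>UNIV - {0}. inverse (j m ^ k) * \<psi> m)" if "k = 1 \<or> k = p" for k
    proof -
      \<comment> \<open>The coefficients in \<open>Y\<close> and in \<open>Z\<close> sum to zero, so
        \<open>teich_elt m\<close> may be replaced by \<open>teich_elt m - 1\<close>.\<close>
      have "(\<Sum>m\<in>UNIV - {0}. inverse (j m ^ k)) = 0"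
        using aug_eltY[OF that] pair_eltY[OF smooth_const, of k 1] by (simp add: aug_def)
      then have "(\<Sum>m\<in>UNIV - {0}. inverse (j m ^ k) * x v) = 0" by (simp add: sum_distrib_right[symmetric])
      then show ?thesis unfolding opr_apply \<psi>_def right_diff_distrib sum_subtractf by simp
    qed
    then have "opr 1 x v = (\<Sum>m\<in>UNIV - {0}. inverse (j m) * \<psi> m)"
      "opr p x v = (\<Sum>m\<in>UNIV - {0}. inverse (j m ^ p) * \<psi> m)" by fastforce+
    then show ?thesis
      using additive_function_expansion[of \<psi> l, OF psi] by (simp add: fscl_def \<psi>_def)
  qed
  ultimately show ?thesis unfolding F_0 by (simp add: F_def del: K.simps)
qed

text \<open>Each \<open>teich_elt l - 1\<close> in \<open>functional_step\<close> is replaced by its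
  expansion in \<open>Y\<close> and \<open>Z\<close>; the witnesses collect the coefficients
  \<open>- j l\<close> and \<open>- j l ^ p\<close>.\<close>

lemma F_Suc_opr:
  assumes x: "x \<in> F (Suc n)"
  shows "\<exists>y\<in>F n. \<exists>z\<in>F n. x - (opr 1 y + opr p z) \<in> F (n + 2)"
proof -
  obtain f where f: "\<And>l. f l \<in> F n" "x = (\<Sum>l\<in>UNIV. act (teich_elt l) (f l) - f l)"
    using functional_step[OF x] by blast
  define y where "y = (\<Sum>l\<in>UNIV. fscl (- j l) (f l))"
  define z where "z = (\<Sum>l\<in>UNIV. fscl (- (j l ^ p)) (f l))"
  have yz: "y \<in> F n" "z \<in> F n" unfolding y_def z_def using f(1) by (intro filt.F_sum filt.F_scale; simp)+
  have "(\<Sum>l\<in>UNIV. act (teich_elt l) (f l) - f l + (fscl (j l) (opr 1 (f l)) + fscl (j l ^ p) (opr p (f l)))) \<in> F (n + 2)"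
    by (intro filt.F_sum act_teich_elt_expansion f(1))
  moreover have "(\<Sum>l\<in>UNIV. act (teich_elt l) (f l) - f l + (fscl (j l) (opr 1 (f l)) + fscl (j l ^ p) (opr p (f l)))) =
      x - (opr 1 y + opr p z)"
  proof -
    have lin: "opr k (\<Sum>l\<in>A. fscl (c l) (f l)) = (\<Sum>l\<in>A. fscl (c l) (opr k (f l)))" for k c and A :: "'q set"
      by (simp only: opr_sum opr_fscl)
    show ?thesis
      unfolding y_def z_def lin f(2) by (simp only: sum.distrib sum_negf FS.scale_minus_left) simp
  qed
  ultimately have "x - (opr 1 y + opr p z) \<in> F (n + 2)" by (simp only:)
  with yz show ?thesis by blast
qed

text \<open>The value at \<open>zeta\<close> of the character \<open>\<alpha>\<close>, which is the
  weight of \<open>Y\<close>. The weight \<open>wt ^ p\<close> of \<open>Z\<close> is its inverse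
  because \<open>wt\<close> has order \<open>p + 1\<close>.\<close>

definition wt :: 'f where
  "wt = j (res zeta ^ (p - 1))"

lemma res_zeta_power_eq_1: "res zeta ^ k = 1 \<Longrightarrow> k < p\<^sup>2 - 1 \<Longrightarrow> k = 0"
  using zeta_power_res zeta_primitive by blast

lemma p_sq_factor: "(p - 1) * (p + 1) = p\<^sup>2 - 1"
  by (simp add: power2_eq_square algebra_simps diff_mult_distrib)

lemma wt_order: "wt ^ (p + 1) = 1" "0 < i \<Longrightarrow> i \<le> p \<Longrightarrow> wt ^ i \<noteq> 1"
proof -
  have "res zeta ^ (p\<^sup>2 - 1) = 1"
    using tau_power[of "res zeta" "p\<^sup>2 - 1"] zeta_order by (metis res_tau tau_one tau_res_zeta)
  then show "wt ^ (p + 1) = 1"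
    unfolding wt_def j_power[symmetric] power_mult[symmetric] p_sq_factor by simp
  assume i: "0 < i" "i \<le> p"
  have "(p - 1) * i < (p - 1) * (p + 1)" using i p_gt_1 by (intro mult_strict_left_mono) simp_all
  then have "(p - 1) * i < p\<^sup>2 - 1" by (simp only: p_sq_factor)
  then have lt: "res zeta ^ ((p - 1) * i) = 1 \<Longrightarrow> (p - 1) * i = 0" using res_zeta_power_eq_1 by blast
  have "(p - 1) * i \<noteq> 0" using i p_gt_1 by simp
  then have ne: "res zeta ^ ((p - 1) * i) \<noteq> 1" using lt by (rule contrapos_nn)
  have "wt ^ i = j (res zeta ^ ((p - 1) * i))" unfolding wt_def j_power[symmetric] power_mult[symmetric] ..
  then show "wt ^ i \<noteq> 1" using ne j_inj[of "res zeta ^ ((p - 1) * i)" 1] by fastforce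
qed

lemma wt_power_p: "wt ^ p = inverse wt"
  using wt_order(1) by (intro inverse_unique[symmetric]) simp

lemma wt_nonzero: "wt \<noteq> 0"
  using wt_order(1) by auto

text \<open>Conjugation by \<open>zeta\<close> multiplies the index \<open>l\<close> by
  \<open>res zeta ^ (p - 1)\<close>; reindexing the sum extracts the factor \<open>wt ^ k\<close>
  from the coefficients.\<close>

lemma zeta_opr: "act zeta (opr k x) = fscl (wt ^ k) (opr k (act zeta x))"
proof -
  let ?c = "res zeta ^ (p - 1)"
  have c0: "?c \<noteq> 0" using res_zeta_nonzero by simp
  have conj: "act zeta (act (teich_elt l) x) = act (teich_elt (?c * l)) (act zeta x)" for l
    using zeta_conj_teich_elt[of l] act_mult[OF zeta_nonzero UU1_nonzero[OF teich_elt_UU]]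
      act_mult[OF UU1_nonzero[OF teich_elt_UU] zeta_nonzero] by metis
  have "act zeta (opr k x) = (\<Sum>l\<in>UNIV - {0}. fscl (inverse (j l ^ k)) (act (teich_elt (?c * l)) (act zeta x)))"
    unfolding opr_def act_sum act_fscl conj ..
  also have "\<dots> = (\<Sum>l\<in>UNIV - {0}. fscl (wt ^ k * inverse (j l ^ k)) (act (teich_elt l) (act zeta x)))"
  proof (rule sum.reindex_bij_witness[of _ "\<lambda>x. x / ?c" "\<lambda>x. ?c * x"])
    fix l :: 'q assume "l \<in> UNIV - {0}"
    have "wt ^ k * inverse (j (?c * l) ^ k) = inverse (j l ^ k)"
    proof -
      have "j (?c * l) ^ k = wt ^ k * j l ^ k" by (simp only: j_mult wt_def power_mult_distrib)
      then show ?thesis using wt_nonzero by simp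
    qed
    then show "fscl (wt ^ k * inverse (j (?c * l) ^ k)) (act (teich_elt (?c * l)) (act zeta x)) =
        fscl (inverse (j l ^ k)) (act (teich_elt (?c * l)) (act zeta x))" by simp
  qed (use c0 in auto)
  also have "\<dots> = fscl (wt ^ k) (opr k (act zeta x))"
    unfolding opr_def FS.scale_sum_right by simp
  finally show ?thesis .
qed

lemma zeta_F: "x \<in> F n \<Longrightarrow> act zeta x \<in> F n"
proof (rule act_F[OF zeta_OD _ zeta_nonzero])
  have "zeta * zeta ^ (p\<^sup>2 - 2) = 1"
    using zeta_order p_sq_gt_1 by (metis Suc_diff_Suc diff_Suc_1 numeral_2_eq_2 power_Suc Suc_1)
  then have "inverse zeta = zeta ^ (p\<^sup>2 - 2)" by (rule inverse_unique)
  then show "inverse zeta \<in> OD" using OD_power[OF zeta_OD] by simp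
qed

lemma zeta_order_act: "(act zeta ^^ (p\<^sup>2 - 1)) x = x"
proof -
  have "(act zeta ^^ n) x = act (zeta ^ n) x" for n
    by (induction n) (simp_all add: act_mult zeta_nonzero)
  then show ?thesis by (simp only: zeta_order act_one)
qed

section \<open>The operator \<open>T\<close> and its commutator with \<open>Z\<close>\<close>

definition cmt :: 'd where
  "cmt = commutator (teich_elt 1) (teich_elt (res zeta))"

definition TT :: "('v \<Rightarrow> 'f) \<Rightarrow> 'v \<Rightarrow> 'f" where
  "TT x = act cmt x - x"

text \<open>The constant \<open>\<beta>\<close> of the overview: \<open>b\<^sup>p - b\<close> for
  the digit \<open>b\<close> of \<open>cmt\<close> in degree 2, as in
  \<open>commutator_level_2\<close>. Here \<open>b\<^sup>p = - b\<close>, so it equals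
  \<open>- 2 * b\<close> and is nonzero.\<close>

definition wdiff :: 'q where
  "wdiff = (res zeta - res zeta ^ p) ^ p - (res zeta - res zeta ^ p)"

lemma wdiff_nonzero: "wdiff \<noteq> 0"
proof -
  have "wdiff + 2 * (res zeta - res zeta ^ p) = (res zeta - res zeta ^ p) ^ p + (res zeta - res zeta ^ p)"
    by (simp add: wdiff_def)
  also have "(res zeta - res zeta ^ p) ^ p + (res zeta - res zeta ^ p) = 0"
  proof -
    have "(res zeta - res zeta ^ p) ^ p + (res zeta ^ p) ^ p = res zeta ^ p"
      using q_frob_add[of "res zeta - res zeta ^ p" "res zeta ^ p"] by simp
    then show ?thesis by (simp add: q_frob_frob algebra_simps)
  qed
  finally have "wdiff = 0 \<longrightarrow> 2 * (res zeta - res zeta ^ p) = 0" by (metis add_0)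
  moreover have "2 * (res zeta - res zeta ^ p) \<noteq> 0" using q_two res_zeta_frob by simp
  ultimately show ?thesis by blast
qed

lemma cmt_cong: "cg 3 cmt (1 + w ^ 2 * tau (res zeta - res zeta ^ p))"
  using teich_elt_commutator[of 1 "res zeta"] by (simp add: cmt_def)

lemma cmt_D: "cmt \<in> D 2"
  using D_commutator[OF UU1_D[OF teich_elt_UU] UU1_D[OF teich_elt_UU], of 1 "res zeta"]
  by (simp add: cmt_def numeral_2_eq_2)

lemma cmt_nonzero: "cmt \<noteq> 0"
  using UU1_nonzero[OF D_D(2)[OF cmt_D]] .

lemma TT_linear: "Vector_Spaces.linear fscl fscl TT"
  using FS.vector_space_axioms
  by (auto simp: Vector_Spaces.linear_iff TT_def act_def fscl_def fun_eq_iff algebra_simps)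

lemma TT_F: "x \<in> F n \<Longrightarrow> TT x \<in> F (n + 2)"
  unfolding TT_def by (rule act_D[OF cmt_D])

lemma commutator_mult: "g \<noteq> 0 \<Longrightarrow> h \<noteq> 0 \<Longrightarrow> commutator g h * (h * g) = g * h"
  by (simp add: commutator_def mult.assoc)

text \<open>To leading order, \<open>A\<close> is \<open>- (Y + Z)\<close> and \<open>B\<close> is
  \<open>- (m Y + m\<^sup>p Z)\<close> with \<open>m = j (res zeta)\<close>. In their commutator the
  squares cancel and \<open>(m - m\<^sup>p) (Z Y - Y Z)\<close> remains, which maps \<open>x\<close>
  to \<open>F 3\<close> by hypothesis.\<close>

lemma TT_deg_3:
  assumes x: "x \<in> F 0" and zy: "opr p (opr 1 x) \<in> F 3" and yz: "opr 1 (opr p x) \<in> F 3"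
  shows "TT x \<in> F 3"
proof -
  let ?g = "teich_elt 1" and ?h = "teich_elt (res zeta)" and ?m = "j (res zeta)"
  let ?Y = "opr 1" and ?Z = "opr p"
  define A where "A x = act ?g x - x" for x
  define B where "B x = act ?h x - x" for x
  have nz: "?g \<noteq> 0" "?h \<noteq> 0" using UU1_nonzero[OF teich_elt_UU] by blast+
  have A_F: "A x \<in> F (Suc n)" and B_F: "B x \<in> F (Suc n)" if "x \<in> F n" for x n
    using act_D[OF UU1_D[OF teich_elt_UU] that] by (simp_all add: A_def B_def)
  have A_diff: "A (x - y) = A x - A y" "B (x - y) = B x - B y"
    and A_add: "A (x + y) = A x + A y" "B (x + y) = B x + B y"
    and A_fscl: "A (fscl c x) = fscl c (A x)" "B (fscl c x) = fscl c (B x)" for x y c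
    by (simp_all add: A_def B_def act_diff act_add act_fscl FS.scale_right_diff_distrib)
  have A: "A x + (?Y x + ?Z x) \<in> F (n + 2)" if "x \<in> F n" for x n
    using act_teich_elt_expansion[OF that, of 1] by (simp add: A_def)
  have B: "B x + (fscl ?m (?Y x) + fscl (?m ^ p) (?Z x)) \<in> F (n + 2)" if "x \<in> F n" for x n
    using act_teich_elt_expansion[OF that, of "res zeta"] by (simp add: B_def)
  have opF: "?Y x \<in> F (Suc n)" "?Z x \<in> F (Suc n)" if "x \<in> F n" for x n
    using opr_F[OF _ that] by simp_all
  define r where "r = A x + (?Y x + ?Z x)"
  define r' where "r' = B x + (fscl ?m (?Y x) + fscl (?m ^ p) (?Z x))"
  have r: "r \<in> F 2" "r' \<in> F 2" using A[OF x] B[OF x] by (simp_all add: r_def r'_def numeral_2_eq_2)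
  have Ax: "A x = r - (?Y x + ?Z x)" and Bx: "B x = r' - (fscl ?m (?Y x) + fscl (?m ^ p) (?Z x))"
    by (simp_all add: r_def r'_def)
  have deg1: "A y + (?Y y + ?Z y) \<in> F 3" "B y + (fscl ?m (?Y y) + fscl (?m ^ p) (?Z y)) \<in> F 3" if "y \<in> F 1" for y
    using A[OF that] B[OF that] by (simp_all add: numeral_3_eq_3)
  have Y1: "?Y x \<in> F 1" "?Z x \<in> F 1" using opF[OF x] by simp_all
  note A1 = deg1[OF Y1(1)] deg1[OF Y1(2)]
  have AB: "A (B x) - B (A x) \<in> F 3"
  proof -
    define s1 s2 where "s1 = A (?Y x) + (?Y (?Y x) + ?Z (?Y x))" and "s2 = A (?Z x) + (?Y (?Z x) + ?Z (?Z x))"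
    define s3 s4 where "s3 = B (?Y x) + (fscl ?m (?Y (?Y x)) + fscl (?m ^ p) (?Z (?Y x)))"
      and "s4 = B (?Z x) + (fscl ?m (?Y (?Z x)) + fscl (?m ^ p) (?Z (?Z x)))"
    have "s1 \<in> F 3" "s2 \<in> F 3" "s3 \<in> F 3" "s4 \<in> F 3" "A r' \<in> F 3" "B r \<in> F 3"
      using A1 A_F[OF r(2)] B_F[OF r(1)] by (simp_all add: s1_def s2_def s3_def s4_def numeral_3_eq_3 numeral_2_eq_2)
    then have "A r' - fscl ?m s1 - fscl (?m ^ p) s2 - (B r - s3 - s4)
        + (fscl (?m - ?m ^ p) (?Z (?Y x)) - fscl (?m - ?m ^ p) (?Y (?Z x))) \<in> F 3"
      using zy yz by (intro filt.F_add filt.F_diff filt.F_scale)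
    then show ?thesis
      unfolding Ax Bx A_diff A_add A_fscl s1_def s2_def s3_def s4_def
      by (simp add: FS.scale_right_distrib FS.scale_left_diff_distrib algebra_simps)
  qed
  have "cmt * (?h * ?g) = ?g * ?h" using commutator_mult[OF nz] by (simp add: cmt_def)
  then have "act cmt (act (?h * ?g) x) = act (?g * ?h) x"
    using act_mult[OF cmt_nonzero, of "?h * ?g"] nz by (metis mult_eq_0_iff)
  \<comment> \<open>\<open>cmt\<close> carries \<open>h g x\<close> to \<open>g h x\<close>, so
    \<open>T\<close> is first computed on \<open>h g x\<close>. The difference
    \<open>h g x - x\<close> lies in \<open>F 1\<close>, and \<open>T\<close> sends it to
    \<open>F 3\<close>.\<close>
  then have "TT x = (A (B x) - B (A x)) - TT (act (?h * ?g) x - x)"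
    using nz by (simp add: TT_def A_def B_def act_diff act_mult)
  moreover have "TT (act (?h * ?g) x - x) \<in> F 3"
    using TT_F[OF act_D[OF UU1_D[OF UU_mult[OF teich_elt_UU teich_elt_UU]] x]] by (simp add: numeral_3_eq_3)
  ultimately show ?thesis using AB by (simp only: filt.F_diff)
qed

text \<open>For each \<open>l\<close> this is the identity \<open>u g - g u = (c - 1) g u\<close>
  with the commutator \<open>c\<close> of \<open>u\<close> and \<open>g\<close>. The commutators of
  \<open>cmt\<close> with the \<open>teich_elt l\<close> lie in \<open>UU 3\<close>, where the
  degree jumps to \<open>p\<close>.\<close>

lemma TT_opr:
  assumes "x \<in> F n"
  shows "TT (opr p x) - opr p (TT x) = (\<Sum>l\<in>UNIV - {0}. fscl (inverse (j l ^ p))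
    (act (commutator cmt (teich_elt l)) (act (teich_elt l * cmt) x) - act (teich_elt l * cmt) x))"
proof -
  have eq: "act cmt (act (teich_elt l) x) - act (teich_elt l) (act cmt x) =
      act (commutator cmt (teich_elt l)) (act (teich_elt l * cmt) x) - act (teich_elt l * cmt) x" for l
  proof -
    have nz: "teich_elt l \<noteq> 0" using UU1_nonzero[OF teich_elt_UU] by blast
    have "act (commutator cmt (teich_elt l)) (act (teich_elt l * cmt) x) = act (cmt * teich_elt l) x"
      using act_mult[of "commutator cmt (teich_elt l)" "teich_elt l * cmt" x] commutator_mult[OF cmt_nonzero nz]
        nz cmt_nonzero by (metis mult_eq_0_iff)
    then show ?thesis using act_mult nz cmt_nonzero by simp
  qed
  have "TT (opr p x) - opr p (TT x) = (\<Sum>l\<in>UNIV - {0}. fscl (inverse (j l ^ p))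
      (act cmt (act (teich_elt l) x) - act (teich_elt l) (act cmt x)))"
    unfolding TT_def opr_def act_sum act_fscl act_diff FS.scale_right_diff_distrib sum_subtractf by simp
  then show ?thesis unfolding eq .
qed

lemma commutator_cmt_UU: "commutator cmt (teich_elt l) \<in> UU 3"
proof -
  have "cg 3 (commutator cmt (teich_elt l)) (1 + w ^ 3 * tau (wdiff * l))"
    using cg_mono[OF commutator_level_2[OF cmt_cong, of l], of 3] by (simp add: wdiff_def)
  moreover have "cg 3 (1 + w ^ 3 * tau (wdiff * l)) 1" by (rule cgI[of "tau (wdiff * l)"]) simp_all
  ultimately show ?thesis unfolding UU_iff by (rule cg_trans)
qed

lemma TT_opr_F:
  assumes x: "x \<in> F n" shows "TT (opr p x) - opr p (TT x) \<in> F (n + p)"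
  unfolding TT_opr[OF x]
  by (intro filt.F_sum filt.F_scale act_D[OF UU_3_D[OF commutator_cmt_UU]] act_F_UU1[OF _ x] UU_mult teich_elt_UU
      D_D(2)[OF cmt_D])

lemma act_power: "g \<in> UU 1 \<Longrightarrow> act (g ^ n) x = (act g ^^ n) x"
proof (induction n)
  case (Suc n)
  then show ?case using act_mult[OF UU1_nonzero UU1_nonzero, of g "g ^ n" x] UU_power[of g 1 n] by simp
qed simp

lemma act_p_power:
  assumes g: "g \<in> UU 1" shows "act (g ^ p) x - x = ((\<lambda>x. act g x - x) ^^ p) x"
proof -
  let ?f = "\<lambda>x. act g x - x"
  have ns: "nscale m y = fscl (of_nat m) y" for m y
    by (induction m) (simp_all add: FS.scale_left_distrib fscl_def fun_eq_iff distrib_right)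
  have "(of_nat p :: 'f) = 0" unfolding of_nat_eq_0_iff_char_dvd char_f by simp
  then have kill: "nscale p (?f y) = 0" for y unfolding ns by (simp only: FS.scale_zero_left)
  have "((\<lambda>x. x + ?f x) ^^ p) x = x + (?f ^^ p) x"
    using p_prime kill by (intro funpow_prime_binomial) (simp_all add: act_add)
  then show ?thesis using act_power[OF g, of p x] by (simp add: fun_eq_iff)
qed

text \<open>On \<open>Y\<^sup>i v\<close> the \<open>Z\<close>-part of the expansion lies one degree
  deeper by hypothesis, so iterating \<open>g - 1\<close> only accumulates factors
  \<open>- j l\<close> and powers of \<open>Y\<close>.\<close>

lemma act_teich_elt_power:
  assumes v: "v \<in> F 0" and ZY: "\<And>i. opr p ((opr 1 ^^ i) v) \<in> F (i + 2)"
  shows "((\<lambda>x. act (teich_elt l) x - x) ^^ i) v - fscl ((- j l) ^ i) ((opr 1 ^^ i) v) \<in> F (i + 1)"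
proof (induction i)
  case 0
  have "((\<lambda>x. act (teich_elt l) x - x) ^^ 0) v - fscl ((- j l) ^ 0) ((opr 1 ^^ 0) v) = 0"
    by (rule ext) (simp add: fscl_def)
  then show ?case by (metis filt.F_zero)
next
  case (Suc i)
  define A where "A = (\<lambda>x. act (teich_elt l) x - x)"
  let ?y = "(opr 1 ^^ i) v"
  have y: "?y \<in> F i"
    by (induction i) (use v opr_F[of 1] in simp_all)
  have A_diff: "A (x - y) = A x - A y" for x y by (simp add: A_def act_diff)
  have A_fscl: "A (fscl c y) = fscl c (A y)" for c y by (simp add: A_def act_fscl FS.scale_right_diff_distrib)
  have "A ((A ^^ i) v - fscl ((- j l) ^ i) ?y) \<in> F (i + 1 + 1)"
    unfolding A_def by (rule act_D[OF UU1_D[OF teich_elt_UU] Suc])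
  then have 1: "(A ^^ Suc i) v - fscl ((- j l) ^ i) (A ?y) \<in> F (i + 2)"
    unfolding A_diff A_fscl by simp
  have "fscl ((- j l) ^ i) (A ?y + (fscl (j l) (opr 1 ?y) + fscl (j l ^ p) (opr p ?y)) - fscl (j l ^ p) (opr p ?y)) \<in> F (i + 2)"
    unfolding A_def
    by (intro filt.F_scale filt.F_diff act_teich_elt_expansion y ZY)
  from filt.F_add[OF 1 this] have "(A ^^ Suc i) v - fscl ((- j l) ^ Suc i) ((opr 1 ^^ Suc i) v) \<in> F (Suc i + 1)"
    by (simp add: FS.scale_right_distrib FS.scale_right_diff_distrib algebra_simps)
  then show ?case unfolding A_def .
qed

text \<open>Both elements have the leading digit \<open>wdiff * l\<close> in degree 3: the
  commutator by \<open>commutator_level_2\<close>, the \<open>p\<close>-th power by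
  \<open>UU_p_power\<close> at level 1. The quotient in \<open>UU 4\<close> acts in degree
  \<open>2 * p\<close>, beyond the precision needed.\<close>

lemma commutator_cmt_eq:
  obtains d where "d \<in> UU 4" "commutator cmt (teich_elt l) = d * teich_elt (wdiff * l) ^ p"
proof -
  have g: "teich_elt (wdiff * l) ^ p \<in> UU 1" by (rule UU_power[OF teich_elt_UU])
  have "cg 4 (teich_elt (wdiff * l) ^ p) (1 + w ^ 3 * tau (wdiff * l))"
    using UU_p_power[of 1 "tau (wdiff * l)"] by (simp add: teich_elt_def numeral_3_eq_3 add.commute numeral_eq_Suc)
  then have "cg 4 (commutator cmt (teich_elt l)) (teich_elt (wdiff * l) ^ p)"
    using cg_trans[OF commutator_level_2[OF cmt_cong, of l] cg_sym] by (simp add: wdiff_def)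
  from cg_right_quotient[OF this UU_unit(1)[OF _ g] UU1_nonzero[OF g]]
  have "commutator cmt (teich_elt l) * inverse (teich_elt (wdiff * l) ^ p) \<in> UU 4" by simp
  moreover have "commutator cmt (teich_elt l) =
      commutator cmt (teich_elt l) * inverse (teich_elt (wdiff * l) ^ p) * teich_elt (wdiff * l) ^ p"
    using UU1_nonzero[OF g] by (simp add: mult.assoc)
  ultimately show ?thesis by (rule that)
qed

text \<open>With \<open>\<beta> = wdiff\<close> read in the coefficient field, the summand for
  \<open>l\<close> has leading term \<open>- (\<beta> l)\<^sup>p Y\<^sup>p v\<close>. The
  coefficient of \<open>teich_elt l\<close> in \<open>Z\<close> cancels the dependence on
  \<open>l\<close>, and the sum of \<open>p\<^sup>2 - 1\<close> equal terms reverses the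
  sign.\<close>

lemma TT_opr_leading:
  assumes v: "v \<in> F 0" and ZY: "\<And>i. opr p ((opr 1 ^^ i) v) \<in> F (i + 2)"
  shows "TT (opr p v) - opr p (TT v) - fscl (j wdiff ^ p) ((opr 1 ^^ p) v) \<in> F (p + 1)"
proof -
  let ?b = "j wdiff" and ?y = "(opr 1 ^^ p) v"
  have step: "act (commutator cmt (teich_elt l)) (act (teich_elt l * cmt) v) - act (teich_elt l * cmt) v
      - fscl (- ((?b * j l) ^ p)) ?y \<in> F (p + 1)" for l
  proof -
    let ?c = "commutator cmt (teich_elt l)" and ?g = "teich_elt (wdiff * l)"
    define z where "z = act (teich_elt l * cmt) v"
    have "z - v \<in> F (0 + 1)"
      unfolding z_def by (rule act_D[OF UU1_D[OF UU_mult[OF teich_elt_UU D_D(2)[OF cmt_D]]] v])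
    from act_D[OF UU_3_D[OF commutator_cmt_UU] this, of l]
    have 1: "act ?c (z - v) - (z - v) \<in> F (p + 1)" by (simp add: add.commute)
    obtain d where d: "d \<in> UU 4" "?c = d * ?g ^ p" by (rule commutator_cmt_eq)
    have gp: "?g ^ p \<in> UU 1" by (rule UU_power[OF teich_elt_UU])
    have dD: "d \<in> D (p * 2)" by (rule UU_4_D[OF d(1)])
    have "act ?c v = act d (act (?g ^ p) v)"
      unfolding d(2) by (rule act_mult[OF UU1_nonzero[OF D_D(2)[OF dD]] UU1_nonzero[OF gp]])
    moreover have "act d (act (?g ^ p) v) - act (?g ^ p) v \<in> F (p + 1)"
      by (rule filt.F_le[OF act_D[OF dD act_F_UU1[OF gp v]]]) (use p_gt_1 in simp)
    ultimately have 2: "act ?c v - act (?g ^ p) v \<in> F (p + 1)" by simp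
    have odd: "(- (?b * j l)) ^ p = - ((?b * j l) ^ p)" using p_ge_5 p_prime prime_odd_nat by (simp add: power_minus_odd)
    have 3: "act (?g ^ p) v - v - fscl (- ((?b * j l) ^ p)) ?y \<in> F (p + 1)"
      using act_teich_elt_power[OF v ZY, where l = "wdiff * l" and i = p] unfolding act_p_power[OF teich_elt_UU, symmetric]
      by (simp only: j_mult odd)
    from filt.F_add[OF filt.F_add[OF 1 2] 3] show ?thesis
      by (simp add: act_diff z_def algebra_simps)
  qed
  have "(\<Sum>l\<in>UNIV - {0}. fscl (inverse (j l ^ p)) (act (commutator cmt (teich_elt l)) (act (teich_elt l * cmt) v)
      - act (teich_elt l * cmt) v - fscl (- ((?b * j l) ^ p)) ?y)) \<in> F (p + 1)"
    by (intro filt.F_sum filt.F_scale step)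
  then have "TT (opr p v) - opr p (TT v) - (\<Sum>l\<in>UNIV - {0}. fscl (inverse (j l ^ p)) (fscl (- ((?b * j l) ^ p)) ?y)) \<in> F (p + 1)"
    unfolding TT_opr[OF v] FS.scale_right_diff_distrib sum_subtractf .
  moreover have "(\<Sum>l\<in>UNIV - {0}. fscl (inverse (j l ^ p)) (fscl (- ((?b * j l) ^ p)) ?y)) = fscl (?b ^ p) ?y"
  proof -
    have "(\<Sum>l\<in>UNIV - {0}. fscl (inverse (j l ^ p)) (fscl (- ((?b * j l) ^ p)) ?y)) =
        (\<Sum>l\<in>UNIV - {0 :: 'q}. fscl (- (?b ^ p)) ?y)"
      by (intro sum.cong) (auto simp: power_mult_distrib)
    also have "\<dots> = fscl (\<Sum>l\<in>UNIV - {0 :: 'q}. - (?b ^ p)) ?y" by (rule FS.scale_sum_left[symmetric])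
    also have "(\<Sum>l\<in>UNIV - {0 :: 'q}. - (?b ^ p)) = ?b ^ p"
      using f_of_nat_order by (simp add: card_Diff_singleton card_q)
    finally show ?thesis .
  qed
  ultimately show ?thesis by simp
qed

lemma no_generating_pair:
  assumes v01: "v0 \<in> F 0" "v1 \<in> F 0"
    and span0: "\<And>x. x \<in> F 0 \<Longrightarrow> \<exists>c d. x - (fscl c v0 + fscl d v1) \<in> F 1"
    and ZY: "\<And>i. opr p ((opr 1 ^^ i) v0) \<in> F (i + 2)"
    and YZ: "\<And>i. opr 1 ((opr p ^^ i) v1) \<in> F (i + 2)"
    and free: "\<And>n c d. n \<le> p \<Longrightarrow>
      fscl c ((opr 1 ^^ n) v0) + fscl d ((opr p ^^ n) v1) \<in> F (Suc n) \<Longrightarrow> c = 0 \<and> d = 0"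
  shows False
proof (rule filtered_operators.contradiction)
  have zy0: "opr p v0 \<in> F 2" "opr p (opr 1 v0) \<in> F 3" "opr 1 v1 \<in> F 2" "opr 1 (opr p v1) \<in> F 3"
    using ZY[of 0] ZY[of 1] YZ[of 0] YZ[of 1] by (simp_all add: numeral_2_eq_2 numeral_3_eq_3)
  \<comment> \<open>\<open>Z v0\<close> and \<open>Y v1\<close> already lie one degree deeper than
    expected, so applying one more operator puts the other mixed products into \<open>F 3\<close> as
    well, as \<open>TT_deg_3\<close> requires.\<close>
  have yz0: "opr 1 (opr p v0) \<in> F 3" "opr p (opr 1 v1) \<in> F 3"
    using opr_F[of 1, OF _ zy0(1)] opr_F[of p, OF _ zy0(3)] by (simp_all add: numeral_3_eq_3 numeral_2_eq_2)
  have ord: "wt ^ (p\<^sup>2 - 1) = 1"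
    unfolding p_sq_factor[symmetric] mult.commute[of "p - 1"] power_mult wt_order(1) by simp
  have N: "(of_nat (p\<^sup>2 - 1) :: 'f) \<noteq> 0" using f_of_nat_order by simp
  have delta: "j wdiff ^ p \<noteq> 0" using wdiff_nonzero by simp
  have p2: "p \<ge> 2" using p_gt_1 by simp
  show "filtered_operators fscl F (opr 1) (opr p) TT (act zeta) v0 v1 p wt (j wdiff ^ p) (p\<^sup>2 - 1)"
  proof (intro filtered_operators.intro filtered_operators_axioms.intro)
    show "linear_filtration fscl F" by (rule filt.linear_filtration_axioms)
    show "opr 1 x \<in> F (Suc n)" "opr p x \<in> F (Suc n)" if "x \<in> F n" for x n
      using opr_F[OF _ that] by simp_all
    show "act zeta (opr 1 x) = fscl wt (opr 1 (act zeta x))" for x using zeta_opr[of 1 x] by simp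
    show "act zeta (opr p x) = fscl (inverse wt) (opr p (act zeta x))" for x
      using zeta_opr[of p x] unfolding wt_power_p .
    show "TT v0 \<in> F 3" "TT v1 \<in> F 3" using TT_deg_3 v01 zy0 yz0 by simp_all
    show "TT (opr p v0) - opr p (TT v0) - fscl (j wdiff ^ p) ((opr 1 ^^ p) v0) \<in> F (p + 1)"
      by (rule TT_opr_leading[OF v01(1) ZY])
    show "c = 0 \<and> d = 0" if "n \<le> p" "fscl c ((opr 1 ^^ n) v0) + fscl d ((opr p ^^ n) v1) \<in> F (Suc n)" for n c d
      using free[OF that] .
  qed (fact opr_linear TT_linear act_linear TT_F zeta_F zeta_order_act N wt_order ord p2 delta v01 span0
      F_Suc_opr ZY YZ TT_opr_F)+
qed

section \<open>Consequences of a graded isomorphism\<close>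
abbreviation GM :: "('d, nat \<Rightarrow> ('d, 'f) iw set, nat \<Rightarrow> ('v \<Rightarrow> 'f) set) graded_module" where
  "GM \<equiv> gr_dual OD w scl \<rho>"

text \<open>The counterpart of \<open>gr_class\<close> for the graded dual: the homogeneous element
  of degree \<open>n\<close> represented by \<open>x\<close>.\<close>

definition mcl :: "nat \<Rightarrow> ('v \<Rightarrow> 'f) \<Rightarrow> nat \<Rightarrow> ('v \<Rightarrow> 'f) set" where
  "mcl n x = (\<lambda>k. F (Suc k) +>\<^bsub>MD\<^esub> (if k = n then x else \<zero>\<^bsub>MD\<^esub>))"

lemma GM_eq: "GM = gr_module IW I0 MD (dual_act \<rho>)"
  by (simp add: gr_dual_def max_ideal_eq)

lemma ideal_times_MD_fun: "ideal_times_module IW I0 MD = F"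
  by (rule ext) (rule ideal_times_MD)

lemma coset_F_eq_iff: "F k +>\<^bsub>MD\<^esub> x = F k +>\<^bsub>MD\<^esub> y \<longleftrightarrow> x - y \<in> F k"
proof
  have c: "F k +>\<^bsub>MD\<^esub> x = (\<lambda>d. d + x) ` F k" for x
    by (simp only: a_r_coset_def' MD_simps(3) UNION_singleton_eq_range)
  assume "F k +>\<^bsub>MD\<^esub> x = F k +>\<^bsub>MD\<^esub> y"
  moreover have "0 + x \<in> F k +>\<^bsub>MD\<^esub> x" unfolding c by (rule imageI) (rule filt.F_zero)
  ultimately obtain d where "d \<in> F k" "0 + x = d + y" unfolding c by blast
  moreover have "x - y = (0 + x) - y" by (simp only: add_0)
  ultimately show "x - y \<in> F k" by (simp only: add_diff_cancel_right')
next
  have c: "F k +>\<^bsub>MD\<^esub> x = (\<lambda>d. d + x) ` F k" for x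
    by (simp only: a_r_coset_def' MD_simps(3) UNION_singleton_eq_range)
  have sub: "F k +>\<^bsub>MD\<^esub> x \<subseteq> F k +>\<^bsub>MD\<^esub> y" if "x - y \<in> F k" for x y
  proof
    fix u assume "u \<in> F k +>\<^bsub>MD\<^esub> x"
    then obtain d where d: "d \<in> F k" "u = d + x" unfolding c by blast
    then have "u = (d + (x - y)) + y" by (simp only: add.assoc diff_add_cancel)
    then show "u \<in> F k +>\<^bsub>MD\<^esub> y" unfolding c using filt.F_add[OF d(1) that] by blast
  qed
  assume xy: "x - y \<in> F k"
  then have "y - x \<in> F k" by (metis filt.F_diff_sym)
  then show "F k +>\<^bsub>MD\<^esub> x = F k +>\<^bsub>MD\<^esub> y" using sub[OF xy] sub by blast
qed

lemma coset_F_zero: "F k +>\<^bsub>MD\<^esub> \<zero>\<^bsub>MD\<^esub> = F k"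
  by (simp only: a_r_coset_def' MD_simps(2,3) UNION_singleton_eq_range add_0_right image_ident)

lemma mcl_eq_iff: "mcl n x = mcl n y \<longleftrightarrow> x - y \<in> F (Suc n)"
proof
  assume "mcl n x = mcl n y"
  then have "mcl n x n = mcl n y n" by (rule arg_cong)
  then have "F (Suc n) +>\<^bsub>MD\<^esub> x = F (Suc n) +>\<^bsub>MD\<^esub> y" by (simp only: mcl_def if_True refl)
  then show "x - y \<in> F (Suc n)" unfolding coset_F_eq_iff .
next
  assume "x - y \<in> F (Suc n)"
  then have "F (Suc n) +>\<^bsub>MD\<^esub> x = F (Suc n) +>\<^bsub>MD\<^esub> y" unfolding coset_F_eq_iff .
  then show "mcl n x = mcl n y" unfolding mcl_def by (intro ext) simp
qed

lemma GM_simps: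
  "carrier GM = gr_carrier MD F" "piece GM = gr_piece MD F"
  "X \<oplus>\<^bsub>GM\<^esub> Y = (\<lambda>n. X n <+>\<^bsub>MD\<^esub> Y n)"
  "A \<odot>\<^bsub>GM\<^esub> X = (\<lambda>n. F (Suc n) +>\<^bsub>MD\<^esub> (\<Oplus>\<^bsub>MD\<^esub>i\<in>{..n}. rep (A i) \<odot>\<^bsub>MD\<^esub> rep (X (n - i))))"
  by (simp_all add: GM_eq gr_module_def ideal_times_MD_fun)

lemma mcl_piece: "x \<in> F n \<Longrightarrow> mcl n x \<in> piece GM n"
proof -
  assume x: "x \<in> F n"
  have "\<exists>a\<in>F k. mcl n x k = F (Suc k) +>\<^bsub>MD\<^esub> a" for k
  proof (cases "k = n")
    case False
    then have "mcl n x k = F (Suc k) +>\<^bsub>MD\<^esub> \<zero>\<^bsub>MD\<^esub>" by (simp add: mcl_def)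
    moreover have "\<zero>\<^bsub>MD\<^esub> \<in> F k" unfolding MD_simps by (rule filt.F_zero)
    ultimately show ?thesis by blast
  qed (use x in \<open>auto simp: mcl_def\<close>)
  moreover have z: "k \<noteq> n \<Longrightarrow> mcl n x k = F (Suc k)" for k using coset_F_zero by (simp add: mcl_def)
  moreover have "finite {k. mcl n x k \<noteq> F (Suc k)}" by (rule finite_subset[of _ "{n}"]) (use z in auto)
  ultimately show ?thesis unfolding GM_simps gr_piece_def gr_carrier_def by blast
qed

lemma piece_carrier: "X \<in> piece GM n \<Longrightarrow> X \<in> carrier GM"
  unfolding GM_simps gr_piece_def by blast

lemma piece_mcl: "X \<in> piece GM n \<Longrightarrow> \<exists>x\<in>F n. X = mcl n x"
proof -
  assume X: "X \<in> piece GM n"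
  then obtain x where x: "x \<in> F n" "X n = F (Suc n) +>\<^bsub>MD\<^esub> x"
    unfolding GM_simps gr_piece_def gr_carrier_def by blast
  have "k \<noteq> n \<Longrightarrow> X k = F (Suc k)" for k using X unfolding GM_simps gr_piece_def by blast
  then have "X = mcl n x" using x coset_F_zero by (auto simp: mcl_def fun_eq_iff)
  then show ?thesis using x by blast
qed

lemma mcl_add:
  assumes "x \<in> F n" "y \<in> F n" shows "mcl n x \<oplus>\<^bsub>GM\<^esub> mcl n y = mcl n (x + y)"
proof -
  have sub: "abelian_subgroup (F k) MD" for k
    by (rule abelian_subgroupI3[OF additive_subgroup.intro[OF F_subgroup] MD_abelian_group])
  have c: "x \<in> carrier MD" "y \<in> carrier MD" "\<zero>\<^bsub>MD\<^esub> \<in> carrier MD"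
    using assms F_functional functionals_closed(1) by (simp_all only: MD_simps)
  have z: "\<zero>\<^bsub>MD\<^esub> + \<zero>\<^bsub>MD\<^esub> = \<zero>\<^bsub>MD\<^esub>" by (simp only: MD_simps add_0)
  show ?thesis
  proof
    fix k
    show "(mcl n x \<oplus>\<^bsub>GM\<^esub> mcl n y) k = mcl n (x + y) k"
      using abelian_subgroup.a_rcos_sum[OF sub c(1,2), of "Suc k"]
        abelian_subgroup.a_rcos_sum[OF sub c(3,3), of "Suc k"]
      by (cases "k = n") (simp_all only: GM_simps mcl_def if_True if_False refl z MD_simps(3))
  qed
qed

lemma gcl_smult_mcl:
  assumes "a \<in> mm m" "x \<in> F n" shows "gcl m a \<odot>\<^bsub>GM\<^esub> mcl n x = mcl (m + n) (a \<odot>\<^bsub>MD\<^esub> x)"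
  unfolding GM_simps
  using filtered_pairing.conv_homogeneous[OF MD_filtered_pairing assms]
  by (simp only: gr_class_def mcl_def)

lemma opr_power: "k = 1 \<or> k = p \<Longrightarrow> (opr k ^^ n) x = (eltY k [^]\<^bsub>IW\<^esub> n) \<odot>\<^bsub>MD\<^esub> x"
proof (induction n arbitrary: x)
  case 0
  show ?case by (simp add: smult_one nat_pow_def)
next
  case (Suc n)
  have "(opr k ^^ Suc n) x = (eltY k [^]\<^bsub>IW\<^esub> n) \<odot>\<^bsub>MD\<^esub> (eltY k \<odot>\<^bsub>MD\<^esub> x)"
    unfolding funpow_Suc_right o_apply opr_smult Suc.IH[OF Suc.prems] ..
  also have "\<dots> = (eltY k [^]\<^bsub>IW\<^esub> n \<otimes>\<^bsub>IW\<^esub> eltY k) \<odot>\<^bsub>MD\<^esub> x"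
    by (rule smult_assoc[OF mm_closed[OF eltY_power[OF Suc.prems]] eltY_closed, symmetric])
  finally show ?case by (simp add: nat_pow_def)
qed

lemma smult_zero_left: "\<zero>\<^bsub>IW\<^esub> \<odot>\<^bsub>MD\<^esub> x = 0"
proof -
  have z: "\<zero>\<^bsub>IW\<^esub> \<in> carrier IW" using ring.ring_simprules(2)[OF iw_ring] .
  have "\<zero>\<^bsub>IW\<^esub> \<oplus>\<^bsub>IW\<^esub> \<zero>\<^bsub>IW\<^esub> = \<zero>\<^bsub>IW\<^esub>" using ring.ring_simprules(8)[OF iw_ring z] .
  with smult_add_left[OF z z, of x] have "\<zero>\<^bsub>IW\<^esub> \<odot>\<^bsub>MD\<^esub> x = \<zero>\<^bsub>IW\<^esub> \<odot>\<^bsub>MD\<^esub> x + \<zero>\<^bsub>IW\<^esub> \<odot>\<^bsub>MD\<^esub> x"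
    by (simp only:)
  then show ?thesis by (rule idem_add_imp_zero)
qed

lemma smult_aug:
  assumes a: "a \<in> carrier IW" and x: "x \<in> F 0" shows "a \<odot>\<^bsub>MD\<^esub> x - fscl (aug a) x \<in> F 1"
proof -
  let ?b = "a \<oplus>\<^bsub>IW\<^esub> iw_scale (- aug a) \<one>\<^bsub>IW\<^esub>"
  have c: "iw_scale (- aug a) \<one>\<^bsub>IW\<^esub> \<in> carrier IW" by (rule iw_scale_closed[OF iw_one_closed])
  have "aug ?b = 0" using aug_add[OF a c] aug_scale[OF iw_one_closed] by (simp add: aug_one)
  then have "?b \<in> I0" using iw_add_closed[OF a c] by (simp add: I0_def)
  from I0_smult[OF this x] have "a \<odot>\<^bsub>MD\<^esub> x + fscl (- aug a) x \<in> F (Suc 0)"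
    unfolding smult_add_left[OF a c] smult_scale[OF iw_one_closed] smult_one .
  then show ?thesis by (simp only: FS.scale_minus_left add_uminus_conv_diff One_nat_def)
qed

lemma no_graded_isomorphism:
  defines "y \<equiv> gr_y p L OD w res j" and "z \<equiv> gr_z p L OD w res j"
  assumes iso: "graded_isomorphic GR H GM
    (direct_sum (twist OD w \<psi> (truncated OD w y z (p + 3))) (twist OD w \<psi>' (truncated OD w z y (p + 3))))"
  shows False
proof -
  interpret GR: ring GR by (rule GR_ring)
  have Y1: "eltY 1 \<in> mm 1" "eltY p \<in> mm 1" using mm_1[OF eltY_I0] by simp_all
  have yz: "y = gcl 1 (eltY 1)" "z = gcl 1 (eltY p)" by (simp_all only: y_def z_def gr_y_eq gr_z_eq)
  have yzc: "y \<in> carrier GR" "z \<in> carrier GR" unfolding yz using gcl_closed Y1 by blast+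
  define J1 where "J1 = Idl\<^bsub>GR\<^esub> {z, y [^]\<^bsub>GR\<^esub> (p + 3)}"
  define J2 where "J2 = Idl\<^bsub>GR\<^esub> {y, z [^]\<^bsub>GR\<^esub> (p + 3)}"
  have gen: "{z, y [^]\<^bsub>GR\<^esub> (p + 3)} \<subseteq> carrier GR" "{y, z [^]\<^bsub>GR\<^esub> (p + 3)} \<subseteq> carrier GR"
    using yzc by simp_all
  interpret J1: ideal J1 GR unfolding J1_def by (rule GR.genideal_ideal[OF gen(1)])
  interpret J2: ideal J2 GR unfolding J2_def by (rule GR.genideal_ideal[OF gen(2)])
  have zJ: "z \<in> J1" "y \<in> J2" unfolding J1_def J2_def using GR.genideal_self[OF gen(1)] GR.genideal_self[OF gen(2)] by simp_all
  let ?N = "direct_sum (twist OD w \<psi> (truncated OD w y z (p + 3))) (twist OD w \<psi>' (truncated OD w z y (p + 3)))"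
  have N_piece: "piece ?N n = {J1 +>\<^bsub>GR\<^esub> a |a. a \<in> gr_piece IW mm n} \<times> {J2 +>\<^bsub>GR\<^esub> a |a. a \<in> gr_piece IW mm n}" for n
    by (simp add: direct_sum_def twist_def truncated_def quot_module_def max_ideal_eq J1_def J2_def)
  have N_add: "(A, B) \<oplus>\<^bsub>?N\<^esub> (A', B') = (A \<oplus>\<^bsub>GR Quot J1\<^esub> A', B \<oplus>\<^bsub>GR Quot J2\<^esub> B')" for A B A' B'
    by (simp add: direct_sum_def twist_def truncated_def quot_module_def J1_def J2_def)
  have N_smult: "r \<odot>\<^bsub>?N\<^esub> (A, B) = ((J1 +>\<^bsub>GR\<^esub> r) \<otimes>\<^bsub>GR Quot J1\<^esub> A, (J2 +>\<^bsub>GR\<^esub> r) \<otimes>\<^bsub>GR Quot J2\<^esub> B)" for r A B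
    by (simp add: direct_sum_def twist_def truncated_def quot_module_def J1_def J2_def)
  obtain \<phi> where bij: "bij_betw \<phi> (carrier GM) (carrier ?N)"
    and add: "\<forall>X\<in>carrier GM. \<forall>Y\<in>carrier GM. \<phi> (X \<oplus>\<^bsub>GM\<^esub> Y) = \<phi> X \<oplus>\<^bsub>?N\<^esub> \<phi> Y"
    and smult: "\<forall>a\<in>carrier GR. \<forall>X\<in>carrier GM. \<phi> (a \<odot>\<^bsub>GM\<^esub> X) = a \<odot>\<^bsub>?N\<^esub> \<phi> X"
    and piece: "\<forall>n. \<phi> ` piece GM n = piece ?N n"
    using iso unfolding graded_isomorphic_def by (elim exE conjE) (rule that)
  have phi_inj: "\<phi> X = \<phi> Y \<Longrightarrow> X \<in> carrier GM \<Longrightarrow> Y \<in> carrier GM \<Longrightarrow> X = Y" for X Y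
    using bij by (simp only: bij_betw_def inj_on_def)
  have mcl_carrier: "x \<in> F n \<Longrightarrow> mcl n x \<in> carrier GM" for x n
    using mcl_piece piece_carrier by blast
  define Q where "Q a b = (J1 +>\<^bsub>GR\<^esub> a, J2 +>\<^bsub>GR\<^esub> b)" for a b
  have Q_piece: "\<exists>x\<in>F n. \<phi> (mcl n x) = Q a b" if "a \<in> gr_piece IW mm n" "b \<in> gr_piece IW mm n" for n a b
  proof -
    have "Q a b \<in> \<phi> ` piece GM n" unfolding piece[rule_format] N_piece Q_def using that by blast
    then obtain X where X: "X \<in> piece GM n" "Q a b = \<phi> X" by (rule imageE)
    obtain x where "x \<in> F n" "X = mcl n x" using piece_mcl[OF X(1)] by (elim bexE)
    with X(2) show ?thesis by (intro bexI[of _ x]) simp_all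
  qed
  have iz: "\<zero>\<^bsub>IW\<^esub> \<in> mm n" for n using additive_subgroup.zero_closed[OF mm_additive] .
  have i1: "\<one>\<^bsub>IW\<^esub> \<in> mm 0" using iw_one_closed by simp
  have gzero: "gcl n \<zero>\<^bsub>IW\<^esub> = \<zero>\<^bsub>GR\<^esub>" for n
  proof -
    have "mm (Suc k) +>\<^bsub>IW\<^esub> \<zero>\<^bsub>IW\<^esub> = mm (Suc k)" for k
      by (rule abelian_group.a_coset_add_zero[OF iw_abelian_group additive_subgroup.a_subset[OF mm_additive]])
    then show ?thesis by (simp add: gr_class_def GR_eq gr_ring_def fun_eq_iff del: ideal_pow.simps)
  qed
  have gone: "gcl 0 \<one>\<^bsub>IW\<^esub> = \<one>\<^bsub>GR\<^esub>" by (simp add: GR_eq gr_ring_def gr_class_def)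
  \<comment> \<open>\<open>v0\<close> and \<open>v1\<close> lift the elements that correspond to the
    generators of the two summands in degree 0.\<close>
  obtain v0 where v0: "v0 \<in> F 0" "\<phi> (mcl 0 v0) = Q \<one>\<^bsub>GR\<^esub> \<zero>\<^bsub>GR\<^esub>"
    using Q_piece[OF gcl_piece[OF i1] gcl_piece[OF iz[of 0]]] unfolding gzero gone by blast
  obtain v1 where v1: "v1 \<in> F 0" "\<phi> (mcl 0 v1) = Q \<zero>\<^bsub>GR\<^esub> \<one>\<^bsub>GR\<^esub>"
    using Q_piece[OF gcl_piece[OF iz[of 0]] gcl_piece[OF i1]] unfolding gzero gone by blast
  have Q_smult: "r \<odot>\<^bsub>?N\<^esub> Q a b = Q (r \<otimes>\<^bsub>GR\<^esub> a) (r \<otimes>\<^bsub>GR\<^esub> b)"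
    if "r \<in> carrier GR" "a \<in> carrier GR" "b \<in> carrier GR" for r a b
    unfolding Q_def N_smult using that J1.rcoset_mult_add J2.rcoset_mult_add by (simp add: FactRing_def)
  have Q_add: "Q a b \<oplus>\<^bsub>?N\<^esub> Q a' b' = Q (a \<oplus>\<^bsub>GR\<^esub> a') (b \<oplus>\<^bsub>GR\<^esub> b')"
    if "a \<in> carrier GR" "b \<in> carrier GR" "a' \<in> carrier GR" "b' \<in> carrier GR" for a b a' b'
    unfolding Q_def N_add using that J1.a_rcos_sum J2.a_rcos_sum by (simp add: FactRing_def)
  have filt0: "a \<odot>\<^bsub>MD\<^esub> x \<in> F n" if "a \<in> mm n" "x \<in> F 0" for a x n
    using smult_filtered[OF that] by simp
  have phi_class: "\<phi> (mcl n (a \<odot>\<^bsub>MD\<^esub> v0 + b \<odot>\<^bsub>MD\<^esub> v1)) = Q (gcl n a) (gcl n b)"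
    if a: "a \<in> mm n" and b: "b \<in> mm n" for a b n
  proof -
    have g: "gcl n a \<in> carrier GR" "gcl n b \<in> carrier GR" using gcl_closed a b by blast+
    have "\<phi> (gcl n a \<odot>\<^bsub>GM\<^esub> mcl 0 v0) = gcl n a \<odot>\<^bsub>?N\<^esub> Q \<one>\<^bsub>GR\<^esub> \<zero>\<^bsub>GR\<^esub>"
      using smult g(1) mcl_carrier[OF v0(1)] unfolding v0(2)[symmetric] by blast
    also have "\<dots> = Q (gcl n a) \<zero>\<^bsub>GR\<^esub>" using Q_smult[OF g(1), of "\<one>\<^bsub>GR\<^esub>" "\<zero>\<^bsub>GR\<^esub>"] g(1) by simp
    finally have 0: "\<phi> (mcl n (a \<odot>\<^bsub>MD\<^esub> v0)) = Q (gcl n a) \<zero>\<^bsub>GR\<^esub>"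
      unfolding gcl_smult_mcl[OF a v0(1)] by simp
    have "\<phi> (gcl n b \<odot>\<^bsub>GM\<^esub> mcl 0 v1) = gcl n b \<odot>\<^bsub>?N\<^esub> Q \<zero>\<^bsub>GR\<^esub> \<one>\<^bsub>GR\<^esub>"
      using smult g(2) mcl_carrier[OF v1(1)] unfolding v1(2)[symmetric] by blast
    also have "\<dots> = Q \<zero>\<^bsub>GR\<^esub> (gcl n b)" using Q_smult[OF g(2), of "\<zero>\<^bsub>GR\<^esub>" "\<one>\<^bsub>GR\<^esub>"] g(2) by simp
    finally have 1: "\<phi> (mcl n (b \<odot>\<^bsub>MD\<^esub> v1)) = Q \<zero>\<^bsub>GR\<^esub> (gcl n b)"
      unfolding gcl_smult_mcl[OF b v1(1)] by simp
    have F01: "a \<odot>\<^bsub>MD\<^esub> v0 \<in> F n" "b \<odot>\<^bsub>MD\<^esub> v1 \<in> F n" using filt0 a b v0(1) v1(1) by blast+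
    have "\<phi> (mcl n (a \<odot>\<^bsub>MD\<^esub> v0 + b \<odot>\<^bsub>MD\<^esub> v1)) = Q (gcl n a) \<zero>\<^bsub>GR\<^esub> \<oplus>\<^bsub>?N\<^esub> Q \<zero>\<^bsub>GR\<^esub> (gcl n b)"
      unfolding mcl_add[OF F01, symmetric] 0[symmetric] 1[symmetric]
      using add mcl_carrier[OF F01(1)] mcl_carrier[OF F01(2)] by blast
    also have "\<dots> = Q (gcl n a) (gcl n b)"
      using Q_add[OF g(1) GR.zero_closed GR.zero_closed g(2)] g by simp
    finally show ?thesis .
  qed
  have Fcomb: "a \<odot>\<^bsub>MD\<^esub> v0 + b \<odot>\<^bsub>MD\<^esub> v1 \<in> F n" if "a \<in> mm n" "b \<in> mm n" for a b n
    using filt.F_add[OF filt0[OF that(1) v0(1)] filt0[OF that(2) v1(1)]] .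
  have phi_zero: "\<phi> (mcl n 0) = Q \<zero>\<^bsub>GR\<^esub> \<zero>\<^bsub>GR\<^esub>" for n
    using phi_class[OF iz iz, of n] unfolding smult_zero_left gzero by (simp only: add_0)
  have Q_zero: "Q a b = Q \<zero>\<^bsub>GR\<^esub> \<zero>\<^bsub>GR\<^esub> \<longleftrightarrow> a \<in> J1 \<and> b \<in> J2"
    if "a \<in> carrier GR" "b \<in> carrier GR" for a b
  proof -
    have "J1 +>\<^bsub>GR\<^esub> a = J1 +>\<^bsub>GR\<^esub> \<zero>\<^bsub>GR\<^esub> \<longleftrightarrow> a \<in> J1" "J2 +>\<^bsub>GR\<^esub> b = J2 +>\<^bsub>GR\<^esub> \<zero>\<^bsub>GR\<^esub> \<longleftrightarrow> b \<in> J2"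
      using J1.a_rcos_const[OF J1.zero_closed] J1.a_rcos_const[of a] J1.a_rcos_self[OF that(1)]
        J2.a_rcos_const[OF J2.zero_closed] J2.a_rcos_const[of b] J2.a_rcos_self[OF that(2)] by auto
    then show ?thesis unfolding Q_def by simp
  qed
  \<comment> \<open>The dictionary between the two sides: a homogeneous combination drops one degree
    further exactly if its coefficients lie in the ideals that define the summands. The relations
    and the freeness required by \<open>no_generating_pair\<close> are read off from it.\<close>
  have deep_iff: "a \<odot>\<^bsub>MD\<^esub> v0 + b \<odot>\<^bsub>MD\<^esub> v1 \<in> F (Suc n) \<longleftrightarrow> gcl n a \<in> J1 \<and> gcl n b \<in> J2"
    if ab: "a \<in> mm n" "b \<in> mm n" for a b n
  proof -
    let ?x = "a \<odot>\<^bsub>MD\<^esub> v0 + b \<odot>\<^bsub>MD\<^esub> v1"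
    have "?x \<in> F (Suc n) \<longleftrightarrow> mcl n ?x = mcl n 0" unfolding mcl_eq_iff by (simp only: diff_zero)
    also have "\<dots> \<longleftrightarrow> \<phi> (mcl n ?x) = \<phi> (mcl n 0)"
      using phi_inj[OF _ mcl_carrier[OF Fcomb[OF ab]] mcl_carrier[OF filt.F_zero]] by metis
    also have "\<dots> \<longleftrightarrow> gcl n a \<in> J1 \<and> gcl n b \<in> J2"
      unfolding phi_class[OF ab] phi_zero by (rule Q_zero[OF gcl_closed[OF ab(1)] gcl_closed[OF ab(2)]])
    finally show ?thesis .
  qed
  have gr0: "\<exists>a'\<in>mm 0. a = gcl 0 a'" if "a \<in> gr_piece IW mm 0" for a
  proof -
    have "a \<in> carrier GR" using that by (simp only: gr_piece_def GR_carrier mem_Collect_eq)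
    then obtain a' where a': "a' \<in> mm 0" "a 0 = mm (Suc 0) +>\<^bsub>IW\<^esub> a'" by (rule gr_component)
    have "a k = gcl 0 a' k" for k
    proof (cases "k = 0")
      case False
      then have "a k = mm (Suc k)" using that unfolding gr_piece_def by blast
      also have "\<dots> = gcl 0 \<zero>\<^bsub>IW\<^esub> k" unfolding gzero by (simp add: GR_eq gr_ring_def del: ideal_pow.simps)
      finally show ?thesis using False by (simp add: gr_class_def)
    qed (use a' in \<open>simp add: gr_class_def del: ideal_pow.simps\<close>)
    then show ?thesis using a'(1) by blast
  qed
  show False
  proof (rule no_generating_pair[OF v0(1) v1(1)])
    fix x assume x: "x \<in> F 0"
    have "\<phi> (mcl 0 x) \<in> piece ?N 0" using piece mcl_piece[OF x] by blast
    then obtain a b where "a \<in> gr_piece IW mm 0" "b \<in> gr_piece IW mm 0" "\<phi> (mcl 0 x) = Q a b"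
      unfolding N_piece Q_def by blast
    then obtain a b where ab: "a \<in> mm 0" "b \<in> mm 0" "\<phi> (mcl 0 x) = Q (gcl 0 a) (gcl 0 b)" using gr0 by metis
    let ?x = "a \<odot>\<^bsub>MD\<^esub> v0 + b \<odot>\<^bsub>MD\<^esub> v1"
    have "\<phi> (mcl 0 x) = \<phi> (mcl 0 ?x)" unfolding phi_class[OF ab(1,2)] ab(3) ..
    then have "mcl 0 x = mcl 0 ?x" by (rule phi_inj[OF _ mcl_carrier[OF x] mcl_carrier[OF Fcomb[OF ab(1,2)]]])
    then have "x - ?x \<in> F 1" unfolding mcl_eq_iff by (simp only: One_nat_def)
    \<comment> \<open>Modulo \<open>F 1\<close> an element of the Iwasawa algebra acts through its
      augmentation, which turns the coefficients \<open>a\<close> and \<open>b\<close> into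
      scalars.\<close>
    moreover have "a \<odot>\<^bsub>MD\<^esub> v0 - fscl (aug a) v0 \<in> F 1" "b \<odot>\<^bsub>MD\<^esub> v1 - fscl (aug b) v1 \<in> F 1"
      using smult_aug[OF mm_closed[OF ab(1)] v0(1)] smult_aug[OF mm_closed[OF ab(2)] v1(1)] .
    ultimately have "(x - ?x) + ((a \<odot>\<^bsub>MD\<^esub> v0 - fscl (aug a) v0) + (b \<odot>\<^bsub>MD\<^esub> v1 - fscl (aug b) v1)) \<in> F 1"
      by (intro filt.F_add)
    moreover have "(x - ?x) + ((a \<odot>\<^bsub>MD\<^esub> v0 - fscl (aug a) v0) + (b \<odot>\<^bsub>MD\<^esub> v1 - fscl (aug b) v1)) =
        x - (fscl (aug a) v0 + fscl (aug b) v1)"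
      by (rule ext) simp
    ultimately show "\<exists>c d. x - (fscl c v0 + fscl d v1) \<in> F 1" by metis
  next
    fix i
    have pw: "eltY 1 [^]\<^bsub>IW\<^esub> i \<in> mm i" by (rule eltY_power) simp
    let ?a = "eltY p \<otimes>\<^bsub>IW\<^esub> (eltY 1 [^]\<^bsub>IW\<^esub> i)"
    have am: "?a \<in> mm (1 + i)" by (rule mm_mult[OF Y1(2) pw])
    have "gcl (1 + i) ?a = z \<otimes>\<^bsub>GR\<^esub> gcl i (eltY 1 [^]\<^bsub>IW\<^esub> i)" unfolding yz by (rule gcl_mult[OF Y1(2) pw, symmetric])
    then have "gcl (1 + i) ?a \<in> J1" using J1.I_r_closed[OF zJ(1) gcl_closed[OF pw]] by simp
    then have "?a \<odot>\<^bsub>MD\<^esub> v0 + \<zero>\<^bsub>IW\<^esub> \<odot>\<^bsub>MD\<^esub> v1 \<in> F (Suc (1 + i))"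
      unfolding deep_iff[OF am iz] gzero using J2.zero_closed by blast
    moreover have "?a \<odot>\<^bsub>MD\<^esub> v0 + \<zero>\<^bsub>IW\<^esub> \<odot>\<^bsub>MD\<^esub> v1 = opr p ((opr 1 ^^ i) v0)"
      unfolding opr_power[of 1, OF disjI1[OF refl]] opr_smult[symmetric] smult_zero_left
        smult_assoc[OF eltY_closed mm_closed[OF pw]] by (rule add_0_right)
    ultimately show "opr p ((opr 1 ^^ i) v0) \<in> F (i + 2)" by simp
  next
    fix i
    have pw: "eltY p [^]\<^bsub>IW\<^esub> i \<in> mm i" by (rule eltY_power) simp
    let ?a = "eltY 1 \<otimes>\<^bsub>IW\<^esub> (eltY p [^]\<^bsub>IW\<^esub> i)"
    have am: "?a \<in> mm (1 + i)" by (rule mm_mult[OF Y1(1) pw])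
    have "gcl (1 + i) ?a = y \<otimes>\<^bsub>GR\<^esub> gcl i (eltY p [^]\<^bsub>IW\<^esub> i)" unfolding yz by (rule gcl_mult[OF Y1(1) pw, symmetric])
    then have "gcl (1 + i) ?a \<in> J2" using J2.I_r_closed[OF zJ(2) gcl_closed[OF pw]] by simp
    then have "\<zero>\<^bsub>IW\<^esub> \<odot>\<^bsub>MD\<^esub> v0 + ?a \<odot>\<^bsub>MD\<^esub> v1 \<in> F (Suc (1 + i))"
      unfolding deep_iff[OF iz am] gzero using J1.zero_closed by blast
    moreover have "\<zero>\<^bsub>IW\<^esub> \<odot>\<^bsub>MD\<^esub> v0 + ?a \<odot>\<^bsub>MD\<^esub> v1 = opr 1 ((opr p ^^ i) v1)"
      unfolding opr_power[of p, OF disjI2[OF refl]] opr_smult[symmetric] smult_zero_left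
        smult_assoc[OF eltY_closed mm_closed[OF pw]] by (rule add_0)
    ultimately show "opr 1 ((opr p ^^ i) v1) \<in> F (i + 2)" by simp
  next
    fix n c d
    assume n: "n \<le> p" and comb: "fscl c ((opr 1 ^^ n) v0) + fscl d ((opr p ^^ n) v1) \<in> F (Suc n)"
    have pw: "eltY 1 [^]\<^bsub>IW\<^esub> n \<in> mm n" "eltY p [^]\<^bsub>IW\<^esub> n \<in> mm n" using eltY_power by simp_all
    have s0: "iw_scale c \<one>\<^bsub>IW\<^esub> \<in> mm 0" for c using iw_scale_closed[OF iw_one_closed] by simp
    have e: "iw_scale c \<one>\<^bsub>IW\<^esub> \<otimes>\<^bsub>IW\<^esub> a = iw_scale c a" if "a \<in> mm n" for c a
      using iw_scale_eq_mult[OF mm_closed[OF that]] by simp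
    have sm: "iw_scale c a \<in> mm n" if "a \<in> mm n" for c a using mm_mult[OF s0 that, of c] e[OF that] by simp
    have "iw_scale c (eltY 1 [^]\<^bsub>IW\<^esub> n) \<odot>\<^bsub>MD\<^esub> v0 + iw_scale d (eltY p [^]\<^bsub>IW\<^esub> n) \<odot>\<^bsub>MD\<^esub> v1 \<in> F (Suc n)"
      unfolding smult_scale[OF mm_closed[OF pw(1)]] smult_scale[OF mm_closed[OF pw(2)]]
      using comb unfolding opr_power[of 1, OF disjI1[OF refl]] opr_power[of p, OF disjI2[OF refl]] .
    then have J: "gcl n (iw_scale c (eltY 1 [^]\<^bsub>IW\<^esub> n)) \<in> J1" "gcl n (iw_scale d (eltY p [^]\<^bsub>IW\<^esub> n)) \<in> J2"
      unfolding deep_iff[OF sm[OF pw(1)] sm[OF pw(2)]] by blast+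
    have g: "gr_const OD w c \<otimes>\<^bsub>GR\<^esub> gcl n a = gcl n (iw_scale c a)" if "a \<in> mm n" for c a
      unfolding gr_const_eq gcl_mult[OF s0 that] e[OF that] by simp
    have "gr_const OD w c \<otimes>\<^bsub>GR\<^esub> (y [^]\<^bsub>GR\<^esub> n) \<in> J1"
      using J(1) gcl_power[OF Y1(1)] g[OF pw(1)] unfolding yz by metis
    moreover have "gr_const OD w d \<otimes>\<^bsub>GR\<^esub> (z [^]\<^bsub>GR\<^esub> n) \<in> J2"
      using J(2) gcl_power[OF Y1(2)] g[OF pw(2)] unfolding yz by metis
    ultimately show "c = 0 \<and> d = 0"
      using y_power_survives[OF n] z_power_survives[OF n] unfolding J1_def J2_def y_def z_def by blast
  qed
qed

end

theorem theorem2p33: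
  fixes p :: nat
    and e :: "(nat \<Rightarrow> int) \<Rightarrow> 'k::field"
    and emb :: "'k \<Rightarrow> 'd::division_ring"
    and L OD :: "'d set"
    and \<sigma> :: "'d \<Rightarrow> 'd"
    and w :: 'd
    and res :: "'d \<Rightarrow> 'q::{field,finite}"
    and j :: "'q \<Rightarrow> 'f::{field,finite}"
    and \<chi> :: "'d \<Rightarrow> 'f"
  assumes "quaternion_setup p e emb L \<sigma> OD w res j"
    and "p \<ge> 5"
    and "smooth_character OD w \<chi>"
  shows "\<nexists>(scl :: 'f \<Rightarrow> 'v::ab_group_add \<Rightarrow> 'v) (\<rho> :: 'd \<Rightarrow> 'v \<Rightarrow> 'v).
    smooth_representation OD w scl \<rho> \<and> has_central_character scl \<rho> \<and>
    graded_isomorphic (gr_iwasawa OD w) (teich_group p L OD res)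
      (gr_dual OD w scl \<rho>)
      (direct_sum
        (twist OD w (dual_char \<chi>)
          (truncated OD w (gr_y p L OD w res j) (gr_z p L OD w res j) (p + 3)))
        (twist OD w (dual_char (sigma_char w \<chi>))
          (truncated OD w (gr_z p L OD w res j) (gr_y p L OD w res j) (p + 3))))"
proof (intro notI, elim exE conjE)
  fix scl :: "'f \<Rightarrow> 'v \<Rightarrow> 'v" and \<rho> :: "'d \<Rightarrow> 'v \<Rightarrow> 'v"
  assume rep: "smooth_representation OD w scl \<rho>" "has_central_character scl \<rho>"
  interpret quaternion_setup_ge5 p e emb L \<sigma> OD w res j
    using assms(1,2) by (simp add: quaternion_setup_ge5_def quaternion_setup_ge5_axioms_def)
  interpret quat_rep p e emb L \<sigma> OD w res j scl \<rho>
    using rep by unfold_locales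
  assume "graded_isomorphic (gr_iwasawa OD w) (teich_group p L OD res)
      (gr_dual OD w scl \<rho>)
      (direct_sum
        (twist OD w (dual_char \<chi>)
          (truncated OD w (gr_y p L OD w res j) (gr_z p L OD w res j) (p + 3)))
        (twist OD w (dual_char (sigma_char w \<chi>))
          (truncated OD w (gr_z p L OD w res j) (gr_y p L OD w res j) (p + 3))))"
  then show False by (rule no_graded_isomorphism)
qed

end
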